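(* Let $L$ be any operator as described in the context, whose kernel satisfies $$0<\frac{\lambda}{|y|^{n+2s}}\le K(y)\le\frac{\Lambda}{|y|^{n+2s}}.$$ Assume that $u$ satisfies $$Lu\le C_0\quad\text{in }B_1$$ in the weak (or viscosity) sense, for some $C_0>0$. Then $$\sup_{B_{1/2}}u\le C\left(\int_{\mathbb R^n}\frac{|u(x)|}{1+|x|^{n+2s}}\,dx+C_0\right).$$ The constant $C$ depends only on $n$, $s$ and the ellipticity constants $\lambda,\Lambda$.
   Context: **Operators.** $s\in(0,1)$, $0<\lambda\le\Lambda$. $K\in L^1_{\rm loc}(\mathbb R^n\setminus\{0\})$ is nonnegative and positively homogeneous of degree $-n-2s$; if $s=\frac12$, moreover $\int_{\partial B_1}y\,K(y)\,d\mathcal H^{n-1}(y)=0$, and $b\in\mathbb R^n$ satisfies $|b|\le\Lambda$. The operator is $$Lu(x)=\begin{cases}\int_{\mathbb R^n}(u(x)-u(x+y))K(y)\,dy & s\in(0,\frac12),\\ \mathrm{P.V.}\int_{\mathbb R^n}(u(x)-u(x+y))K(y)\,dy+b\cdot\nabla u(x)& s=\frac12,\\ \int_{\mathbb R^n}(u(x)-u(x+y)+\nabla u(x)\cdot y)K(y)\,dy& s\in(\frac12,1).\end{cases}$$ **Weak inequality.** $L^*$ is the operator of the same form with $K(y)$ replaced by $K(-y)$ and $b$ by $-b$. $Lu\le C_0$ in $B_1$ in the weak sense means $\int_{\mathbb R^n}u\,L^*\eta\,dx\le C_0\int_{B_1}\eta\,dx$ for every $\eta\in C_c^\infty(B_1)$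 with $\eta\ge0$. $B_r$ is the ball of radius $r$ centered at $0$. *)

theory Defs
  imports "HOL-Analysis.Analysis" "HOL-Probability.Essential_Supremum"
begin

section \<open>Hausdorff measure\<close>

text \<open>
  Normalised so that in dimension \<open>d\<close> it agrees with the usual surface measure. Boundedness is
  required separately since \<open>diameter\<close> is \<open>0\<close> on unbounded sets; the case distinction on \<open>{}\<close>
  matters for \<open>d = 0\<close>, where a nonempty set has weight \<open>1\<close>.
\<close>

definition hausdorff_content :: "real \<Rightarrow> nat \<Rightarrow> 'a::metric_space set \<Rightarrow> ennreal" where
  "hausdorff_content \<delta> d A =
     (INF E\<in>{E :: nat \<Rightarrow> 'a set. A \<subseteq> (\<Union>i. E i) \<and> (\<forall>i. bounded (E i) \<and> diameter (E i) \<le> \<delta>)}.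
        \<Sum>i. if E i = {} then 0
            else ennreal (unit_ball_vol (real d) * (diameter (E i) / 2) ^ d))"

definition hausdorff_outer :: "nat \<Rightarrow> 'a::metric_space set \<Rightarrow> ennreal" where
  "hausdorff_outer d A = (SUP \<delta>\<in>{0<..}. hausdorff_content \<delta> d A)"

definition hausdorff_measure :: "nat \<Rightarrow> 'a::metric_space measure" where
  "hausdorff_measure d =
     measure_of UNIV (lambda_system UNIV (Pow UNIV) (hausdorff_outer d)) (hausdorff_outer d)"


section \<open>Gradients and smooth functions\<close>

definition grad :: "('a::euclidean_space \<Rightarrow> real) \<Rightarrow> 'a \<Rightarrow> 'a" where
  "grad u x = (THE D. GDERIV u x :> D)"

text \<open>Meant for open \<open>S\<close>: all partial derivatives up to order \<open>k\<close> exist and are continuous.\<close>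

primrec C_k_on :: "nat \<Rightarrow> 'a::euclidean_space set \<Rightarrow> ('a \<Rightarrow> real) \<Rightarrow> bool" where
  "C_k_on 0 S f \<longleftrightarrow> continuous_on S f"
| "C_k_on (Suc k) S f \<longleftrightarrow>
     (\<forall>x\<in>S. f differentiable (at x)) \<and>
     (\<forall>v. C_k_on k S (\<lambda>x. frechet_derivative f (at x) v))"

definition test_function :: "'a::euclidean_space set \<Rightarrow> ('a \<Rightarrow> real) \<Rightarrow> bool" where
  "test_function \<Omega> \<eta> \<longleftrightarrow>
     (\<forall>k. C_k_on k UNIV \<eta>) \<and>
     compact (closure {x. \<eta> x \<noteq> 0}) \<and> closure {x. \<eta> x \<noteq> 0} \<subseteq> \<Omega>"


section \<open>Stable operators\<close>

text \<open>
  \<open>admissible s \<Lambda> K b\<close> collects the standing assumptions on kernel and drift. The value \<open>K 0\<close> is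
  irrelevant, and so is \<open>b\<close> unless \<open>s = 1/2\<close>.
\<close>

definition admissible :: "real \<Rightarrow> real \<Rightarrow> ('a::euclidean_space \<Rightarrow> real) \<Rightarrow> 'a \<Rightarrow> bool" where
  "admissible s \<Lambda> K b \<longleftrightarrow>
     (\<forall>S. compact S \<and> 0 \<notin> S \<longrightarrow> K absolutely_integrable_on S) \<and>
     (\<forall>y. y \<noteq> 0 \<longrightarrow> 0 \<le> K y) \<and>
     (\<forall>t>0. \<forall>y. y \<noteq> 0 \<longrightarrow> K (t *\<^sub>R y) = t powr (- (real DIM('a) + 2 * s)) * K y) \<and>
     (s = 1/2 \<longrightarrow>
        (LINT y:sphere 0 1|hausdorff_measure (DIM('a) - 1). K y *\<^sub>R y) = 0 \<and> norm b \<le> \<Lambda>)"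

definition stable_op ::
    "real \<Rightarrow> ('a::euclidean_space \<Rightarrow> real) \<Rightarrow> 'a \<Rightarrow> ('a \<Rightarrow> real) \<Rightarrow> 'a \<Rightarrow> real" where
  "stable_op s K b u x =
     (if s < 1/2 then
        (LINT y|lebesgue. (u x - u (x + y)) * K y)
      else if s = 1/2 then
        Lim (at_right 0) (\<lambda>\<epsilon>. LINT y:- ball 0 \<epsilon>|lebesgue. (u x - u (x + y)) * K y)
          + b \<bullet> grad u x
      else
        (LINT y|lebesgue. (u x - u (x + y) + grad u x \<bullet> y) * K y))"

definition stable_op_adj ::
    "real \<Rightarrow> ('a::euclidean_space \<Rightarrow> real) \<Rightarrow> 'a \<Rightarrow> ('a \<Rightarrow> real) \<Rightarrow> 'a \<Rightarrow> real" where
  "stable_op_adj s K b = stable_op s (\<lambda>y. K (- y)) (- b)"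

definition weak_subsolution ::
    "real \<Rightarrow> ('a::euclidean_space \<Rightarrow> real) \<Rightarrow> 'a \<Rightarrow> real \<Rightarrow> ('a \<Rightarrow> real) \<Rightarrow> bool" where
  "weak_subsolution s K b C\<^sub>0 u \<longleftrightarrow>
     (\<forall>\<eta>. test_function (ball 0 1) \<eta> \<and> (\<forall>x. 0 \<le> \<eta> x) \<longrightarrow>
        (LINT x|lebesgue. u x * stable_op_adj s K b \<eta> x) \<le> C\<^sub>0 * (LINT x:ball 0 1|lebesgue. \<eta> x))"

text \<open>
  Viscosity sense: \<open>u\<close> is upper semicontinuous in \<open>B\<^sub>1\<close>, and \<open>L \<phi> (x) \<le> C\<^sub>0\<close> whenever \<open>\<phi>\<close> touches
  \<open>u\<close> from above at \<open>x \<in> B\<^sub>1\<close>, is \<open>C\<^sup>2\<close> near \<open>x\<close>, and has the decay at infinity that makes \<open>L \<phi> (x)\<close>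
  well defined.
\<close>

definition viscosity_subsolution ::
    "real \<Rightarrow> ('a::euclidean_space \<Rightarrow> real) \<Rightarrow> 'a \<Rightarrow> real \<Rightarrow> ('a \<Rightarrow> real) \<Rightarrow> bool" where
  "viscosity_subsolution s K b C\<^sub>0 u \<longleftrightarrow>
     (\<forall>x\<in>ball 0 1. \<forall>a>u x. \<forall>\<^sub>F z in nhds x. u z < a) \<and>
     (\<forall>x\<in>ball 0 1. \<forall>\<phi>. \<forall>r>0.
        integrable lebesgue (\<lambda>z. \<phi> z / (1 + norm z powr (real DIM('a) + 2 * s))) \<and>
        C_k_on 2 (ball x r) \<phi> \<and> \<phi> x = u x \<and> (\<forall>z. u z \<le> \<phi> z) \<longrightarrow>
        stable_op s K b \<phi> x \<le> C\<^sub>0)"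

end

(*
  Viscosity case. Touch u from above by a multiple of (9/16 - |x|^2)^(-n). At the contact point x0, with
  d = 9/16 - |x0|^2, the value u(x0) d^n controls u on B_{1/2}, and the barrier may be replaced by
  a paraboloid on the ball of radius theta d around x0. By Chebyshev u
  exceeds u(x0)/2 on a small part of that ball only, unless u(x0) d^n is at most a multiple of the
  weighted L^1 norm. Elsewhere in the ball the increments are at least u(x0)/2, so the
  lower bound on K makes the operator larger than C_0, unless u(x0) d^n is at most a multiple of C_0.

  Weak case. By Fubini, the correlation of u with a smooth density supported near 0 satisfies the
  inequality classically, so the same contact argument bounds it with a constant that does not
  depend on the density. Densities converging to normalised indicators of boxes and Lebesgue's
  differentiation theorem give the bound almost everywhere.

  For s = 1/2 the principal value converges because the first moment of K vanishes on every shell.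
  The hypothesis says this for the Hausdorff measure on the sphere only. It transfers to shells
  since Hausdorff measure and the radial projection of Lebesgue measure are both uniformly
  distributed on the sphere, hence proportional by Christensen's theorem.
*)

theory Submission
  imports Defs
begin

section \<open>Hausdorff measures of Borel sets\<close>

text \<open>The exponent n of the barrier makes u(x0) d^n comparable to the integral of u(x0) over
  the contact ball, the quantity that Chebyshev compares with the weighted norm. On the ball of
  radius \<theta>d the lower bound on K gives a gain of order u(x0) (\<theta>d)^(-2s). Gradient,
  paraboloid and drift cost the same power times an extra factor \<theta>, so \<theta> can be fixed
  in terms of n, s, \<lambda>, \<Lambda> alone.

  The Taylor constant of the touched function and the radius on which the expansion holds only make
  the integrals converge and never enter the bound. So the viscosity case may use a paraboloid on a
  tiny ball depending on u, and the weak case a mollifier of any scale.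

  K and u are only Lebesgue measurable, while Fubini is applied to Borel functions; Borel
  representatives are carried along, and point values of u are kept where touching uses them. For s
  = 1/2 this is a real obstacle: the sphere is a Lebesgue null set, so measurability of K on it for
  the Hausdorff measure has to be recovered from homogeneity, through the cones over subsets of the
  sphere.\<close>

abbreviation hausdorff_weight :: "nat \<Rightarrow> 'a::metric_space set \<Rightarrow> ennreal" where
  "hausdorff_weight d E \<equiv>
     (if E = {} then 0 else ennreal (unit_ball_vol (real d) * (diameter E / 2) ^ d))"

definition hausdorff_cover :: "real \<Rightarrow> 'a::metric_space set \<Rightarrow> (nat \<Rightarrow> 'a set) \<Rightarrow> bool" where
  "hausdorff_cover \<delta> A E \<longleftrightarrow> A \<subseteq> (\<Union>i. E i) \<and> (\<forall>i. bounded (E i) \<and> diameter (E i) \<le> \<delta>)"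

lemma hausdorff_content_eq:
  "hausdorff_content \<delta> d A = (INF E\<in>{E. hausdorff_cover \<delta> A E}. \<Sum>i. hausdorff_weight d (E i))"
  by (simp add: hausdorff_content_def hausdorff_cover_def)

lemma hausdorff_content_le:
  "hausdorff_cover \<delta> A E \<Longrightarrow> hausdorff_content \<delta> d A \<le> (\<Sum>i. hausdorff_weight d (E i))"
  unfolding hausdorff_content_eq by (rule INF_lower) simp

lemma hausdorff_content_geI:
  assumes "\<And>E. hausdorff_cover \<delta> A E \<Longrightarrow> c \<le> (\<Sum>i. hausdorff_weight d (E i))"
  shows "c \<le> hausdorff_content \<delta> d A"
  unfolding hausdorff_content_eq by (rule INF_greatest) (use assms in simp)

lemma hausdorff_content_antimono:
  assumes "\<delta> \<le> \<delta>'"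
  shows "hausdorff_content \<delta>' d A \<le> hausdorff_content \<delta> d A"
  by (rule hausdorff_content_geI, rule hausdorff_content_le)
     (use assms in \<open>auto simp: hausdorff_cover_def intro: order_trans\<close>)

lemma hausdorff_weight_mono:
  assumes "A \<subseteq> B" "bounded B"
  shows "hausdorff_weight d A \<le> hausdorff_weight d B"
proof (cases "A = {}")
  case False
  with assms have "B \<noteq> {}" by auto
  have "0 \<le> diameter A" "diameter A \<le> diameter B"
    using assms diameter_subset[OF assms] diameter_ge_0 bounded_subset by blast+
  then show ?thesis using False \<open>B \<noteq> {}\<close>
    by (auto intro!: ennreal_leI mult_left_mono power_mono)
qed auto

text \<open>Choose for each set a cover whose cost exceeds the content by less than e / 2^(i+1) and
  renumber the double family along \<open>prod_decode\<close>. Strictly better covers exist because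
  a finite sum forces every single content to be finite.\<close>

lemma hausdorff_content_UN:
  "hausdorff_content \<delta> d (\<Union>i. A i) \<le> (\<Sum>i::nat. hausdorff_content \<delta> d (A i))"
proof (rule ennreal_le_epsilon)
  fix e :: real
  assume fin: "(\<Sum>i. hausdorff_content \<delta> d (A i)) < top" and e: "0 < e"
  have fin1: "hausdorff_content \<delta> d (A i) < top" for i
    using ennreal_suminf_lessD[OF fin] by auto
  have "\<exists>E. hausdorff_cover \<delta> (A i) E \<and>
      (\<Sum>j. hausdorff_weight d (E j)) < hausdorff_content \<delta> d (A i) + ennreal (e * (1/2) ^ Suc i)" for i
  proof -
    have "0 < ennreal (e * (1/2) ^ Suc i)"
      using e by simp
    then have "hausdorff_content \<delta> d (A i) < hausdorff_content \<delta> d (A i) + ennreal (e * (1/2) ^ Suc i)"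
      using fin1[of i] ennreal_add_left_cancel_less[of "hausdorff_content \<delta> d (A i)" 0 "ennreal (e * (1/2) ^ Suc i)"]
      by (simp only: add_0_right) simp
    then show ?thesis
      by (subst (asm) (1) hausdorff_content_eq) (auto simp: INF_less_iff)
  qed
  then have "\<exists>E. \<forall>i. hausdorff_cover \<delta> (A i) (E i) \<and>
      (\<Sum>j. hausdorff_weight d (E i j)) < hausdorff_content \<delta> d (A i) + ennreal (e * (1/2) ^ Suc i)"
    by (intro choice allI)
  then obtain E where E0: "\<forall>i. hausdorff_cover \<delta> (A i) (E i) \<and>
      (\<Sum>j. hausdorff_weight d (E i j)) < hausdorff_content \<delta> d (A i) + ennreal (e * (1/2) ^ Suc i)"
    by (rule exE)
  have E: "hausdorff_cover \<delta> (A i) (E i)"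
    and Eb: "(\<Sum>j. hausdorff_weight d (E i j)) < hausdorff_content \<delta> d (A i) + ennreal (e * (1/2) ^ Suc i)" for i
    using spec[OF E0, of i] by (rule conjunct1, rule conjunct2)
  define F where "F n = (case prod_decode n of (i, j) \<Rightarrow> E i j)" for n
  have cov: "hausdorff_cover \<delta> (\<Union>i. A i) F"
    unfolding hausdorff_cover_def
  proof safe
    fix x i assume "x \<in> A i"
    then obtain j where "x \<in> E i j" using E[of i] by (auto simp: hausdorff_cover_def)
    then have "x \<in> F (prod_encode (i, j))" by (simp add: F_def)
    then show "x \<in> (\<Union>i. F i)" by blast
  qed (use E in \<open>auto simp: F_def hausdorff_cover_def split: prod.split\<close>)
  have "hausdorff_content \<delta> d (\<Union>i. A i) \<le> (\<Sum>n. hausdorff_weight d (F n))"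
    by (rule hausdorff_content_le[OF cov])
  also have "\<dots> = (\<Sum>n. (\<lambda>(i, j). hausdorff_weight d (E i j)) (prod_decode n))"
    by (intro suminf_cong) (simp only: F_def split: prod.split, simp)
  also have "\<dots> = (\<Sum>i. \<Sum>j. hausdorff_weight d (E i j))"
    by (rule suminf_ennreal_2dimen) simp
  also have "\<dots> \<le> (\<Sum>i. hausdorff_content \<delta> d (A i) + ennreal (e * (1/2) ^ Suc i))"
    by (intro suminf_le less_imp_le[OF Eb] summableI)
  also have "\<dots> = (\<Sum>i. hausdorff_content \<delta> d (A i)) + (\<Sum>i. ennreal (e * (1/2) ^ Suc i))"
    by (rule suminf_add[symmetric]) auto
  also have "(\<Sum>i. ennreal (e * (1/2) ^ Suc i)) = ennreal e"
  proof -
    have "(\<lambda>i. e * (1/2) ^ Suc i) sums (e * 1)" by (intro sums_mult power_half_series)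
    then show ?thesis using e by (subst suminf_ennreal2) (auto simp: sums_iff)
  qed
  finally show "hausdorff_content \<delta> d (\<Union>i. A i) \<le> (\<Sum>i. hausdorff_content \<delta> d (A i)) + ennreal e" .
qed

lemma hausdorff_outer_mono: "A \<subseteq> B \<Longrightarrow> hausdorff_outer d A \<le> hausdorff_outer d B"
  unfolding hausdorff_outer_def
  by (rule SUP_mono') (intro hausdorff_content_geI hausdorff_content_le, unfold hausdorff_cover_def, blast)

lemma hausdorff_content_le_outer: "0 < \<delta> \<Longrightarrow> hausdorff_content \<delta> d A \<le> hausdorff_outer d A"
  unfolding hausdorff_outer_def by (rule SUP_upper) simp

lemma hausdorff_outer_UN:
  "hausdorff_outer d (\<Union>i. A i) \<le> (\<Sum>i::nat. hausdorff_outer d (A i))"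
  unfolding hausdorff_outer_def[of d "\<Union>i. A i"]
proof (rule SUP_least)
  fix \<delta> :: real assume "\<delta> \<in> {0<..}"
  have "hausdorff_content \<delta> d (\<Union>i. A i) \<le> (\<Sum>i::nat. hausdorff_content \<delta> d (A i))"
    by (rule hausdorff_content_UN)
  also have "\<dots> \<le> (\<Sum>i::nat. hausdorff_outer d (A i))"
    using \<open>\<delta> \<in> _\<close> by (intro suminf_le hausdorff_content_le_outer) auto
  finally show "hausdorff_content \<delta> d (\<Union>i. A i) \<le> (\<Sum>i::nat. hausdorff_outer d (A i))" .
qed

lemma hausdorff_outer_empty [simp]: "hausdorff_outer d {} = 0"
proof -
  have "hausdorff_content \<delta> d {} = 0" if "\<delta> > 0" for \<delta>
    using hausdorff_content_le[of \<delta> "{}" "\<lambda>_. {}" d] that by (simp add: hausdorff_cover_def)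
  then show ?thesis by (auto simp: hausdorff_outer_def intro!: SUP_eq_const)
qed

lemma hausdorff_outer_Un: "hausdorff_outer d (A \<union> B) \<le> hausdorff_outer d A + hausdorff_outer d B"
proof -
  have "hausdorff_outer d (\<Union>i. binaryset A B i) \<le> (\<Sum>i. hausdorff_outer d (binaryset A B i))"
    by (rule hausdorff_outer_UN)
  then show ?thesis by (simp add: UN_binaryset_eq suminf_binaryset_eq)
qed

lemma outer_measure_space_hausdorff: "outer_measure_space (Pow UNIV) (hausdorff_outer d)"
  unfolding outer_measure_space_def positive_def increasing_def countably_subadditive_def
  by (auto intro: hausdorff_outer_mono hausdorff_outer_UN)

text \<open>\<open>measure_of\<close> falls back to the zero measure unless the set function is a
  measure on the generated sigma-algebra. Caratheodory's theorem is therefore what makes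
  \<open>emeasure\<close> agree with the outer measure on measurable sets.\<close>

lemma
  shows sets_hausdorff_measure: "sets (hausdorff_measure d) = lambda_system UNIV (Pow UNIV) (hausdorff_outer d)"
    and space_hausdorff_measure [simp]: "space (hausdorff_measure d) = UNIV"
    and emeasure_hausdorff_measure:
      "A \<in> sets (hausdorff_measure d) \<Longrightarrow> emeasure (hausdorff_measure d) A = hausdorff_outer d A"
proof -
  have ms: "measure_space UNIV (lambda_system UNIV (Pow UNIV) (hausdorff_outer d)) (hausdorff_outer d)"
    by (rule sigma_algebra.caratheodory_lemma[OF sigma_algebra_Pow outer_measure_space_hausdorff])
  then have sa: "sigma_algebra UNIV (lambda_system UNIV (Pow UNIV) (hausdorff_outer d))"
    by (auto simp: measure_space_def)
  show s: "sets (hausdorff_measure d) = lambda_system UNIV (Pow UNIV) (hausdorff_outer d)"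
    unfolding hausdorff_measure_def by (rule sigma_algebra.sets_measure_of_eq[OF sa])
  show "space (hausdorff_measure d) = UNIV"
    unfolding hausdorff_measure_def by (simp add: space_measure_of_conv)
  show "A \<in> sets (hausdorff_measure d) \<Longrightarrow> emeasure (hausdorff_measure d) A = hausdorff_outer d A"
    unfolding s unfolding hausdorff_measure_def
    using ms by (auto simp: measure_space_def intro!: emeasure_measure_of_sigma)
qed

text \<open>Subadditivity supplies the opposite inequality, and a test set of infinite outer measure
  satisfies this one trivially.\<close>

lemma hausdorff_measurableI:
  assumes "\<And>T. hausdorff_outer d T < top \<Longrightarrow>
    hausdorff_outer d (T \<inter> F) + hausdorff_outer d (T - F) \<le> hausdorff_outer d T"
  shows "F \<in> sets (hausdorff_measure d)"
  unfolding sets_hausdorff_measure lambda_system_def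
proof safe
  fix T
  have *: "F \<inter> T = T \<inter> F" "(UNIV - F) \<inter> T = T - F" by auto
  have "hausdorff_outer d T \<le> hausdorff_outer d (T \<inter> F) + hausdorff_outer d (T - F)"
    using hausdorff_outer_Un[of d "T \<inter> F" "T - F"] by (simp add: Int_Diff_Un)
  moreover have "hausdorff_outer d (T \<inter> F) + hausdorff_outer d (T - F) \<le> hausdorff_outer d T"
    using assms[of T] by (cases "hausdorff_outer d T = top") (auto simp: less_top)
  ultimately show "hausdorff_outer d (F \<inter> T) + hausdorff_outer d ((UNIV - F) \<inter> T) = hausdorff_outer d T"
    unfolding * by (rule antisym[rotated])
qed auto

lemma hausdorff_null_sets:
  assumes "hausdorff_outer d A = 0"
  shows "A \<in> sets (hausdorff_measure d)"
proof (rule hausdorff_measurableI)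
  fix T
  have "hausdorff_outer d (T \<inter> A) = 0"
    using hausdorff_outer_mono[of "T \<inter> A" A d] assms by simp
  then show "hausdorff_outer d (T \<inter> A) + hausdorff_outer d (T - A) \<le> hausdorff_outer d T"
    using hausdorff_outer_mono[of "T - A" T d] by simp
qed

lemma hausdorff_outer_separated:
  assumes "0 < e" and sep: "\<And>a b. a \<in> A \<Longrightarrow> b \<in> B \<Longrightarrow> e \<le> dist a b"
  shows "hausdorff_outer d A + hausdorff_outer d B \<le> hausdorff_outer d (A \<union> B)"
proof -
  have main: "hausdorff_content \<delta> d A + hausdorff_content \<delta> d B \<le> hausdorff_content \<delta> d (A \<union> B)"
    if "0 < \<delta>" "\<delta> < e" for \<delta>
  proof (rule hausdorff_content_geI)
    fix E assume E: "hausdorff_cover \<delta> (A \<union> B) E"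
    then have bd: "bounded (E i)" "diameter (E i) \<le> \<delta>" for i by (auto simp: hausdorff_cover_def)
    have sub: "hausdorff_cover \<delta> X (\<lambda>i. E i \<inter> X)" if "X \<subseteq> A \<union> B" for X
      unfolding hausdorff_cover_def
    proof safe
      fix x assume "x \<in> X" then show "x \<in> (\<Union>i. E i \<inter> X)"
        using that E unfolding hausdorff_cover_def by blast
    next
      fix i show "bounded (E i \<inter> X)" using bd by (meson bounded_Int)
      show "diameter (E i \<inter> X) \<le> \<delta>"
        using diameter_subset[of "E i \<inter> X" "E i"] bd[of i] by auto
    qed
    have "hausdorff_content \<delta> d A + hausdorff_content \<delta> d B \<le>
       (\<Sum>i. hausdorff_weight d (E i \<inter> A)) + (\<Sum>i. hausdorff_weight d (E i \<inter> B))"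
      by (intro add_mono hausdorff_content_le sub) auto
    also have "\<dots> = (\<Sum>i. hausdorff_weight d (E i \<inter> A) + hausdorff_weight d (E i \<inter> B))"
      by (rule suminf_add) auto
    also have "\<dots> \<le> (\<Sum>i. hausdorff_weight d (E i))"
    proof (intro suminf_le)
      fix i
      have "E i \<inter> A = {} \<or> E i \<inter> B = {}"
      proof (rule ccontr)
        assume "\<not> ?thesis"
        then obtain a b where ab: "a \<in> E i" "a \<in> A" "b \<in> E i" "b \<in> B" by blast
        have "dist a b \<le> \<delta>"
          using diameter_bounded_bound[OF bd(1) ab(1,3)] bd(2)[of i] by simp
        with sep[OF ab(2,4)] \<open>\<delta> < e\<close> show False by simp
      qed
      then show "hausdorff_weight d (E i \<inter> A) + hausdorff_weight d (E i \<inter> B) \<le> hausdorff_weight d (E i)"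
      proof
        assume *: "E i \<inter> A = {}"
        show ?thesis unfolding *
          using hausdorff_weight_mono[of "E i \<inter> B" "E i" d] bd[of i] by simp
      next
        assume *: "E i \<inter> B = {}"
        show ?thesis unfolding *
          using hausdorff_weight_mono[of "E i \<inter> A" "E i" d] bd[of i] by simp
      qed
    qed auto
    finally show "hausdorff_content \<delta> d A + hausdorff_content \<delta> d B \<le> (\<Sum>i. hausdorff_weight d (E i))" .
  qed
  \<comment> \<open>The contents grow as \<delta> decreases, so both families are directed in the
    same direction and the two suprema can be taken jointly.\<close>
  have "hausdorff_outer d A + hausdorff_outer d B =
      (SUP \<delta>\<in>{0<..}. hausdorff_content \<delta> d A + hausdorff_content \<delta> d B)"
    unfolding hausdorff_outer_def
  proof (rule SUP_add_directed_ennreal[symmetric])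
    fix i j :: real assume "i \<in> {0<..}" "j \<in> {0<..}"
    then show "\<exists>k\<in>{0<..}. hausdorff_content i d A + hausdorff_content j d B
         \<le> hausdorff_content k d A + hausdorff_content k d B"
      by (intro bexI[of _ "min i j"] add_mono hausdorff_content_antimono) auto
  qed
  also have "\<dots> \<le> hausdorff_outer d (A \<union> B)"
  proof (rule SUP_least)
    fix \<delta> :: real assume \<delta>: "\<delta> \<in> {0<..}"
    define \<delta>' where "\<delta>' = min \<delta> (e/2)"
    have \<delta>': "0 < \<delta>'" "\<delta>' < e" "\<delta>' \<le> \<delta>" using \<delta> \<open>0 < e\<close> by (auto simp: \<delta>'_def)
    have "hausdorff_content \<delta> d A + hausdorff_content \<delta> d B \<le> hausdorff_content \<delta>' d A + hausdorff_content \<delta>' d B"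
      by (intro add_mono hausdorff_content_antimono \<delta>')
    also have "\<dots> \<le> hausdorff_content \<delta>' d (A \<union> B)" by (rule main) (use \<delta>' in auto)
    also have "\<dots> \<le> hausdorff_outer d (A \<union> B)" by (rule hausdorff_content_le_outer[OF \<delta>'(1)])
    finally show "hausdorff_content \<delta> d A + hausdorff_content \<delta> d B \<le> hausdorff_outer d (A \<union> B)" .
  qed
  finally show ?thesis .
qed

text \<open>Caratheodory's criterion. The layers \<open>R k\<close> at distance about \<open>1/k\<close> from \<open>F\<close> with indices of
  equal parity are pairwise separated, so their measures are summable.\<close>

lemma hausdorff_closed_measurable:
  assumes "closed F"
  shows "F \<in> sets (hausdorff_measure d)"
proof (cases "F = {}")
  case False
  show ?thesis
  proof (rule hausdorff_measurableI)
    fix T :: "'a set"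
    assume fin: "hausdorff_outer d T < top"
    define A where "A k = {x\<in>T. 1 / real (k+1) \<le> infdist x F}" for k :: nat
    define R where "R k = {x\<in>T. 1 / real (k+2) \<le> infdist x F \<and> infdist x F < 1 / real (k+1)}" for k :: nat
    have sepinf: "b - a \<le> dist x y" if "infdist x F \<le> a" "b \<le> infdist y F" for a b and x y :: 'a
      using infdist_triangle[of y F x] that by (simp add: dist_commute)
    have parity: "(\<Sum>j<N. hausdorff_outer d (R (2*j+p))) \<le> hausdorff_outer d (\<Union>j<N. R (2*j+p))" for N p
    proof (induction N)
      case (Suc N)
      have "(\<Sum>j<Suc N. hausdorff_outer d (R (2*j+p)))
          \<le> hausdorff_outer d (\<Union>j<N. R (2*j+p)) + hausdorff_outer d (R (2*N+p))"
        using Suc by (simp add: add_right_mono)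
      also have "\<dots> \<le> hausdorff_outer d ((\<Union>j<N. R (2*j+p)) \<union> R (2*N+p))"
      proof (rule hausdorff_outer_separated)
        \<comment> \<open>For N = 0 the union is empty and any positive gap serves. The general
          formula would fail there for p = 0, where it contains 1 / 0 = 0.\<close>
        show "0 < (if N = 0 then 1 else 1 / real (2*N+p) - 1 / real (2*N+p+1))"
          by (auto simp: frac_less2)
      next
        fix a b assume "a \<in> (\<Union>j<N. R (2*j+p))" "b \<in> R (2*N+p)"
        then obtain j where "j < N" "a \<in> R (2*j+p)" by auto
        then have "1 / real (2*j+p+2) \<le> infdist a F" by (simp add: R_def)
        moreover have "1 / real (2*N+p) \<le> 1 / real (2*j+p+2)"
          using \<open>j < N\<close> by (intro divide_left_mono) auto
        ultimately have "1 / real (2*N+p) \<le> infdist a F" by linarith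
        moreover have "infdist b F \<le> 1 / real (2*N+p+1)" using \<open>b \<in> _\<close> by (simp add: R_def)
        ultimately show "(if N = 0 then 1 else 1 / real (2*N+p) - 1 / real (2*N+p+1)) \<le> dist a b"
          using sepinf[of b "1 / real (2*N+p+1)" "1 / real (2*N+p)" a] \<open>j < N\<close> by (simp add: dist_commute)
      qed
      also have "(\<Union>j<N. R (2*j+p)) \<union> R (2*N+p) = (\<Union>j<Suc N. R (2*j+p))"
        by (auto simp: less_Suc_eq)
      finally show ?case .
    qed simp
    have parity': "(\<Sum>j<N. hausdorff_outer d (R (2*j+p))) \<le> hausdorff_outer d T" for N p
      by (rule order_trans[OF parity], rule hausdorff_outer_mono) (auto simp: R_def)
    have "(\<Sum>j<N. hausdorff_outer d (R j)) \<le> hausdorff_outer d T + hausdorff_outer d T" for N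
    proof -
      have "(\<Sum>j<N. hausdorff_outer d (R j)) \<le> (\<Sum>j<2*N. hausdorff_outer d (R j))"
        by (intro sum_mono2) auto
      also have "\<dots> = (\<Sum>j<N. hausdorff_outer d (R (2*j+0))) + (\<Sum>j<N. hausdorff_outer d (R (2*j+1)))"
        by (induction N) (auto simp: algebra_simps)
      also have "\<dots> \<le> hausdorff_outer d T + hausdorff_outer d T"
        by (intro add_mono parity')
      finally show ?thesis .
    qed
    then have sumle: "(\<Sum>j. hausdorff_outer d (R j)) \<le> hausdorff_outer d T + hausdorff_outer d T"
      by (intro suminf_le_const) auto
    then have sumfin: "(\<Sum>j. hausdorff_outer d (R j)) < top"
      using fin by (metis ennreal_add_less_top le_less_trans)
    have layers: "hausdorff_outer d (T - F) \<le> hausdorff_outer d (A k) + (\<Sum>j. hausdorff_outer d (R (j + k)))" for k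
    proof -
      have "T - F \<subseteq> A k \<union> (\<Union>j. R (j + k))"
      proof
        fix x assume x: "x \<in> T - F"
        have pos: "0 < infdist x F"
          using x in_closed_iff_infdist_zero[OF \<open>closed F\<close> False] infdist_nonneg[of x F] by fastforce
        show "x \<in> A k \<union> (\<Union>j. R (j + k))"
        proof (cases "1 / real (k+1) \<le> infdist x F")
          case False
          obtain m where m: "inverse (real (Suc m)) < infdist x F"
            using reals_Archimedean[OF pos] by blast
          \<comment> \<open>The least such index is the number of the layer that contains x;
            minimality gives the upper bound on the distance in the definition of
            \<open>R\<close>.\<close>
          define n where "n = (LEAST n. 1 / real (n+2) \<le> infdist x F)"
          have "1 / real (m+2) \<le> inverse (real (Suc m))" by (simp add: inverse_eq_divide frac_le)
          then have ex: "1 / real (m+2) \<le> infdist x F" using m by linarith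
          then have n1: "1 / real (n+2) \<le> infdist x F" unfolding n_def by (rule LeastI)
          have kn: "k \<le> n"
          proof (rule ccontr)
            assume "\<not> k \<le> n"
            then have "1 / real (k+1) \<le> 1 / real (n+2)" by (intro divide_left_mono) auto
            with n1 False show False by simp
          qed
          have n2: "infdist x F < 1 / real (n+1)"
          proof (cases "n = k")
            case True then show ?thesis using False by simp
          next
            case nk: False
            with kn have "n - 1 < n" "n - 1 + 2 = n + 1" by auto
            then show ?thesis using not_less_Least[of "n-1" "\<lambda>n. 1 / real (n+2) \<le> infdist x F"]
              unfolding n_def[symmetric] by simp
          qed
          have "x \<in> R ((n - k) + k)" using n1 n2 x kn by (simp add: R_def)
          then show ?thesis by blast
        qed (use x in \<open>simp add: A_def\<close>)
      qed
      then have "hausdorff_outer d (T - F) \<le> hausdorff_outer d (A k \<union> (\<Union>j. R (j + k)))"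
        by (rule hausdorff_outer_mono)
      also have "\<dots> \<le> hausdorff_outer d (A k) + hausdorff_outer d (\<Union>j. R (j + k))"
        by (rule hausdorff_outer_Un)
      also have "\<dots> \<le> hausdorff_outer d (A k) + (\<Sum>j. hausdorff_outer d (R (j + k)))"
        by (intro add_left_mono hausdorff_outer_UN)
      finally show ?thesis .
    qed
    have step: "hausdorff_outer d (T \<inter> F) + hausdorff_outer d (T - F) \<le>
        hausdorff_outer d T + (\<Sum>j. hausdorff_outer d (R (j + k)))" for k
    proof -
      have "hausdorff_outer d (T \<inter> F) + hausdorff_outer d (A k) \<le> hausdorff_outer d ((T \<inter> F) \<union> A k)"
      proof (rule hausdorff_outer_separated)
        fix a b assume "a \<in> T \<inter> F" "b \<in> A k"
        then have "infdist a F \<le> 0" "1 / real (k+1) \<le> infdist b F" by (auto simp: A_def)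
        then show "1 / real (k+1) \<le> dist a b" using sepinf[of a 0 "1 / real (k+1)" b] by simp
      qed simp
      also have "\<dots> \<le> hausdorff_outer d T" by (rule hausdorff_outer_mono) (auto simp: A_def)
      finally have *: "hausdorff_outer d (T \<inter> F) + hausdorff_outer d (A k) \<le> hausdorff_outer d T" .
      have "hausdorff_outer d (T \<inter> F) + hausdorff_outer d (T - F) \<le>
        (hausdorff_outer d (T \<inter> F) + hausdorff_outer d (A k)) + (\<Sum>j. hausdorff_outer d (R (j + k)))"
        using layers[of k] by (simp add: add.assoc add_left_mono)
      also have "\<dots> \<le> hausdorff_outer d T + (\<Sum>j. hausdorff_outer d (R (j + k)))"
        by (intro add_right_mono *)
      finally show ?thesis .
    qed
    have "(\<lambda>k. \<Sum>j. hausdorff_outer d (R (j + k))) \<longlonglongrightarrow> 0"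
    proof -
      define f where "f j = enn2real (hausdorff_outer d (R j))" for j
      have f: "hausdorff_outer d (R j) = ennreal (f j)" "0 \<le> f j" for j
        using ennreal_suminf_lessD[OF sumfin, of j] by (auto simp: f_def)
      then have sm: "summable f"
        using sumfin by (intro summable_suminf_not_top) auto
      then have "(\<lambda>k. suminf f - sum f {..<k}) \<longlonglongrightarrow> suminf f - suminf f"
        by (intro tendsto_diff tendsto_const summable_LIMSEQ)
      then have "(\<lambda>k. \<Sum>j. f (j + k)) \<longlonglongrightarrow> 0"
        by (simp add: suminf_minus_initial_segment[OF sm])
      then have "(\<lambda>k. ennreal (\<Sum>j. f (j + k))) \<longlonglongrightarrow> ennreal 0" by (intro tendsto_ennrealI)
      then show ?thesis
        using f sm by (simp add: suminf_ennreal2 summable_iff_shift)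
    qed
    then have "(\<lambda>k. hausdorff_outer d T + (\<Sum>j. hausdorff_outer d (R (j + k)))) \<longlonglongrightarrow> hausdorff_outer d T + 0"
      by (intro tendsto_add tendsto_const)
    then show "hausdorff_outer d (T \<inter> F) + hausdorff_outer d (T - F) \<le> hausdorff_outer d T"
      by (intro LIMSEQ_le_const[OF _ exI[of _ 0]]) (use step in auto)
  qed
next
  case True
  then show ?thesis by (simp only: sets.empty_sets)
qed

section \<open>Uniformly distributed measures\<close>

lemma sigma_finite_if_finite_on_cballs:
  fixes M :: "'a::euclidean_space measure"
  assumes "sets M = sets borel" "\<And>r. emeasure M (cball 0 r) < \<infinity>"
  shows "sigma_finite_measure M"
proof
  show "\<exists>A. countable A \<and> A \<subseteq> sets M \<and> \<Union>A = space M \<and> (\<forall>a\<in>A. emeasure M a \<noteq> \<infinity>)"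
  proof (intro exI conjI)
    show "countable (range (\<lambda>n::nat. cball (0::'a) (real n)))" by simp
    show "range (\<lambda>n::nat. cball (0::'a) (real n)) \<subseteq> sets M" by (simp add: image_subset_iff assms(1))
    show "\<Union>(range (\<lambda>n::nat. cball (0::'a) (real n))) = space M"
    proof -
      have "\<exists>n::nat. norm x \<le> real n" for x :: 'a by (rule real_arch_simple)
      then show ?thesis using sets_eq_imp_space_eq[OF assms(1)] by (simp add: set_eq_iff)
    qed
  qed (use assms(2) in \<open>auto simp: less_top\<close>)
qed

text \<open>Integrate the indicator of {dist x y < r} over y in F. Taking x first gives
  \<open>hn\<close> for almost every y in F. Taking y first gives at most \<open>hm\<close>, and
  only for x within r of F. The ball masses are known only at points of X, which is enough because
  both measures live on X.\<close>

lemma emeasure_neighbourhood_le: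
  fixes \<mu> \<nu> :: "'a::euclidean_space measure"
  assumes sets: "sets \<mu> = sets borel" "sets \<nu> = sets borel"
    and fin: "\<And>r. emeasure \<mu> (cball 0 r) < \<infinity>" "\<And>r. emeasure \<nu> (cball 0 r) < \<infinity>"
    and conc: "AE x in \<mu>. x \<in> X" "AE x in \<nu>. x \<in> X"
    and unif: "\<And>x. x \<in> X \<Longrightarrow> emeasure \<mu> (ball x r) = hm" "\<And>x. x \<in> X \<Longrightarrow> emeasure \<nu> (ball x r) = hn"
    and F: "compact F"
  shows "hn * emeasure \<mu> F \<le> hm * emeasure \<nu> (\<Union>y\<in>F. ball y r)"
proof -
  interpret m: sigma_finite_measure \<mu> by (rule sigma_finite_if_finite_on_cballs[OF sets(1) fin(1)])
  interpret n: sigma_finite_measure \<nu> by (rule sigma_finite_if_finite_on_cballs[OF sets(2) fin(2)])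
  interpret P: pair_sigma_finite \<nu> \<mu> ..
  have Fb: "F \<in> sets borel" using F by (simp add: compact_imp_closed)
  have Fm: "F \<in> sets \<mu>" using Fb sets by simp
  have sp: "space \<mu> = UNIV" "space \<nu> = UNIV" using sets[THEN sets_eq_imp_space_eq] by auto
  have ballm: "ball x r \<in> sets \<mu>" "ball x r \<in> sets \<nu>" for x using sets by auto
  define k :: "'a \<Rightarrow> 'a \<Rightarrow> ennreal" where "k x y = indicator F y * indicator {z. dist (fst z) (snd z) < r} (x, y)" for x y
  have "open {z :: 'a \<times> 'a. dist (fst z) (snd z) < r}"
    by (intro open_Collect_less continuous_intros)
  then have D: "{z :: 'a \<times> 'a. dist (fst z) (snd z) < r} \<in> sets (\<nu> \<Otimes>\<^sub>M \<mu>)"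
    unfolding sets_pair_measure_cong[OF sets(2,1)] borel_prod by (rule borel_open)
  have k: "case_prod k \<in> borel_measurable (\<nu> \<Otimes>\<^sub>M \<mu>)"
  proof -
    have "(\<lambda>z. indicator F (snd z) * indicator {z. dist (fst z) (snd z) < r} z :: ennreal) \<in> borel_measurable (\<nu> \<Otimes>\<^sub>M \<mu>)"
      using D Fm by measurable
    then show ?thesis by (simp add: k_def case_prod_beta')
  qed
  have "hn * emeasure \<mu> F = (\<integral>\<^sup>+y. hn * indicator F y \<partial>\<mu>)"
    using Fm by (simp add: nn_integral_cmult_indicator)
  also have "\<dots> = (\<integral>\<^sup>+y. \<integral>\<^sup>+x. k x y \<partial>\<nu> \<partial>\<mu>)"
  proof (rule nn_integral_cong_AE)
    show "AE y in \<mu>. hn * indicator F y = (\<integral>\<^sup>+x. k x y \<partial>\<nu>)"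
      using conc(1)
    proof eventually_elim
      case (elim y)
      have "(\<integral>\<^sup>+x. k x y \<partial>\<nu>) = (\<integral>\<^sup>+x. indicator F y * indicator (ball y r) x \<partial>\<nu>)"
        by (intro nn_integral_cong) (auto simp: k_def indicator_def dist_commute)
      also have "\<dots> = indicator F y * hn" using ballm by (simp add: nn_integral_cmult_indicator unif elim)
      finally show ?case by (simp add: mult.commute)
    qed
  qed
  also have "\<dots> = (\<integral>\<^sup>+x. \<integral>\<^sup>+y. k x y \<partial>\<mu> \<partial>\<nu>)" by (rule P.Fubini'[OF k])
  also have "\<dots> \<le> (\<integral>\<^sup>+x. hm * indicator (\<Union>y\<in>F. ball y r) x \<partial>\<nu>)"
  proof (rule nn_integral_mono_AE)
    show "AE x in \<nu>. (\<integral>\<^sup>+y. k x y \<partial>\<mu>) \<le> hm * indicator (\<Union>y\<in>F. ball y r) x"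
      using conc(2)
    proof eventually_elim
      case (elim x)
      show ?case
      proof (cases "x \<in> (\<Union>y\<in>F. ball y r)")
        case True
        have "(\<integral>\<^sup>+y. k x y \<partial>\<mu>) \<le> (\<integral>\<^sup>+y. indicator (ball x r) y \<partial>\<mu>)"
          by (intro nn_integral_mono) (auto simp: k_def indicator_def)
        also have "\<dots> = hm" using ballm by (simp add: unif elim)
        finally show ?thesis using True by simp
      next
        case False
        then have "k x y = 0" for y by (auto simp: k_def indicator_def dist_commute)
        then show ?thesis by simp
      qed
    qed
  qed
  also have "\<dots> = hm * emeasure \<nu> (\<Union>y\<in>F. ball y r)"
    using sets by (intro nn_integral_cmult_indicator) (simp add: borel_open open_UN)
  finally show ?thesis .
qed

text \<open>A compact set is closed, so it is the intersection of its open neighbourhoods; it is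
  bounded, so these have finite measure and continuity from above applies.\<close>

lemma emeasure_neighbourhood_tendsto:
  fixes \<mu> :: "'a::euclidean_space measure"
  assumes sets: "sets \<mu> = sets borel" and fin: "\<And>r. emeasure \<mu> (cball 0 r) < \<infinity>" and F: "compact F"
  shows "(\<lambda>k. emeasure \<mu> (\<Union>y\<in>F. ball y (1 / real (Suc k)))) \<longlonglongrightarrow> emeasure \<mu> F"
proof -
  have I: "(\<Inter>k. \<Union>y\<in>F. ball y (1 / real (Suc k))) = F"
  proof safe
    fix x assume x: "x \<in> (\<Inter>k. \<Union>y\<in>F. ball y (1 / real (Suc k)))"
    show "x \<in> F"
    proof (rule ccontr)
      assume "x \<notin> F"
      then obtain d where d: "d > 0" "\<And>y. y \<in> F \<Longrightarrow> d \<le> dist x y"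
        using separate_point_closed[OF compact_imp_closed[OF F]] by blast
      obtain k where "inverse (real (Suc k)) < d" using reals_Archimedean[OF d(1)] by blast
      moreover obtain y where "y \<in> F" "dist y x < 1 / real (Suc k)" using x by auto
      ultimately show False using d(2)[of y] by (simp add: dist_commute inverse_eq_divide)
    qed
  qed (force)
  obtain B where B: "\<And>y. y \<in> F \<Longrightarrow> norm y \<le> B" using compact_imp_bounded[OF F] bounded_iff by blast
  have "(\<lambda>k. emeasure \<mu> (\<Union>y\<in>F. ball y (1 / real (Suc k)))) \<longlonglongrightarrow> emeasure \<mu> (\<Inter>k. \<Union>y\<in>F. ball y (1 / real (Suc k)))"
  proof (rule Lim_emeasure_decseq)
    show "range (\<lambda>k. \<Union>y\<in>F. ball y (1 / real (Suc k))) \<subseteq> sets \<mu>" using sets by (auto intro!: borel_open)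
    show "decseq (\<lambda>k. \<Union>y\<in>F. ball y (1 / real (Suc k)))"
    proof (rule decseq_SucI)
      fix n
      have "1 / real (Suc (Suc n)) \<le> 1 / real (Suc n)" by (simp add: frac_le)
      then show "(\<Union>y\<in>F. ball y (1 / real (Suc (Suc n)))) \<subseteq> (\<Union>y\<in>F. ball y (1 / real (Suc n)))"
        using subset_ball by blast
    qed
    fix k
    have "(\<Union>y\<in>F. ball y (1 / real (Suc k))) \<subseteq> cball 0 (B + 1)"
    proof safe
      fix x y assume "y \<in> F" "x \<in> ball y (1 / real (Suc k))"
      moreover have "1 / real (Suc k) \<le> 1" by simp
      ultimately have "dist y x < 1" by (simp only: mem_ball)
      then show "x \<in> cball 0 (B + 1)"
        using B[OF \<open>y \<in> F\<close>] norm_triangle_ineq4[of y "y - x"] by (simp add: dist_norm)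
    qed
    then have "emeasure \<mu> (\<Union>y\<in>F. ball y (1 / real (Suc k))) \<le> emeasure \<mu> (cball 0 (B + 1))"
      using sets by (intro emeasure_mono) auto
    then show "emeasure \<mu> (\<Union>y\<in>F. ball y (1 / real (Suc k))) \<noteq> \<infinity>" using fin[of "B+1"] by (auto simp: top_unique)
  qed
  then show ?thesis unfolding I .
qed

lemma emeasure_compact_finite:
  fixes \<mu> :: "'a::euclidean_space measure"
  assumes sets: "sets \<mu> = sets borel" and fin: "\<And>r. emeasure \<mu> (cball 0 r) < \<infinity>" and F: "compact F"
  shows "emeasure \<mu> F < \<infinity>"
proof -
  obtain B where "F \<subseteq> cball 0 B" using compact_imp_bounded[OF F] by (auto simp: bounded_iff subset_iff)
  then have "emeasure \<mu> F \<le> emeasure \<mu> (cball 0 B)" using sets by (intro emeasure_mono) auto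
  then show ?thesis using fin[of B] by (metis le_less_trans)
qed

text \<open>Christensen's argument: integrate the kernel \<open>indicator {(x, y). dist x y < r}\<close> in both
  orders and let \<open>r\<close> tend to \<open>0\<close>.\<close>

lemma uniform_measures_proportional:
  fixes \<mu> \<nu> :: "'a::euclidean_space measure"
  assumes sets: "sets \<mu> = sets borel" "sets \<nu> = sets borel"
    and fin: "\<And>r. emeasure \<mu> (cball 0 r) < \<infinity>" "\<And>r. emeasure \<nu> (cball 0 r) < \<infinity>"
    and conc: "AE x in \<mu>. x \<in> X" "AE x in \<nu>. x \<in> X" and ne: "X \<noteq> {}"
    and unif: "\<And>x r. x \<in> X \<Longrightarrow> r > 0 \<Longrightarrow> emeasure \<mu> (ball x r) = hm r"
      "\<And>x r. x \<in> X \<Longrightarrow> r > 0 \<Longrightarrow> emeasure \<nu> (ball x r) = hn r"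
    and pos: "\<And>r. r > 0 \<Longrightarrow> hm r > 0" "\<And>r. r > 0 \<Longrightarrow> hn r > 0"
    and FG: "compact F" "compact G"
  shows "emeasure \<mu> F * emeasure \<nu> G = emeasure \<nu> F * emeasure \<mu> G"
proof -
  obtain x0 where x0: "x0 \<in> X" using ne by blast
  have hfin: "hm r < \<infinity>" "hn r < \<infinity>" if "r > 0" for r
  proof -
    have sub: "ball x0 r \<subseteq> cball 0 (norm x0 + r)"
    proof
      fix y assume "y \<in> ball x0 r"
      then show "y \<in> cball 0 (norm x0 + r)"
        using norm_triangle_ineq2[of y x0] by (simp add: dist_norm norm_minus_commute)
    qed
    have "emeasure \<mu> (ball x0 r) \<le> emeasure \<mu> (cball 0 (norm x0 + r))"
      using sets sub by (intro emeasure_mono) auto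
    then show "hm r < \<infinity>" using unif(1)[OF x0 that] fin(1) by (metis le_less_trans)
    have "emeasure \<nu> (ball x0 r) \<le> emeasure \<nu> (cball 0 (norm x0 + r))"
      using sets sub by (intro emeasure_mono) auto
    then show "hn r < \<infinity>" using unif(2)[OF x0 that] fin(2) by (metis le_less_trans)
  qed
  have le: "emeasure m A * emeasure n B \<le> emeasure n A * emeasure m B"
    if s: "sets m = sets borel" "sets n = sets borel"
      "\<And>r. emeasure m (cball 0 r) < \<infinity>" "\<And>r. emeasure n (cball 0 r) < \<infinity>"
      "AE x in m. x \<in> X" "AE x in n. x \<in> X"
      and u: "\<And>x r. x \<in> X \<Longrightarrow> r > 0 \<Longrightarrow> emeasure m (ball x r) = h r"
      "\<And>x r. x \<in> X \<Longrightarrow> r > 0 \<Longrightarrow> emeasure n (ball x r) = h' r"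
      and p: "\<And>r. r > 0 \<Longrightarrow> 0 < h r \<and> h r < \<infinity>" "\<And>r. r > 0 \<Longrightarrow> 0 < h' r \<and> h' r < \<infinity>"
      and AB: "compact A" "compact B"
    for m n :: "'a measure" and A B and h h' :: "real \<Rightarrow> ennreal"
  proof -
    \<comment> \<open>Applying the neighbourhood estimate once in each direction and multiplying
      puts the same factor \<open>h r * h' r\<close> on both sides. It is positive and finite and
      cancels, so nothing has to be known about the ratio of the ball masses as r tends to
      0.\<close>
    have *: "emeasure m A * emeasure n B \<le> emeasure n (\<Union>y\<in>A. ball y r) * emeasure m (\<Union>y\<in>B. ball y r)"
      if r: "r > 0" for r
    proof -
      have 1: "h' r * emeasure m A \<le> h r * emeasure n (\<Union>y\<in>A. ball y r)"
        by (rule emeasure_neighbourhood_le[OF s u(1)[OF _ r] u(2)[OF _ r] AB(1)]) auto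
      have 2: "h r * emeasure n B \<le> h' r * emeasure m (\<Union>y\<in>B. ball y r)"
        by (rule emeasure_neighbourhood_le[OF s(2,1,4,3,6,5) u(2)[OF _ r] u(1)[OF _ r] AB(2)]) auto
      have "(h r * h' r) * (emeasure m A * emeasure n B) \<le>
          (h r * h' r) * (emeasure n (\<Union>y\<in>A. ball y r) * emeasure m (\<Union>y\<in>B. ball y r))"
        using mult_mono[OF 1 2] by (simp add: mult_ac)
      moreover have "h r * h' r \<noteq> 0" "h r * h' r < top"
        using p(1)[OF r] p(2)[OF r] by (auto simp: ennreal_mult_less_top)
      ultimately show ?thesis
        using ennreal_mult_le_mult_iff[of "h r * h' r"] by (simp add: less_top)
    qed
    have "(\<lambda>k. emeasure n (\<Union>y\<in>A. ball y (1 / real (Suc k))) * emeasure m (\<Union>y\<in>B. ball y (1 / real (Suc k))))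
        \<longlonglongrightarrow> emeasure n A * emeasure m B"
      using emeasure_compact_finite[OF s(2,4) AB(1)] emeasure_compact_finite[OF s(1,3) AB(2)]
      by (intro tendsto_mult_ennreal emeasure_neighbourhood_tendsto s AB) auto
    then show ?thesis
      by (rule LIMSEQ_le_const) (use * in \<open>auto intro!: exI[of _ 0]\<close>)
  qed
  have "emeasure \<mu> F * emeasure \<nu> G \<le> emeasure \<nu> F * emeasure \<mu> G"
    by (rule le[OF sets fin conc unif _ _ FG]) (use pos hfin in auto)
  moreover have "emeasure \<mu> G * emeasure \<nu> F \<le> emeasure \<nu> G * emeasure \<mu> F"
    by (rule le[OF sets fin conc unif _ _ FG(2,1)]) (use pos hfin in auto)
  ultimately show ?thesis by (simp add: mult.commute)
qed

text \<open>An isometric involution pulls balls back to balls of the same radius, so the image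
  measure gives every ball its Lebesgue measure. Uniformly distributed measures are proportional,
  and the unit ball fixes the factor 1.\<close>

lemma lborel_distr_isometry:
  fixes T :: "'a::euclidean_space \<Rightarrow> 'a"
  assumes iso: "\<And>x y. dist (T x) (T y) = dist x y" and inv: "\<And>x. T (T x) = x"
  shows "distr lborel borel T = lborel"
proof -
  have cont: "continuous_on UNIV T"
    by (rule continuous_onI) (use iso in auto)
  then have Tm[measurable]: "T \<in> borel_measurable borel"
    by (rule borel_measurable_continuous_onI)
  have "dist x (T y) = dist (T x) y" for x y
    using iso[of "T x" y] inv[of x] by simp
  then have bal: "T -` ball x r = ball (T x) r" "T -` cball x r = cball (T x) r" for x r
    by auto
  let ?n = "distr lborel borel T"
  have nb: "emeasure ?n (ball x r) = emeasure lborel (ball (T x) r)"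
      "emeasure ?n (cball x r) = emeasure lborel (cball (T x) r)" for x r
    by (subst emeasure_distr; simp add: bal)+
  have cp: "emeasure ?n F = emeasure lborel F" if "compact F" for F
  proof -
    have "emeasure lborel F * emeasure ?n (cball 0 1) = emeasure ?n F * emeasure lborel (cball (0::'a) 1)"
    proof (rule uniform_measures_proportional[of lborel ?n UNIV
          "\<lambda>r. ennreal (unit_ball_vol (DIM('a)) * r ^ DIM('a))"
          "\<lambda>r. ennreal (unit_ball_vol (DIM('a)) * r ^ DIM('a))" F "cball 0 1"])
      show "emeasure lborel (cball 0 r :: 'a set) < \<infinity>" for r by (rule emeasure_lborel_cball_finite)
      show "emeasure ?n (cball 0 r :: 'a set) < \<infinity>" for r unfolding nb by (rule emeasure_lborel_cball_finite)
      show "emeasure lborel (ball x r) = ennreal (unit_ball_vol (DIM('a)) * r ^ DIM('a))" if "r > 0" for x :: 'a and r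
        using that by (simp add: emeasure_ball)
      show "emeasure ?n (ball x r) = ennreal (unit_ball_vol (DIM('a)) * r ^ DIM('a))" if "r > 0" for x :: 'a and r
        using that by (simp add: nb emeasure_ball)
      show "0 < ennreal (unit_ball_vol (DIM('a)) * r ^ DIM('a))" if "r > 0" for r
        using that by simp
    qed (use that in auto)
    moreover have "emeasure ?n (cball 0 1) = emeasure lborel (cball 0 1 :: 'a set)" by (simp add: nb emeasure_cball)
    moreover have "emeasure lborel (cball 0 1 :: 'a set) \<noteq> 0" "emeasure lborel (cball 0 1 :: 'a set) \<noteq> top"
      using less_imp_neq[OF unit_ball_vol_pos[of "DIM('a)"]] by (auto simp: emeasure_cball)
    ultimately show ?thesis
      by (simp add: mult.commute[of _ "emeasure lborel (cball 0 1)"] ennreal_mult_cancel_left)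
  qed
  show ?thesis
  proof (rule lborel_eqI[symmetric])
    fix l u :: 'a assume lu: "\<And>b. b \<in> Basis \<Longrightarrow> l \<bullet> b \<le> u \<bullet> b"
    \<comment> \<open>Equality is available on compact sets only, so the open box is exhausted by an
      increasing sequence of them.\<close>
    obtain C where C: "\<And>n. compact (C n)" "\<And>n::nat. C n \<subseteq> box l u" "\<And>n. C n \<subseteq> interior (C (Suc n))" "\<Union>(range C) = box l u"
      by (rule open_Union_compact_subsets[OF open_box[of l u]]) (rule that)
    have inc: "incseq C" using C(3) interior_subset by (intro incseq_SucI) blast
    have sb: "range C \<subseteq> sets borel" using C(1) by (auto intro: borel_compact)
    have "emeasure ?n (box l u) = (SUP k. emeasure ?n (C k))"
      using SUP_emeasure_incseq[of C ?n] inc sb C(4) by simp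
    also have "\<dots> = (SUP k. emeasure lborel (C k))" using cp C(1) by simp
    also have "\<dots> = emeasure lborel (box l u)"
      using SUP_emeasure_incseq[of C lborel] inc sb C(4) by simp
    finally show "emeasure ?n (box l u) = (\<Prod>b\<in>Basis. (u - l) \<bullet> b)" using lu by simp
  qed simp
qed

section \<open>Hyperplane reflections and their action on spheres\<close>

definition reflection :: "'a::euclidean_space \<Rightarrow> 'a \<Rightarrow> 'a" where
  "reflection w z = z - (2 * (z \<bullet> w) / (w \<bullet> w)) *\<^sub>R w"

lemma reflection_scaleR: "reflection w (c *\<^sub>R z) = c *\<^sub>R reflection w z"
  by (simp add: reflection_def algebra_simps)

lemma reflection_diff: "reflection w (x - y) = reflection w x - reflection w y"
  by (simp add: reflection_def algebra_simps diff_divide_distrib)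

lemma reflection_reflection: "reflection w (reflection w z) = z"
proof (cases "w = 0")
  case False
  then have "reflection w z \<bullet> w = - (z \<bullet> w)" by (simp add: reflection_def inner_diff_left)
  then have "reflection w (reflection w z) = reflection w z + (2 * (z \<bullet> w) / (w \<bullet> w)) *\<^sub>R w"
    by (subst reflection_def) simp
  then show ?thesis by (simp add: reflection_def)
qed (simp add: reflection_def)

lemma norm_reflection: "norm (reflection w z) = norm z"
proof (cases "w = 0")
  case False
  define c where "c = z \<bullet> w / (w \<bullet> w)"
  have c: "c * (w \<bullet> w) = z \<bullet> w" using False by (simp add: c_def)
  have r: "reflection w z = z - (2 * c) *\<^sub>R w" by (simp add: reflection_def c_def)
  have "reflection w z \<bullet> reflection w z = z \<bullet> z - 4 * c * (z \<bullet> w) + 4 * c * (c * (w \<bullet> w))"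
    by (simp add: r inner_diff_left inner_diff_right inner_commute algebra_simps)
  also have "\<dots> = z \<bullet> z" unfolding c by simp
  finally show ?thesis by (simp add: norm_eq_sqrt_inner)
qed (simp add: reflection_def)

lemma dist_reflection: "dist (reflection w x) (reflection w y) = dist x y"
  by (metis dist_norm norm_reflection reflection_diff)

text \<open>The difference of two vectors of equal norm is normal to the hyperplane that bisects
  them. Hence any point of the sphere is carried to any other by an isometric involution.\<close>

lemma reflection_swap:
  assumes "norm x = norm y"
  shows "reflection (x - y) x = y"
proof (cases "x = y")
  case False
  have "x \<bullet> x = y \<bullet> y" using assms by (simp add: norm_eq_sqrt_inner)
  then have "(x - y) \<bullet> (x - y) = 2 * (x \<bullet> (x - y))" by (simp add: inner_diff_left inner_diff_right inner_commute)
  moreover have "(x - y) \<bullet> (x - y) \<noteq> 0" using False by simp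
  ultimately have "2 * (x \<bullet> (x - y)) / ((x - y) \<bullet> (x - y)) = 1" by (metis divide_self)
  then have "reflection (x - y) x = x - 1 *\<^sub>R (x - y)" unfolding reflection_def by (rule arg_cong)
  then show ?thesis by simp
qed (simp add: reflection_def)

section \<open>Hausdorff measure on the sphere\<close>

text \<open>The value at \<open>0\<close> is a unit vector in order that \<open>dir\<close> maps into the sphere.\<close>

definition dir :: "'a::euclidean_space \<Rightarrow> 'a" where
  "dir y = (if y = 0 then SOME i. i \<in> Basis else sgn y)"

text \<open>The solid piece of a shell over a subset of the sphere. Lebesgue measure sees this piece
  but not the subset itself.\<close>

definition sector :: "real \<Rightarrow> real \<Rightarrow> 'a::euclidean_space set \<Rightarrow> 'a set" where
  "sector P Q A = {y. P \<le> norm y \<and> norm y \<le> Q \<and> dir y \<in> A}"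

lemma norm_dir [simp]: "norm (dir y) = 1"
  by (simp add: dir_def norm_sgn some_in_eq)

lemma dir_scaleR: "0 < c \<Longrightarrow> dir (c *\<^sub>R y) = dir y"
  by (simp add: dir_def sgn_scaleR)

lemma norm_scaleR_dir: "y \<noteq> 0 \<Longrightarrow> norm y *\<^sub>R dir y = y"
  by (simp add: dir_def sgn_div_norm)

lemma dir_unit: "norm y = 1 \<Longrightarrow> dir y = y"
  by (auto simp: dir_def sgn_div_norm)

lemma borel_measurable_dir [measurable]: "dir \<in> borel_measurable borel"
  unfolding dir_def[abs_def] sgn_div_norm by measurable

lemma measurable_dir_lebesgue [measurable]: "dir \<in> borel_measurable lebesgue"
  by (rule measurable_completion) simp

text \<open>The norm is 1-Lipschitz, so its values on K fill at most an interval of length the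
  diameter, starting at the minimum of the norm.\<close>

lemma emeasure_norm_image_le:
  fixes K :: "'a::euclidean_space set"
  assumes "compact K"
  shows "emeasure lborel (norm ` K) \<le> ennreal (diameter K)"
proof (cases "K = {}")
  case False
  obtain x0 where x0: "x0 \<in> K" "\<And>x. x \<in> K \<Longrightarrow> norm x0 \<le> norm x"
    using continuous_attains_inf[OF assms False, of norm] by (auto intro: continuous_intros)
  have "norm ` K \<subseteq> {norm x0..norm x0 + diameter K}"
  proof safe
    fix x assume x: "x \<in> K"
    have "norm x \<le> norm x0 + dist x0 x" using norm_triangle_ineq2[of x x0] by (simp add: dist_norm norm_minus_commute)
    also have "dist x0 x \<le> diameter K"
      by (rule diameter_bounded_bound[OF compact_imp_bounded[OF assms] x0(1) x])
    finally show "norm x \<in> {norm x0..norm x0 + diameter K}" using x0(2)[OF x] by simp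
  qed
  then have "emeasure lborel (norm ` K) \<le> emeasure lborel {norm x0..norm x0 + diameter K}"
    by (intro emeasure_mono) auto
  then show ?thesis using diameter_ge_0[OF compact_imp_bounded[OF assms]] by simp
qed simp

text \<open>Small cubes cover the sector over \<open>A\<close>; the spheres of radius \<open>t \<in> {1..2}\<close> slice these cubes
  into covers of copies of \<open>A\<close>, and the average over \<open>t\<close> of the cost of these covers is at most the
  total volume of the cubes.\<close>

lemma hausdorff_outer_le_open:
  fixes A U :: "'a::euclidean_space set"
  assumes A: "A \<subseteq> sphere 0 1" and U: "open U" "sector 1 2 A \<subseteq> U"
  shows "hausdorff_outer (DIM('a) - 1) A \<le>
    ennreal (unit_ball_vol (DIM('a) - 1) * DIM('a) ^ DIM('a)) * emeasure lborel U"
  unfolding hausdorff_outer_def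
proof (rule SUP_least)
  define n where "n = DIM('a)"
  have n: "0 < n" "real (n - 1) = real n - 1" by (auto simp: n_def of_nat_diff)
  define w where "w = unit_ball_vol (real (n - 1))"
  have w: "0 < w" by (simp add: w_def)
  fix \<delta> :: real assume "\<delta> \<in> {0<..}"
  then have \<delta>: "0 < \<delta>" by simp
  \<comment> \<open>The gauge confines a cube tagged in U to U and to diameter at most \<delta>.
    Tags outside U do not occur, so the radius 1 there only makes g a gauge.\<close>
  define g where "g x = (if x \<in> U then U \<inter> ball x (\<delta>/2) else ball x 1)" for x
  have "gauge g" using U(1) \<delta> by (auto simp: gauge_def g_def)
  have nle: "norm x \<le> 2 \<Longrightarrow> x \<in> cbox (- 2 *\<^sub>R One) (2 *\<^sub>R One)" for x :: 'a
  proof -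
    assume nx: "norm x \<le> 2"
    have "\<bar>x \<bullet> i\<bar> \<le> 2" if "i \<in> Basis" for i using Basis_le_norm[OF that, of x] nx by linarith
    then show ?thesis by (force simp: mem_box abs_le_iff)
  qed
  have "sector 1 2 A \<subseteq> cbox (- 2 *\<^sub>R One) (2 *\<^sub>R One)" using nle by (auto simp: sector_def)
  moreover have "box (- 2 *\<^sub>R One) (2 *\<^sub>R One) \<noteq> ({} :: 'a set)" by (simp add: box_ne_empty)
  ultimately obtain D where D: "countable D"
      "\<And>K. K \<in> D \<Longrightarrow> interior K \<noteq> {} \<and> (\<exists>c d. K = cbox c d)"
      "pairwise (\<lambda>A B. interior A \<inter> interior B = {}) D"
      "\<And>K. K \<in> D \<Longrightarrow> \<exists>x \<in> sector 1 2 A \<inter> K. K \<subseteq> g x"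
      "\<And>u v. cbox u v \<in> D \<Longrightarrow> \<exists>m. \<forall>i \<in> Basis. v \<bullet> i - u \<bullet> i = ((2 *\<^sub>R One) \<bullet> i - (- 2 *\<^sub>R One) \<bullet> i) / 2^m"
      "sector 1 2 A \<subseteq> \<Union>D"
    using covering_lemma[OF _ _ \<open>gauge g\<close>] by metis
  \<comment> \<open>An enumeration of the countable family \<open>D\<close>, padded with empty sets
    in case it is finite.\<close>
  define K where "K i = (if i \<in> to_nat_on D ` D then from_nat_into D i else {})" for i
  have K_D: "K i = {} \<or> K i \<in> D" for i using D(1) by (auto simp: K_def)
  have D_K: "\<exists>i. L = K i" if "L \<in> D" for L
    using that D(1) by (intro exI[of _ "to_nat_on D L"]) (auto simp: K_def)
  have K_disj: "disjoint_family (\<lambda>i. interior (K i))"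
    unfolding disjoint_family_on_def
  proof (intro ballI impI)
    fix i j :: nat assume "i \<noteq> j"
    show "interior (K i) \<inter> interior (K j) = {}"
    proof (cases "i \<in> to_nat_on D ` D \<and> j \<in> to_nat_on D ` D")
      case True
      then obtain L M where LM: "L \<in> D" "M \<in> D" "i = to_nat_on D L" "j = to_nat_on D M" by auto
      then have "K i = L" "K j = M" "L \<noteq> M" using D(1) \<open>i \<noteq> j\<close> by (auto simp: K_def)
      then show ?thesis using D(3) LM(1,2) by (auto simp: pairwise_def)
    qed (auto simp: K_def)
  qed
  have K_cpt: "compact (K i)" for i using K_D[of i] D(2)[of "K i"] by (auto simp: compact_cbox)
  have K_bd: "bounded (K i)" for i by (rule compact_imp_bounded[OF K_cpt])
  have K_U: "K i \<subseteq> U" "diameter (K i) \<le> \<delta>" for i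
  proof -
    have "K i \<subseteq> U \<and> diameter (K i) \<le> \<delta>"
    proof (cases "K i = {}")
      case False
      then have KD: "K i \<in> D" using K_D by blast
      obtain x where x: "x \<in> sector 1 2 A" "x \<in> K i" "K i \<subseteq> g x" using D(4)[OF KD] by blast
      then have "x \<in> U" using U(2) by blast
      then have sub: "K i \<subseteq> U \<inter> ball x (\<delta>/2)" using x(3) by (simp add: g_def)
      have "diameter (K i) \<le> \<delta>"
      proof (rule diameter_le)
        fix y z assume "y \<in> K i" "z \<in> K i"
        then have "dist x y < \<delta>/2" "dist x z < \<delta>/2" using sub by auto
        then show "norm (y - z) \<le> \<delta>" using dist_triangle2[of y z x] by (simp add: dist_norm norm_minus_commute)
      qed (use False in simp)
      then show ?thesis using sub by auto
    qed (use \<delta> in simp)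
    then show "K i \<subseteq> U" "diameter (K i) \<le> \<delta>" by auto
  qed
  \<comment> \<open>The pieces are dyadic subcubes of [-2, 2]^n, so all sides equal 4 / 2^m. The
    diameter is at most n times the side, which is the origin of the factor n^n.\<close>
  have K_vol: "ennreal (diameter (K i) ^ n) \<le> ennreal (real n ^ n) * emeasure lborel (interior (K i))" for i
  proof (cases "K i = {}")
    case True
    then show ?thesis using n by (simp add: power_0_left)
  next
    case False
    then have KD: "K i \<in> D" using K_D by blast
    obtain c d where cd: "K i = cbox c d" using D(2)[OF KD] by blast
    obtain m where m: "\<And>j. j \<in> Basis \<Longrightarrow> d \<bullet> j - c \<bullet> j = ((2 *\<^sub>R One) \<bullet> j - (- 2 *\<^sub>R One) \<bullet> j) / 2^m"
      using D(5) KD cd by metis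
    define l :: real where "l = 4 / 2^m"
    have side: "d \<bullet> j - c \<bullet> j = l" if "j \<in> Basis" for j using m[OF that] that by (simp add: l_def)
    have l0: "0 \<le> l" by (simp add: l_def)
    have "diameter (K i) \<le> real n * l"
    proof (rule diameter_le)
      fix y z assume yz: "y \<in> K i" "z \<in> K i"
      have "norm (y - z) \<le> (\<Sum>j\<in>Basis. \<bar>(y - z) \<bullet> j\<bar>)" by (rule norm_le_l1)
      also have "\<dots> \<le> (\<Sum>j\<in>(Basis::'a set). l)"
      proof (rule sum_mono)
        fix j :: 'a assume j: "j \<in> Basis"
        have "c \<bullet> j \<le> y \<bullet> j" "y \<bullet> j \<le> d \<bullet> j" "c \<bullet> j \<le> z \<bullet> j" "z \<bullet> j \<le> d \<bullet> j"
          using yz j unfolding cd by (auto simp: mem_box)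
        then show "\<bar>(y - z) \<bullet> j\<bar> \<le> l" using side[OF j] by (simp add: inner_diff_left abs_le_iff)
      qed
      finally show "norm (y - z) \<le> real n * l" by (simp add: n_def)
    qed (use False in simp)
    then have "diameter (K i) ^ n \<le> (real n * l) ^ n"
      using diameter_ge_0[OF K_bd] by (intro power_mono) auto
    then have "ennreal (diameter (K i) ^ n) \<le> ennreal (real n ^ n * l ^ n)"
      by (intro ennreal_leI) (simp add: power_mult_distrib)
    also have "\<dots> = ennreal (real n ^ n) * ennreal (l ^ n)" using l0 by (intro ennreal_mult) auto
    also have "ennreal (l ^ n) = emeasure lborel (interior (K i))"
    proof -
      have "emeasure lborel (box c d) = (\<Prod>j\<in>Basis. (d - c) \<bullet> j)"
        using side l0 by (intro emeasure_lborel_box) (metis diff_ge_0_iff_ge)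
      also have "(\<Prod>j\<in>Basis. (d - c) \<bullet> j) = l ^ n"
        using side by (simp add: inner_diff_left n_def)
      finally show ?thesis by (simp add: cd)
    qed
    finally show ?thesis .
  qed
  define c where "c i = ennreal (w * (diameter (K i) / 2) ^ (n - 1))" for i
  \<comment> \<open>Division by t carries the slice of a cube by the sphere of radius t to the unit
    sphere, and does not increase distances because 1 \<le> t.\<close>
  have slice: "hausdorff_content \<delta> (n - 1) A \<le> (\<Sum>i. c i * indicator (norm ` K i) t)" if t: "t \<in> {1..2}" for t
  proof -
    define E where "E i = (\<lambda>x. x /\<^sub>R t) ` (K i \<inter> sphere 0 t)" for i
    have E_dist: "dist x y \<le> diameter (K i)" if "x \<in> E i" "y \<in> E i" for x y i
    proof -
      obtain x' y' where xy: "x = x' /\<^sub>R t" "x' \<in> K i" "y = y' /\<^sub>R t" "y' \<in> K i"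
        using \<open>x \<in> E i\<close> \<open>y \<in> E i\<close> by (auto simp: E_def)
      have "dist x y = dist x' y' / t" using t unfolding xy by (simp add: dist_norm flip: scaleR_diff_right) (simp add: field_simps)
      also have "\<dots> \<le> dist x' y'" using t by (simp add: divide_le_eq mult_le_cancel_left1)
      also have "\<dots> \<le> diameter (K i)" using diameter_bounded_bound[OF K_bd] xy by blast
      finally show ?thesis .
    qed
    have E_bd: "bounded (E i)" for i
      unfolding bounded_two_points using E_dist by blast
    have E_diam: "diameter (E i) \<le> diameter (K i)" for i
      using E_dist diameter_ge_0[OF K_bd] by (intro diameter_le) (auto simp: dist_norm)
    have "hausdorff_cover \<delta> A E"
      unfolding hausdorff_cover_def
    proof safe
      fix a assume a: "a \<in> A"
      then have na: "norm a = 1" using A by auto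
      then have "t *\<^sub>R a \<in> sector 1 2 A" using t a by (simp add: sector_def dir_scaleR dir_unit)
      then obtain L where "L \<in> D" "t *\<^sub>R a \<in> L" using D(6) by blast
      then obtain i where i: "t *\<^sub>R a \<in> K i" using D_K by blast
      have "a = (t *\<^sub>R a) /\<^sub>R t" using t by simp
      then have "a \<in> E i" unfolding E_def using i na t by (intro image_eqI[of _ _ "t *\<^sub>R a"]) auto
      then show "a \<in> (\<Union>i. E i)" by blast
    qed (use E_bd E_diam K_U(2) in \<open>auto intro: order_trans\<close>)
    then have "hausdorff_content \<delta> (n - 1) A \<le> (\<Sum>i. hausdorff_weight (n - 1) (E i))"
      by (rule hausdorff_content_le)
    also have "\<dots> \<le> (\<Sum>i. c i * indicator (norm ` K i) t)"
    proof (intro suminf_le summableI)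
      fix i
      show "hausdorff_weight (n - 1) (E i) \<le> c i * indicator (norm ` K i) t"
      proof (cases "E i = {}")
        case False
        then have "t \<in> norm ` K i" by (auto simp: E_def)
        moreover have "w * (diameter (E i) / 2) ^ (n - 1) \<le> w * (diameter (K i) / 2) ^ (n - 1)"
          using E_diam[of i] diameter_ge_0[OF E_bd] w by (intro mult_left_mono power_mono) auto
        ultimately show ?thesis using False by (auto simp: c_def w_def intro: ennreal_leI)
      qed simp
    qed
    finally show ?thesis .
  qed
  \<comment> \<open>The interval of radii has length 1, so averaging the slicing bound over it
    reproduces the left-hand side exactly.\<close>
  have "hausdorff_content \<delta> (n - 1) A = (\<integral>\<^sup>+t. hausdorff_content \<delta> (n - 1) A * indicator {1..2::real} t \<partial>lborel)"
    by (simp add: nn_integral_cmult_indicator)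
  also have "\<dots> \<le> (\<integral>\<^sup>+t. (\<Sum>i. c i * indicator (norm ` K i) t) \<partial>lborel)"
    by (rule nn_integral_mono) (use slice in \<open>auto simp: indicator_def\<close>)
  also have "\<dots> = (\<Sum>i. \<integral>\<^sup>+t. c i * indicator (norm ` K i) t \<partial>lborel)"
  proof (rule nn_integral_suminf)
    fix i
    have "compact (norm ` K i)" by (intro compact_continuous_image K_cpt continuous_intros)
    then have "norm ` K i \<in> sets borel" by (rule borel_compact)
    then show "(\<lambda>t. c i * indicator (norm ` K i) t) \<in> borel_measurable lborel" by simp
  qed
  also have "\<dots> = (\<Sum>i. c i * emeasure lborel (norm ` K i))"
  proof (rule suminf_cong)
    fix i
    have "compact (norm ` K i)" by (intro compact_continuous_image K_cpt continuous_intros)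
    then have "norm ` K i \<in> sets lborel" by (simp add: borel_compact)
    then show "(\<integral>\<^sup>+t. c i * indicator (norm ` K i) t \<partial>lborel) = c i * emeasure lborel (norm ` K i)"
      by (rule nn_integral_cmult_indicator)
  qed
  \<comment> \<open>The cost is of order diameter^(n-1), and the cube is met for a set of radii of
    length at most its diameter. The product is of order diameter^n, hence of the order of the
    volume.\<close>
  also have "\<dots> \<le> (\<Sum>i. ennreal (w * real n ^ n) * emeasure lborel (interior (K i)))"
  proof (intro suminf_le summableI)
    fix i
    define x where "x = diameter (K i)"
    have x: "0 \<le> x" using diameter_ge_0[OF K_bd] by (simp add: x_def)
    have "c i * emeasure lborel (norm ` K i) \<le> ennreal (w * (x / 2) ^ (n - 1)) * ennreal x"
      unfolding c_def x_def by (intro mult_left_mono emeasure_norm_image_le K_cpt) auto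
    also have "\<dots> = ennreal (w * ((x / 2) ^ (n - 1) * x))"
      using x w by (subst ennreal_mult[symmetric]) (auto simp: mult_ac)
    also have "\<dots> \<le> ennreal (w * (x ^ (n - 1) * x))"
      using x w by (intro ennreal_leI mult_left_mono mult_right_mono power_mono) auto
    also have "x ^ (n - 1) * x = x ^ n" using n by (metis power_minus_mult)
    also have "ennreal (w * x ^ n) = ennreal w * ennreal (x ^ n)" using x w by (intro ennreal_mult) auto
    also have "\<dots> \<le> ennreal w * (ennreal (real n ^ n) * emeasure lborel (interior (K i)))"
      unfolding x_def by (intro mult_left_mono K_vol) auto
    also have "\<dots> = ennreal (w * real n ^ n) * emeasure lborel (interior (K i))"
      using w by (simp add: ennreal_mult mult.assoc)
    finally show "c i * emeasure lborel (norm ` K i) \<le> ennreal (w * real n ^ n) * emeasure lborel (interior (K i))" .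
  qed
  also have "\<dots> = ennreal (w * real n ^ n) * (\<Sum>i. emeasure lborel (interior (K i)))"
    by (rule ennreal_suminf_cmult)
  also have "(\<Sum>i. emeasure lborel (interior (K i))) = emeasure lborel (\<Union>i. interior (K i))"
    using K_disj by (intro suminf_emeasure) (auto simp: borel_open)
  also have "\<dots> \<le> emeasure lborel U"
    using K_U(1) interior_subset U(1) by (intro emeasure_mono) (auto simp: borel_open)
  finally show "hausdorff_content \<delta> (DIM('a) - 1) A \<le>
      ennreal (unit_ball_vol (DIM('a) - 1) * DIM('a) ^ DIM('a)) * emeasure lborel U"
    using n by (simp add: w_def n_def mult_left_mono)
qed

abbreviation slicing_const :: "'a::euclidean_space itself \<Rightarrow> real" where
  "slicing_const _ \<equiv> unit_ball_vol (DIM('a) - 1) * DIM('a) ^ DIM('a)"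

lemma sector_eq: "sector P Q A = {y. P \<le> norm y \<and> norm y \<le> Q} \<inter> dir -` A"
  by (auto simp: sector_def)

lemma sets_sector:
  assumes "dir -` A \<in> sets lebesgue"
  shows "sector P Q A \<in> sets lebesgue"
proof -
  have "closed {y::'a. P \<le> norm y \<and> norm y \<le> Q}"
    by (intro closed_Collect_conj closed_Collect_le continuous_intros)
  then have "{y::'a. P \<le> norm y \<and> norm y \<le> Q} \<in> sets lebesgue"
    by (simp add: borel_closed sets_completionI_sets)
  then show ?thesis unfolding sector_eq using assms by (rule sets.Int)
qed

text \<open>Outer regularity of Lebesgue measure lets the open neighbourhood shrink to the
  sector.\<close>

lemma hausdorff_outer_le_sector:
  fixes A :: "'a::euclidean_space set"
  assumes A: "A \<subseteq> sphere 0 1" and m: "sector 1 2 A \<in> sets lebesgue"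
  shows "hausdorff_outer (DIM('a) - 1) A \<le> ennreal (slicing_const TYPE('a)) * emeasure lebesgue (sector 1 2 A)"
proof (rule ennreal_le_epsilon)
  fix e :: real assume e: "0 < e"
  define C where "C = slicing_const TYPE('a)"
  have C: "0 < C" by (simp add: C_def)
  obtain T where T: "open T" "sector 1 2 A \<subseteq> T" "T - sector 1 2 A \<in> lmeasurable"
      "emeasure lebesgue (T - sector 1 2 A) < ennreal (e / C)"
    using sets_lebesgue_outer_open[OF m, of "e / C"] e C by auto
  have "hausdorff_outer (DIM('a) - 1) A \<le> ennreal C * emeasure lborel T"
    unfolding C_def by (rule hausdorff_outer_le_open[OF A T(1,2)])
  also have "emeasure lborel T = emeasure lebesgue T" using T(1) by (simp add: borel_open)
  also have "\<dots> = emeasure lebesgue (sector 1 2 A \<union> (T - sector 1 2 A))"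
    using T(2) by (simp add: Un_absorb1)
  also have "\<dots> \<le> emeasure lebesgue (sector 1 2 A) + emeasure lebesgue (T - sector 1 2 A)"
    using m T(3) by (intro emeasure_subadditive) auto
  also have "\<dots> \<le> emeasure lebesgue (sector 1 2 A) + ennreal (e / C)"
    using T(4) by (intro add_left_mono) auto
  finally have "hausdorff_outer (DIM('a) - 1) A \<le> ennreal C * (emeasure lebesgue (sector 1 2 A) + ennreal (e / C))"
    by (simp add: mult_left_mono)
  also have "\<dots> = ennreal C * emeasure lebesgue (sector 1 2 A) + ennreal e"
    using C e by (simp add: distrib_left flip: ennreal_mult)
  finally show "hausdorff_outer (DIM('a) - 1) A \<le> ennreal (slicing_const TYPE('a)) * emeasure lebesgue (sector 1 2 A) + ennreal e"
    by (simp add: C_def)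
qed

lemma hausdorff_outer_sphere_finite:
  "hausdorff_outer (DIM('a) - 1) (sphere 0 1 :: 'a::euclidean_space set) < \<infinity>"
proof -
  have "hausdorff_outer (DIM('a) - 1) (sphere 0 1 :: 'a set) \<le> ennreal (slicing_const TYPE('a)) * emeasure lborel (ball 0 3 :: 'a set)"
    by (rule hausdorff_outer_le_open) (auto simp: sector_def)
  also have "\<dots> < \<infinity>" using emeasure_lborel_ball_finite[of "0::'a" 3] by (simp add: ennreal_mult_less_top)
  finally show ?thesis .
qed

text \<open>Balls of radius 3 r with centres spaced by r along the ray through \<open>x0\<close>
  suffice. There are about 1 / r of them, each of volume of order r^n.\<close>

lemma sector_small_cover:
  fixes E :: "'a::euclidean_space set"
  assumes E: "x0 \<in> E" "E \<subseteq> sphere 0 1" and r: "0 < r" "r \<le> 1"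
    and d: "\<And>x y. x \<in> E \<Longrightarrow> y \<in> E \<Longrightarrow> dist x y \<le> r"
  obtains W where "W \<in> sets borel" "sector 1 2 E \<subseteq> W"
    "emeasure lborel W \<le> ennreal (2 * unit_ball_vol (DIM('a)) * 3 ^ DIM('a) * r ^ (DIM('a) - 1))"
proof
  define n where "n = DIM('a)"
  have n: "0 < n" by (simp add: n_def)
  define N where "N = nat \<lfloor>1 / r\<rfloor>"
  have N: "real N \<le> 1 / r" using r by (simp add: N_def)
  define B where "B k = cball ((1 + real k * r) *\<^sub>R x0) (3 * r)" for k
  define W where "W = (\<Union>k\<in>{..N}. B k)"
  show "W \<in> sets borel" by (auto simp: W_def B_def intro!: sets.finite_UN)
  show "sector 1 2 E \<subseteq> W"
  proof
    fix y assume "y \<in> sector 1 2 E"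
    then have y: "1 \<le> norm y" "norm y \<le> 2" "dir y \<in> E" by (auto simp: sector_def)
    define k where "k = nat \<lfloor>(norm y - 1) / r\<rfloor>"
    have "real k \<le> (norm y - 1) / r" "(norm y - 1) / r < real k + 1"
      using y r by (simp_all add: k_def)
    then have k: "real k * r \<le> norm y - 1" "norm y - 1 < real k * r + r"
      using r by (simp_all add: field_simps)
    have "k \<le> N" unfolding k_def N_def using y r by (intro nat_mono floor_mono divide_right_mono) auto
    have "dist ((1 + real k * r) *\<^sub>R x0) y = norm ((1 + real k * r) *\<^sub>R x0 - norm y *\<^sub>R dir y)"
      using y by (subst norm_scaleR_dir) (auto simp: dist_norm)
    also have "(1 + real k * r) *\<^sub>R x0 - norm y *\<^sub>R dir y =
        (1 + real k * r - norm y) *\<^sub>R x0 + norm y *\<^sub>R (x0 - dir y)"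
      by (simp add: algebra_simps)
    also have "norm \<dots> \<le> \<bar>1 + real k * r - norm y\<bar> * norm x0 + norm y * dist x0 (dir y)"
      by (rule order_trans[OF norm_triangle_ineq]) (simp add: dist_norm)
    \<comment> \<open>One r comes from the spacing of the centres, 2 r from the deviation in
      direction, magnified by the norm of y, which is at most 2.\<close>
    also have "\<dots> \<le> r * 1 + 2 * r"
    proof (intro add_mono mult_mono)
      show "norm x0 \<le> 1" using E by auto
      show "dist x0 (dir y) \<le> r" using d E y by blast
    qed (use k y r in auto)
    finally have "y \<in> B k" by (simp add: B_def)
    then show "y \<in> W" using \<open>k \<le> N\<close> by (auto simp: W_def)
  qed
  have "emeasure lborel W \<le> (\<Sum>k\<in>{..N}. emeasure lborel (B k))"
    unfolding W_def by (rule emeasure_subadditive_finite) (auto simp: B_def)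
  also have "\<dots> = (\<Sum>k\<in>{..N}. ennreal (unit_ball_vol n * (3 * r) ^ n))"
    using r by (simp add: B_def emeasure_cball n_def)
  also have "\<dots> = ennreal (real (Suc N) * (unit_ball_vol n * (3 * r) ^ n))"
    using r by (simp add: ennreal_of_nat_eq_real_of_nat ennreal_mult del: of_nat_Suc)
  also have "\<dots> \<le> ennreal (2 * unit_ball_vol n * 3 ^ n * r ^ (n - 1))"
  proof (rule ennreal_leI)
    have "real (Suc N) * r \<le> 2" using N r by (simp add: field_simps)
    moreover have "r ^ n = r * r ^ (n - 1)" using n by (metis power_eq_if less_not_refl)
    ultimately have "real (Suc N) * r ^ n \<le> 2 * r ^ (n - 1)"
      using r by (simp add: mult_right_mono flip: mult.assoc del: of_nat_Suc)
    then have "(real (Suc N) * r ^ n) * (unit_ball_vol n * 3 ^ n) \<le> (2 * r ^ (n - 1)) * (unit_ball_vol n * 3 ^ n)"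
      by (rule mult_right_mono) simp
    then show "real (Suc N) * (unit_ball_vol n * (3 * r) ^ n) \<le> 2 * unit_ball_vol n * 3 ^ n * r ^ (n - 1)"
      by (simp add: power_mult_distrib mult_ac del: of_nat_Suc)
  qed
  finally show "emeasure lborel W \<le> ennreal (2 * unit_ball_vol (DIM('a)) * 3 ^ DIM('a) * r ^ (DIM('a) - 1))"
    by (simp add: n_def)
qed

text \<open>If the sphere were null it would have covers of arbitrarily small cost. The sectors over
  the covering sets have volume bounded by the cost, so the shell between radii 1 and 2 would be a
  null set; yet it contains a ball.\<close>

lemma hausdorff_outer_sphere_pos:
  "hausdorff_outer (DIM('a) - 1) (sphere 0 1 :: 'a::euclidean_space set) \<noteq> 0"
proof
  assume 0: "hausdorff_outer (DIM('a) - 1) (sphere 0 1 :: 'a set) = 0"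
  let ?S = "sphere 0 1 :: 'a set"
  define m where "m = DIM('a) - 1"
  define C where "C = 2 * unit_ball_vol (DIM('a)) * 3 ^ DIM('a)"
  define w where "w = unit_ball_vol (real m)"
  have C: "0 < C" and w: "0 < w" by (simp_all add: C_def w_def)
  define C' where "C' = C * 2 ^ m / w"
  have C': "0 < C'" using C w by (simp add: C'_def)
  have small: "emeasure lborel (sector 1 2 ?S) \<le> ennreal ((C' + C) * e)" if e: "0 < e" for e
  proof -
    have "hausdorff_content 1 m ?S < ennreal e"
      using hausdorff_content_le_outer[of 1 m ?S] 0 e by (simp add: m_def)
    then obtain E where E: "hausdorff_cover 1 ?S E" "(\<Sum>i. hausdorff_weight m (E i)) < ennreal e"
      unfolding hausdorff_content_eq by (auto simp only: INF_less_iff mem_Collect_eq)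
    have "\<exists>W. W \<in> sets borel \<and> sector 1 2 (E i \<inter> ?S) \<subseteq> W \<and>
        emeasure lborel W \<le> ennreal C' * hausdorff_weight m (E i) + ennreal (C * (e * (1/2) ^ Suc i))" for i
    proof (cases "E i \<inter> ?S = {}")
      case True
      then show ?thesis by (intro exI[of _ "{}"]) (auto simp: sector_def)
    next
      case False
      then obtain x0 where x0: "x0 \<in> E i \<inter> ?S" by blast
      define D where "D = diameter (E i)"
      have bd: "bounded (E i)" "D \<le> 1" using E(1) by (auto simp: hausdorff_cover_def D_def)
      have D0: "0 \<le> D" using diameter_ge_0[OF bd(1)] by (simp add: D_def)
      define f where "f = e * (1/2) ^ Suc i"
      have f: "0 < f" using e by (simp add: f_def)
      \<comment> \<open>The volume bound asks for a positive r, while a covering set may have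
        diameter 0. Enlarging D adds at most f to the power, and the f sum to e. In dimension 1 the
        power is 0, and r = 1 works for D = 0 because 0 ^ 0 = 1.\<close>
      obtain r where r: "0 < r" "r \<le> 1" "D \<le> r" "r ^ m \<le> D ^ m + f"
      proof (cases "D = 0")
        case True
        show ?thesis
        proof (cases "m = 0")
          case True
          then show ?thesis using that[of 1] bd f by simp
        next
          case False
          have "min 1 f ^ m \<le> min 1 f ^ 1" using f False by (intro power_decreasing) auto
          then show ?thesis using that[of "min 1 f"] f True False by (simp add: zero_power)
        qed
      next
        case False
        then show ?thesis using that[of D] D0 bd f by simp
      qed
      obtain W where W: "W \<in> sets borel" "sector 1 2 (E i \<inter> ?S) \<subseteq> W" "emeasure lborel W \<le> ennreal (C * r ^ m)"
      proof (rule sector_small_cover[OF x0 _ r(1,2)])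
        fix x y assume "x \<in> E i \<inter> ?S" "y \<in> E i \<inter> ?S"
        then show "dist x y \<le> r" using diameter_bounded_bound[OF bd(1), of x y] r(3) by (simp add: D_def)
      qed (auto simp: C_def m_def)
      have "ennreal (C * r ^ m) \<le> ennreal (C * (D ^ m + f))" using r C by (intro ennreal_leI mult_left_mono) auto
      also have "\<dots> = ennreal (C' * (w * (D / 2) ^ m) + C * f)"
        using w by (simp add: C'_def power_divide distrib_left)
      also have "\<dots> = ennreal C' * ennreal (w * (D / 2) ^ m) + ennreal (C * f)"
        using C C' w D0 f by (simp add: ennreal_plus ennreal_mult)
      also have "ennreal (w * (D / 2) ^ m) = hausdorff_weight m (E i)"
        using x0 by (auto simp: w_def D_def)
      finally show ?thesis using W unfolding f_def by (intro exI[of _ W]) (auto intro: order_trans)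
    qed
    then have "\<exists>W. \<forall>i. W i \<in> sets borel \<and> sector 1 2 (E i \<inter> ?S) \<subseteq> W i \<and>
        emeasure lborel (W i) \<le> ennreal C' * hausdorff_weight m (E i) + ennreal (C * (e * (1/2) ^ Suc i))"
      by (intro choice allI)
    then obtain W where W0: "\<forall>i. W i \<in> sets borel \<and> sector 1 2 (E i \<inter> ?S) \<subseteq> W i \<and>
        emeasure lborel (W i) \<le> ennreal C' * hausdorff_weight m (E i) + ennreal (C * (e * (1/2) ^ Suc i))"
      by (rule exE)
    have W1: "W i \<in> sets borel" and W2: "sector 1 2 (E i \<inter> ?S) \<subseteq> W i"
      and W3: "emeasure lborel (W i) \<le> ennreal C' * hausdorff_weight m (E i) + ennreal (C * (e * (1/2) ^ Suc i))" for i
      using spec[OF W0, of i] by (blast, blast, blast)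
    have "sector 1 2 ?S \<subseteq> (\<Union>i. W i)"
    proof
      fix y :: 'a assume y: "y \<in> sector 1 2 ?S"
      then have "dir y \<in> (\<Union>i. E i)" using E(1) unfolding hausdorff_cover_def sector_def by blast
      then obtain i where "dir y \<in> E i" by blast
      then have "y \<in> sector 1 2 (E i \<inter> ?S)" using y by (simp add: sector_def)
      then show "y \<in> (\<Union>i. W i)" using W2 by blast
    qed
    then have "emeasure lborel (sector 1 2 ?S) \<le> emeasure lborel (\<Union>i. W i)"
      using W1 by (intro emeasure_mono) auto
    also have "\<dots> \<le> (\<Sum>i. emeasure lborel (W i))"
      using W1 by (intro emeasure_subadditive_countably) auto
    also have "\<dots> \<le> (\<Sum>i. ennreal C' * hausdorff_weight m (E i) + ennreal (C * (e * (1/2) ^ Suc i)))"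
      by (intro suminf_le W3 summableI)
    also have "\<dots> = (\<Sum>i. ennreal C' * hausdorff_weight m (E i)) + (\<Sum>i. ennreal (C * (e * (1/2) ^ Suc i)))"
      by (rule suminf_add[symmetric]) auto
    also have "(\<Sum>i. ennreal C' * hausdorff_weight m (E i)) = ennreal C' * (\<Sum>i. hausdorff_weight m (E i))"
      by (rule ennreal_suminf_cmult)
    also have "\<dots> \<le> ennreal C' * ennreal e" using E(2) by (intro mult_left_mono) auto
    also have "(\<Sum>i. ennreal (C * (e * (1/2) ^ Suc i))) = ennreal (C * e)"
    proof -
      have "(\<lambda>i. C * (e * (1/2) ^ Suc i)) sums (C * (e * 1))" by (intro sums_mult power_half_series)
      then show ?thesis using e C by (subst suminf_ennreal2) (auto simp: sums_iff)
    qed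
    also have "ennreal C' * ennreal e + ennreal (C * e) = ennreal ((C' + C) * e)"
      using C C' e by (simp add: distrib_right ennreal_plus ennreal_mult)
    finally show ?thesis by (simp add: add_right_mono)
  qed
  have "emeasure lborel (sector 1 2 ?S) \<le> 0"
  proof (rule ennreal_le_epsilon)
    fix e :: real assume "0 < e"
    then show "emeasure lborel (sector 1 2 ?S) \<le> 0 + ennreal e"
      using small[of "e / (C' + C)"] C C' by simp
  qed
  moreover obtain i :: 'a where i: "i \<in> Basis" by (metis nonempty_Basis ex_in_conv)
  have "ball ((3/2) *\<^sub>R i) (1/2) \<subseteq> sector 1 2 ?S"
  proof
    fix y assume "y \<in> ball ((3/2) *\<^sub>R i) (1/2)"
    then have "norm ((3/2) *\<^sub>R i - y) < 1/2" by (simp add: dist_norm)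
    moreover have "norm ((3/2) *\<^sub>R i) = 3/2" using i by simp
    ultimately have "1 \<le> norm y" "norm y \<le> 2"
      using norm_triangle_ineq2[of "(3/2) *\<^sub>R i" y] norm_triangle_ineq2[of y "(3/2) *\<^sub>R i"]
      by (simp_all add: norm_minus_commute)
    then show "y \<in> sector 1 2 ?S" by (simp add: sector_def)
  qed
  moreover have "sector 1 2 ?S \<in> sets borel"
  proof -
    have "closed {y::'a. 1 \<le> norm y \<and> norm y \<le> 2}"
      by (intro closed_Collect_conj closed_Collect_le continuous_intros)
    moreover have "sector 1 2 ?S = {y. 1 \<le> norm y \<and> norm y \<le> 2}" by (auto simp: sector_def)
    ultimately show ?thesis by (simp add: borel_closed)
  qed
  ultimately have "emeasure lborel (ball ((3/2) *\<^sub>R i) (1/2)) \<le> 0"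
    using emeasure_mono[of "ball ((3/2) *\<^sub>R i) (1/2)" "sector 1 2 ?S" lborel] by simp
  moreover have "0 < unit_ball_vol (real DIM('a)) * (1 / 2) ^ DIM('a)" by simp
  ultimately show False by (simp add: emeasure_ball)
qed

text \<open>Images of covering sets keep their diameters. One inequality is enough, since the
  reverse one arises by exchanging the roles of the two sets.\<close>

lemma hausdorff_outer_isometry_le:
  fixes T :: "'a::metric_space \<Rightarrow> 'b::metric_space"
  assumes iso: "\<And>x y. dist (T x) (T y) = dist x y"
  shows "hausdorff_outer d (T ` A) \<le> hausdorff_outer d A"
  unfolding hausdorff_outer_def
proof (rule SUP_mono', rule hausdorff_content_geI)
  fix \<delta> E assume E: "hausdorff_cover \<delta> A E"
  have diam: "diameter (T ` X) = diameter X" for X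
  proof -
    have "(\<lambda>(x, y). dist x y) ` (T ` X \<times> T ` X) = (\<lambda>(x, y). dist x y) ` (X \<times> X)"
      by (force simp: iso image_iff)
    then show ?thesis by (simp add: diameter_def)
  qed
  have bdd: "bounded (T ` X)" if "bounded X" for X
    using that iso unfolding bounded_two_points by auto
  have "hausdorff_cover \<delta> (T ` A) (\<lambda>i. T ` E i)"
    using E bdd unfolding hausdorff_cover_def diam by blast
  then have "hausdorff_content \<delta> d (T ` A) \<le> (\<Sum>i. hausdorff_weight d (T ` E i))"
    by (rule hausdorff_content_le)
  then show "hausdorff_content \<delta> d (T ` A) \<le> (\<Sum>i. hausdorff_weight d (E i))"
    by (simp add: diam cong: if_cong)
qed

lemma borel_subset_hausdorff: "sets borel \<subseteq> sets (hausdorff_measure d)"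
proof -
  have "{S. closed S} \<subseteq> sets (hausdorff_measure d)" using hausdorff_closed_measurable by auto
  then have "sigma_sets UNIV {S. closed S} \<subseteq> sets (hausdorff_measure d)"
    using sets.sigma_sets_subset[of "{S. closed S}" "hausdorff_measure d"] by simp
  then show ?thesis by (simp add: borel_eq_closed)
qed

text \<open>Finitely many balls of the common mass h cover the compact set X, whose mass is not
  0.\<close>

lemma uniform_ball_pos:
  fixes \<mu> :: "'a::euclidean_space measure"
  assumes sets: "sets \<mu> = sets borel" and X: "compact X" "emeasure \<mu> X \<noteq> 0"
    and unif: "\<And>x. x \<in> X \<Longrightarrow> emeasure \<mu> (ball x r) = h" and r: "0 < r"
  shows "0 < h"
proof (rule ccontr)
  assume "\<not> 0 < h"
  then have h: "h = 0" by (simp add: not_gr_zero)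
  obtain D where D: "D \<subseteq> X" "finite D" "X \<subseteq> (\<Union>x\<in>D. ball x r)"
  proof (rule compactE_image[OF X(1), of X "\<lambda>x. ball x r"])
    show "X \<subseteq> (\<Union>x\<in>X. ball x r)" using r by auto
  qed auto
  have "emeasure \<mu> X \<le> emeasure \<mu> (\<Union>x\<in>D. ball x r)"
    by (intro emeasure_mono D) (simp add: sets borel_open open_UN)
  also have "\<dots> \<le> (\<Sum>x\<in>D. emeasure \<mu> (ball x r))"
    by (intro emeasure_subadditive_finite D) (simp add: sets image_subset_iff borel_open)
  also have "\<dots> = 0" using D(1) unif h by (intro sum.neutral) auto
  finally show False using X(2) by simp
qed

section \<open>Radial projection of Lebesgue measure and Hausdorff measure on the sphere\<close>

context
  fixes p q :: real
  assumes pq: "0 < p" "p < q"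
begin

text \<open>For K homogeneous of degree -(n+1), the vector K(y) y is |y|^(-n) times a function of
  the direction alone. The weight is this radial factor, restricted to the shell.\<close>

definition shell_weight :: "'a::euclidean_space \<Rightarrow> ennreal" where
  "shell_weight y = ennreal (indicator {y. p \<le> norm y \<and> norm y < q} y / norm y ^ DIM('a))"

definition sphere_measure :: "'a::euclidean_space measure" where
  "sphere_measure = distr (density lborel shell_weight) borel dir"

text \<open>The image under the identity only cuts the sigma-algebra down to the Borel sets, so that
  the two measures to be compared have the same measurable sets.\<close>

definition sphere_hausdorff :: "'a::euclidean_space measure" where
  "sphere_hausdorff = distr (density (hausdorff_measure (DIM('a) - 1)) (indicator (sphere 0 1))) borel (\<lambda>x. x)"

lemma shell_weight_measurable [measurable]: "shell_weight \<in> borel_measurable borel"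
  unfolding shell_weight_def[abs_def] by measurable

lemma shell_weight_le: "shell_weight (y::'a::euclidean_space) \<le> ennreal (1 / p ^ DIM('a)) * indicator (sector p q UNIV) y"
proof (cases "p \<le> norm y \<and> norm y < q")
  case True
  have "1 / norm y ^ DIM('a) \<le> 1 / p ^ DIM('a)"
    using True pq by (intro divide_left_mono power_mono mult_pos_pos zero_less_power) auto
  then show ?thesis using True by (auto simp: shell_weight_def sector_def intro: ennreal_leI)
qed (simp add: shell_weight_def)

lemma emeasure_sphere_measure:
  assumes "A \<in> sets borel"
  shows "emeasure sphere_measure A = (\<integral>\<^sup>+y. shell_weight y * indicator A (dir y) \<partial>lborel)"
proof -
  have 1: "dir -` A \<in> sets borel" using measurable_sets[OF borel_measurable_dir assms] by simp
  then have "emeasure sphere_measure A = emeasure (density lborel shell_weight) (dir -` A)"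
    unfolding sphere_measure_def using assms by (subst emeasure_distr) auto
  also have "\<dots> = (\<integral>\<^sup>+y. shell_weight y * indicator (dir -` A) y \<partial>lborel)"
    using 1 by (subst emeasure_density) auto
  finally show ?thesis by (simp add: indicator_def)
qed

lemma emeasure_sphere_hausdorff:
  fixes A :: "'a::euclidean_space set"
  assumes "A \<in> sets borel"
  shows "emeasure sphere_hausdorff A = hausdorff_outer (DIM('a) - 1) (sphere 0 1 \<inter> A)"
proof -
  let ?H = "hausdorff_measure (DIM('a) - 1) :: 'a measure"
  have A: "A \<in> sets ?H" using assms by (rule subsetD[OF borel_subset_hausdorff])
  have S: "sphere 0 1 \<in> sets ?H" by (rule subsetD[OF borel_subset_hausdorff]) (simp add: borel_closed)
  have id: "(\<lambda>x. x) \<in> density ?H (indicator (sphere 0 1)) \<rightarrow>\<^sub>M borel"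
    using borel_subset_hausdorff[of "DIM('a) - 1"] by (intro measurableI) auto
  have "emeasure sphere_hausdorff A = emeasure (density ?H (indicator (sphere 0 1))) A"
    unfolding sphere_hausdorff_def using assms by (subst emeasure_distr[OF id]) auto
  also have "\<dots> = (\<integral>\<^sup>+y. indicator (sphere 0 1) y * indicator A y \<partial>?H)"
    using A S by (subst emeasure_density) auto
  also have "\<dots> = (\<integral>\<^sup>+y. indicator (sphere 0 1 \<inter> A) y \<partial>?H)"
    by (simp add: indicator_inter_arith)
  also have "\<dots> = emeasure ?H (sphere 0 1 \<inter> A)" using A S by simp
  also have "\<dots> = hausdorff_outer (DIM('a) - 1) (sphere 0 1 \<inter> A)"
    using A S by (intro emeasure_hausdorff_measure) auto
  finally show ?thesis .
qed

text \<open>The reflection that exchanges the two centres preserves Lebesgue measure and the norm,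
  hence the weight, and commutes with \<open>dir\<close> away from 0.\<close>

lemma sphere_measure_ball:
  fixes x e :: "'a::euclidean_space"
  assumes "norm x = 1" "norm e = 1"
  shows "emeasure sphere_measure (ball x r) = emeasure sphere_measure (ball e r)"
proof -
  define T where "T = reflection (x - e)"
  have Tx: "T x = e" using reflection_swap[of x e] assms by (simp add: T_def)
  have iso: "dist (T y) (T z) = dist y z" for y z by (simp add: T_def dist_reflection)
  have dT: "distr lborel borel T = lborel"
    by (rule lborel_distr_isometry) (simp_all add: T_def dist_reflection reflection_reflection)
  have [measurable]: "T \<in> borel_measurable borel"
    by (intro borel_measurable_continuous_onI continuous_onI) (use iso in auto)
  have [measurable]: "ball e r \<in> sets borel" "ball x r \<in> sets borel" by auto
  have "emeasure sphere_measure (ball e r) = (\<integral>\<^sup>+y. shell_weight y * indicator (ball e r) (dir y) \<partial>distr lborel borel T)"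
    unfolding dT by (rule emeasure_sphere_measure) simp
  also have "\<dots> = (\<integral>\<^sup>+y. shell_weight (T y) * indicator (ball e r) (dir (T y)) \<partial>lborel)"
    by (subst nn_integral_distr) auto
  also have "\<dots> = (\<integral>\<^sup>+y. shell_weight y * indicator (ball x r) (dir y) \<partial>lborel)"
  proof (rule nn_integral_cong)
    fix y :: 'a
    show "shell_weight (T y) * indicator (ball e r) (dir (T y)) = shell_weight y * indicator (ball x r) (dir y)"
    \<comment> \<open>At 0 the value of \<open>dir\<close> is arbitrary and not respected by
      \<open>T\<close>; the weight vanishes there because p is positive.\<close>
    proof (cases "y = 0")
      case True
      then show ?thesis using pq by (simp add: shell_weight_def T_def reflection_def)
    next
      case False
      have "norm (T y) = norm y" by (simp add: T_def norm_reflection)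
      moreover from this False have "T y \<noteq> 0" by auto
      then have "dir (T y) = T (dir y)"
        using False by (simp add: dir_def sgn_div_norm T_def reflection_scaleR norm_reflection)
      moreover have "dist e (T (dir y)) = dist x (dir y)" using iso[of x "dir y"] Tx by simp
      ultimately show ?thesis by (simp add: shell_weight_def indicator_def)
    qed
  qed
  also have "\<dots> = emeasure sphere_measure (ball x r)"
    by (rule emeasure_sphere_measure[symmetric]) simp
  finally show ?thesis ..
qed

lemma sphere_hausdorff_ball:
  fixes x e :: "'a::euclidean_space"
  assumes "norm x = 1" "norm e = 1"
  shows "emeasure sphere_hausdorff (ball x r) = emeasure sphere_hausdorff (ball e r)"
proof -
  have le: "hausdorff_outer d (sphere 0 1 \<inter> ball x r) \<le> hausdorff_outer d (sphere 0 1 \<inter> ball e r)"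
    if "norm x = 1" "norm e = 1" for x e :: 'a and d
  proof -
    define T where "T = reflection (x - e)"
    have Tx: "T x = e" using reflection_swap[of x e] that by (simp add: T_def)
    have iso: "dist (T y) (T z) = dist y z" for y z by (simp add: T_def dist_reflection)
    have "sphere 0 1 \<inter> ball x r \<subseteq> T ` (sphere 0 1 \<inter> ball e r)"
    proof
      fix y assume y: "y \<in> sphere 0 1 \<inter> ball x r"
      have "dist e (T y) = dist x y" using iso[of x y] Tx by simp
      then have "T y \<in> sphere 0 1 \<inter> ball e r" using y by (simp add: T_def norm_reflection)
      moreover have "y = T (T y)" by (simp add: T_def reflection_reflection)
      ultimately show "y \<in> T ` (sphere 0 1 \<inter> ball e r)" by blast
    qed
    then have "hausdorff_outer d (sphere 0 1 \<inter> ball x r) \<le> hausdorff_outer d (T ` (sphere 0 1 \<inter> ball e r))"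
      by (rule hausdorff_outer_mono)
    also have "\<dots> \<le> hausdorff_outer d (sphere 0 1 \<inter> ball e r)"
      by (rule hausdorff_outer_isometry_le[OF iso])
    finally show ?thesis .
  qed
  show ?thesis using le[OF assms] le[OF assms(2,1)]
    by (simp add: emeasure_sphere_hausdorff antisym)
qed

lemma sphere_measure_sphere: "emeasure sphere_measure (sphere 0 1 :: 'a::euclidean_space set) \<noteq> 0"
proof
  obtain i :: 'a where i: "i \<in> Basis" by (metis nonempty_Basis ex_in_conv)
  define c where "c = ((p + q) / 2) *\<^sub>R i"
  assume "emeasure sphere_measure (sphere 0 1 :: 'a set) = 0"
  then have "(\<integral>\<^sup>+y. shell_weight y * indicator (sphere 0 1) (dir y) \<partial>(lborel :: 'a measure)) = 0"
    by (subst (asm) emeasure_sphere_measure) (auto simp: borel_closed)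
  then have "(\<integral>\<^sup>+y. shell_weight y \<partial>(lborel :: 'a measure)) = 0" by simp
  then have "AE y::'a in lborel. shell_weight y = 0" by (subst (asm) nn_integral_0_iff_AE) auto
  moreover have "shell_weight y \<noteq> 0" if "y \<in> ball c ((q - p) / 2)" for y
  proof -
    have "norm (c - y) < (q - p) / 2" "norm c = (p + q) / 2" using that pq i by (auto simp: dist_norm c_def)
    then have "p \<le> norm y" "norm y < q"
      using norm_triangle_ineq2[of c y] norm_triangle_ineq2[of y c]
      by (simp_all add: norm_minus_commute field_simps)
    then show ?thesis using pq by (auto simp: shell_weight_def)
  qed
  ultimately have "AE y in lborel. y \<notin> ball c ((q - p) / 2)" by (auto elim!: eventually_mono)
  then have "emeasure lborel (ball c ((q - p) / 2)) = 0"
    by (rule AE_iff_measurable[THEN iffD1, rotated 2]) auto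
  moreover have "0 < unit_ball_vol (real DIM('a)) * ((q - p) / 2) ^ DIM('a)" using pq by simp
  ultimately show False using pq by (simp add: emeasure_ball)
qed

lemma sphere_measure_finite: "emeasure sphere_measure (A :: 'a::euclidean_space set) < \<infinity>"
proof (cases "A \<in> sets borel")
  case True
  have "emeasure sphere_measure A \<le> (\<integral>\<^sup>+y. ennreal (1 / p ^ DIM('a)) * indicator (cball 0 q) y \<partial>(lborel :: 'a measure))"
    unfolding emeasure_sphere_measure[OF True]
  proof (rule nn_integral_mono)
    fix y :: 'a
    have "shell_weight y * indicator A (dir y) \<le> shell_weight y * 1"
      by (intro mult_left_mono) (auto simp: indicator_def)
    also have "\<dots> \<le> ennreal (1 / p ^ DIM('a)) * indicator (sector p q UNIV) y"
      using shell_weight_le[of y] by simp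
    also have "\<dots> \<le> ennreal (1 / p ^ DIM('a)) * indicator (cball 0 q) y"
      by (intro mult_left_mono) (auto simp: indicator_def sector_def)
    finally show "shell_weight y * indicator A (dir y) \<le> ennreal (1 / p ^ DIM('a)) * indicator (cball 0 q) y" .
  qed
  also have "\<dots> < \<infinity>" using emeasure_lborel_cball_finite[of "0::'a" q]
    by (subst nn_integral_cmult_indicator) (auto simp: ennreal_mult_less_top)
  finally show ?thesis .
qed (simp add: emeasure_notin_sets sphere_measure_def)

lemma sphere_hausdorff_finite: "emeasure sphere_hausdorff (A :: 'a::euclidean_space set) < \<infinity>"
proof (cases "A \<in> sets borel")
  case True
  have "hausdorff_outer (DIM('a) - 1) (sphere 0 1 \<inter> A) \<le> hausdorff_outer (DIM('a) - 1) (sphere 0 1 :: 'a set)"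
    by (rule hausdorff_outer_mono) auto
  then show ?thesis using hausdorff_outer_sphere_finite
    unfolding emeasure_sphere_hausdorff[OF True] by (rule le_less_trans)
qed (simp add: emeasure_notin_sets sphere_hausdorff_def)

text \<open>Both measures are finite, live on the sphere, and give balls about points of the sphere
  a positive mass depending on the radius only. The factor is the ratio of the total masses, kept
  cross-multiplied to stay within \<open>ennreal\<close>.\<close>

lemma sphere_measures_proportional:
  fixes F :: "'a::euclidean_space set"
  assumes "compact F"
  shows "emeasure sphere_measure F * emeasure sphere_hausdorff (sphere 0 1 :: 'a set) =
         emeasure sphere_hausdorff F * emeasure sphere_measure (sphere 0 1 :: 'a set)"
proof -
  obtain e :: 'a where e: "norm e = 1" by (metis nonempty_Basis ex_in_conv norm_Basis)
  have S: "compact (sphere 0 1 :: 'a set)" by simp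
  have sm: "sets (sphere_measure :: 'a measure) = sets borel" by (simp add: sphere_measure_def)
  have sh: "sets (sphere_hausdorff :: 'a measure) = sets borel" by (simp add: sphere_hausdorff_def)
  have um: "emeasure sphere_measure (ball x r) = emeasure sphere_measure (ball e r)" if "x \<in> sphere 0 1" for x :: 'a and r
    by (rule sphere_measure_ball[OF _ e]) (use that in simp)
  have uh: "emeasure sphere_hausdorff (ball x r) = emeasure sphere_hausdorff (ball e r)" if "x \<in> sphere 0 1" for x :: 'a and r
    by (rule sphere_hausdorff_ball[OF _ e]) (use that in simp)
  have hS: "emeasure sphere_hausdorff (sphere 0 1 :: 'a set) \<noteq> 0"
    using hausdorff_outer_sphere_pos by (subst emeasure_sphere_hausdorff) (auto simp: borel_closed)
  have AEm: "AE x::'a in sphere_measure. x \<in> sphere 0 1"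
    unfolding sphere_measure_def by (subst AE_distr_iff) (auto simp: borel_closed)
  have AEh: "AE x::'a in sphere_hausdorff. x \<in> sphere 0 1"
  proof (rule AE_I')
    show "- sphere 0 1 \<in> null_sets (sphere_hausdorff :: 'a measure)"
      by (rule null_setsI) (auto simp: sh emeasure_sphere_hausdorff borel_closed)
  qed auto
  show ?thesis
  proof (rule uniform_measures_proportional[OF sm sh sphere_measure_finite sphere_hausdorff_finite AEm AEh _ um uh _ _ assms S])
    show "sphere 0 1 \<noteq> ({} :: 'a set)" using e by auto
    show "0 < emeasure sphere_measure (ball e r)" if "0 < r" for r
      by (rule uniform_ball_pos[OF sm S sphere_measure_sphere um that])
    show "0 < emeasure sphere_hausdorff (ball e r)" if "0 < r" for r
      by (rule uniform_ball_pos[OF sh S hS uh that])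
  qed
qed

end

section \<open>Vanishing moments on shells\<close>

text \<open>The kernel is Lebesgue measurable only, so its restriction to the sphere may fail to be
  Borel. What homogeneity does give is measurability of its extension that is constant along rays;
  these are the sets for which that extension is Lebesgue measurable.\<close>

definition sphere_sets :: "'a::euclidean_space set set" where
  "sphere_sets = {A. A \<subseteq> sphere 0 1 \<and> dir -` A \<in> sets lebesgue}"

lemma sigma_algebra_sphere_sets: "sigma_algebra (sphere 0 1) (sphere_sets :: 'a::euclidean_space set set)"
  unfolding sigma_algebra_iff2
proof (intro conjI ballI allI impI)
  show "sphere_sets \<subseteq> Pow (sphere (0::'a) 1)" by (auto simp: sphere_sets_def)
  show "{} \<in> (sphere_sets :: 'a set set)" by (simp add: sphere_sets_def)
next
  fix A :: "'a set" assume A: "A \<in> sphere_sets"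
  have "dir -` (sphere 0 1 - A) = UNIV - dir -` A" by auto
  then show "sphere 0 1 - A \<in> sphere_sets" using A sets.compl_sets[of "dir -` A" lebesgue]
    by (simp add: sphere_sets_def)
next
  fix A :: "nat \<Rightarrow> 'a set" assume A: "range A \<subseteq> sphere_sets"
  have "dir -` (\<Union>i. A i) = (\<Union>i. dir -` A i)" by auto
  moreover have "(\<Union>i. dir -` A i) \<in> sets lebesgue"
    using A by (intro sets.countable_UN) (auto simp: sphere_sets_def)
  ultimately show "(\<Union>i. A i) \<in> sphere_sets" using A by (auto simp: sphere_sets_def)
qed

lemma borel_sphere_sets: "A \<in> sets borel \<Longrightarrow> A \<subseteq> sphere 0 1 \<Longrightarrow> A \<in> sphere_sets"
  using measurable_sets[OF measurable_dir_lebesgue, of A] by (simp add: sphere_sets_def)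

context
  fixes p q :: real
  assumes pq: "0 < p" "p < q"
begin

text \<open>The same radial projection as \<open>sphere_measure\<close>, but on the larger
  sigma-algebra. The zero function in \<open>measure_of\<close> is a dummy: the target of
  \<open>distr\<close> contributes only its sets.\<close>

definition sphere_lebesgue :: "'a::euclidean_space measure" where
  "sphere_lebesgue = distr (density lebesgue (shell_weight p q)) (measure_of (sphere 0 1) sphere_sets (\<lambda>_. 0)) dir"

lemma sets_sphere_lebesgue: "sets sphere_lebesgue = sphere_sets"
  by (simp add: sphere_lebesgue_def sigma_algebra.sets_measure_of_eq[OF sigma_algebra_sphere_sets])

lemma space_sphere_lebesgue: "space sphere_lebesgue = sphere 0 1"
  by (simp add: sphere_lebesgue_def space_measure_of_conv)

lemma measurable_dir_sphere:
  "dir \<in> lebesgue \<rightarrow>\<^sub>M measure_of (sphere 0 1) sphere_sets (\<lambda>_. 0)"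
proof (rule measurableI)
  fix A :: "'a set" assume "A \<in> sets (measure_of (sphere 0 1) sphere_sets (\<lambda>_. 0))"
  then have "A \<in> sphere_sets" by (simp add: sigma_algebra.sets_measure_of_eq[OF sigma_algebra_sphere_sets])
  then show "dir -` A \<inter> space lebesgue \<in> sets lebesgue" by (simp add: sphere_sets_def)
qed (simp add: space_measure_of_conv)

lemma shell_weight_lebesgue: "shell_weight p q \<in> borel_measurable lebesgue"
  by (rule measurable_completion) (simp add: shell_weight_measurable[OF pq])

lemma emeasure_sphere_lebesgue:
  assumes "A \<in> sphere_sets"
  shows "emeasure sphere_lebesgue A = (\<integral>\<^sup>+y. shell_weight p q y * indicator A (dir y) \<partial>lebesgue)"
proof -
  have m: "dir \<in> density lebesgue (shell_weight p q) \<rightarrow>\<^sub>M measure_of (sphere 0 1) sphere_sets (\<lambda>_. 0)"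
    using measurable_dir_sphere by simp
  have "emeasure sphere_lebesgue A = emeasure (density lebesgue (shell_weight p q)) (dir -` A)"
    unfolding sphere_lebesgue_def using assms
    by (subst emeasure_distr[OF m]) (auto simp: sigma_algebra.sets_measure_of_eq[OF sigma_algebra_sphere_sets])
  also have "\<dots> = (\<integral>\<^sup>+y. shell_weight p q y * indicator (dir -` A) y \<partial>lebesgue)"
    using assms shell_weight_lebesgue by (subst emeasure_density) (auto simp: sphere_sets_def)
  finally show ?thesis by (simp add: indicator_def)
qed

lemma sphere_lebesgue_borel:
  assumes "A \<in> sets borel" "A \<subseteq> sphere 0 1"
  shows "emeasure sphere_lebesgue A = emeasure (sphere_measure p q) A"
proof -
  have "(\<lambda>y. shell_weight p q y * indicator A (dir y)) \<in> borel_measurable borel"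
    using assms(1) shell_weight_measurable[OF pq] by measurable
  then show ?thesis
    unfolding emeasure_sphere_lebesgue[OF borel_sphere_sets[OF assms]] emeasure_sphere_measure[OF pq assms(1)]
    by (simp add: nn_integral_completion)
qed

text \<open>Radially measurable sets are exhausted from inside by compact sets up to a set that is null
  for both measures; this transfers the proportionality to all of them.\<close>

lemma sphere_sets_inner:
  fixes A :: "'a::euclidean_space set"
  assumes A: "A \<in> sphere_sets"
  obtains G where "\<And>k::nat. compact (G k)" "incseq G" "(\<Union>k. G k) \<subseteq> A"
    "hausdorff_outer (DIM('a) - 1) (A - (\<Union>k. G k)) = 0" "emeasure sphere_lebesgue (A - (\<Union>k. G k)) = 0"
proof -
  \<comment> \<open>The enlarged shell contains both the shell between radii 1 and 2, on which the
    Hausdorff estimate rests, and the shell that carries the weight. One exhaustion then serves both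
    measures.\<close>
  define P Q where "P = min 1 p" and "Q = max 2 q"
  have PQ: "0 < P" "P \<le> p" "P \<le> 1" "2 \<le> Q" "q \<le> Q" using pq by (auto simp: P_def Q_def)
  have dA: "dir -` A \<in> sets lebesgue" and AS: "A \<subseteq> sphere 0 1" using A by (auto simp: sphere_sets_def)
  have sA: "sector P Q A \<in> sets lebesgue" by (rule sets_sector[OF dA])
  have "\<exists>F. compact F \<and> F \<subseteq> A \<and> emeasure lebesgue (sector P Q (A - F)) \<le> ennreal (1 / real (Suc k))" for k
  proof -
    obtain T where T: "closed T" "T \<subseteq> sector P Q A" "sector P Q A - T \<in> lmeasurable"
        "emeasure lebesgue (sector P Q A - T) < ennreal (1 / real (Suc k))"
      using sets_lebesgue_inner_closed[OF sA, of "1 / real (Suc k)"] by auto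
    have "T \<subseteq> cball 0 Q" using T(2) by (auto simp: sector_def)
    then have "compact T" using T(1) by (metis bounded_cball bounded_subset compact_eq_bounded_closed)
    have T0: "y \<noteq> 0" if "y \<in> T" for y using that T(2) PQ by (auto simp: sector_def)
    \<comment> \<open>The closed set T keeps distance at least P from the origin, so the radial
      projection is continuous on it and has a compact image.\<close>
    have "continuous_on T (sgn :: 'a \<Rightarrow> 'a)" unfolding sgn_div_norm using T0 by (intro continuous_intros) auto
    moreover have "dir ` T = sgn ` T" using T0 by (intro image_cong) (auto simp: dir_def)
    ultimately have c: "compact (dir ` T)" using compact_continuous_image[OF _ \<open>compact T\<close>, of sgn] by simp
    have sub: "dir ` T \<subseteq> A" using T(2) by (auto simp: sector_def)
    have "sector P Q (A - dir ` T) \<subseteq> sector P Q A - T" by (auto simp: sector_def)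
    then have "emeasure lebesgue (sector P Q (A - dir ` T)) \<le> emeasure lebesgue (sector P Q A - T)"
      using T(3) by (intro emeasure_mono) auto
    then show ?thesis using c sub T(4) by (intro exI[of _ "dir ` T"]) auto
  qed
  then have "\<exists>F. \<forall>k. compact (F k) \<and> F k \<subseteq> A \<and> emeasure lebesgue (sector P Q (A - F k)) \<le> ennreal (1 / real (Suc k))"
    by (intro choice allI)
  then obtain F where F0: "\<forall>k. compact (F k) \<and> F k \<subseteq> A \<and> emeasure lebesgue (sector P Q (A - F k)) \<le> ennreal (1 / real (Suc k))"
    by (rule exE)
  have F: "compact (F k)" "F k \<subseteq> A" "emeasure lebesgue (sector P Q (A - F k)) \<le> ennreal (1 / real (Suc k))" for k
    using spec[OF F0, of k] by (blast, blast, blast)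
  define G where "G k = (\<Union>j\<le>k. F j)" for k
  have G: "compact (G k)" for k unfolding G_def using F(1) by (intro compact_UN) auto
  have inc: "incseq G" unfolding G_def incseq_def by (auto intro: order_trans)
  have UN: "(\<Union>k. G k) = (\<Union>k. F k)" unfolding G_def by auto
  let ?R = "A - (\<Union>k. G k)"
  have FS: "F k \<in> sphere_sets" for k using F(1,2) AS by (intro borel_sphere_sets borel_compact) auto
  have R: "?R \<in> sphere_sets"
  proof -
    have "A - (\<Union>k. F k) \<in> sets (sphere_lebesgue)"
      using A FS by (intro sets.Diff sets.countable_UN) (auto simp: sets_sphere_lebesgue)
    then show ?thesis by (simp add: UN sets_sphere_lebesgue)
  qed
  then have dR: "dir -` ?R \<in> sets lebesgue" by (simp add: sphere_sets_def)
  have Rle: "emeasure lebesgue (sector P Q ?R) \<le> ennreal (1 / real (Suc k))" for k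
  proof -
    have "dir -` (A - F k) \<in> sets lebesgue"
      using dA FS[of k] by (auto simp: sphere_sets_def vimage_Diff)
    then have "emeasure lebesgue (sector P Q ?R) \<le> emeasure lebesgue (sector P Q (A - F k))"
      unfolding UN by (intro emeasure_mono sets_sector) (auto simp: sector_def)
    then show ?thesis using F(3)[of k] by (rule order_trans)
  qed
  have R0: "emeasure lebesgue (sector P Q ?R) = 0"
  proof -
    have "(\<lambda>k. ennreal (1 / real (Suc k))) \<longlonglongrightarrow> ennreal 0"
      by (intro tendsto_ennrealI) (use LIMSEQ_inverse_real_of_nat in \<open>simp add: inverse_eq_divide\<close>)
    then have "emeasure lebesgue (sector P Q ?R) \<le> ennreal 0"
      by (rule LIMSEQ_le_const) (use Rle in auto)
    then show ?thesis by simp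
  qed
  have "emeasure lebesgue (sector 1 2 ?R) \<le> emeasure lebesgue (sector P Q ?R)"
    using PQ by (intro emeasure_mono sets_sector dR) (auto simp: sector_def)
  then have "emeasure lebesgue (sector 1 2 ?R) = 0" using R0 by simp
  then have H0: "hausdorff_outer (DIM('a) - 1) ?R = 0"
    using hausdorff_outer_le_sector[of ?R] sets_sector[OF dR] AS by auto
  have "emeasure sphere_lebesgue ?R \<le> (\<integral>\<^sup>+y. ennreal (1 / p ^ DIM('a)) * indicator (sector P Q ?R) y \<partial>lebesgue)"
    unfolding emeasure_sphere_lebesgue[OF R]
  proof (rule nn_integral_mono)
    fix y :: 'a
    have "shell_weight p q y * indicator ?R (dir y) \<le> (ennreal (1 / p ^ DIM('a)) * indicator (sector p q UNIV) y) * indicator ?R (dir y)"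
      by (intro mult_right_mono shell_weight_le[OF pq]) auto
    also have "\<dots> = ennreal (1 / p ^ DIM('a)) * (indicator (sector p q UNIV) y * indicator ?R (dir y))"
      by (rule mult.assoc)
    also have "\<dots> \<le> ennreal (1 / p ^ DIM('a)) * indicator (sector P Q ?R) y"
      using PQ by (intro mult_left_mono) (auto simp: indicator_def sector_def)
    finally show "shell_weight p q y * indicator ?R (dir y) \<le> ennreal (1 / p ^ DIM('a)) * indicator (sector P Q ?R) y" .
  qed
  also have "\<dots> = ennreal (1 / p ^ DIM('a)) * emeasure lebesgue (sector P Q ?R)"
    by (rule nn_integral_cmult_indicator[OF sets_sector[OF dR]])
  finally have "emeasure sphere_lebesgue ?R = 0" using R0 by simp
  with G inc H0 F(2) show ?thesis by (intro that[of G]) (auto simp: UN)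
qed

text \<open>The set is a countable union of compact sets up to a remainder of outer measure 0, and
  such a remainder is Caratheodory measurable. The identity holds on the compact sets and is
  continuous along the increasing sequence.\<close>

lemma sphere_sets_hausdorff:
  fixes A :: "'a::euclidean_space set"
  assumes A: "A \<in> sphere_sets"
  shows "A \<in> sets (hausdorff_measure (DIM('a) - 1))"
    and "emeasure sphere_lebesgue A * hausdorff_outer (DIM('a) - 1) (sphere 0 1 :: 'a set) =
      hausdorff_outer (DIM('a) - 1) A * emeasure (sphere_measure p q) (sphere 0 1 :: 'a set)"
proof -
  let ?S = "sphere 0 1 :: 'a set" and ?o = "hausdorff_outer (DIM('a) - 1) :: 'a set \<Rightarrow> ennreal"
  obtain G where G: "\<And>k::nat. compact (G k)" "incseq G" "(\<Union>k. G k) \<subseteq> A"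
    "?o (A - (\<Union>k. G k)) = 0" "emeasure sphere_lebesgue (A - (\<Union>k. G k)) = 0"
    using sphere_sets_inner[OF A] by metis
  have AS: "A \<subseteq> ?S" using A by (auto simp: sphere_sets_def)
  have GS: "G k \<subseteq> ?S" for k using G(3) AS by blast
  have Gb: "(\<Union>k. G k) \<in> sets borel" using G(1) by (intro sets.countable_UN) (auto intro: borel_compact)
  have "(\<Union>k. G k) \<in> sets (hausdorff_measure (DIM('a) - 1))" by (rule subsetD[OF borel_subset_hausdorff Gb])
  moreover have "A - (\<Union>k. G k) \<in> sets (hausdorff_measure (DIM('a) - 1))"
    by (rule hausdorff_null_sets[OF G(4)])
  ultimately have "(\<Union>k. G k) \<union> (A - (\<Union>k. G k)) \<in> sets (hausdorff_measure (DIM('a) - 1))"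
    by (rule sets.Un)
  moreover have dec: "(\<Union>k. G k) \<union> (A - (\<Union>k. G k)) = A" using G(3) by blast
  ultimately show "A \<in> sets (hausdorff_measure (DIM('a) - 1))" by simp
  have GSS: "(\<Union>k. G k) \<in> sphere_sets" using Gb GS by (intro borel_sphere_sets) auto
  have o: "?o A = ?o (\<Union>k. G k)"
  proof (rule antisym)
    have "?o A \<le> ?o (\<Union>k. G k) + ?o (A - (\<Union>k. G k))"
      using hausdorff_outer_Un[of "DIM('a) - 1" "\<Union>k. G k" "A - (\<Union>k. G k)"] unfolding dec .
    then show "?o A \<le> ?o (\<Union>k. G k)" by (simp only: G(4) add_0_right)
    show "?o (\<Union>k. G k) \<le> ?o A" by (rule hausdorff_outer_mono[OF G(3)])
  qed
  have sl: "emeasure sphere_lebesgue A = emeasure sphere_lebesgue (\<Union>k. G k)"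
  proof -
    have "A - (\<Union>k. G k) \<in> sets sphere_lebesgue"
      using A GSS by (intro sets.Diff) (auto simp: sets_sphere_lebesgue)
    then have "emeasure sphere_lebesgue ((\<Union>k. G k) \<union> (A - (\<Union>k. G k))) = emeasure sphere_lebesgue (\<Union>k. G k)"
      using GSS G(5) by (intro emeasure_Un_null_set) (auto simp: sets_sphere_lebesgue null_sets_def)
    then show ?thesis unfolding dec .
  qed
  also have "\<dots> = emeasure (sphere_measure p q) (\<Union>k. G k)"
    using Gb GS by (intro sphere_lebesgue_borel) auto
  finally have sm: "emeasure sphere_lebesgue A = emeasure (sphere_measure p q) (\<Union>k. G k)" .
  have oS: "?o ?S = emeasure sphere_hausdorff ?S"
    by (subst emeasure_sphere_hausdorff[OF pq]) (auto simp: borel_closed)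
  have oG: "?o (\<Union>k. G k) = emeasure sphere_hausdorff (\<Union>k. G k)"
  proof -
    have "?S \<inter> (\<Union>k. G k) = (\<Union>k. G k)" using GS by blast
    then show ?thesis by (simp only: emeasure_sphere_hausdorff[OF pq Gb])
  qed
  have r: "range G \<subseteq> sets (sphere_measure p q)" "range G \<subseteq> sets sphere_hausdorff"
    using G(1) by (auto simp: sphere_measure_def[OF pq] sphere_hausdorff_def[OF pq] borel_compact)
  have L1: "(\<lambda>k. emeasure (sphere_measure p q) (G k) * emeasure sphere_hausdorff ?S) \<longlonglongrightarrow>
      emeasure (sphere_measure p q) (\<Union>k. G k) * emeasure sphere_hausdorff ?S"
    using sphere_measure_finite[OF pq, of "\<Union>k. G k"] sphere_hausdorff_finite[OF pq, of ?S]
    by (intro tendsto_mult_ennreal Lim_emeasure_incseq r G(2) tendsto_const) auto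
  have L2: "(\<lambda>k. emeasure sphere_hausdorff (G k) * emeasure (sphere_measure p q) ?S) \<longlonglongrightarrow>
      emeasure sphere_hausdorff (\<Union>k. G k) * emeasure (sphere_measure p q) ?S"
    using sphere_measure_finite[OF pq, of ?S] sphere_hausdorff_finite[OF pq, of "\<Union>k. G k"]
    by (intro tendsto_mult_ennreal Lim_emeasure_incseq r G(2) tendsto_const) auto
  show "emeasure sphere_lebesgue A * ?o ?S = ?o A * emeasure (sphere_measure p q) ?S"
    unfolding sm o oS oG
    by (rule LIMSEQ_unique[OF L1[unfolded sphere_measures_proportional[OF pq G(1)]] L2])
qed

end

text \<open>In polar form the moment is the integral over the sphere of f(\<omega>) = K(\<omega>)
  \<omega> against \<open>sphere_lebesgue\<close>, and this measure is a constant multiple of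
  Hausdorff measure. Every step is an identity of Bochner integrals valid for all measurable f, so
  integrability of K on the sphere is not at issue.\<close>

lemma shell_moment_zero:
  fixes K :: "'a::euclidean_space \<Rightarrow> real"
  assumes pq: "0 < p" "p < q" and Km: "K \<in> borel_measurable lebesgue"
    and hom: "\<And>t y. 0 < t \<Longrightarrow> y \<noteq> 0 \<Longrightarrow> K (t *\<^sub>R y) = t powr (- (real DIM('a) + 1)) * K y"
    and zero: "(LINT y:sphere 0 1|hausdorff_measure (DIM('a) - 1). K y *\<^sub>R y) = 0"
  shows "(LINT y:{y. p \<le> norm y \<and> norm y < q}|lebesgue. K y *\<^sub>R y) = 0"
proof -
  let ?S = "sphere 0 1 :: 'a set" and ?H = "hausdorff_measure (DIM('a) - 1) :: 'a measure"
  define n where "n = DIM('a)"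
  define f where "f y = K y *\<^sub>R y" for y
  have hom_dir: "K y = norm y powr (- (real n + 1)) * K (dir y)" if "y \<noteq> 0" for y
    using hom[of "norm y" "dir y"] norm_scaleR_dir[OF that] that by (auto simp: n_def dir_def sgn_zero_iff)
  have f_dir: "f (dir y) = (norm y powr (real n + 1) * K y) *\<^sub>R dir y" if "y \<noteq> 0" for y
    using that by (simp add: f_def hom_dir[OF that] powr_add[symmetric] flip: mult.assoc)
  \<comment> \<open>Homogeneity expresses f(dir y) through the Lebesgue measurable K(y) for y
    different from 0; the origin, where \<open>dir\<close> is constant by convention, is treated
    apart.\<close>
  have f_dir_m: "(\<lambda>y. f (dir y)) \<in> borel_measurable lebesgue"
  proof -
    have "(\<lambda>y. if y \<in> {0} then f (dir 0) else (norm y powr (real n + 1) * K y) *\<^sub>R dir y) \<in> borel_measurable lebesgue"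
    proof (rule measurable_If_set)
      have "(\<lambda>y::'a. norm y powr (real n + 1)) \<in> borel_measurable lebesgue"
        by (rule measurable_completion) simp
      then show "(\<lambda>y. (norm y powr (real n + 1) * K y) *\<^sub>R dir y) \<in> borel_measurable lebesgue"
        using Km measurable_dir_lebesgue by (intro borel_measurable_scaleR borel_measurable_times)
    qed auto
    then show ?thesis by (rule measurable_cong[THEN iffD1, rotated]) (auto simp: f_dir)
  qed
  have f_m: "f \<in> borel_measurable (sphere_lebesgue p q)"
  proof (rule measurableI)
    fix B :: "'a set" assume "B \<in> sets borel"
    then have "dir -` (f -` B \<inter> ?S) \<in> sets lebesgue"
      using measurable_sets[OF f_dir_m, of B] by (simp add: vimage_def)
    then show "f -` B \<inter> space (sphere_lebesgue p q) \<in> sets (sphere_lebesgue p q)"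
      by (simp add: sets_sphere_lebesgue[OF pq] space_sphere_lebesgue[OF pq] sphere_sets_def)
  qed simp
  have w_nn: "0 \<le> indicator {y. p \<le> norm y \<and> norm y < q} y / norm y ^ DIM('a)" for y :: 'a by simp
  have w_m: "(\<lambda>y::'a. indicator {y. p \<le> norm y \<and> norm y < q} y / norm y ^ DIM('a) :: real) \<in> borel_measurable lebesgue"
    by (rule measurable_completion) measurable
  have "(LINT y:{y. p \<le> norm y \<and> norm y < q}|lebesgue. K y *\<^sub>R y) =
      (LINT y|lebesgue. (indicator {y. p \<le> norm y \<and> norm y < q} y / norm y ^ DIM('a)) *\<^sub>R f (dir y))"
    unfolding set_lebesgue_integral_def
  proof (rule Bochner_Integration.integral_cong[OF refl])
    fix y :: 'a
    show "indicator {y. p \<le> norm y \<and> norm y < q} y *\<^sub>R K y *\<^sub>R y =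
      (indicator {y. p \<le> norm y \<and> norm y < q} y / norm y ^ DIM('a)) *\<^sub>R f (dir y)"
    proof (cases "p \<le> norm y \<and> norm y < q")
      case True
      then have y: "y \<noteq> 0" using pq by auto
      have "norm y powr (real n + 1) = norm y ^ n * norm y" using y by (simp add: powr_add powr_realpow)
      then have "f (dir y) = (norm y ^ n * K y) *\<^sub>R (norm y *\<^sub>R dir y)" by (simp add: f_dir[OF y] mult_ac)
      then show ?thesis using True y by (simp add: norm_scaleR_dir n_def)
    qed simp
  qed
  also have "\<dots> = integral\<^sup>L (density lebesgue (shell_weight p q)) (\<lambda>y. f (dir y))"
    unfolding shell_weight_def[OF pq] using f_dir_m w_m w_nn by (intro integral_density[symmetric]) auto
  also have "\<dots> = integral\<^sup>L (sphere_lebesgue p q) f"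
    unfolding sphere_lebesgue_def[OF pq]
  proof (rule integral_distr[symmetric])
    show "dir \<in> density lebesgue (shell_weight p q) \<rightarrow>\<^sub>M measure_of ?S sphere_sets (\<lambda>_. 0)"
      using measurable_dir_sphere[OF pq] by simp
    show "f \<in> borel_measurable (measure_of ?S sphere_sets (\<lambda>_. 0))"
      using f_m by (simp add: sphere_lebesgue_def[OF pq])
  qed
  also have "\<dots> = 0"
  proof -
    define hS where "hS = enn2real (hausdorff_outer (DIM('a) - 1) ?S)"
    define mS where "mS = enn2real (emeasure (sphere_measure p q) ?S)"
    have hS: "hausdorff_outer (DIM('a) - 1) ?S = ennreal hS" "0 < hS"
      using hausdorff_outer_sphere_finite[where 'a='a] hausdorff_outer_sphere_pos[where 'a='a]
      by (auto simp: hS_def enn2real_positive_iff zero_less_iff_neq_zero)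
    have mS: "emeasure (sphere_measure p q) ?S = ennreal mS" "0 \<le> mS"
      using sphere_measure_finite[OF pq, of ?S] by (auto simp: mS_def)
    define c where "c = mS / hS"
    have c: "0 \<le> c" using hS mS by (simp add: c_def)
    have S: "?S \<in> sets ?H" by (rule subsetD[OF borel_subset_hausdorff]) (simp add: borel_closed)
    let ?R = "restrict_space ?H ?S"
    have Rs: "sphere_sets \<subseteq> sets ?R"
    proof
      fix A :: "'a set" assume A: "A \<in> sphere_sets"
      then show "A \<in> sets ?R" using sphere_sets_hausdorff(1)[OF pq A] S
        by (simp add: sets_restrict_space_iff sphere_sets_def)
    qed
    have fR: "f \<in> borel_measurable ?R"
    proof (rule measurableI)
      fix B :: "'a set" assume "B \<in> sets borel"
      then have "f -` B \<inter> ?S \<in> sphere_sets"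
        using measurable_sets[OF f_m, of B] by (simp add: sets_sphere_lebesgue[OF pq] space_sphere_lebesgue[OF pq])
      then show "f -` B \<inter> space ?R \<in> sets ?R" using Rs by (auto simp: space_restrict_space)
    qed simp
    \<comment> \<open>The Hausdorff measure has more measurable sets. Since f is measurable for the
      smaller sigma-algebra, agreement of the measures there is enough.\<close>
    have "integral\<^sup>L (sphere_lebesgue p q) f = integral\<^sup>L (density ?R (\<lambda>_. ennreal c)) f"
    proof (rule integral_subalgebra[OF f_m])
      show "sets (sphere_lebesgue p q) \<subseteq> sets (density ?R (\<lambda>_. ennreal c))"
        using Rs by (simp add: sets_sphere_lebesgue[OF pq])
      show "space (sphere_lebesgue p q) = space (density ?R (\<lambda>_. ennreal c))"
        by (simp add: space_sphere_lebesgue[OF pq] space_restrict_space)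
      fix A :: "'a set" assume "A \<in> sets (sphere_lebesgue p q)"
      then have A: "A \<in> sphere_sets" by (simp add: sets_sphere_lebesgue[OF pq])
      have AH: "A \<in> sets ?H" "A \<subseteq> ?S" "A \<in> sets ?R"
        using sphere_sets_hausdorff(1)[OF pq A] A Rs by (auto simp: sphere_sets_def)
      have "emeasure (density ?R (\<lambda>_. ennreal c)) A = ennreal c * emeasure ?R A"
        using AH by (subst emeasure_density) (auto simp: nn_integral_cmult_indicator)
      also have "emeasure ?R A = hausdorff_outer (DIM('a) - 1) A"
        using AH S by (simp add: emeasure_restrict_space emeasure_hausdorff_measure)
      finally have 1: "ennreal hS * emeasure (density ?R (\<lambda>_. ennreal c)) A = ennreal (hS * c) * hausdorff_outer (DIM('a) - 1) A"
        using hS c by (simp add: ennreal_mult mult.assoc)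
      have "hS * c = mS" using hS by (simp add: c_def)
      then have "ennreal hS * emeasure (density ?R (\<lambda>_. ennreal c)) A = ennreal hS * emeasure (sphere_lebesgue p q) A"
        using sphere_sets_hausdorff(2)[OF pq A] unfolding 1 hS(1) mS(1) by (simp add: mult.commute)
      then show "emeasure (sphere_lebesgue p q) A = emeasure (density ?R (\<lambda>_. ennreal c)) A"
        using hS(2) by (auto simp: ennreal_mult_cancel_left)
    qed
    also have "\<dots> = (LINT y|?R. c *\<^sub>R f y)"
      using fR c by (intro integral_density) auto
    also have "\<dots> = c *\<^sub>R (LINT y|?R. f y)" by simp
    also have "(LINT y|?R. f y) = (LINT y:?S|?H. f y)"
      using S by (simp add: integral_restrict_space set_lebesgue_integral_def)
    also have "\<dots> = 0" using zero by (simp add: f_def)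
    finally show ?thesis by simp
  qed
  finally show ?thesis .
qed

section \<open>Radial integrals\<close>

lemma nn_integral_le_imp_integrable:
  fixes f :: "'a \<Rightarrow> real"
  assumes "f \<in> borel_measurable M" "\<And>x. 0 \<le> f x" "0 \<le> c" "(\<integral>\<^sup>+x. ennreal (f x) \<partial>M) \<le> ennreal c"
  shows "integrable M f" "integral\<^sup>L M f \<le> c"
proof -
  show i: "integrable M f"
    using assms by (intro integrableI_nonneg) (auto intro: le_less_trans)
  have "ennreal (integral\<^sup>L M f) \<le> ennreal c"
    using nn_integral_eq_integral[OF i] assms by simp
  then show "integral\<^sup>L M f \<le> c" using assms(3) by (simp add: ennreal_le_iff)
qed

text \<open>On the shell the norm lies within a factor 2 of \<rho>, so the power varies by at most
  2^|\<gamma>|. The shell lies in the ball of radius 2 \<rho>.\<close>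

lemma nn_integral_dyadic_shell:
  fixes \<gamma> \<rho> :: real
  assumes "0 < \<rho>"
  shows "(\<integral>\<^sup>+y. ennreal (indicator {y. \<rho> \<le> norm y \<and> norm y < 2 * \<rho>} y * norm y powr \<gamma>) \<partial>(lborel :: 'a::euclidean_space measure))
    \<le> ennreal ((2 powr \<bar>\<gamma>\<bar> * unit_ball_vol (DIM('a)) * 2 ^ DIM('a)) * \<rho> powr (\<gamma> + real DIM('a)))"
proof -
  have "(\<integral>\<^sup>+y. ennreal (indicator {y. \<rho> \<le> norm y \<and> norm y < 2 * \<rho>} y * norm y powr \<gamma>) \<partial>(lborel :: 'a measure))
      \<le> (\<integral>\<^sup>+y. ennreal (2 powr \<bar>\<gamma>\<bar> * \<rho> powr \<gamma>) * indicator (ball 0 (2 * \<rho>)) y \<partial>(lborel :: 'a measure))"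
  proof (rule nn_integral_mono)
    fix y :: 'a
    show "ennreal (indicator {y. \<rho> \<le> norm y \<and> norm y < 2 * \<rho>} y * norm y powr \<gamma>)
      \<le> ennreal (2 powr \<bar>\<gamma>\<bar> * \<rho> powr \<gamma>) * indicator (ball 0 (2 * \<rho>)) y"
    proof (cases "\<rho> \<le> norm y \<and> norm y < 2 * \<rho>")
      case True
      define t where "t = norm y / \<rho>"
      have t: "1 \<le> t" "t \<le> 2" using True assms by (auto simp: t_def field_simps)
      have "norm y powr \<gamma> = t powr \<gamma> * \<rho> powr \<gamma>"
        using assms t by (subst powr_mult[symmetric]) (auto simp: t_def)
      also have "t powr \<gamma> \<le> t powr \<bar>\<gamma>\<bar>" using t by (intro powr_mono) auto
      also have "\<dots> \<le> 2 powr \<bar>\<gamma>\<bar>" using t by (intro powr_mono2) auto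
      finally have "norm y powr \<gamma> \<le> 2 powr \<bar>\<gamma>\<bar> * \<rho> powr \<gamma>" by (simp add: mult_right_mono)
      then show ?thesis using True by (auto intro: ennreal_leI)
    qed simp
  qed
  also have "\<dots> = ennreal (2 powr \<bar>\<gamma>\<bar> * \<rho> powr \<gamma>) * ennreal (unit_ball_vol (DIM('a)) * (2 * \<rho>) ^ DIM('a))"
    using assms by (subst nn_integral_cmult_indicator) (auto simp: emeasure_ball)
  also have "\<dots> = ennreal ((2 powr \<bar>\<gamma>\<bar> * unit_ball_vol (DIM('a)) * 2 ^ DIM('a)) * \<rho> powr (\<gamma> + real DIM('a)))"
    using assms by (simp add: powr_add powr_realpow power_mult_distrib mult_ac flip: ennreal_mult)
  finally show ?thesis .
qed

lemma dyadic_less: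
  fixes r x :: real
  assumes "0 < x" "x < r"
  obtains k :: nat where "r / 2 ^ Suc k \<le> x" "x < 2 * (r / 2 ^ Suc k)"
proof -
  have "\<exists>k. r / x \<le> 2 ^ k" using real_arch_pow[of 2 "r / x"] by (auto intro: less_imp_le)
  define m where "m = (LEAST k. r / x \<le> 2 ^ k)"
  have m: "r / x \<le> 2 ^ m" unfolding m_def by (rule LeastI_ex) fact
  have "m \<noteq> 0" using m assms by (cases m) (auto simp: field_simps)
  then obtain k where k: "m = Suc k" by (metis not0_implies_Suc)
  have "\<not> r / x \<le> 2 ^ k" using not_less_Least[of k "\<lambda>k. r / x \<le> 2 ^ k"] k unfolding m_def by simp
  then show ?thesis using m assms by (intro that[of k]) (auto simp: k field_simps)
qed

lemma dyadic_ge: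
  fixes r x :: real
  assumes "0 < r" "r \<le> x"
  obtains k :: nat where "r * 2 ^ k \<le> x" "x < 2 * (r * 2 ^ k)"
proof -
  have "\<exists>k. x / r < 2 ^ k" using real_arch_pow[of 2 "x / r"] by auto
  define m where "m = (LEAST k. x / r < 2 ^ k)"
  have m: "x / r < 2 ^ m" unfolding m_def by (rule LeastI_ex) fact
  have "m \<noteq> 0" using m assms by (cases m) (auto simp: field_simps)
  then obtain k where k: "m = Suc k" by (metis not0_implies_Suc)
  have "\<not> x / r < 2 ^ k" using not_less_Least[of k "\<lambda>k. x / r < 2 ^ k"] k unfolding m_def by simp
  then show ?thesis using m assms by (intro that[of k]) (auto simp: k field_simps)
qed

text \<open>An upper bound only asks that the shells cover S. The origin belongs to no shell, but
  contributes nothing because \<open>0 powr \<gamma> = 0\<close>.\<close>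

lemma shells_sum_le:
  fixes \<gamma> :: real and \<rho> :: "nat \<Rightarrow> real" and S :: "'a::euclidean_space set"
  assumes \<rho>: "\<And>k. 0 < \<rho> k" and cov: "\<And>y. y \<in> S \<Longrightarrow> y \<noteq> 0 \<Longrightarrow> \<exists>k. \<rho> k \<le> norm y \<and> norm y < 2 * \<rho> k"
    and S: "S \<in> sets borel" and sum: "(\<lambda>k. \<rho> k powr (\<gamma> + real DIM('a))) sums c"
  defines "A \<equiv> 2 powr \<bar>\<gamma>\<bar> * unit_ball_vol (DIM('a)) * 2 ^ DIM('a)"
  shows "integrable lborel (\<lambda>y. indicator S y * norm y powr \<gamma>)"
    "(LINT y|lborel. indicator S y * norm y powr \<gamma>) \<le> A * c"
proof -
  have A: "0 \<le> A" by (simp add: A_def)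
  have c: "0 \<le> c" using sums_le[OF _ sums_zero sum] by simp
  have "(\<integral>\<^sup>+y. ennreal (indicator S y * norm y powr \<gamma>) \<partial>lborel)
      \<le> (\<integral>\<^sup>+y. (\<Sum>k. ennreal (indicator {y. \<rho> k \<le> norm y \<and> norm y < 2 * \<rho> k} y * norm y powr \<gamma>)) \<partial>(lborel :: 'a measure))"
  proof (rule nn_integral_mono)
    fix y :: 'a
    show "ennreal (indicator S y * norm y powr \<gamma>) \<le>
      (\<Sum>k. ennreal (indicator {y. \<rho> k \<le> norm y \<and> norm y < 2 * \<rho> k} y * norm y powr \<gamma>))" (is "_ \<le> (\<Sum>k. ?g k)")
    proof (cases "y \<in> S \<and> y \<noteq> 0")
      case True
      then obtain k where "\<rho> k \<le> norm y \<and> norm y < 2 * \<rho> k" using cov by blast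
      then have "ennreal (indicator S y * norm y powr \<gamma>) \<le> ?g k" by (auto simp: indicator_def)
      also have "\<dots> = sum ?g {k}" by (subst sum.insert) simp_all
      also have "\<dots> \<le> (\<Sum>k. ?g k)" by (rule sum_le_suminf) auto
      finally show ?thesis .
    qed (auto simp: indicator_def)
  qed
  also have "\<dots> = (\<Sum>k. \<integral>\<^sup>+y. ennreal (indicator {y. \<rho> k \<le> norm y \<and> norm y < 2 * \<rho> k} y * norm y powr \<gamma>) \<partial>(lborel :: 'a measure))"
    by (rule nn_integral_suminf) measurable
  also have "\<dots> \<le> (\<Sum>k. ennreal (A * \<rho> k powr (\<gamma> + real DIM('a))))"
    unfolding A_def by (intro suminf_le nn_integral_dyadic_shell \<rho> summableI)
  also have "\<dots> = ennreal (A * c)"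
    using sums_mult[OF sum, of A] A by (subst suminf_ennreal2) (auto simp: sums_iff)
  finally have le: "(\<integral>\<^sup>+y. ennreal (indicator S y * norm y powr \<gamma>) \<partial>lborel) \<le> ennreal (A * c)" .
  have m: "(\<lambda>y. indicator S y * norm y powr \<gamma>) \<in> borel_measurable lborel" using S by measurable
  show "integrable lborel (\<lambda>y. indicator S y * norm y powr \<gamma>)"
    "(LINT y|lborel. indicator S y * norm y powr \<gamma>) \<le> A * c"
    using nn_integral_le_imp_integrable[OF m _ _ le] A c by auto
qed

text \<open>The dyadic shells inside the ball form a geometric series of ratio 2^(-\<alpha>).
  Scaling leaves the factor r^\<alpha>, so the constant is uniform in r.\<close>

lemma radial_integral_ball:
  fixes \<alpha> :: real
  assumes \<alpha>: "0 < \<alpha>"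
  obtains C where "0 \<le> C"
    "\<And>r. 0 < r \<Longrightarrow> integrable lborel (\<lambda>y::'a::euclidean_space. indicator (ball 0 r) y * norm y powr (\<alpha> - real DIM('a)))"
    "\<And>r. 0 < r \<Longrightarrow> (LINT y|(lborel :: 'a measure). indicator (ball 0 r) y * norm y powr (\<alpha> - real DIM('a))) \<le> C * r powr \<alpha>"
proof -
  define A where "A = 2 powr \<bar>\<alpha> - real DIM('a)\<bar> * unit_ball_vol (DIM('a)) * 2 ^ DIM('a)"
  define x :: real where "x = 2 powr (- \<alpha>)"
  have x: "0 < x" "x < 1" using \<alpha> by (auto simp: x_def powr_less_one)
  have sm: "(\<lambda>k. (r / 2 ^ Suc k) powr ((\<alpha> - real DIM('a)) + real DIM('a))) sums (r powr \<alpha> * x * (1 / (1 - x)))" if r: "0 < r" for r :: real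
  proof -
    have "(r / 2 ^ Suc k) powr ((\<alpha> - real DIM('a)) + real DIM('a)) = r powr \<alpha> * x * x ^ k" for k
      using r by (simp add: powr_divide powr_mult x_def powr_minus powr_realpow[symmetric] powr_powr mult.commute powr_power field_simps)
    then show ?thesis using x by (simp only:) (intro sums_mult geometric_sums, simp)
  qed
  have cov: "\<exists>k. r / 2 ^ Suc k \<le> norm y \<and> norm y < 2 * (r / 2 ^ Suc k)" if "y \<in> ball 0 r" "y \<noteq> 0" for y :: 'a and r
    using dyadic_less[of "norm y" r] that by (auto simp del: power_Suc)
  show ?thesis
  proof (rule that[of "A * (x / (1 - x))"])
    show "0 \<le> A * (x / (1 - x))" using x by (simp add: A_def)
    fix r :: real assume r: "0 < r"
    note * = shells_sum_le[of "\<lambda>k. r / 2 ^ Suc k", OF _ cov _ sm[OF r]]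
    show "integrable lborel (\<lambda>y::'a. indicator (ball 0 r) y * norm y powr (\<alpha> - real DIM('a)))"
      by (rule *(1)) (use r in auto)
    have "(LINT y|(lborel :: 'a measure). indicator (ball 0 r) y * norm y powr (\<alpha> - real DIM('a))) \<le> A * (r powr \<alpha> * x * (1 / (1 - x)))"
      unfolding A_def by (rule *(2)) (use r in auto)
    then show "(LINT y|(lborel :: 'a measure). indicator (ball 0 r) y * norm y powr (\<alpha> - real DIM('a))) \<le> A * (x / (1 - x)) * r powr \<alpha>"
      by (simp add: mult_ac)
  qed
qed

lemma radial_integral_outside:
  fixes \<alpha> :: real
  assumes \<alpha>: "0 < \<alpha>"
  obtains C where "0 \<le> C"
    "\<And>r. 0 < r \<Longrightarrow> integrable lborel (\<lambda>y::'a::euclidean_space. indicator (- ball 0 r) y * norm y powr (- \<alpha> - real DIM('a)))"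
    "\<And>r. 0 < r \<Longrightarrow> (LINT y|(lborel :: 'a measure). indicator (- ball 0 r) y * norm y powr (- \<alpha> - real DIM('a))) \<le> C * r powr (- \<alpha>)"
proof -
  define A where "A = 2 powr \<bar>- \<alpha> - real DIM('a)\<bar> * unit_ball_vol (DIM('a)) * 2 ^ DIM('a)"
  define x :: real where "x = 2 powr (- \<alpha>)"
  have x: "0 < x" "x < 1" using \<alpha> by (auto simp: x_def powr_less_one)
  have sm: "(\<lambda>k. (r * 2 ^ k) powr ((- \<alpha> - real DIM('a)) + real DIM('a))) sums (r powr (- \<alpha>) * (1 / (1 - x)))" if r: "0 < r" for r :: real
  proof -
    have "(r * 2 ^ k) powr ((- \<alpha> - real DIM('a)) + real DIM('a)) = r powr (- \<alpha>) * x ^ k" for k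
      using r by (simp add: powr_mult x_def powr_realpow[symmetric] powr_powr mult.commute)
    then show ?thesis using x by (simp only:) (intro sums_mult geometric_sums, simp)
  qed
  have cov: "\<exists>k. r * 2 ^ k \<le> norm y \<and> norm y < 2 * (r * 2 ^ k)" if "0 < r" "y \<in> - ball 0 r" for y :: 'a and r
    using dyadic_ge[of r "norm y"] that by auto
  show ?thesis
  proof (rule that[of "A * (1 / (1 - x))"])
    show "0 \<le> A * (1 / (1 - x))" using x by (simp add: A_def)
    fix r :: real assume r: "0 < r"
    note * = shells_sum_le[of "\<lambda>k. r * 2 ^ k", OF _ cov[OF r] _ sm[OF r]]
    show "integrable lborel (\<lambda>y::'a. indicator (- ball 0 r) y * norm y powr (- \<alpha> - real DIM('a)))"
      by (rule *(1)) (use r in auto)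
    have "(LINT y|(lborel :: 'a measure). indicator (- ball 0 r) y * norm y powr (- \<alpha> - real DIM('a))) \<le> A * (r powr (- \<alpha>) * (1 / (1 - x)))"
      unfolding A_def by (rule *(2)) (use r in auto)
    then show "(LINT y|(lborel :: 'a measure). indicator (- ball 0 r) y * norm y powr (- \<alpha> - real DIM('a))) \<le> A * (1 / (1 - x)) * r powr (- \<alpha>)"
      by (simp add: mult_ac)
  qed
qed

text \<open>The form in which the estimates consume an admissible kernel: a Borel representative
  with bounds at every point and, for s = 1/2, vanishing moments on shells instead of on the sphere.
  At the origin both bounds are 0, since \<open>0 powr a = 0\<close>.\<close>

definition stable_kernel :: "real \<Rightarrow> real \<Rightarrow> real \<Rightarrow> ('a::euclidean_space \<Rightarrow> real) \<Rightarrow> bool" where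
  "stable_kernel s lam Lam K \<longleftrightarrow> K \<in> borel_measurable borel \<and>
     (\<forall>y. lam * norm y powr (- (real DIM('a) + 2 * s)) \<le> K y \<and> K y \<le> Lam * norm y powr (- (real DIM('a) + 2 * s))) \<and>
     (s = 1/2 \<longrightarrow> (\<forall>p q. 0 < p \<longrightarrow> p < q \<longrightarrow>
        (LINT y|lborel. indicator {y. p \<le> norm y \<and> norm y < q} y *\<^sub>R (K y *\<^sub>R y)) = 0))"

text \<open>The operator applied to a function with increments \<open>- f\<close> and gradient \<open>p\<close> at the point.\<close>

definition increment_op :: "real \<Rightarrow> ('a::euclidean_space \<Rightarrow> real) \<Rightarrow> 'a \<Rightarrow> ('a \<Rightarrow> real) \<Rightarrow> 'a \<Rightarrow> real" where
  "increment_op s K b f p =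
     (if s < 1/2 then (LINT y|lborel. f y * K y)
      else if s = 1/2 then
        Lim (at_right 0) (\<lambda>\<epsilon>. LINT y|lborel. indicator (- ball 0 \<epsilon>) y * (f y * K y)) + b \<bullet> p
      else (LINT y|lborel. (f y + p \<bullet> y) * K y))"

text \<open>The part of the gradient term that makes the integrals absolutely convergent. For \<open>s = 1/2\<close> it may be
  inserted on a ball of any radius because the shell moments of \<open>K\<close> vanish.\<close>

definition correction :: "real \<Rightarrow> real \<Rightarrow> 'a::euclidean_space \<Rightarrow> real" where
  "correction s r y = (if s < 1/2 then 0 else if s = 1/2 then indicator (ball 0 r) y else 1)"

lemma correction_measurable [measurable]: "correction s r \<in> borel_measurable borel"
  unfolding correction_def[abs_def] by (cases "s < 1/2"; cases "s = 1/2") (simp_all add: borel_measurable_indicator borel_open)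

lemma correction_bounds: "0 \<le> correction s r y" "correction s r y \<le> 1"
  by (auto simp: correction_def indicator_def)

lemma correction_minus: "correction s r (- y) = correction s r y"
  by (auto simp: correction_def indicator_def)

text \<open>The corrected integrand is dominated by |y|^(\<alpha>-n) with \<alpha> > 0 near the
  origin and by the tail assumption elsewhere. For s = 1/2 the correction integrates to 0 over every
  shell, so it does not change the truncated integrals, and what is missing inside the ball of
  radius \<epsilon> is of order \<epsilon>^\<alpha>.\<close>

lemma increment_op_eq:
  fixes f :: "'a::euclidean_space \<Rightarrow> real"
  assumes s: "0 < s" "s < 1" and lam: "0 < lam" and K: "stable_kernel s lam Lam K"
    and f: "f \<in> borel_measurable borel" and \<rho>: "0 < \<rho>" "\<rho> \<le> r"
    and near: "\<And>y. norm y < \<rho> \<Longrightarrow> \<bar>f y + p \<bullet> y\<bar> \<le> C * (norm y)\<^sup>2"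
    and tail: "integrable lborel (\<lambda>y. indicator (- ball 0 \<rho>) y * (\<bar>f y\<bar> * norm y powr (- (real DIM('a) + 2 * s))))"
  shows "integrable lborel (\<lambda>y. (f y + correction s r y * (p \<bullet> y)) * K y)"
    and "increment_op s K b f p = (LINT y|lborel. (f y + correction s r y * (p \<bullet> y)) * K y) + (if s = 1/2 then b \<bullet> p else 0)"
proof -
  define n where "n = real DIM('a)"
  have n0: "0 \<le> n" by (simp add: n_def)
  let ?\<kappa> = "\<lambda>y::'a. norm y powr (- (n + 2 * s))"
  have Km [measurable]: "K \<in> borel_measurable borel"
    and Kb: "\<And>y. lam * ?\<kappa> y \<le> K y" "\<And>y. K y \<le> Lam * ?\<kappa> y"
    using K by (auto simp: stable_kernel_def n_def)
  note [measurable] = f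
  have K0: "0 \<le> K y" for y using Kb(1)[of y] lam by (smt (verit) mult_nonneg_nonneg powr_ge_zero)
  have Lam: "0 \<le> Lam"
  proof -
    obtain i :: 'a where "i \<in> Basis" by (metis nonempty_Basis ex_in_conv)
    then show ?thesis using K0[of i] Kb(2)[of i] by simp
  qed
  have C: "0 \<le> C"
  proof -
    obtain i :: 'a where i: "i \<in> Basis" by (metis nonempty_Basis ex_in_conv)
    have "0 \<le> C * (norm ((\<rho>/2) *\<^sub>R i))\<^sup>2"
      using near[of "(\<rho>/2) *\<^sub>R i"] \<rho> i by simp
    then show ?thesis using \<rho> i by (simp add: zero_le_mult_iff)
  qed
  define F where "F y = (f y + correction s r y * (p \<bullet> y)) * K y" for y
  have Fm [measurable]: "F \<in> borel_measurable borel" unfolding F_def[abs_def] by measurable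
  \<comment> \<open>The order of vanishing at the origin: 1 for s < 1/2, where no gradient is added,
    and 2 otherwise. In each case it exceeds 2 s.\<close>
  define k where "k = (if s < 1/2 then 1 else 2 :: nat)"
  define \<alpha> where "\<alpha> = real k - 2 * s"
  have \<alpha>: "0 < \<alpha>" using s by (auto simp: \<alpha>_def k_def)
  define M where "M = (C * max 1 \<rho> + norm p) * Lam"
  have M: "0 \<le> M" using C Lam by (auto simp: M_def intro!: mult_nonneg_nonneg add_nonneg_nonneg)
  have inner: "\<bar>F y\<bar> \<le> M * norm y powr (\<alpha> - n)" if y: "norm y < \<rho>" for y
  proof -
    have "\<bar>f y + correction s r y * (p \<bullet> y)\<bar> \<le> (C * max 1 \<rho> + norm p) * norm y ^ k"
    proof (cases "s < 1/2")
      case True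
      have "\<bar>f y\<bar> \<le> C * (norm y)\<^sup>2 + norm p * norm y"
        using near[OF y] Cauchy_Schwarz_ineq2[of p y] by linarith
      also have "C * (norm y)\<^sup>2 \<le> (C * max 1 \<rho>) * norm y"
        using y C by (simp add: power2_eq_square mult.assoc[symmetric] mult_right_mono mult_left_mono)
      finally show ?thesis using True by (simp add: k_def correction_def distrib_right)
    next
      case False
      have "correction s r y = 1" using False y \<rho> by (auto simp: correction_def)
      then have "\<bar>f y + correction s r y * (p \<bullet> y)\<bar> \<le> C * (norm y)\<^sup>2" using near[OF y] by simp
      also have "\<dots> \<le> (C * max 1 \<rho> + norm p) * (norm y)\<^sup>2"
      proof (rule mult_right_mono)
        have "C * 1 \<le> C * max 1 \<rho>" using C by (intro mult_left_mono) auto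
        then show "C \<le> C * max 1 \<rho> + norm p" by (simp add: add_increasing2)
      qed simp
      finally show ?thesis using False by (simp add: k_def)
    qed
    then have "\<bar>F y\<bar> \<le> ((C * max 1 \<rho> + norm p) * norm y ^ k) * (Lam * ?\<kappa> y)"
      unfolding F_def abs_mult using K0 Kb(2) by (intro mult_mono) auto
    also have "\<dots> = M * (norm y ^ k * ?\<kappa> y)" by (simp add: M_def mult_ac)
    also have "norm y ^ k * ?\<kappa> y = norm y powr (\<alpha> - n)"
      by (cases "y = 0") (auto simp: \<alpha>_def powr_realpow[symmetric] powr_add[symmetric] algebra_simps k_def)
    finally show ?thesis .
  qed
  obtain Ci where Ci: "0 \<le> Ci"
    "\<And>r. 0 < r \<Longrightarrow> integrable lborel (\<lambda>y::'a. indicator (ball 0 r) y * norm y powr (\<alpha> - real DIM('a)))"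
    "\<And>r. 0 < r \<Longrightarrow> (LINT y|(lborel :: 'a measure). indicator (ball 0 r) y * norm y powr (\<alpha> - real DIM('a))) \<le> Ci * r powr \<alpha>"
    by (rule radial_integral_ball[OF \<alpha>, where 'a='a]) (rule that)
  \<comment> \<open>For s > 1/2 the gradient term reaches infinity and costs one power of |y|. For s
    = 1/2 it is confined to the ball of radius r, so the kernel's own decay remains.\<close>
  define \<beta> where "\<beta> = (if s \<le> 1/2 then 2 * s else 2 * s - 1)"
  have \<beta>: "0 < \<beta>" using s by (auto simp: \<beta>_def)
  define L where "L = (if s = 1/2 then norm p * r else norm p) * Lam"
  have L: "0 \<le> L" using Lam \<rho> by (auto simp: L_def)
  have io: "integrable lborel (\<lambda>y::'a. indicator (- ball 0 \<rho>) y * norm y powr (- \<beta> - real DIM('a)))"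
    by (rule radial_integral_outside[OF \<beta>, where 'a='a]) (use \<rho>(1) in blast)
  have outer: "\<bar>F y\<bar> \<le> Lam * (\<bar>f y\<bar> * ?\<kappa> y) + L * norm y powr (- \<beta> - n)" if y: "\<rho> \<le> norm y" for y
  proof -
    have y0: "y \<noteq> 0" using y \<rho> by auto
    have "\<bar>correction s r y * (p \<bullet> y)\<bar> * (Lam * ?\<kappa> y) \<le> L * norm y powr (- \<beta> - n)"
    proof (cases "s < 1/2")
      case True then show ?thesis using L by (simp add: correction_def)
    next
      case False
      have cs: "\<bar>p \<bullet> y\<bar> \<le> norm p * norm y" by (rule Cauchy_Schwarz_ineq2)
      show ?thesis
      proof (cases "s = 1/2")
        case True
        have "\<bar>correction s r y * (p \<bullet> y)\<bar> \<le> norm p * r"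
        proof (cases "norm y < r")
          case True
          have "norm p * norm y \<le> norm p * r" using True by (intro mult_left_mono) auto
          then show ?thesis using cs True \<open>s = 1/2\<close> by (simp add: correction_def)
        qed (use \<open>s = 1/2\<close> \<rho> in \<open>simp add: correction_def\<close>)
        then have "\<bar>correction s r y * (p \<bullet> y)\<bar> * (Lam * ?\<kappa> y) \<le> (norm p * r) * (Lam * ?\<kappa> y)"
          using Lam by (intro mult_right_mono) auto
        moreover have "L = norm p * r * Lam" using True by (simp add: L_def)
        moreover have "- (n + 2 * s) = - \<beta> - n" using True by (simp add: \<beta>_def)
        ultimately show ?thesis by (simp only: mult_ac)
      next
        case ns: False
        have "\<bar>correction s r y * (p \<bullet> y)\<bar> * (Lam * ?\<kappa> y) \<le> (norm p * norm y) * (Lam * ?\<kappa> y)"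
          using Lam cs False ns by (intro mult_right_mono) (auto simp: correction_def)
        also have "\<dots> = L * (norm y powr 1 * ?\<kappa> y)" using ns y0 by (simp add: L_def)
        also have "norm y powr 1 * ?\<kappa> y = norm y powr (- \<beta> - n)"
          using ns False by (simp only: powr_add[symmetric]) (simp add: \<beta>_def algebra_simps)
        finally show ?thesis .
      qed
    qed
    moreover have "\<bar>f y\<bar> * K y \<le> \<bar>f y\<bar> * (Lam * ?\<kappa> y)" using Kb(2) by (intro mult_left_mono) auto
    moreover have "\<bar>correction s r y * (p \<bullet> y)\<bar> * K y \<le> \<bar>correction s r y * (p \<bullet> y)\<bar> * (Lam * ?\<kappa> y)"
      using Kb(2) by (intro mult_left_mono) auto
    moreover have "\<bar>F y\<bar> \<le> \<bar>f y\<bar> * K y + \<bar>correction s r y * (p \<bullet> y)\<bar> * K y"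
      unfolding F_def abs_mult[of _ "K y"] using K0[of y]
      by (simp add: distrib_right[symmetric] mult_right_mono)
    ultimately show ?thesis by (simp add: mult_ac)
  qed
  define g where "g y = M * (indicator (ball 0 \<rho>) y * norm y powr (\<alpha> - real DIM('a))) +
    (Lam * (indicator (- ball 0 \<rho>) y * (\<bar>f y\<bar> * norm y powr (- (real DIM('a) + 2 * s)))) +
     L * (indicator (- ball 0 \<rho>) y * norm y powr (- \<beta> - real DIM('a))))" for y
  have ig: "integrable lborel g"
    unfolding g_def using Ci(2)[OF \<rho>(1)] tail io
    by (intro Bochner_Integration.integrable_add integrable_mult_right)
  have intF: "integrable lborel F"
  proof (rule Bochner_Integration.integrable_bound[OF ig])
    show "AE y in lborel. norm (F y) \<le> norm (g y)"
    proof (rule AE_I2)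
      fix y
      have "\<bar>F y\<bar> \<le> g y"
        using inner[of y] outer[of y] unfolding g_def n_def by (cases "norm y < \<rho>") auto
      then show "norm (F y) \<le> norm (g y)" by simp
    qed
  qed simp
  then show "integrable lborel (\<lambda>y. (f y + correction s r y * (p \<bullet> y)) * K y)" unfolding F_def .
  show "increment_op s K b f p = (LINT y|lborel. (f y + correction s r y * (p \<bullet> y)) * K y) + (if s = 1/2 then b \<bullet> p else 0)"
  proof (cases "s = 1/2")
    case False
    then show ?thesis by (auto simp: increment_op_def correction_def)
  next
    case s2: True
    \<comment> \<open>The two integrands differ by p applied to K(y) y on the shell between
      \<epsilon> and r, whose integral is 0.\<close>
    have cut: "(LINT y|lborel. indicator (- ball 0 \<epsilon>) y * (f y * K y)) = (LINT y|lborel. indicator (- ball 0 \<epsilon>) y * F y)"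
      if \<epsilon>: "0 < \<epsilon>" "\<epsilon> < r" for \<epsilon>
    proof -
      let ?A = "{y::'a. \<epsilon> \<le> norm y \<and> norm y < r}"
      have iA: "integrable lborel (\<lambda>y. indicator ?A y *\<^sub>R (K y *\<^sub>R y))"
      proof (rule Bochner_Integration.integrable_bound)
        show "integrable lborel (\<lambda>y::'a. (Lam * \<epsilon> powr (- (n + 2 * s)) * r) * indicator (ball 0 r) y)"
          using emeasure_lborel_ball_finite[of "0::'a" r]
          by (intro integrable_mult_right integrable_real_indicator) auto
        show "(\<lambda>y. indicator ?A y *\<^sub>R (K y *\<^sub>R y)) \<in> borel_measurable lborel" by measurable
        show "AE y in lborel. norm (indicator ?A y *\<^sub>R (K y *\<^sub>R y)) \<le> norm ((Lam * \<epsilon> powr (- (n + 2 * s)) * r) * indicator (ball 0 r) y :: real)"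
        proof (rule AE_I2)
          fix y :: 'a
          show "norm (indicator ?A y *\<^sub>R (K y *\<^sub>R y)) \<le> norm ((Lam * \<epsilon> powr (- (n + 2 * s)) * r) * indicator (ball 0 r) y :: real)"
          proof (cases "y \<in> ?A")
            case True
            have "K y \<le> Lam * \<epsilon> powr (- (n + 2 * s))"
              using True \<epsilon> Lam s n0
              by (intro order_trans[OF Kb(2)] mult_left_mono powr_mono2') auto
            then have "K y * norm y \<le> Lam * \<epsilon> powr (- (n + 2 * s)) * r"
              using True K0 Lam by (intro mult_mono) auto
            then show ?thesis using True K0 Lam \<epsilon> by (simp add: abs_mult)
          qed simp
        qed
      qed
      have "(LINT y|lborel. indicator (- ball 0 \<epsilon>) y * F y) - (LINT y|lborel. p \<bullet> (indicator ?A y *\<^sub>R (K y *\<^sub>R y)))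
        = (LINT y|lborel. indicator (- ball 0 \<epsilon>) y * F y - p \<bullet> (indicator ?A y *\<^sub>R (K y *\<^sub>R y)))"
        by (intro Bochner_Integration.integral_diff[symmetric] integrable_real_mult_indicator[OF _ intF, unfolded mult.commute[of "F _"]]
            integrable_inner_right) (use iA in auto)
      also have "\<dots> = (LINT y|lborel. indicator (- ball 0 \<epsilon>) y * (f y * K y))"
        using \<epsilon> s2 by (intro Bochner_Integration.integral_cong refl)
          (auto simp: F_def correction_def indicator_def algebra_simps)
      also have "(LINT y|lborel. p \<bullet> (indicator ?A y *\<^sub>R (K y *\<^sub>R y))) = p \<bullet> (LINT y|lborel. indicator ?A y *\<^sub>R (K y *\<^sub>R y))"
        by (rule integral_inner_right) (use iA in auto)
      also have "(LINT y|lborel. indicator ?A y *\<^sub>R (K y *\<^sub>R y)) = 0"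
        using K s2 \<epsilon> by (auto simp: stable_kernel_def)
      finally show ?thesis by simp
    qed
    have "((\<lambda>\<epsilon>. LINT y|lborel. indicator (- ball 0 \<epsilon>) y * (f y * K y)) \<longlongrightarrow> (LINT y|lborel. F y)) (at_right 0)"
    proof (rule Lim_null_comparison[THEN LIM_zero_cancel])
      have ev: "\<forall>\<^sub>F \<epsilon> in at_right 0. 0 < \<epsilon> \<and> \<epsilon> < \<rho>"
        using \<rho>(1) by (auto simp: eventually_at_right_field)
      show "\<forall>\<^sub>F \<epsilon> in at_right 0. norm ((LINT y|lborel. indicator (- ball 0 \<epsilon>) y * (f y * K y)) - (LINT y|lborel. F y)) \<le> M * (Ci * \<epsilon> powr \<alpha>)"
        using ev
      proof eventually_elim
        case (elim \<epsilon>)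
        have e: "0 < \<epsilon>" "\<epsilon> < r" using elim \<rho> by auto
        have ib: "integrable lborel (\<lambda>y. indicator B y * F y)" if "B \<in> sets borel" for B
          using integrable_real_mult_indicator[OF _ intF, of B] that by (simp add: mult.commute)
        have "(LINT y|lborel. F y) - (LINT y|lborel. indicator (- ball 0 \<epsilon>) y * F y) = (LINT y|lborel. F y - indicator (- ball 0 \<epsilon>) y * F y)"
          by (intro Bochner_Integration.integral_diff[symmetric] intF ib) auto
        also have "\<dots> = (LINT y|lborel. indicator (ball 0 \<epsilon>) y * F y)"
          by (intro Bochner_Integration.integral_cong refl) (auto simp: indicator_def)
        also have "norm \<dots> \<le> (LINT y|(lborel :: 'a measure). M * (indicator (ball 0 \<epsilon>) y * norm y powr (\<alpha> - real DIM('a))))"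
        proof (rule Bochner_Integration.integral_norm_bound_integral)
          show "integrable lborel (\<lambda>y. indicator (ball 0 \<epsilon>) y * F y)" by (rule ib) auto
          show "integrable lborel (\<lambda>y::'a. M * (indicator (ball 0 \<epsilon>) y * norm y powr (\<alpha> - real DIM('a))))"
            by (intro integrable_mult_right Ci(2) e)
          fix y :: 'a
          show "norm (indicator (ball 0 \<epsilon>) y * F y) \<le> M * (indicator (ball 0 \<epsilon>) y * norm y powr (\<alpha> - real DIM('a)))"
            using inner[of y] elim by (auto simp: indicator_def n_def)
        qed
        also have "\<dots> = M * (LINT y|(lborel :: 'a measure). indicator (ball 0 \<epsilon>) y * norm y powr (\<alpha> - real DIM('a)))"
          by simp
        also have "\<dots> \<le> M * (Ci * \<epsilon> powr \<alpha>)" by (intro mult_left_mono Ci(3) e M)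
        finally show ?case unfolding cut[OF e] by (simp add: norm_minus_commute)
      qed
      have "((\<lambda>\<epsilon>. M * (Ci * \<epsilon> powr \<alpha>)) \<longlongrightarrow> M * (Ci * 0 powr \<alpha>)) (at_right 0)"
        using \<alpha> by (intro tendsto_intros) (auto intro: eventually_mono[OF eventually_at_right_less])
      then show "((\<lambda>\<epsilon>. M * (Ci * \<epsilon> powr \<alpha>)) \<longlongrightarrow> 0) (at_right 0)" using \<alpha> by simp
    qed
    then have "Lim (at_right 0) (\<lambda>\<epsilon>. LINT y|lborel. indicator (- ball 0 \<epsilon>) y * (f y * K y)) = (LINT y|lborel. F y)"
      by (intro tendsto_Lim) (auto simp: trivial_limit_at_right_real)
    then show ?thesis unfolding F_def increment_op_def s2 by simp
  qed
qed

section \<open>The contact point estimate\<close>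

definition decay_weight :: "real \<Rightarrow> 'a::euclidean_space \<Rightarrow> real" where
  "decay_weight s x = 1 / (1 + norm x powr (real DIM('a) + 2 * s))"

lemma decay_weight_pos: "0 < decay_weight s x"
  unfolding decay_weight_def by (smt (verit) divide_pos_pos powr_ge_zero)

lemma decay_weight_measurable [measurable]: "decay_weight s \<in> borel_measurable borel"
  unfolding decay_weight_def[abs_def] by measurable

lemma decay_weight_near:
  fixes x :: "'a::euclidean_space"
  assumes "0 < s" "norm x \<le> R" "0 \<le> R"
  shows "1 \<le> (1 + R powr (real DIM('a) + 2 * s)) * decay_weight s x"
proof -
  have "norm x powr (real DIM('a) + 2 * s) \<le> R powr (real DIM('a) + 2 * s)"
    using assms by (intro powr_mono2) auto
  moreover have "0 < 1 + norm x powr (real DIM('a) + 2 * s)" by (smt (verit) powr_ge_zero)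
  ultimately show ?thesis unfolding decay_weight_def by (simp add: field_simps)
qed

text \<open>Writing |y| = r t with 1 \<le> t, the growth of z makes 1 + |z|^m at most a multiple of
  t^m. Away from the ball of radius r the kernel is therefore bounded by the decay weight at z, at
  the price r^(-m).\<close>

lemma decay_weight_far:
  fixes z y :: "'a::euclidean_space"
  assumes s: "0 < s" and r: "0 < r" "r \<le> norm y" and z: "norm z \<le> c * (norm y / r)" and c: "0 \<le> c"
  shows "norm y powr (- (real DIM('a) + 2 * s)) \<le>
    (1 + c powr (real DIM('a) + 2 * s)) * r powr (- (real DIM('a) + 2 * s)) * decay_weight s z"
proof -
  define m where "m = real DIM('a) + 2 * s"
  have m: "0 < m" using s by (simp add: m_def add_nonneg_pos)
  define t where "t = norm y / r"
  have t: "1 \<le> t" using r by (simp add: t_def)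
  have "norm z powr m \<le> (c * t) powr m" using z m c t by (intro powr_mono2) (auto simp: t_def)
  also have "\<dots> = c powr m * t powr m" using c t by (simp add: powr_mult)
  finally have "1 + norm z powr m \<le> (1 + c powr m) * t powr m"
    using ge_one_powr_ge_zero[OF t, of m] m by (simp add: distrib_right)
  moreover have p: "0 < 1 + norm z powr m" by (smt (verit) powr_ge_zero)
  ultimately have "1 \<le> (1 + c powr m) * t powr m * decay_weight s z"
    unfolding decay_weight_def m_def[symmetric] by (simp add: field_simps)
  then have "norm y powr (- m) * 1 \<le> norm y powr (- m) * ((1 + c powr m) * t powr m * decay_weight s z)"
    by (intro mult_left_mono) auto
  also have "norm y powr (- m) * ((1 + c powr m) * t powr m * decay_weight s z) =
      (1 + c powr m) * (norm y powr (- m) * t powr m) * decay_weight s z" by (simp add: mult_ac)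
  also have "norm y powr (- m) * t powr m = r powr (- m)"
  proof -
    have "0 < norm y" using r by linarith
    then show ?thesis using r by (simp add: t_def powr_divide powr_minus field_simps)
  qed
  finally show ?thesis by (simp add: m_def)
qed

lemma lborel_translate:
  fixes f :: "'a::euclidean_space \<Rightarrow> real"
  shows "integrable lborel f \<Longrightarrow> integrable lborel (\<lambda>y. f (c + y))"
    and "f \<in> borel_measurable borel \<Longrightarrow> (LINT y|lborel. f (c + y)) = (LINT y|lborel. f y)"
proof -
  assume "integrable lborel f"
  then have "integrable (distr lborel borel ((+) c)) f" by (simp add: lborel_distr_plus)
  then show "integrable lborel (\<lambda>y. f (c + y))" by (rule integrable_distr[rotated]) simp
next
  assume "f \<in> borel_measurable borel"
  then have "integral\<^sup>L (distr lborel borel ((+) c)) f = (LINT y|lborel. f (c + y))"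
    by (intro integral_distr) auto
  then show "(LINT y|lborel. f (c + y)) = (LINT y|lborel. f y)" by (simp add: lborel_distr_plus)
qed

text \<open>The core estimate. Near \<open>x\<^sub>0\<close> the function \<open>V\<close> lies below a paraboloid with opening
  \<open>\<beta> / d\<^sup>2\<close>, and by Chebyshev it exceeds \<open>u\<^sub>0 / 2\<close> on a small part of the ball of radius \<open>\<theta> d\<close> only,
  so the operator is large compared with \<open>u\<^sub>0\<close> unless \<open>u\<^sub>0 d^n\<close> is controlled by the weighted norm.\<close>

lemma contact_point_bound:
  fixes s lam Lam a \<beta> \<theta>m :: real
  assumes s: "0 < s" "s < 1" and lam: "0 < lam" "lam \<le> Lam" and ab: "0 \<le> a" "0 \<le> \<beta>" "0 < \<theta>m"
  obtains \<theta> A where "0 < \<theta>" "\<theta> \<le> \<theta>m" "\<theta> \<le> 1" "0 < A"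
    "\<And>(K :: 'a::euclidean_space \<Rightarrow> real) b V x\<^sub>0 u\<^sub>0 d p N \<rho> C C\<^sub>0.
       stable_kernel s lam Lam K \<Longrightarrow> (s = 1/2 \<longrightarrow> norm b \<le> Lam) \<Longrightarrow> V \<in> borel_measurable borel \<Longrightarrow>
       norm x\<^sub>0 < 1 \<Longrightarrow> 0 < d \<Longrightarrow> d \<le> 1 \<Longrightarrow> 0 < u\<^sub>0 \<Longrightarrow> norm p \<le> a / d \<Longrightarrow>
       (\<forall>y. norm y < \<theta> * d \<longrightarrow> V (x\<^sub>0 + y) \<le> u\<^sub>0 * (1 + p \<bullet> y + \<beta> / d\<^sup>2 * (norm y)\<^sup>2)) \<Longrightarrow>
       0 < \<rho> \<Longrightarrow> \<rho> \<le> \<theta> * d \<Longrightarrow>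
       (\<forall>y. norm y < \<rho> \<longrightarrow> \<bar>u\<^sub>0 - V (x\<^sub>0 + y) + (u\<^sub>0 *\<^sub>R p) \<bullet> y\<bar> \<le> C * (norm y)\<^sup>2) \<Longrightarrow>
       integrable lborel (\<lambda>z. \<bar>V z\<bar> * decay_weight s z) \<Longrightarrow> (LINT z|lborel. \<bar>V z\<bar> * decay_weight s z) \<le> N \<Longrightarrow>
       0 \<le> C\<^sub>0 \<Longrightarrow> increment_op s K b (\<lambda>y. u\<^sub>0 - V (x\<^sub>0 + y)) (u\<^sub>0 *\<^sub>R p) \<le> C\<^sub>0 \<Longrightarrow>
       u\<^sub>0 * d ^ DIM('a) \<le> A * (N + C\<^sub>0)"
proof -
  define n where "n = DIM('a)"
  define \<omega> where "\<omega> = unit_ball_vol (real n)"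
  have \<omega>: "0 < \<omega>" by (simp add: \<omega>_def)
  have Lam: "0 < Lam" using lam by simp
  define m where "m = real n + 2 * s"
  have m: "0 < m" using s by (simp add: m_def add_nonneg_pos)
  define W where "W = 1 + 2 powr m"
  have W: "1 \<le> W" by (simp add: W_def)
  define k where "k = (if s < 1/2 then 1 else 2 :: nat)"
  define \<alpha> where "\<alpha> = real k - 2 * s"
  have \<alpha>: "0 < \<alpha>" using s by (auto simp: \<alpha>_def k_def)
  obtain Ci where Ci: "0 \<le> Ci"
    "\<And>r. 0 < r \<Longrightarrow> integrable lborel (\<lambda>y::'a. indicator (ball 0 r) y * norm y powr (\<alpha> - real DIM('a)))"
    "\<And>r. 0 < r \<Longrightarrow> (LINT y|(lborel :: 'a measure). indicator (ball 0 r) y * norm y powr (\<alpha> - real DIM('a))) \<le> Ci * r powr \<alpha>"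
    by (rule radial_integral_ball[OF \<alpha>, where 'a='a]) (rule that)
  \<comment> \<open>The value 1 for s \<le> 1/2 is a placeholder that keeps the exponent positive;
    the coefficient \<open>q'\<close> of that term is then 0.\<close>
  define \<beta>' where "\<beta>' = (if s \<le> 1/2 then 1 else 2 * s - 1)"
  have \<beta>': "0 < \<beta>'" using s by (auto simp: \<beta>'_def)
  obtain Co where Co: "0 \<le> Co"
    "\<And>r. 0 < r \<Longrightarrow> integrable lborel (\<lambda>y::'a. indicator (- ball 0 r) y * norm y powr (- \<beta>' - real DIM('a)))"
    "\<And>r. 0 < r \<Longrightarrow> (LINT y|(lborel :: 'a measure). indicator (- ball 0 r) y * norm y powr (- \<beta>' - real DIM('a))) \<le> Co * r powr (- \<beta>')"
    by (rule radial_integral_outside[OF \<beta>', where 'a='a]) (rule that)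
  \<comment> \<open>The three error terms, each up to the common factor
    \<open>u\<^sub>0 * S * \<theta>\<close>: gradient and paraboloid inside the ball, the gradient
    tail for s > 1/2, and the drift for s = 1/2.\<close>
  define c1 where "c1 = Lam * (a + \<beta>) * Ci + Lam * a * Co + Lam * a"
  have c1: "0 \<le> c1" using Lam ab Ci(1) Co(1) by (auto simp: c1_def intro!: add_nonneg_nonneg mult_nonneg_nonneg)
  \<comment> \<open>The third bound keeps the gradient term below a quarter of
    \<open>u\<^sub>0\<close> on the ball, the fourth keeps all errors below a quarter of the gain.
    The added 1 avoids zero denominators.\<close>
  define \<theta> where "\<theta> = Min {\<theta>m, 1, 1 / (4 * a + 1), lam * \<omega> / (16 * c1 + 1)}"
  have \<theta>: "0 < \<theta>" "\<theta> \<le> \<theta>m" "\<theta> \<le> 1" "\<theta> \<le> 1 / (4 * a + 1)" "\<theta> \<le> lam * \<omega> / (16 * c1 + 1)"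
    using ab c1 lam \<omega> by (auto simp: \<theta>_def add_nonneg_pos)
  have \<theta>a: "a * \<theta> \<le> 1/4"
  proof -
    have "\<theta> * (4 * a + 1) \<le> 1" using \<theta>(4) ab by (simp add: pos_le_divide_eq add_nonneg_pos)
    then show ?thesis using \<theta>(1) by (simp add: algebra_simps)
  qed
  have \<theta>c: "c1 * \<theta> \<le> lam * \<omega> / 16"
  proof -
    have "\<theta> * (16 * c1 + 1) \<le> lam * \<omega>" using \<theta>(5) c1 by (simp add: pos_le_divide_eq add_nonneg_pos)
    then show ?thesis using \<theta>(1) by (simp add: algebra_simps)
  qed
  \<comment> \<open>If the norm does not already control \<open>u\<^sub>0 * d ^ n\<close>, the first
    summand makes its contribution at most a quarter of the gain lam \<omega> / 4. With another
    quarter lost to errors, lam \<omega> / 8 remains, which explains the second summand.\<close>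
  define A where "A = 32 * Lam * W / (\<theta> ^ n * lam * \<omega>) + 8 / (lam * \<omega>)"
  have A1: "32 * Lam * W \<le> A * (\<theta> ^ n * lam * \<omega>)" and A2: "8 / (lam * \<omega>) \<le> A" and A0: "0 < A"
    using \<theta>(1) lam \<omega> Lam W unfolding A_def by (auto simp: distrib_right intro!: add_nonneg_pos divide_nonneg_pos)
  show ?thesis
  proof (rule that[OF \<theta>(1,2,3) A0])
    fix K :: "'a \<Rightarrow> real" and b :: 'a and V :: "'a \<Rightarrow> real" and x\<^sub>0 p :: 'a and u\<^sub>0 d N \<rho> C C\<^sub>0 :: real
    assume K: "stable_kernel s lam Lam K" and b: "s = 1/2 \<longrightarrow> norm b \<le> Lam" and Vm: "V \<in> borel_measurable borel"
      and x0: "norm x\<^sub>0 < 1" and d: "0 < d" "d \<le> 1" and u0: "0 < u\<^sub>0" and p: "norm p \<le> a / d"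
      and upper: "\<forall>y. norm y < \<theta> * d \<longrightarrow> V (x\<^sub>0 + y) \<le> u\<^sub>0 * (1 + p \<bullet> y + \<beta> / d\<^sup>2 * (norm y)\<^sup>2)"
      and \<rho>: "0 < \<rho>" "\<rho> \<le> \<theta> * d"
      and near: "\<forall>y. norm y < \<rho> \<longrightarrow> \<bar>u\<^sub>0 - V (x\<^sub>0 + y) + (u\<^sub>0 *\<^sub>R p) \<bullet> y\<bar> \<le> C * (norm y)\<^sup>2"
      and Vi: "integrable lborel (\<lambda>z. \<bar>V z\<bar> * decay_weight s z)"
      and VN: "(LINT z|lborel. \<bar>V z\<bar> * decay_weight s z) \<le> N"
      and C0: "0 \<le> C\<^sub>0" and op: "increment_op s K b (\<lambda>y. u\<^sub>0 - V (x\<^sub>0 + y)) (u\<^sub>0 *\<^sub>R p) \<le> C\<^sub>0"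
    note [measurable] = Vm
    define r where "r = \<theta> * d"
    have r: "0 < r" "r \<le> 1" "\<rho> \<le> r" using \<theta> d \<rho> by (auto simp: r_def mult_le_one)
    let ?\<kappa> = "\<lambda>y::'a. norm y powr (- m)"
    have Kb: "lam * ?\<kappa> y \<le> K y" "K y \<le> Lam * ?\<kappa> y" for y
      using K by (auto simp: stable_kernel_def m_def n_def)
    have K0: "0 \<le> K y" for y using Kb(1)[of y] lam by (smt (verit) mult_nonneg_nonneg powr_ge_zero)
    define T where "T y = \<bar>V (x\<^sub>0 + y)\<bar> * decay_weight s (x\<^sub>0 + y)" for y
    have T0: "0 \<le> T y" for y using decay_weight_pos[of s "x\<^sub>0 + y"] by (simp add: T_def)
    have Ti: "integrable lborel T" unfolding T_def by (rule lborel_translate(1)[OF Vi])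
    have TN: "integral\<^sup>L lborel T \<le> N"
      unfolding T_def using lborel_translate(2)[of "\<lambda>z. \<bar>V z\<bar> * decay_weight s z" x\<^sub>0] VN by simp
    have N0: "0 \<le> N" by (rule order_trans[OF Bochner_Integration.integral_nonneg[OF T0] TN])
    define R where "R = r powr (- m)"
    have R: "0 < R" using r by (simp add: R_def)
    have T_near: "\<bar>V (x\<^sub>0 + y)\<bar> \<le> W * T y" if "norm y < r" for y
    proof -
      have "norm (x\<^sub>0 + y) \<le> 2" using norm_triangle_ineq[of x\<^sub>0 y] x0 that r by linarith
      then have "1 \<le> W * decay_weight s (x\<^sub>0 + y)"
        using decay_weight_near[of s "x\<^sub>0 + y" 2] s by (simp add: W_def m_def n_def)
      then have "\<bar>V (x\<^sub>0 + y)\<bar> * 1 \<le> \<bar>V (x\<^sub>0 + y)\<bar> * (W * decay_weight s (x\<^sub>0 + y))" by (intro mult_left_mono) auto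
      then show ?thesis by (simp add: T_def mult_ac)
    qed
    have T_far: "\<bar>V (x\<^sub>0 + y)\<bar> * ?\<kappa> y \<le> W * R * T y" if y: "r \<le> norm y" for y
    proof -
      have "1 \<le> norm y / r" using y r by simp
      moreover have "norm y * 1 \<le> norm y * (1 / r)" using r by (intro mult_left_mono) auto
      ultimately have "norm (x\<^sub>0 + y) \<le> 2 * (norm y / r)"
        using norm_triangle_ineq[of x\<^sub>0 y] x0 by simp
      then have "?\<kappa> y \<le> W * R * decay_weight s (x\<^sub>0 + y)"
        using decay_weight_far[OF s(1) r(1) y, of "x\<^sub>0 + y" 2] by (simp add: W_def R_def m_def n_def)
      then have "\<bar>V (x\<^sub>0 + y)\<bar> * ?\<kappa> y \<le> \<bar>V (x\<^sub>0 + y)\<bar> * (W * R * decay_weight s (x\<^sub>0 + y))" by (intro mult_left_mono) auto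
      then show ?thesis by (simp add: T_def mult_ac)
    qed
    define f where "f y = u\<^sub>0 - V (x\<^sub>0 + y)" for y
    have fm: "f \<in> borel_measurable borel" unfolding f_def[abs_def] by measurable
    define F where "F y = (f y + correction s r y * ((u\<^sub>0 *\<^sub>R p) \<bullet> y)) * K y" for y
    have tail: "integrable lborel (\<lambda>y. indicator (- ball 0 \<rho>) y * (\<bar>f y\<bar> * norm y powr (- (real DIM('a) + 2 * s))))"
    proof (rule Bochner_Integration.integrable_bound)
      have s2: "0 < 2 * s" using s by simp
      have "integrable lborel (\<lambda>y::'a. indicator (- ball 0 \<rho>) y * norm y powr (- (2 * s) - real DIM('a)))"
        by (rule radial_integral_outside[OF s2, where 'a='a]) (use \<rho>(1) in blast)
      then show "integrable lborel (\<lambda>y. u\<^sub>0 * (indicator (- ball 0 \<rho>) y * norm y powr (- (2 * s) - real DIM('a))) + ((1 + 2 powr m) * \<rho> powr (- m)) * T y)"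
        by (intro Bochner_Integration.integrable_add integrable_mult_right Ti)
      show "(\<lambda>y. indicator (- ball 0 \<rho>) y * (\<bar>f y\<bar> * norm y powr (- (real DIM('a) + 2 * s)))) \<in> borel_measurable lborel"
        using fm by measurable
      show "AE y in lborel. norm (indicator (- ball 0 \<rho>) y * (\<bar>f y\<bar> * norm y powr (- (real DIM('a) + 2 * s))))
        \<le> norm (u\<^sub>0 * (indicator (- ball 0 \<rho>) y * norm y powr (- (2 * s) - real DIM('a))) + ((1 + 2 powr m) * \<rho> powr (- m)) * T y)"
      proof (rule AE_I2)
        fix y :: 'a
        have "0 \<le> u\<^sub>0 * (indicator (- ball 0 \<rho>) y * norm y powr (- (2 * s) - real DIM('a)))"
          using u0 by (intro mult_nonneg_nonneg) auto
        moreover have "0 \<le> ((1 + 2 powr m) * \<rho> powr (- m)) * T y"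
          using T0 by (intro mult_nonneg_nonneg add_nonneg_nonneg) auto
        moreover have "\<bar>f y\<bar> * ?\<kappa> y \<le> u\<^sub>0 * norm y powr (- (2 * s) - real DIM('a)) + ((1 + 2 powr m) * \<rho> powr (- m)) * T y"
          if y: "\<rho> \<le> norm y"
        proof -
          have "1 \<le> norm y / \<rho>" using y \<rho> by simp
          moreover have "norm y * 1 \<le> norm y * (1 / \<rho>)" using \<rho> r by (intro mult_left_mono) auto
          ultimately have "norm (x\<^sub>0 + y) \<le> 2 * (norm y / \<rho>)"
            using norm_triangle_ineq[of x\<^sub>0 y] x0 by simp
          then have "?\<kappa> y \<le> (1 + 2 powr m) * \<rho> powr (- m) * decay_weight s (x\<^sub>0 + y)"
            using decay_weight_far[OF s(1) \<rho>(1) y, of "x\<^sub>0 + y" 2] by (simp add: m_def n_def)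
          then have "\<bar>V (x\<^sub>0 + y)\<bar> * ?\<kappa> y \<le> \<bar>V (x\<^sub>0 + y)\<bar> * ((1 + 2 powr m) * \<rho> powr (- m) * decay_weight s (x\<^sub>0 + y))"
            by (intro mult_left_mono) auto
          moreover have "\<bar>f y\<bar> * ?\<kappa> y \<le> (u\<^sub>0 + \<bar>V (x\<^sub>0 + y)\<bar>) * ?\<kappa> y"
            using u0 by (intro mult_right_mono) (auto simp: f_def)
          moreover have "?\<kappa> y = norm y powr (- (2 * s) - real DIM('a))"
            by (rule arg_cong[where f = "\<lambda>e. norm y powr e"]) (simp add: m_def n_def)
          ultimately show ?thesis by (simp add: T_def mult_ac distrib_right)
        qed
        ultimately show "norm (indicator (- ball 0 \<rho>) y * (\<bar>f y\<bar> * norm y powr (- (real DIM('a) + 2 * s))))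
          \<le> norm (u\<^sub>0 * (indicator (- ball 0 \<rho>) y * norm y powr (- (2 * s) - real DIM('a))) + ((1 + 2 powr m) * \<rho> powr (- m)) * T y)"
          by (cases "norm y < \<rho>") (auto simp: m_def n_def)
      qed
    qed
    have near': "\<bar>f y + (u\<^sub>0 *\<^sub>R p) \<bullet> y\<bar> \<le> C * (norm y)\<^sup>2" if "norm y < \<rho>" for y
      using near that by (simp add: f_def)
    note rep = increment_op_eq[OF s lam(1) K fm \<rho>(1) r(3) near' tail]
    have Fi: "integrable lborel F" using rep(1) unfolding F_def .
    have opF: "increment_op s K b f (u\<^sub>0 *\<^sub>R p) = integral\<^sup>L lborel F + (if s = 1/2 then b \<bullet> (u\<^sub>0 *\<^sub>R p) else 0)"
      using rep(2) unfolding F_def .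
    \<comment> \<open>The coefficients of a pointwise minorant g of the integrand: the gain on the
      ball, the Chebyshev cost paid by the weighted norm, the local error and the gradient error at
      infinity.\<close>
    define P where "P = u\<^sub>0 / 4 * lam * R"
    define Q where "Q = 2 * Lam * W * R"
    define q where "q = u\<^sub>0 * Lam * ((a + \<beta>) / d ^ k)"
    define q' where "q' = (if s \<le> 1/2 then 0 else u\<^sub>0 * Lam * (a / d))"
    have nn: "0 \<le> P" "0 \<le> Q" "0 \<le> q" "0 \<le> q'"
      using u0 lam Lam R W ab d by (auto simp: P_def Q_def q_def q'_def)
    define g where "g y = P * indicator (ball 0 r) y - Q * T y -
        q * (indicator (ball 0 r) y * norm y powr (\<alpha> - real DIM('a))) -
        q' * (indicator (- ball 0 r) y * norm y powr (- \<beta>' - real DIM('a)))" for y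
    have gi: "integrable lborel g"
      unfolding g_def using emeasure_lborel_ball_finite[of "0::'a" r]
      by (intro Bochner_Integration.integrable_diff integrable_mult_right integrable_real_indicator Ti Ci(2) Co(2) r(1)) auto
    have pd: "\<bar>p \<bullet> y\<bar> \<le> a / d * norm y" for y
      using Cauchy_Schwarz_ineq2[of p y] mult_right_mono[OF p, of "norm y"] by simp
    have gF: "g y \<le> F y" if y0: "y \<noteq> 0" for y
    proof (cases "norm y < r")
      case True
      have "r powr (- m) \<le> norm y powr (- m)" using True y0 m by (intro powr_mono2') auto
      then have KR: "lam * R \<le> K y" using Kb(1)[of y] lam by (smt (verit) R_def mult_left_mono)
      have g_eq: "g y = P - Q * T y - q * norm y powr (\<alpha> - real DIM('a))" using True by (simp add: g_def)
      have yd: "norm y / d \<le> \<theta>" using True d by (simp add: r_def pos_divide_le_eq)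
      \<comment> \<open>Where V exceeds half its contact value, the weighted density of V is so
        large that its cost cancels the gain, and the paraboloid bounds the rest. Elsewhere the
        increment is at least \<open>u\<^sub>0 / 2\<close>, of which the gradient takes at most
        half.\<close>
      show ?thesis
      proof (cases "V (x\<^sub>0 + y) > u\<^sub>0 / 2")
        case big: True
        have "u\<^sub>0 / 2 \<le> W * T y" using T_near[OF True] big by linarith
        then have "(lam * R / 2) * (u\<^sub>0 / 2) \<le> (lam * R / 2) * (W * T y)"
          using lam R by (intro mult_left_mono) auto
        also have "\<dots> \<le> Q * T y"
        proof -
          have "lam / 2 * (W * R) \<le> 2 * Lam * (W * R)" using lam W R by (intro mult_right_mono) auto
          then have "lam / 2 * (W * R) * T y \<le> 2 * Lam * (W * R) * T y" using T0 by (rule mult_right_mono)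
          then show ?thesis by (simp add: Q_def mult_ac)
        qed
        finally have PQ: "P \<le> Q * T y" by (simp add: P_def mult_ac)
        have low: "- (u\<^sub>0 * ((a + \<beta>) / d ^ k) * norm y ^ k) \<le> f y + correction s r y * ((u\<^sub>0 *\<^sub>R p) \<bullet> y)"
        proof -
          have up: "V (x\<^sub>0 + y) \<le> u\<^sub>0 * (1 + p \<bullet> y + \<beta> / d\<^sup>2 * (norm y)\<^sup>2)" using upper True by (simp add: r_def)
          show ?thesis
          proof (cases "s < 1/2")
            case s1: True
            have "(norm y)\<^sup>2 / d\<^sup>2 \<le> norm y / d"
            proof -
              have "(norm y / d) * (norm y / d) \<le> 1 * (norm y / d)" using d by (intro mult_right_mono order_trans[OF yd \<theta>(3)]) auto
              then show ?thesis by (simp add: power2_eq_square)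
            qed
            then have "\<beta> / d\<^sup>2 * (norm y)\<^sup>2 \<le> \<beta> * (norm y / d)"
              using ab by (simp add: mult_left_mono flip: times_divide_eq_right)
            then have "1 + p \<bullet> y + \<beta> / d\<^sup>2 * (norm y)\<^sup>2 \<le> 1 + (a + \<beta>) / d * norm y"
              using pd[of y] by (simp add: add_divide_distrib distrib_right)
            then have "u\<^sub>0 * (1 + p \<bullet> y + \<beta> / d\<^sup>2 * (norm y)\<^sup>2) \<le> u\<^sub>0 * (1 + (a + \<beta>) / d * norm y)"
              using u0 by (intro mult_left_mono) auto
            moreover have "u\<^sub>0 * (1 + (a + \<beta>) / d * norm y) = u\<^sub>0 + u\<^sub>0 * ((a + \<beta>) / d ^ k) * norm y ^ k"
              using s1 by (simp add: k_def distrib_left[of "u\<^sub>0" 1])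
            ultimately have "V (x\<^sub>0 + y) \<le> u\<^sub>0 + u\<^sub>0 * ((a + \<beta>) / d ^ k) * norm y ^ k" using up by linarith
            then show ?thesis unfolding f_def using s1 by (simp add: correction_def)
          next
            case s1: False
            then have c: "correction s r y = 1" using True by (auto simp: correction_def)
            have "\<beta> / d\<^sup>2 * (norm y)\<^sup>2 \<le> (a + \<beta>) / d\<^sup>2 * (norm y)\<^sup>2"
              using ab by (intro mult_right_mono divide_right_mono) auto
            then have "u\<^sub>0 * (\<beta> / d\<^sup>2 * (norm y)\<^sup>2) \<le> u\<^sub>0 * ((a + \<beta>) / d\<^sup>2 * (norm y)\<^sup>2)"
              using u0 by (intro mult_left_mono) auto
            moreover have "u\<^sub>0 * ((a + \<beta>) / d\<^sup>2 * (norm y)\<^sup>2) = u\<^sub>0 * ((a + \<beta>) / d ^ k) * norm y ^ k"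
              using s1 by (simp add: k_def)
            moreover have "u\<^sub>0 * (1 + p \<bullet> y + \<beta> / d\<^sup>2 * (norm y)\<^sup>2) = u\<^sub>0 + (u\<^sub>0 *\<^sub>R p) \<bullet> y + u\<^sub>0 * (\<beta> / d\<^sup>2 * (norm y)\<^sup>2)"
              by (simp add: distrib_left)
            ultimately have "V (x\<^sub>0 + y) \<le> u\<^sub>0 + (u\<^sub>0 *\<^sub>R p) \<bullet> y + u\<^sub>0 * ((a + \<beta>) / d ^ k) * norm y ^ k"
              using up by linarith
            then show ?thesis unfolding f_def c by linarith
          qed
        qed
        define Z where "Z = u\<^sub>0 * ((a + \<beta>) / d ^ k) * norm y ^ k"
        have "q * norm y powr (\<alpha> - real DIM('a)) = Z * (Lam * ?\<kappa> y)"
        proof -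
          have "norm y powr (\<alpha> - real DIM('a)) = norm y ^ k * ?\<kappa> y"
            using y0 by (simp add: \<alpha>_def m_def n_def powr_realpow[symmetric] powr_add[symmetric] algebra_simps)
          then show ?thesis by (simp add: q_def Z_def mult_ac)
        qed
        moreover have "Z * K y \<le> Z * (Lam * ?\<kappa> y)"
          using u0 ab d by (intro mult_left_mono Kb(2)) (auto simp: Z_def)
        moreover have "- (Z * K y) \<le> F y"
          using mult_right_mono[OF low[folded Z_def] K0[of y]] by (simp only: F_def mult_minus_left)
        ultimately show ?thesis using PQ unfolding g_eq by linarith
      next
        case small: False
        have "\<bar>correction s r y * ((u\<^sub>0 *\<^sub>R p) \<bullet> y)\<bar> \<le> u\<^sub>0 / 4"
        proof -
          have "a * (norm y / d) \<le> a * \<theta>" using yd ab by (intro mult_left_mono) auto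
          then have "\<bar>p \<bullet> y\<bar> \<le> 1/4" using pd[of y] \<theta>a by simp
          then have "u\<^sub>0 * \<bar>p \<bullet> y\<bar> \<le> u\<^sub>0 * (1/4)" using u0 by (intro mult_left_mono) auto
          then have "\<bar>(u\<^sub>0 *\<^sub>R p) \<bullet> y\<bar> \<le> u\<^sub>0 / 4" using u0 by (simp add: abs_mult)
          moreover have "\<bar>correction s r y\<bar> * \<bar>(u\<^sub>0 *\<^sub>R p) \<bullet> y\<bar> \<le> 1 * \<bar>(u\<^sub>0 *\<^sub>R p) \<bullet> y\<bar>"
            using correction_bounds[of s r y] by (intro mult_right_mono) auto
          ultimately show ?thesis by (simp add: abs_mult)
        qed
        then have "u\<^sub>0 / 4 \<le> f y + correction s r y * ((u\<^sub>0 *\<^sub>R p) \<bullet> y)" using small by (simp add: f_def)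
        then have "u\<^sub>0 / 4 * (lam * R) \<le> F y"
          unfolding F_def using KR lam R u0 by (intro mult_mono) auto
        moreover have "0 \<le> Q * T y" "0 \<le> q * norm y powr (\<alpha> - real DIM('a))" using nn T0 by auto
        ultimately show ?thesis unfolding g_eq P_def by simp
      qed
    next
      case False
      then have ry: "r \<le> norm y" by simp
      have g_eq: "g y = - Q * T y - q' * norm y powr (- \<beta>' - real DIM('a))" using False by (simp add: g_def)
      have "- (\<bar>V (x\<^sub>0 + y)\<bar> + (if s \<le> 1/2 then 0 else u\<^sub>0 * (a / d) * norm y)) \<le> f y + correction s r y * ((u\<^sub>0 *\<^sub>R p) \<bullet> y)"
      proof (cases "s \<le> 1/2")
        case True
        then have "correction s r y = 0" using False by (auto simp: correction_def)
        then show ?thesis using True u0 by (simp add: f_def)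
      next
        case s1: False
        then have c: "correction s r y = 1" by (auto simp: correction_def)
        have "u\<^sub>0 * \<bar>p \<bullet> y\<bar> \<le> u\<^sub>0 * (a / d * norm y)" using u0 pd by (intro mult_left_mono) auto
        moreover have "- (u\<^sub>0 * \<bar>p \<bullet> y\<bar>) \<le> u\<^sub>0 * (p \<bullet> y)" using u0 mult_left_mono[of "- \<bar>p \<bullet> y\<bar>" "p \<bullet> y" "u\<^sub>0"] by simp
        ultimately have "- (u\<^sub>0 * (a / d) * norm y) \<le> (u\<^sub>0 *\<^sub>R p) \<bullet> y" by (simp add: mult.assoc)
        then show ?thesis using s1 c u0 by (simp add: f_def)
      qed
      then have "- (\<bar>V (x\<^sub>0 + y)\<bar> + (if s \<le> 1/2 then 0 else u\<^sub>0 * (a / d) * norm y)) * K y \<le> F y"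
        unfolding F_def by (rule mult_right_mono[OF _ K0])
      moreover have "\<bar>V (x\<^sub>0 + y)\<bar> * K y \<le> Q * T y"
      proof -
        have "\<bar>V (x\<^sub>0 + y)\<bar> * K y \<le> \<bar>V (x\<^sub>0 + y)\<bar> * (Lam * ?\<kappa> y)" by (intro mult_left_mono Kb(2)) auto
        also have "\<dots> = Lam * (\<bar>V (x\<^sub>0 + y)\<bar> * ?\<kappa> y)" by simp
        also have "\<dots> \<le> Lam * (W * R * T y)" using Lam by (intro mult_left_mono T_far ry) auto
        also have "\<dots> \<le> 2 * (Lam * (W * R * T y))" using Lam W R T0 by (simp add: mult_nonneg_nonneg)
        finally show ?thesis by (simp add: Q_def mult_ac)
      qed
      moreover have "(if s \<le> 1/2 then 0 else u\<^sub>0 * (a / d) * norm y) * K y \<le> q' * norm y powr (- \<beta>' - real DIM('a))"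
      proof (cases "s \<le> 1/2")
        case s1: False
        have "u\<^sub>0 * (a / d) * norm y * K y \<le> u\<^sub>0 * (a / d) * norm y * (Lam * ?\<kappa> y)"
          using u0 ab d by (intro mult_left_mono Kb(2)) auto
        also have "\<dots> = q' * (norm y powr 1 * ?\<kappa> y)" using s1 y0 by (simp add: q'_def mult_ac)
        also have "norm y powr 1 * ?\<kappa> y = norm y powr (- \<beta>' - real DIM('a))"
          using s1 by (simp only: powr_add[symmetric]) (simp add: \<beta>'_def m_def n_def algebra_simps)
        finally show ?thesis using s1 by simp
      qed (simp add: q'_def)
      ultimately show ?thesis unfolding g_eq by (simp add: distrib_right algebra_simps)
    qed
    have "integral\<^sup>L lborel g \<le> integral\<^sup>L lborel F"
    proof (rule integral_mono_AE[OF gi Fi])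
      show "AE y in lborel. g y \<le> F y" using AE_lborel_singleton[of "0::'a"] by eventually_elim (use gF in auto)
    qed
    moreover have "integral\<^sup>L lborel g = P * (\<omega> * r ^ n) - Q * integral\<^sup>L lborel T -
        q * (LINT y|(lborel :: 'a measure). indicator (ball 0 r) y * norm y powr (\<alpha> - real DIM('a))) -
        q' * (LINT y|(lborel :: 'a measure). indicator (- ball 0 r) y * norm y powr (- \<beta>' - real DIM('a)))"
    proof -
      have i1: "integrable lborel (\<lambda>y::'a. P * indicator (ball 0 r) y)"
        using emeasure_lborel_ball_finite[of "0::'a" r] by (intro integrable_mult_right integrable_real_indicator) auto
      have "(LINT y|lborel. P * indicator (ball (0::'a) r) y) = P * (\<omega> * r ^ n)"
        using content_ball[of r "0::'a"] r by (simp add: \<omega>_def n_def)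
      then show ?thesis
        unfolding g_def using i1 Ti Ci(2)[OF r(1)] Co(2)[OF r(1)]
        by (simp only: Bochner_Integration.integral_diff Bochner_Integration.integrable_diff integrable_mult_right integral_mult_right_zero)
    qed
    moreover have "Q * integral\<^sup>L lborel T \<le> Q * N" by (intro mult_left_mono TN nn)
    moreover have "q * (LINT y|(lborel :: 'a measure). indicator (ball 0 r) y * norm y powr (\<alpha> - real DIM('a))) \<le> q * (Ci * r powr \<alpha>)"
      by (intro mult_left_mono Ci(3) nn r(1))
    moreover have "q' * (LINT y|(lborel :: 'a measure). indicator (- ball 0 r) y * norm y powr (- \<beta>' - real DIM('a))) \<le> q' * (Co * r powr (- \<beta>'))"
      by (intro mult_left_mono Co(3) nn r(1))
    ultimately have lowF: "P * (\<omega> * r ^ n) - Q * N - q * (Ci * r powr \<alpha>) - q' * (Co * r powr (- \<beta>')) \<le> integral\<^sup>L lborel F"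
      by linarith
    define S where "S = r powr (- (2 * s))"
    have S: "1 \<le> S" unfolding S_def using powr_mono2'[of "- (2 * s)" r 1] r s by simp
    \<comment> \<open>The kernel size r^(-n-2s) times the ball volume r^n: gain and Chebyshev cost
      are both multiples of r^(-2s), which is at least 1.\<close>
    have Rn: "R * r ^ n = S"
      using r by (simp add: R_def S_def m_def powr_realpow[symmetric] powr_add[symmetric])
    have dr: "1 / d = \<theta> / r" using \<theta> d by (simp add: r_def)
    have e1: "P * (\<omega> * r ^ n) = u\<^sub>0 * S * (lam * \<omega> / 4)" unfolding P_def Rn[symmetric] by simp
    have \<theta>k: "\<theta> ^ k \<le> \<theta>" using \<theta> by (auto simp: k_def power2_eq_square mult_le_one mult_left_le)
    have e2: "q * (Ci * r powr \<alpha>) \<le> u\<^sub>0 * S * (Lam * (a + \<beta>) * Ci * \<theta>)"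
    proof -
      have "r powr \<alpha> = r ^ k * S" using r by (simp add: \<alpha>_def S_def powr_realpow[symmetric] powr_add[symmetric])
      moreover have "r ^ k = \<theta> ^ k * d ^ k" by (simp add: r_def power_mult_distrib)
      ultimately have "q * (Ci * r powr \<alpha>) = (u\<^sub>0 * S * (Lam * (a + \<beta>) * Ci)) * \<theta> ^ k"
        using d by (simp add: q_def)
      also have "\<dots> \<le> (u\<^sub>0 * S * (Lam * (a + \<beta>) * Ci)) * \<theta>"
        using \<theta>k u0 S Lam ab Ci(1) by (intro mult_left_mono) auto
      finally show ?thesis by (simp add: mult_ac)
    qed
    have e3: "q' * (Co * r powr (- \<beta>')) \<le> u\<^sub>0 * S * (Lam * a * Co * \<theta>)"
    proof (cases "s \<le> 1/2")
      case True
      then show ?thesis using u0 S Lam ab Co(1) \<theta> by (simp add: q'_def)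
    next
      case False
      have "r powr (- \<beta>') = r * S"
      proof -
        have "r * S = r powr 1 * S" using r by simp
        also have "\<dots> = r powr (- \<beta>')" using False by (simp only: S_def powr_add[symmetric]) (simp add: \<beta>'_def)
        finally show ?thesis ..
      qed
      then show ?thesis using False d by (simp add: q'_def r_def)
    qed
    \<comment> \<open>At s = 1/2 the drift scales like the gain: the gradient is of order 1 / d =
      \<theta> / r, while S = 1 / r.\<close>
    have e4: "- (u\<^sub>0 * S * (Lam * a * \<theta>)) \<le> (if s = 1/2 then b \<bullet> (u\<^sub>0 *\<^sub>R p) else 0)"
    proof (cases "s = 1/2")
      case True
      have Sr: "S = 1 / r" unfolding S_def True using r by (simp add: powr_minus_divide)
      have "\<bar>b \<bullet> p\<bar> \<le> norm b * norm p" by (rule Cauchy_Schwarz_ineq2)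
      also have "\<dots> \<le> Lam * (a / d)" using b True p Lam by (intro mult_mono) auto
      finally have "u\<^sub>0 * \<bar>b \<bullet> p\<bar> \<le> u\<^sub>0 * (Lam * (a / d))" using u0 by (intro mult_left_mono) auto
      also have "\<dots> = u\<^sub>0 * S * (Lam * a * \<theta>)" using dr d r \<theta>(1) by (simp add: Sr field_simps)
      finally have "u\<^sub>0 * \<bar>b \<bullet> p\<bar> \<le> u\<^sub>0 * S * (Lam * a * \<theta>)" .
      moreover have "- (u\<^sub>0 * \<bar>b \<bullet> p\<bar>) \<le> u\<^sub>0 * (b \<bullet> p)" using u0 mult_left_mono[of "- \<bar>b \<bullet> p\<bar>" "b \<bullet> p" "u\<^sub>0"] by simp
      ultimately show ?thesis using True by simp
    next
      case False
      then show ?thesis using u0 S Lam ab \<theta> by (simp add: mult_nonneg_nonneg)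
    qed
    have sumc: "u\<^sub>0 * S * (Lam * (a + \<beta>) * Ci * \<theta>) + u\<^sub>0 * S * (Lam * a * Co * \<theta>) + u\<^sub>0 * S * (Lam * a * \<theta>) \<le> u\<^sub>0 * S * (lam * \<omega> / 16)"
    proof -
      have "u\<^sub>0 * S * (c1 * \<theta>) \<le> u\<^sub>0 * S * (lam * \<omega> / 16)" using \<theta>c u0 S by (intro mult_left_mono) auto
      then show ?thesis by (simp add: c1_def algebra_simps)
    qed
    have opC: "integral\<^sup>L lborel F + (if s = 1/2 then b \<bullet> (u\<^sub>0 *\<^sub>R p) else 0) \<le> C\<^sub>0"
      using op opF unfolding f_def by simp
    show "u\<^sub>0 * d ^ DIM('a) \<le> A * (N + C\<^sub>0)"
    proof (cases "u\<^sub>0 * d ^ n \<le> A * N")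
      case True
      then show ?thesis using A0 C0 by (simp add: n_def distrib_left add_increasing2)
    next
      case False
      \<comment> \<open>Multiplying the failed bound by the kernel size turns r^n into S and
        compares the norm term with the gain.\<close>
      have "Q * N \<le> u\<^sub>0 * S * (lam * \<omega> / 16)"
      proof -
        have "32 * Lam * W * N \<le> A * (\<theta> ^ n * lam * \<omega>) * N" by (intro mult_right_mono A1 N0)
        also have "\<dots> = (A * N) * (\<theta> ^ n * lam * \<omega>)" by simp
        also have "\<dots> \<le> (u\<^sub>0 * d ^ n) * (\<theta> ^ n * lam * \<omega>)"
          using False \<theta> lam \<omega> by (intro mult_right_mono) auto
        finally have "32 * Lam * W * N \<le> u\<^sub>0 * r ^ n * (lam * \<omega>)" by (simp add: r_def power_mult_distrib mult_ac)
        then have "R * (32 * Lam * W * N) \<le> R * (u\<^sub>0 * r ^ n * (lam * \<omega>))" using R by (intro mult_left_mono) auto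
        then show ?thesis by (simp add: Q_def Rn[symmetric] mult_ac)
      qed
      with lowF e1 e2 e3 e4 sumc opC have "u\<^sub>0 * S * (lam * \<omega> / 4) \<le> C\<^sub>0 + 2 * (u\<^sub>0 * S * (lam * \<omega> / 16))"
        by linarith
      then have "u\<^sub>0 * S * (lam * \<omega> / 8) \<le> C\<^sub>0" by (simp add: field_simps)
      moreover have "u\<^sub>0 * 1 * (lam * \<omega> / 8) \<le> u\<^sub>0 * S * (lam * \<omega> / 8)"
        using S u0 lam \<omega> by (intro mult_right_mono mult_left_mono) auto
      ultimately have "u\<^sub>0 * 1 * (lam * \<omega> / 8) \<le> C\<^sub>0" by (rule order_trans[rotated])
      then have "u\<^sub>0 \<le> 8 / (lam * \<omega>) * C\<^sub>0" using lam \<omega> by (simp add: field_simps)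
      also have "\<dots> \<le> A * C\<^sub>0" by (intro mult_right_mono A2 C0)
      finally have "u\<^sub>0 \<le> A * C\<^sub>0" .
      moreover have "u\<^sub>0 * d ^ n \<le> u\<^sub>0 * 1" using u0 d by (intro mult_left_mono power_le_one) auto
      moreover have "0 \<le> A * N" using A0 N0 by simp
      ultimately show ?thesis by (simp add: n_def distrib_left)
    qed
  qed
qed

section \<open>Smooth bump functions\<close>

text \<open>For k = 0 the classical smooth function that is flat at 0. Division by powers of t makes
  the family closed under differentiation up to linear combinations.\<close>

definition flat_exp :: "nat \<Rightarrow> real \<Rightarrow> real" where
  "flat_exp k t = (if t > 0 then exp (- (1 / t)) / t ^ k else 0)"

text \<open>A single term of the exponential series gives exp(1/t) at least (1/t)^(k+1) / (k+1)!.
  Linear decay at 0, for every k, is all that differentiability there asks for.\<close>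

lemma flat_exp_le: "\<bar>flat_exp k t\<bar> \<le> fact (Suc k) * \<bar>t\<bar>"
proof (cases "t > 0")
  case True
  have "(\<Sum>n\<in>{Suc k}. (1 / t) ^ n /\<^sub>R fact n) \<le> (\<Sum>n. (1 / t) ^ n /\<^sub>R fact n)"
    using True by (intro sum_le_suminf summable_exp_generic) auto
  then have "(1 / t) ^ Suc k / fact (Suc k) \<le> exp (1 / t)"
    by (simp add: exp_def divide_inverse mult.commute)
  then have "(1 / t) ^ Suc k \<le> fact (Suc k) * exp (1 / t)"
    by (simp only: pos_divide_le_eq[OF fact_gt_zero] mult.commute)
  then have "(exp (- (1 / t)) * t) * (1 / t) ^ Suc k \<le> (exp (- (1 / t)) * t) * (fact (Suc k) * exp (1 / t))"
    using True by (intro mult_left_mono) auto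
  also have "\<dots> = fact (Suc k) * t * (exp (- (1 / t)) * exp (1 / t))" by (simp only: mult_ac)
  also have "exp (- (1 / t)) * exp (1 / t) = 1" by (simp flip: exp_add)
  also have "(exp (- (1 / t)) * t) * (1 / t) ^ Suc k = exp (- (1 / t)) / t ^ k"
    using True by (simp add: power_one_over divide_simps)
  finally have "exp (- (1 / t)) / t ^ k \<le> fact (Suc k) * t" by simp
  then show ?thesis using True by (simp add: flat_exp_def)
next
  case False
  have "0 \<le> fact (Suc k) * \<bar>t\<bar>" by (intro mult_nonneg_nonneg) auto
  then show ?thesis using False by (simp only: flat_exp_def if_False abs_zero)
qed

lemma flat_exp_has_derivative:
  "(flat_exp k has_real_derivative (flat_exp (k + 2) t - real k * flat_exp (k + 1) t)) (at t)"
proof -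
  consider "t > 0" | "t < 0" | "t = 0" by linarith
  then show ?thesis
  proof cases
    case 1
    have "((\<lambda>t. exp (- (1 / t)) / t ^ k) has_real_derivative (flat_exp (k + 2) t - real k * flat_exp (k + 1) t)) (at t)"
      using 1 by (auto intro!: derivative_eq_intros simp: flat_exp_def field_simps power2_eq_square) (cases k; simp add: field_simps)
    then show ?thesis
      by (rule DERIV_cong_ev[THEN iffD1, rotated -1, OF _ refl _ refl])
         (use 1 in \<open>auto simp: flat_exp_def eventually_nhds intro!: exI[of _ "{0<..}"]\<close>)
  next
    case 2
    have "((\<lambda>t. 0) has_real_derivative 0) (at t)" by simp
    then have "(flat_exp k has_real_derivative 0) (at t)"
      by (rule DERIV_cong_ev[THEN iffD1, rotated -1, OF _ refl _ refl])
         (use 2 in \<open>auto simp: flat_exp_def eventually_nhds intro!: exI[of _ "{..<0}"]\<close>)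
    then show ?thesis using 2 by (simp add: flat_exp_def)
  next
    case 3
    \<comment> \<open>The difference quotient at 0 is the next member of the family, which tends to
      0 linearly.\<close>
    have "((\<lambda>h. (flat_exp k (0 + h) - flat_exp k 0) / h) \<longlongrightarrow> 0) (at 0)"
    proof (rule Lim_null_comparison)
      show "((\<lambda>h. fact (Suc (Suc k)) * \<bar>h\<bar>) \<longlongrightarrow> 0) (at (0::real))"
        by (auto intro!: tendsto_eq_intros)
      show "\<forall>\<^sub>F h in at 0. norm ((flat_exp k (0 + h) - flat_exp k 0) / h) \<le> fact (Suc (Suc k)) * \<bar>h\<bar>"
      proof (intro always_eventually allI)
        fix h :: real
        have "(flat_exp k (0 + h) - flat_exp k 0) / h = flat_exp (Suc k) h"
          by (simp add: flat_exp_def)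
        then show "norm ((flat_exp k (0 + h) - flat_exp k 0) / h) \<le> fact (Suc (Suc k)) * \<bar>h\<bar>"
          using flat_exp_le[of "Suc k" h] by simp
      qed
    qed
    then show ?thesis using 3 by (simp add: DERIV_def flat_exp_def)
  qed
qed

text \<open>Closed under directional derivatives, so all members are smooth.\<close>

inductive elementary :: "('a::euclidean_space \<Rightarrow> real) \<Rightarrow> bool" where
  const: "elementary (\<lambda>_. c)"
| inner: "elementary (\<lambda>x. x \<bullet> v)"
| add: "elementary f \<Longrightarrow> elementary g \<Longrightarrow> elementary (\<lambda>x. f x + g x)"
| mult: "elementary f \<Longrightarrow> elementary g \<Longrightarrow> elementary (\<lambda>x. f x * g x)"
| flat: "elementary f \<Longrightarrow> elementary (\<lambda>x. flat_exp k (f x))"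

lemma elementary_derivative:
  assumes "elementary f"
  shows "\<exists>D. (\<forall>x. (f has_derivative D x) (at x)) \<and> (\<forall>v. elementary (\<lambda>x. D x v))"
  using assms
proof induction
  case (const c)
  then show ?case by (intro exI[of _ "\<lambda>_ _. 0"]) (auto intro: elementary.const)
next
  case (inner v)
  show ?case
  proof (intro exI[of _ "\<lambda>_ h. h \<bullet> v"] conjI allI)
    show "((\<lambda>x. x \<bullet> v) has_derivative (\<lambda>h. h \<bullet> v)) (at x)" for x
      by (auto intro!: derivative_eq_intros)
  qed (rule elementary.const)
next
  case (add f g)
  then obtain D E where D: "\<And>x. (f has_derivative D x) (at x)" "\<And>v. elementary (\<lambda>x. D x v)"
    and E: "\<And>x. (g has_derivative E x) (at x)" "\<And>v. elementary (\<lambda>x. E x v)" by blast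
  show ?case
    by (intro exI[of _ "\<lambda>x v. D x v + E x v"] conjI allI has_derivative_add D E elementary.add)
next
  case (mult f g)
  then obtain D E where D: "\<And>x. (f has_derivative D x) (at x)" "\<And>v. elementary (\<lambda>x. D x v)"
    and E: "\<And>x. (g has_derivative E x) (at x)" "\<And>v. elementary (\<lambda>x. E x v)" by blast
  show ?case
    using mult.hyps
    by (intro exI[of _ "\<lambda>x v. f x * E x v + D x v * g x"] conjI allI has_derivative_mult D E
      elementary.add elementary.mult)
next
  case (flat f k)
  then obtain D where D: "\<And>x. (f has_derivative D x) (at x)" "\<And>v. elementary (\<lambda>x. D x v)" by blast
  let ?e = "\<lambda>x. flat_exp (k + 2) (f x) + (- real k) * flat_exp (k + 1) (f x)"
  show ?case
  proof (intro exI[of _ "\<lambda>x v. ?e x * D x v"] conjI allI)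
    fix x
    have "((\<lambda>x. flat_exp k (f x)) has_derivative (\<lambda>v. D x v * (flat_exp (k + 2) (f x) - real k * flat_exp (k + 1) (f x)))) (at x)"
      by (rule DERIV_compose_FDERIV[OF flat_exp_has_derivative D(1)])
    then show "((\<lambda>x. flat_exp k (f x)) has_derivative (\<lambda>v. ?e x * D x v)) (at x)"
      by (simp add: mult.commute)
  next
    fix v
    show "elementary (\<lambda>x. ?e x * D x v)"
      using flat.hyps D(2) by (intro elementary.mult elementary.add elementary.flat elementary.const)
  qed
qed

lemma elementary_C_k_on: "elementary f \<Longrightarrow> C_k_on k S f"
proof (induction k arbitrary: f)
  case 0
  obtain D where "\<And>x. (f has_derivative D x) (at x)" using elementary_derivative[OF 0] by blast
  then show ?case
    by (auto intro!: continuous_at_imp_continuous_on has_derivative_continuous)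
next
  case (Suc k)
  obtain D where D: "\<And>x. (f has_derivative D x) (at x)" "\<And>v. elementary (\<lambda>x. D x v)"
    using elementary_derivative[OF Suc.prems] by blast
  have "frechet_derivative f (at x) = D x" for x
    using frechet_derivative_at[OF D(1)] by simp
  then show ?case using D Suc.IH by (auto simp: differentiable_def)
qed

lemma elementary_prod: "finite I \<Longrightarrow> (\<And>i. i \<in> I \<Longrightarrow> elementary (f i)) \<Longrightarrow> elementary (\<lambda>x. \<Prod>i\<in>I. f i x)"
  by (induction I rule: finite_induct) (auto intro: elementary.const elementary.mult)

text \<open>\<open>flat_exp 0\<close> vanishes on the negative half-line and tends to 1 at infinity,
  so stretching its argument by j + 1 makes the product converge to the indicator of the box. Boxes
  are used because the differentiation theorem is applied to cubes with a corner at the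
  point.\<close>

definition box_bump :: "nat \<Rightarrow> 'a::euclidean_space \<Rightarrow> 'a \<Rightarrow> 'a \<Rightarrow> real" where
  "box_bump j l u x = (\<Prod>i\<in>Basis. flat_exp 0 (real (Suc j) * (x \<bullet> i - l \<bullet> i)) * flat_exp 0 (real (Suc j) * (u \<bullet> i - x \<bullet> i)))"

lemma elementary_box_bump: "elementary (\<lambda>x. box_bump j l u (x - c))"
proof -
  have "elementary (\<lambda>x. \<Prod>i\<in>Basis. flat_exp 0 (real (Suc j) * (x \<bullet> i + - ((l + c) \<bullet> i))) *
      flat_exp 0 (real (Suc j) * ((u + c) \<bullet> i + (-1) * (x \<bullet> i))))"
    by (intro elementary_prod elementary.intros) auto
  then show ?thesis by (simp add: box_bump_def inner_diff_left inner_add_left algebra_simps)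
qed

lemma flat_exp_0_bounds: "0 \<le> flat_exp 0 t" "flat_exp 0 t \<le> 1"
  by (auto simp: flat_exp_def)

lemma box_bump_nonneg: "0 \<le> box_bump j l u x"
  unfolding box_bump_def by (intro prod_nonneg ballI mult_nonneg_nonneg flat_exp_0_bounds)

lemma box_bump_le_1: "box_bump j l u x \<le> 1"
  unfolding box_bump_def by (intro prod_le_1 conjI mult_nonneg_nonneg mult_le_one flat_exp_0_bounds)

lemma box_bump_outside:
  assumes "x \<notin> box l u"
  shows "box_bump j l u x = 0"
proof -
  obtain i where i: "i \<in> Basis" "\<not> (l \<bullet> i < x \<bullet> i \<and> x \<bullet> i < u \<bullet> i)" using assms by (auto simp: mem_box)
  then have "\<not> 0 < real (Suc j) * (x \<bullet> i - l \<bullet> i) \<or> \<not> 0 < real (Suc j) * (u \<bullet> i - x \<bullet> i)"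
    by (auto simp: zero_less_mult_iff)
  then have "flat_exp 0 (real (Suc j) * (x \<bullet> i - l \<bullet> i)) * flat_exp 0 (real (Suc j) * (u \<bullet> i - x \<bullet> i)) = 0"
    by (auto simp: flat_exp_def simp del: of_nat_Suc)
  then show ?thesis unfolding box_bump_def using i(1) by (intro prod_zero) auto
qed

lemma box_bump_tendsto: "(\<lambda>j. box_bump j l u x) \<longlonglongrightarrow> indicator (box l u) x"
proof (cases "x \<in> box l u")
  case True
  have fl: "(\<lambda>j. flat_exp 0 (real (Suc j) * t)) \<longlonglongrightarrow> 1" if t: "0 < t" for t
  proof -
    have "(\<lambda>j. inverse (real (Suc j)) * (1 / t)) \<longlonglongrightarrow> 0 * (1 / t)"
      by (intro tendsto_mult LIMSEQ_inverse_real_of_nat tendsto_const)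
    then have "(\<lambda>j. exp (- (inverse (real (Suc j)) * (1 / t)))) \<longlonglongrightarrow> exp (- 0)"
      by (intro tendsto_exp tendsto_minus) simp
    then show ?thesis using t by (simp add: flat_exp_def inverse_eq_divide del: of_nat_Suc)
  qed
  have "(\<lambda>j. box_bump j l u x) \<longlonglongrightarrow> (\<Prod>i\<in>(Basis::'a set). 1 * 1)"
    unfolding box_bump_def
    using True by (intro tendsto_prod tendsto_mult fl) (auto simp: mem_box)
  then show ?thesis using True by simp
qed (simp add: box_bump_outside)

text \<open>Derivatives vanish outside the ball of radius R and are continuous, so compactness
  bounds them globally. The quadratic remainder is thus uniform in the base point.\<close>

lemma C2_taylor_bounds:
  fixes \<eta> :: "'a::euclidean_space \<Rightarrow> real"
  assumes C2: "C_k_on 2 UNIV \<eta>" and supp: "\<And>x. R \<le> norm x \<Longrightarrow> \<eta> x = 0"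
  obtains G C where "0 \<le> C" "\<And>x. (\<eta> has_derivative (\<lambda>h. G x \<bullet> h)) (at x)" "continuous_on UNIV G"
    "\<And>x. \<bar>\<eta> x\<bar> \<le> C" "\<And>x. norm (G x) \<le> C" "\<And>x y. \<bar>\<eta> (x + y) - \<eta> x - G x \<bullet> y\<bar> \<le> C * (norm y)\<^sup>2"
    "\<And>x. R < norm x \<Longrightarrow> G x = 0"
proof -
  define D where "D i x = frechet_derivative \<eta> (at x) i" for i x
  define G where "G x = (\<Sum>i\<in>Basis. D i x *\<^sub>R i)" for x
  have C1: "\<eta> differentiable (at x)" "C_k_on 1 UNIV (D v)" for x v
    using C2 by (auto simp: numeral_2_eq_2 D_def[abs_def])
  have C0: "D v differentiable (at x)" "continuous_on UNIV (\<lambda>x. frechet_derivative (D v) (at x) w)" for x v w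
    using C1(2)[of v] by auto
  have fd: "(\<eta> has_derivative (\<lambda>h. G x \<bullet> h)) (at x)" for x
  proof -
    have h: "(\<eta> has_derivative frechet_derivative \<eta> (at x)) (at x)"
      using C1(1) frechet_derivative_works by blast
    interpret bounded_linear "frechet_derivative \<eta> (at x)" by (rule has_derivative_bounded_linear[OF h])
    have "frechet_derivative \<eta> (at x) v = G x \<bullet> v" for v
    proof -
      have "frechet_derivative \<eta> (at x) v = frechet_derivative \<eta> (at x) (\<Sum>i\<in>Basis. (v \<bullet> i) *\<^sub>R i)"
        by (simp add: euclidean_representation)
      also have "\<dots> = (\<Sum>i\<in>Basis. (v \<bullet> i) * D i x)" by (simp add: sum scaleR D_def)
      also have "\<dots> = G x \<bullet> v" by (simp add: G_def inner_sum_left inner_commute[of v] mult.commute)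
      finally show ?thesis .
    qed
    then have "frechet_derivative \<eta> (at x) = (\<lambda>h. G x \<bullet> h)" by auto
    then show ?thesis using h by simp
  qed
  have Dcont: "continuous_on UNIV (D v)" for v
    using C0(1)[of v] by (intro differentiable_imp_continuous_on) (auto simp: differentiable_on_def intro: differentiable_at_withinI)
  have Gcont: "continuous_on UNIV G" unfolding G_def by (intro continuous_intros Dcont)
  have out: "open {x::'a. R < norm x}" by (intro open_Collect_less continuous_intros)
  have zero_out: "frechet_derivative f (at x) w = 0" if "\<And>y. R < norm y \<Longrightarrow> f y = 0" "R < norm x" for f :: "'a \<Rightarrow> real" and x w
  proof -
    have "((\<lambda>_. 0) has_derivative (\<lambda>_. 0)) (at x)" by simp
    then have "(f has_derivative (\<lambda>_. 0)) (at x)"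
      by (rule has_derivative_transform_within_open[OF _ out]) (use that in auto)
    then show ?thesis using frechet_derivative_at by metis
  qed
  have D_out: "D v x = 0" if "R < norm x" for v x
    unfolding D_def by (rule zero_out) (use supp that in auto)
  have bdd: "\<exists>B\<ge>0. \<forall>x. \<bar>f x\<bar> \<le> B" if "continuous_on UNIV f" "\<And>x. R < norm x \<Longrightarrow> f x = 0" for f :: "'a \<Rightarrow> real"
  proof -
    have cpt: "compact (f ` cball 0 R)" using that(1) by (intro compact_continuous_image) (auto intro: continuous_on_subset)
    obtain B where "\<forall>y\<in>f ` cball 0 R. norm y \<le> B"
      using compact_imp_bounded[OF cpt, unfolded bounded_iff] by (rule exE)
    then have B: "norm x \<le> R \<Longrightarrow> \<bar>f x\<bar> \<le> B" for x by auto
    have "\<bar>f x\<bar> \<le> max B 0" for x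
      using B[of x] that(2)[of x] by (cases "norm x \<le> R") auto
    then show ?thesis by (intro exI[of _ "max B 0"]) auto
  qed
  have \<eta>cont: "continuous_on UNIV \<eta>"
    using fd by (auto intro!: continuous_at_imp_continuous_on has_derivative_continuous)
  obtain B0 where B0: "0 \<le> B0" "\<And>x. \<bar>\<eta> x\<bar> \<le> B0" using bdd[OF \<eta>cont] supp by force
  have "\<exists>B. \<forall>i. 0 \<le> B i \<and> (\<forall>x. \<bar>D i x\<bar> \<le> B i)"
    using bdd[OF Dcont D_out] by (intro choice allI) blast
  then obtain B1 where B1: "\<And>i. 0 \<le> B1 i" "\<And>i x. \<bar>D i x\<bar> \<le> B1 i" by blast
  have "\<exists>B. \<forall>ij. 0 \<le> B ij \<and> (\<forall>x. \<bar>frechet_derivative (D (fst ij)) (at x) (snd ij)\<bar> \<le> B ij)"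
    using bdd[OF C0(2) zero_out[OF D_out]] by (intro choice allI) blast
  then obtain B2 where B2: "\<And>ij. 0 \<le> B2 ij" "\<And>ij x. \<bar>frechet_derivative (D (fst ij)) (at x) (snd ij)\<bar> \<le> B2 ij" by blast
  define L1 where "L1 = (\<Sum>i\<in>(Basis::'a set). B1 i)"
  define L2 where "L2 = (\<Sum>i\<in>(Basis::'a set). \<Sum>j\<in>(Basis::'a set). B2 (i, j))"
  have L: "0 \<le> L1" "0 \<le> L2" unfolding L1_def L2_def using B1 B2 by (auto intro!: sum_nonneg)
  have GL1: "norm (G x) \<le> L1" for x
    unfolding G_def L1_def by (rule sum_norm_le) (use B1 in auto)
  have DL: "\<bar>D i y - D i x\<bar> \<le> (\<Sum>j\<in>Basis. B2 (i, j)) * norm (y - x)" for i x y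
  proof -
    have "norm (D i y - D i x) \<le> (\<Sum>j\<in>Basis. B2 (i, j)) * norm (y - x)"
    proof (rule differentiable_bound[of UNIV "D i" "\<lambda>z. frechet_derivative (D i) (at z)"])
      fix z
      have h: "(D i has_derivative frechet_derivative (D i) (at z)) (at z)"
        using C0(1) frechet_derivative_works by blast
      then show "(D i has_derivative frechet_derivative (D i) (at z)) (at z within UNIV)" by simp
      interpret bounded_linear "frechet_derivative (D i) (at z)" by (rule has_derivative_bounded_linear[OF h])
      show "onorm (frechet_derivative (D i) (at z)) \<le> (\<Sum>j\<in>Basis. B2 (i, j))"
      proof (rule onorm_bound)
        fix v :: 'a
        have "frechet_derivative (D i) (at z) v = frechet_derivative (D i) (at z) (\<Sum>j\<in>Basis. (v \<bullet> j) *\<^sub>R j)"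
          by (simp add: euclidean_representation)
        also have "\<dots> = (\<Sum>j\<in>Basis. (v \<bullet> j) * frechet_derivative (D i) (at z) j)" by (simp add: sum scaleR)
        also have "norm \<dots> \<le> (\<Sum>j\<in>Basis. B2 (i, j) * norm v)"
        proof (rule sum_norm_le)
          fix j :: 'a assume j: "j \<in> Basis"
          have "\<bar>v \<bullet> j\<bar> * \<bar>frechet_derivative (D i) (at z) j\<bar> \<le> norm v * B2 (i, j)"
            using B2(2)[of "(i, j)" z] Basis_le_norm[OF j, of v] by (intro mult_mono) auto
          then show "norm (v \<bullet> j * frechet_derivative (D i) (at z) j) \<le> B2 (i, j) * norm v" by (simp add: abs_mult mult.commute)
        qed
        finally show "norm (frechet_derivative (D i) (at z) v) \<le> (\<Sum>j\<in>Basis. B2 (i, j)) * norm v" by (simp add: sum_distrib_right)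
      qed (use B2 in \<open>auto intro!: sum_nonneg\<close>)
    qed auto
    then show ?thesis by simp
  qed
  have GL2: "norm (G y - G x) \<le> L2 * norm (y - x)" for x y
  proof -
    have "G y - G x = (\<Sum>i\<in>Basis. (D i y - D i x) *\<^sub>R i)" by (simp add: G_def sum_subtractf scaleR_diff_left)
    also have "norm \<dots> \<le> (\<Sum>i\<in>Basis. (\<Sum>j\<in>Basis. B2 (i, j)) * norm (y - x))"
      by (rule sum_norm_le) (use DL in simp)
    finally show ?thesis by (simp add: L2_def sum_distrib_right)
  qed
  have taylor: "\<bar>\<eta> (x + y) - \<eta> x - G x \<bullet> y\<bar> \<le> L2 * (norm y)\<^sup>2" for x y
  proof -
    \<comment> \<open>After subtracting the linear part at x, the gradient on the ball of radius |y|
      about x is at most \<open>L2 * norm y\<close>; the mean value inequality yields the second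
      factor |y|.\<close>
    define g where "g z = \<eta> z - G x \<bullet> z" for z
    have "norm (g (x + y) - g x) \<le> (L2 * norm y) * norm ((x + y) - x)"
    proof (rule differentiable_bound[of "cball x (norm y)" g "\<lambda>z h. (G z - G x) \<bullet> h"])
      fix z assume z: "z \<in> cball x (norm y)"
      show "(g has_derivative (\<lambda>h. (G z - G x) \<bullet> h)) (at z within cball x (norm y))"
        unfolding g_def[abs_def] using has_derivative_at_withinI[OF fd[of z]]
        by (auto intro!: derivative_eq_intros simp: inner_diff_left)
      show "onorm (\<lambda>h. (G z - G x) \<bullet> h) \<le> L2 * norm y"
      proof (rule onorm_bound)
        fix h
        have "\<bar>(G z - G x) \<bullet> h\<bar> \<le> norm (G z - G x) * norm h" by (rule Cauchy_Schwarz_ineq2)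
        also have "norm (G z - G x) \<le> L2 * norm (z - x)" by (rule GL2)
        also have "\<dots> \<le> L2 * norm y" using z L by (intro mult_left_mono) (auto simp: dist_norm norm_minus_commute)
        finally show "norm ((G z - G x) \<bullet> h) \<le> L2 * norm y * norm h" by (simp add: mult_right_mono)
      qed (use L in simp)
    qed (auto simp: dist_norm)
    then show ?thesis by (simp add: g_def inner_add_right power2_eq_square algebra_simps)
  qed
  define C where "C = max B0 (max L1 L2)"
  show ?thesis
  proof (rule that[of C G])
    show "0 \<le> C" using B0(1) by (simp add: C_def)
    show "\<bar>\<eta> x\<bar> \<le> C" for x using B0(2)[of x] by (simp add: C_def)
    show "norm (G x) \<le> C" for x using GL1[of x] by (simp add: C_def)
    show "\<bar>\<eta> (x + y) - \<eta> x - G x \<bullet> y\<bar> \<le> C * (norm y)\<^sup>2" for x y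
    proof -
      have "L2 * (norm y)\<^sup>2 \<le> C * (norm y)\<^sup>2" by (intro mult_right_mono) (auto simp: C_def)
      then show ?thesis using taylor[of x y] by linarith
    qed
    show "G x = 0" if "R < norm x" for x using D_out[OF that] by (simp add: G_def)
  qed (fact fd Gcont)+
qed

section \<open>The barrier\<close>

text \<open>Otherwise every point x has a better point f x, and by semicontinuity h stays below h (f
  x) near x. Finitely many of these neighbourhoods cover S, and the largest of the finitely many
  values h (f x) is then beaten by one of them.\<close>

lemma usc_attains_sup:
  fixes h :: "'a::topological_space \<Rightarrow> real"
  assumes S: "compact S" "S \<noteq> {}"
    and usc: "\<And>x a. x \<in> S \<Longrightarrow> h x < a \<Longrightarrow> \<forall>\<^sub>F z in nhds x. z \<in> S \<longrightarrow> h z < a"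
  shows "\<exists>x\<in>S. \<forall>y\<in>S. h y \<le> h x"
proof (rule ccontr)
  assume "\<not> ?thesis"
  then have "\<forall>x\<in>S. \<exists>y\<in>S. h x < h y" by (auto simp: not_le)
  then obtain f where f: "\<And>x. x \<in> S \<Longrightarrow> f x \<in> S" "\<And>x. x \<in> S \<Longrightarrow> h x < h (f x)" by metis
  have "\<forall>x\<in>S. \<exists>U. open U \<and> x \<in> U \<and> (\<forall>z\<in>U. z \<in> S \<longrightarrow> h z < h (f x))"
    using usc[OF _ f(2)] unfolding eventually_nhds by blast
  then obtain U where U: "\<And>x. x \<in> S \<Longrightarrow> open (U x)" "\<And>x. x \<in> S \<Longrightarrow> x \<in> U x"
    "\<And>x z. x \<in> S \<Longrightarrow> z \<in> U x \<Longrightarrow> z \<in> S \<Longrightarrow> h z < h (f x)" by metis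
  obtain D where D: "D \<subseteq> S" "finite D" "S \<subseteq> (\<Union>x\<in>D. U x)"
  proof (rule compactE_image[OF S(1), of S U])
    show "S \<subseteq> (\<Union>x\<in>S. U x)" using U(2) by blast
  qed (use U(1) in auto)
  have "D \<noteq> {}" using D(3) S(2) by auto
  then have "finite (h ` f ` D)" "h ` f ` D \<noteq> {}" using D(2) by auto
  then have "Max (h ` f ` D) \<in> h ` f ` D" by (rule Max_in)
  then obtain x where x: "x \<in> D" "h (f x) = Max (h ` f ` D)" by auto
  obtain y where y: "y \<in> D" "f x \<in> U y" using D(1,3) f(1) x(1) by blast
  have "h (f x) < h (f y)" using U(3)[of y "f x"] y D(1) f(1) x(1) by blast
  moreover have "h (f y) \<le> h (f x)" unfolding x(2) using D(2) y(1) by (intro Max_ge) auto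
  ultimately show False by simp
qed

text \<open>Bernoulli's inequality reduces the power to 1 - n \<tau>, and the geometric series of n
  \<tau>, which is at most 1/2 in size, is cut after the quadratic term.\<close>

lemma inverse_one_minus_bound:
  fixes \<tau> :: real
  assumes "real n * \<bar>\<tau>\<bar> \<le> 1/2" "0 < n"
  shows "1 / (1 - \<tau>) ^ n \<le> 1 + real n * \<tau> + 2 * (real n * \<tau>)\<^sup>2"
proof -
  have t: "\<bar>\<tau>\<bar> \<le> 1/2"
  proof -
    have "1 * \<bar>\<tau>\<bar> \<le> real n * \<bar>\<tau>\<bar>" using assms by (intro mult_right_mono) auto
    then show ?thesis using assms by simp
  qed
  define x where "x = real n * \<tau>"
  have x: "\<bar>x\<bar> \<le> 1/2" using assms by (simp add: x_def abs_mult)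
  have "1 - x \<le> (1 - \<tau>) ^ n"
    using Bernoulli_inequality[of "- \<tau>" n] t by (simp add: x_def)
  then have "1 / (1 - \<tau>) ^ n \<le> 1 / (1 - x)" using x by (intro divide_left_mono) auto
  also have "\<dots> \<le> 1 + x + 2 * x\<^sup>2"
  proof -
    have "0 \<le> x\<^sup>2 * (1 - 2 * x)" using x by (intro mult_nonneg_nonneg) auto
    then have "1 \<le> (1 + x + 2 * x\<^sup>2) * (1 - x)" by (simp add: algebra_simps power2_eq_square)
    then show ?thesis using x by (simp add: pos_divide_le_eq)
  qed
  finally show ?thesis by (simp add: x_def)
qed

text \<open>Touch \<open>g\<close> from above by a multiple of \<open>(9/16 - |x|\<^sup>2)^(-n)\<close>, and this barrier by a paraboloid.\<close>

lemma barrier_contact_point: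
  fixes g :: "'a::euclidean_space \<Rightarrow> real"
  defines "n \<equiv> real DIM('a)"
  assumes usc: "\<And>x a. norm x \<le> 3/4 \<Longrightarrow> g x < a \<Longrightarrow> \<forall>\<^sub>F z in nhds x. g z < a"
    and x1: "norm x1 < 1/2" "0 < g x1"
  obtains x\<^sub>0 d p where "norm x\<^sub>0 < 3/4" "0 < d" "d \<le> 1" "0 < g x\<^sub>0" "g x1 * (5/16) ^ DIM('a) \<le> g x\<^sub>0 * d ^ DIM('a)"
    "norm p \<le> 2 * n / d" "\<And>y. norm y < 1 / (6 * n) * d \<Longrightarrow> norm (x\<^sub>0 + y) < 3/4"
    "\<And>y. norm y < 1 / (6 * n) * d \<Longrightarrow> g (x\<^sub>0 + y) \<le> g x\<^sub>0 * (1 + p \<bullet> y + 19 * n\<^sup>2 / d\<^sup>2 * (norm y)\<^sup>2)"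
proof -
  have n: "1 \<le> n" by (simp add: n_def Suc_le_eq)
  define \<psi> :: "'a \<Rightarrow> real" where "\<psi> x = 9/16 - (norm x)\<^sup>2" for x
  define h where "h x = g x * \<psi> x ^ DIM('a)" for x
  let ?S = "cball (0::'a) (3/4)"
  have \<psi>0: "0 \<le> \<psi> x" if "x \<in> ?S" for x
    using power_mono[of "norm x" "3/4" 2] that by (simp add: \<psi>_def power2_eq_square)
  have "\<exists>x\<in>?S. \<forall>y\<in>?S. h y \<le> h x"
  proof (rule usc_attains_sup)
    fix x a assume x: "x \<in> ?S" and a: "h x < a"
    define k where "k = \<psi> x ^ DIM('a)"
    have k: "0 \<le> k" using \<psi>0[OF x] by (simp add: k_def)
    \<comment> \<open>Half of the gap between h x and a is spent on raising g. The 1 in the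
      denominator covers boundary points, where the barrier factor k is 0.\<close>
    define e where "e = (a - h x) / (2 * (k + 1))"
    define a' where "a' = g x + e"
    have "g x < a'" using a k by (simp add: a'_def e_def)
    then have 1: "\<forall>\<^sub>F z in nhds x. g z < a'" by (intro usc) (use x in auto)
    have "a' * k < a"
    proof -
      have "e * k \<le> (a - h x) / 2"
        using a k by (simp add: e_def field_simps)
      moreover have "a' * k = h x + e * k"
        by (simp only: a'_def h_def k_def distrib_right)
      ultimately have "a' * k \<le> h x + (a - h x) / 2" by simp
      also have "\<dots> < a" using a by (simp add: field_simps)
      finally show ?thesis .
    qed
    moreover have "((\<lambda>z. a' * \<psi> z ^ DIM('a)) \<longlongrightarrow> a' * \<psi> x ^ DIM('a)) (nhds x)"
      unfolding \<psi>_def by (intro tendsto_intros filterlim_ident)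
    ultimately have 2: "\<forall>\<^sub>F z in nhds x. a' * \<psi> z ^ DIM('a) < a"
      by (intro order_tendstoD(2)) (auto simp: k_def)
    show "\<forall>\<^sub>F z in nhds x. z \<in> ?S \<longrightarrow> h z < a"
      using 1 2
    proof eventually_elim
      case (elim z)
      show ?case
      proof
        assume "z \<in> ?S"
        then have "h z \<le> a' * \<psi> z ^ DIM('a)" unfolding h_def using \<psi>0 elim(1) by (intro mult_right_mono) auto
        then show "h z < a" using elim(2) by simp
      qed
    qed
  qed auto
  then obtain x\<^sub>0 where x0: "x\<^sub>0 \<in> ?S" and hmax: "\<And>y. y \<in> ?S \<Longrightarrow> h y \<le> h x\<^sub>0" by blast
  define d where "d = \<psi> x\<^sub>0"
  \<comment> \<open>5/16 = 9/16 - 1/4, the least value of \<psi> on the ball of radius 1/2.\<close>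
  have \<psi>1: "5/16 \<le> \<psi> x1" using power_mono[of "norm x1" "1/2" 2] x1 by (simp add: \<psi>_def power2_eq_square)
  have "g x1 * (5/16) ^ DIM('a) \<le> h x1" unfolding h_def using \<psi>1 x1 by (intro mult_left_mono power_mono) auto
  also have "\<dots> \<le> h x\<^sub>0" using x1 by (intro hmax) auto
  finally have main: "g x1 * (5/16) ^ DIM('a) \<le> g x\<^sub>0 * d ^ DIM('a)" by (simp add: h_def d_def)
  have "0 < g x1 * (5/16) ^ DIM('a)" using x1 by simp
  with main have pos: "0 < g x\<^sub>0 * d ^ DIM('a)" by linarith
  have d0: "0 \<le> d" using \<psi>0[OF x0] by (simp add: d_def)
  then have d: "0 < d" using pos by (cases "d = 0") (auto simp: zero_power)
  have g0: "0 < g x\<^sub>0" using pos d by (simp add: zero_less_mult_iff)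
  have d1: "d \<le> 1" unfolding d_def \<psi>_def using zero_le_power2[of "norm x\<^sub>0"] by linarith
  have nx0: "norm x\<^sub>0 < 3/4"
  proof (rule ccontr)
    assume "\<not> ?thesis"
    then have "norm x\<^sub>0 = 3/4" using x0 by simp
    then have "(norm x\<^sub>0)\<^sup>2 = (3/4)\<^sup>2" by (rule arg_cong)
    then have "d = 0" unfolding d_def \<psi>_def by (simp add: power_divide)
    then show False using d by simp
  qed
  \<comment> \<open>The logarithmic gradient of the barrier \<psi>^(-n) at the contact
    point.\<close>
  define p where "p = (2 * n / d) *\<^sub>R x\<^sub>0"
  have key: "norm (x\<^sub>0 + y) < 3/4 \<and> g (x\<^sub>0 + y) \<le> g x\<^sub>0 * (1 + p \<bullet> y + 19 * n\<^sup>2 / d\<^sup>2 * (norm y)\<^sup>2)"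
    if y: "norm y < 1 / (6 * n) * d" for y
  proof -
    have ny: "6 * n * norm y < d" using y n by (simp add: field_simps)
    have yd: "norm y \<le> 1"
    proof -
      have "1 * norm y \<le> 6 * n * norm y" using n by (intro mult_right_mono) auto
      then show ?thesis using ny d1 by simp
    qed
    \<comment> \<open>The relative decrease of \<psi> from the contact point to x0 + y. The radius d
      / (6 n) is chosen so that |\<tau>| \<le> 3 |y| / d yields n |\<tau>| \<le> 1/2.\<close>
    define \<tau> where "\<tau> = (2 * (x\<^sub>0 \<bullet> y) + (norm y)\<^sup>2) / d"
    have psi: "\<psi> (x\<^sub>0 + y) = d * (1 - \<tau>)"
      using d by (simp add: \<psi>_def d_def[symmetric] \<tau>_def right_diff_distrib)
        (simp add: d_def \<psi>_def power2_norm_eq_inner inner_add_left inner_add_right inner_commute)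
    have tb: "\<bar>\<tau>\<bar> \<le> 3 * norm y / d"
    proof -
      have "\<bar>x\<^sub>0 \<bullet> y\<bar> \<le> norm x\<^sub>0 * norm y" by (rule Cauchy_Schwarz_ineq2)
      also have "\<dots> \<le> 1 * norm y" using nx0 by (intro mult_right_mono) auto
      finally have "\<bar>x\<^sub>0 \<bullet> y\<bar> \<le> norm y" by simp
      moreover have "(norm y)\<^sup>2 \<le> norm y" using yd by (simp add: power2_eq_square mult_left_le)
      ultimately have "\<bar>2 * (x\<^sub>0 \<bullet> y) + (norm y)\<^sup>2\<bar> \<le> 3 * norm y" using zero_le_power2[of "norm y"] by linarith
      then show ?thesis using d by (simp add: \<tau>_def divide_right_mono)
    qed
    have nt: "n * \<bar>\<tau>\<bar> \<le> 1/2"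
    proof -
      have "n * \<bar>\<tau>\<bar> \<le> n * (3 * norm y / d)" using tb n by (intro mult_left_mono) auto
      also have "\<dots> \<le> 1/2" using ny d by (simp add: field_simps)
      finally show ?thesis .
    qed
    have "\<bar>\<tau>\<bar> \<le> 1/2"
    proof -
      have "1 * \<bar>\<tau>\<bar> \<le> n * \<bar>\<tau>\<bar>" using n by (intro mult_right_mono) auto
      then show ?thesis using nt by simp
    qed
    then have t1: "0 < 1 - \<tau>" by linarith
    then have psi_pos: "0 < \<psi> (x\<^sub>0 + y)" unfolding psi using d by simp
    then have "(norm (x\<^sub>0 + y))\<^sup>2 < (3/4)\<^sup>2" by (simp add: \<psi>_def power2_eq_square)
    then have in_S: "norm (x\<^sub>0 + y) < 3/4" by (rule power2_less_imp_less) simp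
    have "h (x\<^sub>0 + y) \<le> h x\<^sub>0" using in_S by (intro hmax) auto
    then have "g (x\<^sub>0 + y) * (d ^ DIM('a) * (1 - \<tau>) ^ DIM('a)) \<le> g x\<^sub>0 * d ^ DIM('a)"
      by (simp add: h_def psi power_mult_distrib d_def[symmetric])
    then have "d ^ DIM('a) * (g (x\<^sub>0 + y) * (1 - \<tau>) ^ DIM('a)) \<le> d ^ DIM('a) * g x\<^sub>0" by (simp add: mult_ac)
    then have "g (x\<^sub>0 + y) * (1 - \<tau>) ^ DIM('a) \<le> g x\<^sub>0" using d by (simp add: mult_le_cancel_left_pos)
    then have "g (x\<^sub>0 + y) \<le> g x\<^sub>0 * (1 / (1 - \<tau>) ^ DIM('a))" using t1 by (simp add: field_simps)
    also have "\<dots> \<le> g x\<^sub>0 * (1 + n * \<tau> + 2 * (n * \<tau>)\<^sup>2)"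
      unfolding n_def using g0 nt by (intro mult_left_mono inverse_one_minus_bound) (auto simp: n_def)
    \<comment> \<open>The coefficient 19 = 1 + 18: one from the |y|^2 part of n \<tau>, and 2 * 9
      from the square, by |\<tau>| \<le> 3 |y| / d.\<close>
    also have "\<dots> \<le> g x\<^sub>0 * (1 + p \<bullet> y + 19 * n\<^sup>2 / d\<^sup>2 * (norm y)\<^sup>2)"
    proof (intro mult_left_mono)
      have "n * \<tau> = p \<bullet> y + n * (norm y)\<^sup>2 / d" by (simp add: \<tau>_def p_def add_divide_distrib distrib_left)
      moreover have "n * (norm y)\<^sup>2 / d \<le> n\<^sup>2 / d\<^sup>2 * (norm y)\<^sup>2"
      proof -
        have "n / d \<le> n\<^sup>2 / d\<^sup>2"
        proof -
          have "1 \<le> n / d" using n d d1 by simp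
          then have "(n / d) * 1 \<le> (n / d) * (n / d)" using n d by (intro mult_left_mono) auto
          then show ?thesis by (simp add: power2_eq_square)
        qed
        then have "n / d * (norm y)\<^sup>2 \<le> n\<^sup>2 / d\<^sup>2 * (norm y)\<^sup>2" by (intro mult_right_mono) auto
        then show ?thesis by simp
      qed
      moreover have "2 * (n * \<tau>)\<^sup>2 \<le> 18 * (n\<^sup>2 / d\<^sup>2 * (norm y)\<^sup>2)"
      proof -
        have "n * \<bar>\<tau>\<bar> \<le> n * (3 * norm y / d)" using tb n by (intro mult_left_mono) auto
        then have "(n * \<bar>\<tau>\<bar>)\<^sup>2 \<le> (n * (3 * norm y / d))\<^sup>2" using n by (intro power_mono) auto
        then have "(n * \<tau>)\<^sup>2 \<le> (n * (3 * norm y / d))\<^sup>2" by (simp add: power_mult_distrib)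
        also have "\<dots> = 9 * (n\<^sup>2 / d\<^sup>2 * (norm y)\<^sup>2)" by (simp add: power_mult_distrib power_divide)
        finally show ?thesis by simp
      qed
      moreover have "19 * n\<^sup>2 / d\<^sup>2 * (norm y)\<^sup>2 = n\<^sup>2 / d\<^sup>2 * (norm y)\<^sup>2 + 18 * (n\<^sup>2 / d\<^sup>2 * (norm y)\<^sup>2)" by simp
      moreover have "1 + e + 2 * f \<le> 1 + b + g" if "e = b + c" "c \<le> z" "2 * f \<le> 18 * z" "g = z + 18 * z"
        for b c e f g z :: real using that by linarith
      ultimately show "1 + n * \<tau> + 2 * (n * \<tau>)\<^sup>2 \<le> 1 + p \<bullet> y + 19 * n\<^sup>2 / d\<^sup>2 * (norm y)\<^sup>2" by blast
    qed (use g0 in simp)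
    finally show ?thesis using in_S by simp
  qed
  show ?thesis
  proof (rule that[OF nx0 d d1 g0 main])
    have "norm p = 2 * n / d * norm x\<^sub>0" using n d by (simp add: p_def)
    also have "\<dots> \<le> 2 * n / d * 1" using nx0 n d by (intro mult_left_mono) auto
    finally show "norm p \<le> 2 * n / d" by simp
  qed (use key in auto)
qed

text \<open>Measurability of f is a conclusion: Lebesgue measure is complete, so agreeing almost
  everywhere with a Borel function is enough. Every passage from given data to representatives goes
  through this.\<close>

lemma lebesgue_AE_eq:
  fixes f g :: "'a::euclidean_space \<Rightarrow> 'b::{banach,second_countable_topology}"
  assumes g: "g \<in> borel_measurable borel" and eq: "AE x in lborel. f x = g x"
  shows "f \<in> borel_measurable lebesgue" "integral\<^sup>L lebesgue f = integral\<^sup>L lborel g"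
proof -
  have gl: "g \<in> borel_measurable lebesgue" using g by (intro measurable_completion) simp
  obtain N where N: "N \<in> null_sets lborel" "{x. f x \<noteq> g x} \<subseteq> N"
    using eq by (auto elim!: AE_E simp: null_sets_def)
  show f: "f \<in> borel_measurable lebesgue"
  proof (rule measurableI)
    fix A :: "'b set" assume "A \<in> sets borel"
    then have 1: "g -` A \<in> sets lebesgue" using measurable_sets[OF gl, of A] by simp
    have 2: "f -` A \<inter> N \<in> sets lebesgue" by (rule sets_completionI_sub[OF N(1)]) auto
    have "N \<in> sets lebesgue" using N(1) by auto
    then have "(g -` A - N) \<union> (f -` A \<inter> N) \<in> sets lebesgue" using 1 2 by blast
    moreover have "(g -` A - N) \<union> (f -` A \<inter> N) = f -` A" using N(2) by auto
    ultimately show "f -` A \<inter> space lebesgue \<in> sets lebesgue" by simp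
  qed simp
  have "integral\<^sup>L lebesgue f = integral\<^sup>L lebesgue g"
    by (rule integral_cong_AE[OF f gl]) (use eq in \<open>rule AE_completion\<close>)
  then show "integral\<^sup>L lebesgue f = integral\<^sup>L lborel g" using g by (simp add: integral_completion)
qed

section \<open>Viscosity subsolutions\<close>

lemma lborel_distr_uminus_euclidean: "distr lborel borel uminus = (lborel :: 'a::euclidean_space measure)"
  by (rule lborel_distr_isometry) (auto simp: dist_norm norm_minus_commute)

lemma lborel_integral_reflect:
  fixes f :: "'a::euclidean_space \<Rightarrow> 'b::{banach,second_countable_topology}"
  assumes "f \<in> borel_measurable borel"
  shows "(LINT y|lborel. f (- y)) = (LINT y|lborel. f y)"
proof -
  have "integral\<^sup>L (distr lborel borel uminus) f = (LINT y|lborel. f (- y))"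
    using assms by (intro integral_distr) auto
  then show ?thesis by (simp add: lborel_distr_uminus_euclidean)
qed

lemma AE_lborel_reflect:
  assumes "AE y::'a::euclidean_space in lborel. P y"
  shows "AE y in lborel. P (- y)"
proof -
  have "AE y::'a in distr lborel borel uminus. P y" by (subst lborel_distr_uminus_euclidean) (rule assms)
  then show ?thesis by (rule AE_distrD[rotated]) simp
qed

lemma AE_lborel_translate:
  assumes "AE y::'a::euclidean_space in lborel. P y"
  shows "AE y in lborel. P (c + y)"
proof -
  have "AE y::'a in distr lborel borel ((+) c). P y" by (subst lborel_distr_plus) (rule assms)
  then show ?thesis by (rule AE_distrD[rotated]) simp
qed

text \<open>Integrability on compact annuli includes measurability there, and the annuli exhaust
  everything but the origin, where one value is patched in.\<close>

lemma admissible_measurable: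
  assumes "admissible s Lam K b"
  shows "K \<in> borel_measurable lebesgue"
proof -
  define S where "S k = {y::'a. 1 / real (Suc k) \<le> norm y \<and> norm y \<le> real (Suc k)}" for k
  have S: "compact (S k)" "0 \<notin> S k" for k
  proof -
    have "closed (S k)" unfolding S_def by (intro closed_Collect_conj closed_Collect_le continuous_intros)
    moreover have "S k \<subseteq> cball 0 (real (Suc k))" by (auto simp: S_def)
    ultimately show "compact (S k)" by (meson bounded_cball bounded_subset compact_eq_bounded_closed)
    show "0 \<notin> S k" by (simp add: S_def)
  qed
  have m: "(\<lambda>y. indicator (S k) y *\<^sub>R K y) \<in> borel_measurable lebesgue" for k
  proof -
    have "K absolutely_integrable_on (S k)" using assms S[of k] by (auto simp: admissible_def)
    then show ?thesis by (simp add: set_integrable_def borel_measurable_integrable)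
  qed
  have lim: "(\<lambda>k. indicator (S k) y *\<^sub>R K y) \<longlonglongrightarrow> (if y = 0 then 0 else K y)" for y
  proof (cases "y = 0")
    case True then show ?thesis using S(2) by simp
  next
    case False
    obtain a where a: "norm y \<le> real a" using real_arch_simple by blast
    obtain c where c: "inverse (real (Suc c)) < norm y" using reals_Archimedean[of "norm y"] False by auto
    have "indicator (S k) y *\<^sub>R K y = K y" if k: "max a c \<le> k" for k
    proof -
      have "1 / real (Suc k) \<le> inverse (real (Suc c))" using k by (simp add: inverse_eq_divide frac_le)
      then have "y \<in> S k" using a c k by (auto simp: S_def)
      then show ?thesis by simp
    qed
    then show ?thesis using False
      by (intro tendsto_eventually eventually_sequentiallyI[of "max a c"]) auto
  qed
  have "(\<lambda>y. if y = 0 then 0 else K y) \<in> borel_measurable lebesgue"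
    by (rule borel_measurable_LIMSEQ_metric[OF m lim])
  then have "(\<lambda>y. if y \<in> {0} then K 0 else (if y = 0 then 0 else K y)) \<in> borel_measurable lebesgue"
    by (intro measurable_If_set) auto
  moreover have "(\<lambda>y. if y \<in> {0} then K 0 else (if y = 0 then 0 else K y)) = K" by auto
  ultimately show ?thesis by simp
qed

text \<open>A Borel representative satisfies the bounds only almost everywhere; clamping it between
  them makes them hold at every point and changes it on a null set only. For s = 1/2 the degree of
  homogeneity is -(n+1), as the shell moments require.\<close>

lemma admissible_stable_kernel:
  fixes K\<^sub>0 :: "'a::euclidean_space \<Rightarrow> real"
  assumes lam: "0 < lam" "lam \<le> Lam" and adm: "admissible s Lam K\<^sub>0 b"
    and bds: "\<forall>y. y \<noteq> 0 \<longrightarrow> lam / norm y powr (real DIM('a) + 2 * s) \<le> K\<^sub>0 y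
                 \<and> K\<^sub>0 y \<le> Lam / norm y powr (real DIM('a) + 2 * s)"
  obtains K where "stable_kernel s lam Lam K" "AE y in lborel. K\<^sub>0 y = K y"
proof -
  let ?\<kappa> = "\<lambda>y::'a. norm y powr (- (real DIM('a) + 2 * s))"
  have m0: "K\<^sub>0 \<in> borel_measurable lebesgue" by (rule admissible_measurable[OF adm])
  obtain K' where K': "K' \<in> borel_measurable lborel" "AE y in lborel. K\<^sub>0 y = K' y"
    using completion_ex_borel_measurable_real[OF m0] by blast
  define K where "K y = max (lam * ?\<kappa> y) (min (Lam * ?\<kappa> y) (K' y))" for y
  have Km: "K \<in> borel_measurable borel"
    unfolding K_def[abs_def] using K'(1) by simp
  have eq: "AE y in lborel. K\<^sub>0 y = K y"
    using K'(2) AE_lborel_singleton[of "0::'a"]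
  proof eventually_elim
    case (elim y)
    have "lam * ?\<kappa> y \<le> K\<^sub>0 y" "K\<^sub>0 y \<le> Lam * ?\<kappa> y"
      using bds elim(2) unfolding powr_minus_divide by auto
    then show ?case using elim(1) by (simp add: K_def)
  qed
  have "lam * ?\<kappa> y \<le> Lam * ?\<kappa> y" for y using lam by (intro mult_right_mono) auto
  then have Kb: "lam * ?\<kappa> y \<le> K y \<and> K y \<le> Lam * ?\<kappa> y" for y by (auto simp: K_def)
  have shell: "(LINT y|lborel. indicator {y. p \<le> norm y \<and> norm y < q} y *\<^sub>R (K y *\<^sub>R y)) = 0"
    if s: "s = 1/2" and pq: "0 < p" "p < q" for p q
  proof -
    have "(LINT y:{y. p \<le> norm y \<and> norm y < q}|lebesgue. K\<^sub>0 y *\<^sub>R y) = 0"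
      using adm s by (intro shell_moment_zero pq m0) (auto simp: admissible_def)
    moreover have "(LINT y:{y. p \<le> norm y \<and> norm y < q}|lebesgue. K\<^sub>0 y *\<^sub>R y) =
        (LINT y|lborel. indicator {y. p \<le> norm y \<and> norm y < q} y *\<^sub>R (K y *\<^sub>R y))"
      unfolding set_lebesgue_integral_def
    proof (rule lebesgue_AE_eq(2))
      show "(\<lambda>y. indicator {y. p \<le> norm y \<and> norm y < q} y *\<^sub>R (K y *\<^sub>R y)) \<in> borel_measurable borel"
        using Km by measurable
    qed (use eq in \<open>auto elim: eventually_mono\<close>)
    ultimately show ?thesis by simp
  qed
  show ?thesis
    by (rule that[of K]) (use Km Kb shell eq in \<open>auto simp: stable_kernel_def\<close>)
qed

text \<open>Only v(x + y), which sits under the integral, is replaced by its representative. The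
  value at x itself is kept, since a representative may differ from v at that point.\<close>

lemma stable_op_increment:
  fixes K\<^sub>0 K v V :: "'a::euclidean_space \<Rightarrow> real"
  assumes K: "K \<in> borel_measurable borel" "AE y in lborel. K\<^sub>0 y = K y"
    and V: "V \<in> borel_measurable borel" "AE y in lborel. v y = V y"
  shows "stable_op s K\<^sub>0 b v x = increment_op s K b (\<lambda>y. v x - V (x + y)) (grad v x)"
proof -
  note [measurable] = K(1) V(1)
  have V': "AE y in lborel. v (x + y) = V (x + y)" by (rule AE_lborel_translate[OF V(2)])
  have 1: "(LINT y|lebesgue. (v x - v (x + y)) * K\<^sub>0 y) = (LINT y|lborel. (v x - V (x + y)) * K y)"
  proof (rule lebesgue_AE_eq(2))
    show "AE y in lborel. (v x - v (x + y)) * K\<^sub>0 y = (v x - V (x + y)) * K y"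
      using V' K(2) by eventually_elim simp
  qed measurable
  have 2: "(LINT y:- ball 0 \<epsilon>|lebesgue. (v x - v (x + y)) * K\<^sub>0 y) =
      (LINT y|lborel. indicator (- ball 0 \<epsilon>) y * ((v x - V (x + y)) * K y))" for \<epsilon>
    unfolding set_lebesgue_integral_def real_scaleR_def
  proof (rule lebesgue_AE_eq(2))
    show "AE y in lborel. indicator (- ball 0 \<epsilon>) y * ((v x - v (x + y)) * K\<^sub>0 y) = indicator (- ball 0 \<epsilon>) y * ((v x - V (x + y)) * K y)"
      using V' K(2) by eventually_elim simp
    have "- ball 0 \<epsilon> \<in> sets (borel :: 'a measure)" by auto
    then show "(\<lambda>y. indicator (- ball 0 \<epsilon>) y * ((v x - V (x + y)) * K y)) \<in> borel_measurable borel"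
      by measurable
  qed
  have 3: "(LINT y|lebesgue. (v x - v (x + y) + grad v x \<bullet> y) * K\<^sub>0 y) = (LINT y|lborel. (v x - V (x + y) + grad v x \<bullet> y) * K y)"
  proof (rule lebesgue_AE_eq(2))
    show "AE y in lborel. (v x - v (x + y) + grad v x \<bullet> y) * K\<^sub>0 y = (v x - V (x + y) + grad v x \<bullet> y) * K y"
      using V' K(2) by eventually_elim simp
  qed measurable
  show ?thesis unfolding stable_op_def increment_op_def 1 2 3 ..
qed

section \<open>Gradients and local regularity of test functions\<close>

lemma grad_eqI:
  assumes "(f has_derivative (\<lambda>h. D \<bullet> h)) (at x)"
  shows "grad f x = D"
  unfolding grad_def
proof (rule the_equality)
  show "GDERIV f x :> D" using assms by (simp add: gderiv_def inner_commute)
next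
  fix E assume "GDERIV f x :> E"
  then have "(f has_derivative (\<lambda>h. E \<bullet> h)) (at x)" by (simp add: gderiv_def inner_commute)
  then have "(\<lambda>h. E \<bullet> h) = (\<lambda>h. D \<bullet> h)" using assms by (rule has_derivative_unique)
  then have "E \<bullet> (E - D) = D \<bullet> (E - D)" by meson
  then have "(E - D) \<bullet> (E - D) = 0" by (simp add: inner_diff_left)
  then show "E = D" by simp
qed

lemma taylor_imp_has_derivative:
  fixes f :: "'a::euclidean_space \<Rightarrow> real"
  assumes "0 < \<rho>" "\<And>y. norm y < \<rho> \<Longrightarrow> \<bar>f (x + y) - f x - D \<bullet> y\<bar> \<le> C * (norm y)\<^sup>2"
  shows "(f has_derivative (\<lambda>h. D \<bullet> h)) (at x)"
  unfolding has_derivative_at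
proof (intro conjI bounded_linear_inner_right)
  show "(\<lambda>h. norm (f (x + h) - f x - D \<bullet> h) / norm h) \<midarrow>0\<rightarrow> 0"
  proof (rule Lim_null_comparison)
    have "\<forall>\<^sub>F h::'a in at 0. norm h < \<rho>"
      using assms(1) by (auto simp: eventually_at dist_norm intro!: exI[of _ \<rho>])
    then show "\<forall>\<^sub>F h in at 0. norm (norm (f (x + h) - f x - D \<bullet> h) / norm h) \<le> C * norm h"
    proof eventually_elim
      case (elim h)
      then show ?case using assms(2)[OF elim] by (cases "h = 0") (auto simp: divide_simps power2_eq_square mult_ac)
    qed
    show "((\<lambda>h::'a. C * norm h) \<longlongrightarrow> 0) (at 0)" by (auto intro!: tendsto_eq_intros)
  qed
qed

text \<open>Derivatives at points of an open set depend on the values in that set only. This covers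
  functions that agree with a paraboloid on a small ball and are arbitrary outside.\<close>

lemma C_k_on_cong:
  assumes S: "open S" and eq: "\<And>x. x \<in> S \<Longrightarrow> f x = g x" and g: "C_k_on k S g"
  shows "C_k_on k S f"
  using eq g
proof (induction k arbitrary: f g)
  case 0
  then show ?case by (auto cong: continuous_on_cong)
next
  case (Suc k)
  have d: "(f has_derivative frechet_derivative g (at x)) (at x)" if x: "x \<in> S" for x
  proof -
    have "(g has_derivative frechet_derivative g (at x)) (at x)"
      using Suc.prems(2) x frechet_derivative_works by auto
    then show ?thesis
      by (rule has_derivative_transform_within_open[OF _ S x]) (use Suc.prems(1) in auto)
  qed
  have fd: "frechet_derivative f (at x) = frechet_derivative g (at x)" if "x \<in> S" for x
    using frechet_derivative_at[OF d[OF that]] by simp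
  show ?case
    unfolding C_k_on.simps
  proof (intro conjI ballI allI)
    show "f differentiable (at x)" if "x \<in> S" for x using d[OF that] by (auto simp: differentiable_def)
    fix v
    have "C_k_on k S (\<lambda>x. frechet_derivative g (at x) v)" using Suc.prems(2) by simp
    then show "C_k_on k S (\<lambda>x. frechet_derivative f (at x) v)"
      by (rule Suc.IH[rotated]) (simp add: fd)
  qed
qed

lemma elementary_sum: "finite I \<Longrightarrow> (\<And>i. i \<in> I \<Longrightarrow> elementary (f i)) \<Longrightarrow> elementary (\<lambda>x. \<Sum>i\<in>I. f i x)"
  by (induction I rule: finite_induct) (auto intro: elementary.const elementary.add)

lemma elementary_paraboloid: "elementary (\<lambda>z. c * (1 + p \<bullet> (z - x\<^sub>0) + \<gamma> * (norm (z - x\<^sub>0))\<^sup>2))"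
proof -
  have "elementary (\<lambda>z. c * (1 + (z \<bullet> p + (- (x\<^sub>0 \<bullet> p))) + \<gamma> * (\<Sum>i\<in>Basis. (z \<bullet> i + (- (x\<^sub>0 \<bullet> i))) * (z \<bullet> i + (- (x\<^sub>0 \<bullet> i))))))"
    by (intro elementary.intros elementary_sum) auto
  moreover have "(norm (z - x\<^sub>0))\<^sup>2 = (\<Sum>i\<in>Basis. (z \<bullet> i + (- (x\<^sub>0 \<bullet> i))) * (z \<bullet> i + (- (x\<^sub>0 \<bullet> i))))" for z
  proof -
    have "(norm (z - x\<^sub>0))\<^sup>2 = (\<Sum>i\<in>Basis. ((z - x\<^sub>0) \<bullet> i) * ((z - x\<^sub>0) \<bullet> i))"
      unfolding power2_norm_eq_inner by (rule euclidean_inner)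
    then show ?thesis by (simp add: inner_diff_left)
  qed
  moreover have "p \<bullet> (z - x\<^sub>0) = z \<bullet> p + (- (x\<^sub>0 \<bullet> p))" for z
    by (simp add: inner_diff_right inner_commute)
  ultimately show ?thesis by simp
qed

text \<open>The test function is the paraboloid on a tiny ball about the contact point and u itself
  elsewhere, so that the operator sees the true increments of u outside that ball. The radius
  depends on u, but is so small that the change adds at most \<open>C\<^sub>0\<close> to the
  weighted norm; hence the factor 2 in the constant.\<close>

lemma viscosity_bound:
  fixes s lam Lam :: real
  assumes s: "0 < s" "s < 1" and lam: "0 < lam" "lam \<le> Lam"
  obtains A where "0 < A"
    "\<And>(K\<^sub>0 :: 'a::euclidean_space \<Rightarrow> real) K b u w C\<^sub>0 x N.
       stable_kernel s lam Lam K \<Longrightarrow> AE y in lborel. K\<^sub>0 y = K y \<Longrightarrow> (s = 1/2 \<longrightarrow> norm b \<le> Lam) \<Longrightarrow>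
       w \<in> borel_measurable borel \<Longrightarrow> AE y in lborel. u y = w y \<Longrightarrow> 0 < C\<^sub>0 \<Longrightarrow>
       viscosity_subsolution s K\<^sub>0 b C\<^sub>0 u \<Longrightarrow> integrable lborel (\<lambda>z. \<bar>w z\<bar> * decay_weight s z) \<Longrightarrow>
       (LINT z|lborel. \<bar>w z\<bar> * decay_weight s z) \<le> N \<Longrightarrow> norm x < 1/2 \<Longrightarrow> u x \<le> A * (N + C\<^sub>0)"
proof -
  define n where "n = real DIM('a)"
  have n: "1 \<le> n" by (simp add: n_def Suc_le_eq)
  have p1: "0 \<le> 2 * n" "0 \<le> 19 * n\<^sup>2" "0 < 1 / (6 * n)" using n by auto
  obtain \<theta> A where \<theta>: "0 < \<theta>" "\<theta> \<le> 1 / (6 * n)" "\<theta> \<le> 1" and A: "0 < A"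
    and contact: "\<And>(K :: 'a \<Rightarrow> real) b V x\<^sub>0 u\<^sub>0 d p N \<rho> C C\<^sub>0.
       stable_kernel s lam Lam K \<Longrightarrow> (s = 1/2 \<longrightarrow> norm b \<le> Lam) \<Longrightarrow> V \<in> borel_measurable borel \<Longrightarrow>
       norm x\<^sub>0 < 1 \<Longrightarrow> 0 < d \<Longrightarrow> d \<le> 1 \<Longrightarrow> 0 < u\<^sub>0 \<Longrightarrow> norm p \<le> (2 * n) / d \<Longrightarrow>
       (\<forall>y. norm y < \<theta> * d \<longrightarrow> V (x\<^sub>0 + y) \<le> u\<^sub>0 * (1 + p \<bullet> y + (19 * n\<^sup>2) / d\<^sup>2 * (norm y)\<^sup>2)) \<Longrightarrow>
       0 < \<rho> \<Longrightarrow> \<rho> \<le> \<theta> * d \<Longrightarrow>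
       (\<forall>y. norm y < \<rho> \<longrightarrow> \<bar>u\<^sub>0 - V (x\<^sub>0 + y) + (u\<^sub>0 *\<^sub>R p) \<bullet> y\<bar> \<le> C * (norm y)\<^sup>2) \<Longrightarrow>
       integrable lborel (\<lambda>z. \<bar>V z\<bar> * decay_weight s z) \<Longrightarrow> (LINT z|lborel. \<bar>V z\<bar> * decay_weight s z) \<le> N \<Longrightarrow>
       0 \<le> C\<^sub>0 \<Longrightarrow> increment_op s K b (\<lambda>y. u\<^sub>0 - V (x\<^sub>0 + y)) (u\<^sub>0 *\<^sub>R p) \<le> C\<^sub>0 \<Longrightarrow>
       u\<^sub>0 * d ^ DIM('a) \<le> A * (N + C\<^sub>0)"
    by (rule contact_point_bound[OF s lam p1, where 'a='a]) (rule that)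
  define c where "c = (5/16 :: real) ^ DIM('a)"
  have c: "0 < c" by (simp add: c_def)
  show ?thesis
  proof (rule that[of "2 * A / c"])
    show "0 < 2 * A / c" using A c by simp
    fix K\<^sub>0 K :: "'a \<Rightarrow> real" and b :: 'a and u w :: "'a \<Rightarrow> real" and C\<^sub>0 N :: real and x :: 'a
    assume K: "stable_kernel s lam Lam K" and KK: "AE y in lborel. K\<^sub>0 y = K y" and b: "s = 1/2 \<longrightarrow> norm b \<le> Lam"
      and wm: "w \<in> borel_measurable borel" and uw: "AE y in lborel. u y = w y" and C0: "0 < C\<^sub>0"
      and visc: "viscosity_subsolution s K\<^sub>0 b C\<^sub>0 u" and wi: "integrable lborel (\<lambda>z. \<bar>w z\<bar> * decay_weight s z)"
      and wN: "(LINT z|lborel. \<bar>w z\<bar> * decay_weight s z) \<le> N" and x: "norm x < 1/2"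
    note [measurable] = wm
    have Km: "K \<in> borel_measurable borel" using K by (simp add: stable_kernel_def)
    have N0: "0 \<le> N"
      by (rule order_trans[OF Bochner_Integration.integral_nonneg wN]) (intro mult_nonneg_nonneg abs_ge_zero less_imp_le[OF decay_weight_pos])
    show "u x \<le> 2 * A / c * (N + C\<^sub>0)"
    proof (cases "0 < u x")
      case False
      have "0 \<le> 2 * A / c * (N + C\<^sub>0)" using A c N0 C0 by simp
      then show ?thesis using False by linarith
    next
      case ux: True
      have usc: "\<forall>\<^sub>F z in nhds x. u z < a" if "norm x \<le> 3/4" "u x < a" for x a
        using visc that by (auto simp: viscosity_subsolution_def)
      obtain x\<^sub>0 d p where x0: "norm x\<^sub>0 < 3/4" and d: "0 < d" "d \<le> 1" and u0: "0 < u x\<^sub>0"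
        and main: "u x * (5/16) ^ DIM('a) \<le> u x\<^sub>0 * d ^ DIM('a)" and p: "norm p \<le> 2 * n / d"
        and up: "\<And>y. norm y < 1 / (6 * n) * d \<Longrightarrow> u (x\<^sub>0 + y) \<le> u x\<^sub>0 * (1 + p \<bullet> y + 19 * n\<^sup>2 / d\<^sup>2 * (norm y)\<^sup>2)"
        by (rule barrier_contact_point[OF usc x ux]) (simp_all add: n_def)
      define Q where "Q z = u x\<^sub>0 * (1 + p \<bullet> (z - x\<^sub>0) + 19 * n\<^sup>2 / d\<^sup>2 * (norm (z - x\<^sub>0))\<^sup>2)" for z
      have Qel: "elementary Q" unfolding Q_def[abs_def] by (rule elementary_paraboloid)
      have Qm [measurable]: "Q \<in> borel_measurable borel" unfolding Q_def[abs_def] by measurable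
      define q where "q = u x\<^sub>0 * (1 + 2 * n / d + 19 * n\<^sup>2 / d\<^sup>2)"
      have q: "0 \<le> q" using u0 n d by (auto simp: q_def)
      define \<omega> where "\<omega> = unit_ball_vol (real DIM('a))"
      have \<omega>: "0 \<le> \<omega>" by (simp add: \<omega>_def)
      \<comment> \<open>q bounds the paraboloid on the ball of radius \<rho> and \<omega> is the
        volume of the unit ball, so the paraboloid contributes at most q \<omega> \<rho> \<le>
        \<open>C\<^sub>0\<close> to the norm.\<close>
      define \<rho> where "\<rho> = min (\<theta> * d) (C\<^sub>0 / (q * \<omega> + 1))"
      have \<rho>: "0 < \<rho>" "\<rho> \<le> \<theta> * d" "\<rho> \<le> C\<^sub>0 / (q * \<omega> + 1)"
        using \<theta> d C0 q \<omega> by (auto simp: \<rho>_def add_nonneg_pos)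
      have td: "\<theta> * d \<le> 1 / (6 * n) * d" using \<theta>(2) d by (intro mult_right_mono) auto
      have td1: "\<theta> * d \<le> 1" using \<theta> d by (intro mult_le_one) auto
      have \<rho>1: "\<rho> \<le> 1" using \<rho> td1 by linarith
      have Qabs: "\<bar>Q z\<bar> \<le> q" if "z \<in> ball x\<^sub>0 \<rho>" for z
      proof -
        have nz: "norm (z - x\<^sub>0) \<le> 1" using that \<rho>1 by (simp add: dist_norm norm_minus_commute)
        have "\<bar>p \<bullet> (z - x\<^sub>0)\<bar> \<le> norm p * norm (z - x\<^sub>0)" by (rule Cauchy_Schwarz_ineq2)
        also have "\<dots> \<le> 2 * n / d * 1" using p nz n d by (intro mult_mono) auto
        finally have 1: "\<bar>p \<bullet> (z - x\<^sub>0)\<bar> \<le> 2 * n / d" by simp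
        have "19 * n\<^sup>2 / d\<^sup>2 * (norm (z - x\<^sub>0))\<^sup>2 \<le> 19 * n\<^sup>2 / d\<^sup>2 * 1"
          using nz by (intro mult_left_mono power_le_one) auto
        moreover have "0 \<le> 19 * n\<^sup>2 / d\<^sup>2 * (norm (z - x\<^sub>0))\<^sup>2" by simp
        ultimately have "\<bar>1 + p \<bullet> (z - x\<^sub>0) + 19 * n\<^sup>2 / d\<^sup>2 * (norm (z - x\<^sub>0))\<^sup>2\<bar> \<le> 1 + 2 * n / d + 19 * n\<^sup>2 / d\<^sup>2"
          using 1 by linarith
        then show ?thesis unfolding Q_def q_def abs_mult using u0 by (intro mult_mono) auto
      qed
      have uQ: "u z \<le> Q z" if "z \<in> ball x\<^sub>0 (\<theta> * d)" for z
        using up[of "z - x\<^sub>0"] that td by (simp add: Q_def dist_norm norm_minus_commute)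
      define \<phi> where "\<phi> z = (if z \<in> ball x\<^sub>0 \<rho> then Q z else u z)" for z
      \<comment> \<open>A Borel version of \<phi>. The minimum with Q matters because w equals u
        only almost everywhere, while the contact estimate asks for the upper bound at every point
        of the ball of radius \<theta> d.\<close>
      define V where "V z = (if z \<in> ball x\<^sub>0 \<rho> then Q z else if z \<in> ball x\<^sub>0 (\<theta> * d) then min (w z) (Q z) else w z)" for z
      have Vm [measurable]: "V \<in> borel_measurable borel"
        unfolding V_def[abs_def] by (intro measurable_If_set measurable_If) (auto simp: borel_open)
      have \<phi>V: "AE z in lborel. \<phi> z = V z"
        using uw
      proof eventually_elim
        case (elim z)
        then show ?case using uQ[of z] by (auto simp: \<phi>_def V_def min_def)
      qed
      have \<phi>u: "u z \<le> \<phi> z" for z using uQ[of z] \<rho>(2) by (auto simp: \<phi>_def)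
      have \<phi>x: "\<phi> x\<^sub>0 = u x\<^sub>0" using \<rho> by (simp add: \<phi>_def Q_def)
      have wle1: "decay_weight s z \<le> 1" for z :: 'a by (simp add: decay_weight_def divide_le_eq_1 add_nonneg_pos add_pos_nonneg)
      have Vle: "AE z in lborel. \<bar>V z\<bar> * decay_weight s z \<le> \<bar>w z\<bar> * decay_weight s z + q * indicator (ball x\<^sub>0 \<rho>) z"
        using uw
      proof eventually_elim
        case (elim z)
        show ?case
        proof (cases "z \<in> ball x\<^sub>0 \<rho>")
          case True
          have "\<bar>V z\<bar> * decay_weight s z \<le> q * 1"
            using True Qabs[OF True] wle1[of z] decay_weight_pos[of s z] q by (intro mult_mono) (auto simp: V_def)
          moreover have "0 \<le> \<bar>w z\<bar> * decay_weight s z" using decay_weight_pos[of s z] by simp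
          ultimately show ?thesis using True by simp
        next
          case False
          then have "V z = w z" using elim uQ[of z] by (auto simp: V_def min_def)
          then show ?thesis using False by simp
        qed
      qed
      have bi: "integrable lborel (\<lambda>z. q * indicator (ball x\<^sub>0 \<rho>) z)"
        using emeasure_lborel_ball_finite[of x\<^sub>0 \<rho>] by (intro integrable_mult_right integrable_real_indicator) auto
      have Vi: "integrable lborel (\<lambda>z. \<bar>V z\<bar> * decay_weight s z)"
      proof (rule Bochner_Integration.integrable_bound[OF Bochner_Integration.integrable_add[OF wi bi]])
        show "AE z in lborel. norm (\<bar>V z\<bar> * decay_weight s z) \<le> norm (\<bar>w z\<bar> * decay_weight s z + q * indicator (ball x\<^sub>0 \<rho>) z)"
          using Vle
        proof eventually_elim
          case (elim z)
          have "0 \<le> \<bar>V z\<bar> * decay_weight s z" using decay_weight_pos[of s z] by simp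
          with elim show ?case by (simp only: real_norm_def)
        qed
      qed measurable
      have VN: "(LINT z|lborel. \<bar>V z\<bar> * decay_weight s z) \<le> N + C\<^sub>0"
      proof -
        have "(LINT z|lborel. \<bar>V z\<bar> * decay_weight s z) \<le> (LINT z|lborel. \<bar>w z\<bar> * decay_weight s z + q * indicator (ball x\<^sub>0 \<rho>) z)"
          by (rule integral_mono_AE[OF Vi Bochner_Integration.integrable_add[OF wi bi] Vle])
        also have "\<dots> = (LINT z|lborel. \<bar>w z\<bar> * decay_weight s z) + (LINT z|lborel. q * indicator (ball x\<^sub>0 \<rho>) z)"
          by (rule Bochner_Integration.integral_add[OF wi bi])
        also have "(LINT z|lborel. q * indicator (ball x\<^sub>0 \<rho>) z) = q * (\<omega> * \<rho> ^ DIM('a))"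
          using content_ball[of \<rho> x\<^sub>0] \<rho> by (simp add: \<omega>_def)
        also have "\<dots> \<le> q * (\<omega> * \<rho> ^ 1)"
          using q \<omega> \<rho> \<rho>1 by (intro mult_left_mono power_decreasing) auto
        also have "\<dots> \<le> C\<^sub>0"
        proof -
          have "\<rho> * (q * \<omega> + 1) \<le> C\<^sub>0" using \<rho>(3) q \<omega> by (simp add: pos_le_divide_eq add_nonneg_pos)
          then have "q * \<omega> * \<rho> + \<rho> \<le> C\<^sub>0" by (simp add: algebra_simps)
          then show ?thesis using \<rho>(1) by (simp add: mult.assoc)
        qed
        finally show ?thesis using wN by simp
      qed
      have "integrable lebesgue (\<lambda>z. \<phi> z / (1 + norm z powr (real DIM('a) + 2 * s)))"
      proof -
        have 1: "integrable lborel (\<lambda>z. V z * decay_weight s z)"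
          by (rule Bochner_Integration.integrable_bound[OF Vi]) (simp_all add: abs_mult)
        have 2: "(\<lambda>z. V z * decay_weight s z) \<in> borel_measurable borel" by measurable
        have 3: "AE z in lborel. \<phi> z * decay_weight s z = V z * decay_weight s z"
          using \<phi>V by (auto elim: eventually_mono)
        have "integrable lebesgue (\<lambda>z. V z * decay_weight s z)" using 1 2 by (simp add: integrable_completion)
        then have "integrable lebesgue (\<lambda>z. \<phi> z * decay_weight s z)"
        proof (rule integrable_cong_AE_imp)
          show "(\<lambda>z. \<phi> z * decay_weight s z) \<in> borel_measurable lebesgue" by (rule lebesgue_AE_eq(1)[OF 2 3])
          show "AE z in lebesgue. V z * decay_weight s z = \<phi> z * decay_weight s z"
            by (rule AE_completion) (use 3 in \<open>auto elim: eventually_mono\<close>)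
        qed
        then show ?thesis by (simp add: decay_weight_def)
      qed
      moreover have "C_k_on 2 (ball x\<^sub>0 \<rho>) \<phi>"
        by (rule C_k_on_cong[OF _ _ elementary_C_k_on[OF Qel]]) (auto simp: \<phi>_def)
      moreover have "x\<^sub>0 \<in> ball 0 1" using x0 by simp
      ultimately have op: "stable_op s K\<^sub>0 b \<phi> x\<^sub>0 \<le> C\<^sub>0"
        using visc \<phi>x \<phi>u \<rho>(1) unfolding viscosity_subsolution_def by blast
      have near: "u x\<^sub>0 - V (x\<^sub>0 + y) + (u x\<^sub>0 *\<^sub>R p) \<bullet> y = - (u x\<^sub>0 * (19 * n\<^sup>2 / d\<^sup>2) * (norm y)\<^sup>2)" if "norm y < \<rho>" for y
      proof -
        have "V (x\<^sub>0 + y) = Q (x\<^sub>0 + y)" using that by (simp add: V_def dist_norm)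
        then show ?thesis by (simp add: Q_def algebra_simps)
      qed
      have "(\<phi> has_derivative (\<lambda>h. (u x\<^sub>0 *\<^sub>R p) \<bullet> h)) (at x\<^sub>0)"
      proof (rule taylor_imp_has_derivative[OF \<rho>(1)])
        fix y :: 'a assume y: "norm y < \<rho>"
        have "\<phi> (x\<^sub>0 + y) = V (x\<^sub>0 + y)" using y by (simp add: V_def \<phi>_def dist_norm)
        then have "\<phi> (x\<^sub>0 + y) - \<phi> x\<^sub>0 - (u x\<^sub>0 *\<^sub>R p) \<bullet> y = u x\<^sub>0 * (19 * n\<^sup>2 / d\<^sup>2) * (norm y)\<^sup>2"
          using near[OF y] \<phi>x by linarith
        then show "\<bar>\<phi> (x\<^sub>0 + y) - \<phi> x\<^sub>0 - (u x\<^sub>0 *\<^sub>R p) \<bullet> y\<bar> \<le> (u x\<^sub>0 * (19 * n\<^sup>2 / d\<^sup>2)) * (norm y)\<^sup>2"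
          using u0 by simp
      qed
      then have gr: "grad \<phi> x\<^sub>0 = u x\<^sub>0 *\<^sub>R p" by (rule grad_eqI)
      have "stable_op s K\<^sub>0 b \<phi> x\<^sub>0 = increment_op s K b (\<lambda>y. u x\<^sub>0 - V (x\<^sub>0 + y)) (u x\<^sub>0 *\<^sub>R p)"
        using stable_op_increment[OF Km KK Vm \<phi>V, of s b x\<^sub>0] by (simp add: gr \<phi>x)
      then have op': "increment_op s K b (\<lambda>y. u x\<^sub>0 - V (x\<^sub>0 + y)) (u x\<^sub>0 *\<^sub>R p) \<le> C\<^sub>0" using op by simp
      have "u x\<^sub>0 * d ^ DIM('a) \<le> A * ((N + C\<^sub>0) + C\<^sub>0)"
      proof (rule contact[OF K b Vm _ d u0 _ _ \<rho>(1,2) _ Vi VN _ op'])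
        show "norm x\<^sub>0 < 1" using x0 by simp
        show "norm p \<le> 2 * n / d" by (rule p)
        show "\<forall>y. norm y < \<theta> * d \<longrightarrow> V (x\<^sub>0 + y) \<le> u x\<^sub>0 * (1 + p \<bullet> y + 19 * n\<^sup>2 / d\<^sup>2 * (norm y)\<^sup>2)"
        proof (intro allI impI)
          fix y :: 'a assume that: "norm y < \<theta> * d"
          have "V (x\<^sub>0 + y) \<le> Q (x\<^sub>0 + y)" using that by (simp add: V_def dist_norm)
          then show "V (x\<^sub>0 + y) \<le> u x\<^sub>0 * (1 + p \<bullet> y + 19 * n\<^sup>2 / d\<^sup>2 * (norm y)\<^sup>2)" by (simp add: Q_def)
        qed
        show "\<forall>y. norm y < \<rho> \<longrightarrow> \<bar>u x\<^sub>0 - V (x\<^sub>0 + y) + (u x\<^sub>0 *\<^sub>R p) \<bullet> y\<bar> \<le> (u x\<^sub>0 * (19 * n\<^sup>2 / d\<^sup>2)) * (norm y)\<^sup>2"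
          using near u0 by simp
      qed (use C0 in simp)
      also have "\<dots> \<le> A * (2 * (N + C\<^sub>0))" using A N0 by (intro mult_left_mono) auto
      also have "\<dots> = 2 * A * (N + C\<^sub>0)" by simp
      finally have "u x * c \<le> 2 * A * (N + C\<^sub>0)" unfolding c_def by (rule order_trans[OF main])
      then show ?thesis using c by (simp add: field_simps)
    qed
  qed
qed

section \<open>Weak subsolutions\<close>

text \<open>On the ball of radius R the decay weight is bounded below, so a bounded function
  supported there is a multiple of the weight at most.\<close>

lemma integrable_mult_compact_support:
  fixes w h :: "'a::euclidean_space \<Rightarrow> real"
  assumes s: "0 < s" and w: "w \<in> borel_measurable borel" "integrable lborel (\<lambda>z. \<bar>w z\<bar> * decay_weight s z)"
    and h: "h \<in> borel_measurable borel" "\<And>z. \<bar>h z\<bar> \<le> C" "\<And>z. R \<le> norm z \<Longrightarrow> h z = 0" and R: "0 \<le> R"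
  shows "integrable lborel (\<lambda>z. w z * h z)"
    and "\<bar>LINT z|lborel. w z * h z\<bar> \<le> C * (1 + R powr (real DIM('a) + 2 * s)) * (LINT z|lborel. \<bar>w z\<bar> * decay_weight s z)"
proof -
  note [measurable] = w(1) h(1)
  let ?D = "C * (1 + R powr (real DIM('a) + 2 * s))"
  have C: "0 \<le> C" using h(2)[of 0] by linarith
  have D: "0 \<le> ?D" using C by (intro mult_nonneg_nonneg add_nonneg_nonneg) auto
  have le: "\<bar>w z * h z\<bar> \<le> ?D * (\<bar>w z\<bar> * decay_weight s z)" for z
  proof (cases "norm z < R")
    case True
    have "1 \<le> (1 + R powr (real DIM('a) + 2 * s)) * decay_weight s z"
      using True R s by (intro decay_weight_near) auto
    then have "C * 1 \<le> C * ((1 + R powr (real DIM('a) + 2 * s)) * decay_weight s z)" using C by (rule mult_left_mono)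
    then have "\<bar>w z\<bar> * \<bar>h z\<bar> \<le> \<bar>w z\<bar> * (C * ((1 + R powr (real DIM('a) + 2 * s)) * decay_weight s z))"
      using h(2)[of z] by (intro mult_left_mono) auto
    then show ?thesis by (simp add: abs_mult mult_ac)
  next
    case False
    then show ?thesis using h(3)[of z] D decay_weight_pos[of s z] by simp
  qed
  have Di: "integrable lborel (\<lambda>z. ?D * (\<bar>w z\<bar> * decay_weight s z))" using w(2) by (rule integrable_mult_right)
  show i: "integrable lborel (\<lambda>z. w z * h z)"
  proof (rule Bochner_Integration.integrable_bound[OF Di])
    show "AE z in lborel. norm (w z * h z) \<le> norm (?D * (\<bar>w z\<bar> * decay_weight s z))"
      using le by (intro AE_I2) (simp only: real_norm_def, rule order_trans[OF _ abs_ge_self])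
  qed measurable
  have "norm (LINT z|lborel. w z * h z) \<le> (LINT z|lborel. ?D * (\<bar>w z\<bar> * decay_weight s z))"
    by (rule Bochner_Integration.integral_norm_bound_integral[OF i Di]) (use le in simp)
  then show "\<bar>LINT z|lborel. w z * h z\<bar> \<le> ?D * (LINT z|lborel. \<bar>w z\<bar> * decay_weight s z)" by simp
qed

text \<open>A correlation: the mollifier \<open>\<eta>\<close> is not reflected, so that \<open>L\<close> acting on \<open>conv w \<eta>\<close> becomes \<open>L\<^sup>*\<close> acting on
  a translate of \<open>\<eta>\<close>.\<close>

definition conv :: "('a::euclidean_space \<Rightarrow> real) \<Rightarrow> ('a \<Rightarrow> real) \<Rightarrow> 'a \<Rightarrow> real" where
  "conv w \<eta> y = (LINT z|lborel. w z * \<eta> (z - y))"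

lemma conv_shift: "conv w (\<lambda>z. \<eta> (z - x)) y = conv w \<eta> (x + y)"
  by (simp add: conv_def algebra_simps)

lemma conv_measurable:
  assumes [measurable]: "w \<in> borel_measurable borel" "\<eta> \<in> borel_measurable borel"
  shows "conv w \<eta> \<in> borel_measurable borel"
  unfolding conv_def[abs_def] by measurable

lemma decay_weight_shift:
  fixes z y :: "'a::euclidean_space"
  assumes s: "0 < s" and zy: "norm (z - y) \<le> 1"
  shows "decay_weight s y \<le> (1 + 2 powr (real DIM('a) + 2 * s)) * decay_weight s z"
proof -
  define m where "m = real DIM('a) + 2 * s"
  have m: "0 < m" using s by (simp add: m_def add_nonneg_pos)
  have "norm z powr m \<le> 2 powr m * (1 + norm y powr m)"
  proof -
    have "norm z \<le> 2 * max 1 (norm y)" using norm_triangle_ineq2[of z y] zy by linarith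
    then have "norm z powr m \<le> (2 * max 1 (norm y)) powr m" using m by (intro powr_mono2) auto
    also have "\<dots> = 2 powr m * max 1 (norm y) powr m" by (rule powr_mult)
    also have "\<dots> \<le> 2 powr m * (1 + norm y powr m)" by (intro mult_left_mono) (auto simp: max_def)
    finally show ?thesis .
  qed
  then have "1 + norm z powr m \<le> (1 + 2 powr m) * (1 + norm y powr m)" by (simp add: algebra_simps add_increasing)
  moreover have "0 < 1 + norm z powr m" "0 < 1 + norm y powr m" by (simp_all add: add_pos_nonneg)
  ultimately show ?thesis unfolding decay_weight_def m_def[symmetric] by (simp add: field_simps)
qed

text \<open>The decay weight changes by a bounded factor over distance 1, so by Fubini averaging
  with a density costs that factor times the mass of the density. The bound does not see the scale
  of the mollifier.\<close>

lemma conv_decay: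
  fixes w \<eta> :: "'a::euclidean_space \<Rightarrow> real"
  assumes s: "0 < s" and w: "w \<in> borel_measurable borel" "integrable lborel (\<lambda>z. \<bar>w z\<bar> * decay_weight s z)"
    and \<eta>: "\<eta> \<in> borel_measurable borel" "integrable lborel \<eta>" "\<And>z. 0 \<le> \<eta> z" "\<And>z. 1 \<le> norm z \<Longrightarrow> \<eta> z = 0"
  shows "integrable lborel (\<lambda>y. \<bar>conv w \<eta> y\<bar> * decay_weight s y)"
    and "(LINT y|lborel. \<bar>conv w \<eta> y\<bar> * decay_weight s y) \<le>
      (1 + 2 powr (real DIM('a) + 2 * s)) * (LINT z|lborel. \<bar>w z\<bar> * decay_weight s z) * (LINT z|lborel. \<eta> z)"
proof -
  note [measurable] = w(1) \<eta>(1) conv_measurable[OF w(1) \<eta>(1)]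
  define W where "W = 1 + 2 powr (real DIM('a) + 2 * s)"
  have W: "0 \<le> W" by (simp add: W_def add_nonneg_nonneg)
  define F where "F z y = \<bar>w z\<bar> * \<eta> (z - y) * decay_weight s y" for z y
  have F0: "0 \<le> F z y" for z y
    unfolding F_def by (intro mult_nonneg_nonneg abs_ge_zero \<eta>(3) less_imp_le[OF decay_weight_pos])
  have Fm [measurable]: "case_prod F \<in> borel_measurable (lborel \<Otimes>\<^sub>M lborel)"
    unfolding F_def[abs_def] by measurable
  have Fle: "F z y \<le> (W * (\<bar>w z\<bar> * decay_weight s z)) * \<eta> (z - y)" for z y
  proof (cases "norm (z - y) \<le> 1")
    case True
    have "(\<bar>w z\<bar> * \<eta> (z - y)) * decay_weight s y \<le> (\<bar>w z\<bar> * \<eta> (z - y)) * (W * decay_weight s z)"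
      unfolding W_def by (intro mult_left_mono decay_weight_shift s True mult_nonneg_nonneg \<eta>(3)) auto
    then show ?thesis by (simp add: F_def mult_ac)
  qed (use \<eta>(4) in \<open>simp add: F_def\<close>)
  have refl_i: "integrable lborel (\<lambda>y. \<eta> (z - y))" and refl: "(LINT y|lborel. \<eta> (z - y)) = (LINT y|lborel. \<eta> y)" for z
  proof -
    have 1: "integrable lborel (\<lambda>y. \<eta> (z + y))" by (rule lborel_translate(1)[OF \<eta>(2)])
    have "integrable (distr lborel borel uminus) (\<lambda>y. \<eta> (z + y))" by (simp add: lborel_distr_uminus_euclidean 1)
    then have "integrable lborel (\<lambda>y. \<eta> (z + - y))" by (rule integrable_distr[rotated]) simp
    then show "integrable lborel (\<lambda>y. \<eta> (z - y))" by simp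
    have "(LINT y|lborel. \<eta> (z + - y)) = (LINT y|lborel. \<eta> (z + y))" by (rule lborel_integral_reflect) measurable
    also have "\<dots> = (LINT y|lborel. \<eta> y)" by (rule lborel_translate(2)[OF \<eta>(1)])
    finally show "(LINT y|lborel. \<eta> (z - y)) = (LINT y|lborel. \<eta> y)" by simp
  qed
  have Fi: "integrable lborel (F z)" for z
    by (rule Bochner_Integration.integrable_bound[OF integrable_mult_right[OF refl_i, of "W * (\<bar>w z\<bar> * decay_weight s z)" z]])
       (use F0 Fle in \<open>auto simp: F_def[abs_def] intro!: AE_I2 order_trans[OF _ abs_ge_self]\<close>)
  have FI: "(LINT y|lborel. F z y) \<le> (W * (LINT y|lborel. \<eta> y)) * (\<bar>w z\<bar> * decay_weight s z)" for z
  proof -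
    have "(LINT y|lborel. F z y) \<le> (LINT y|lborel. (W * (\<bar>w z\<bar> * decay_weight s z)) * \<eta> (z - y))"
      by (rule integral_mono[OF Fi integrable_mult_right[OF refl_i] Fle])
    then show ?thesis by (simp add: refl mult_ac)
  qed
  have FIi: "integrable lborel (\<lambda>z. LINT y|lborel. F z y)"
  proof (rule Bochner_Integration.integrable_bound[OF integrable_mult_right[OF w(2), of "W * (LINT y|lborel. \<eta> y)"]])
    show "AE z in lborel. norm (LINT y|lborel. F z y) \<le> norm (W * (LINT y|lborel. \<eta> y) * (\<bar>w z\<bar> * decay_weight s z))"
    proof (rule AE_I2)
      fix z
      have "0 \<le> (LINT y|lborel. F z y)" by (intro Bochner_Integration.integral_nonneg F0)
      then show "norm (LINT y|lborel. F z y) \<le> norm (W * (LINT y|lborel. \<eta> y) * (\<bar>w z\<bar> * decay_weight s z))"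
        using FI[of z] by simp
    qed
  qed measurable
  have Fpi: "integrable (lborel \<Otimes>\<^sub>M lborel) (case_prod F)"
  proof (rule lborel_pair.Fubini_integrable)
    show "integrable lborel (\<lambda>z. LINT y|lborel. norm (case (z, y) of (z, y) \<Rightarrow> F z y))" using FIi F0 by simp
  qed (use Fi in auto)
  have snd_i: "integrable lborel (\<lambda>y. LINT z|lborel. F z y)" using lborel_pair.integrable_snd[OF Fpi] by simp
  have swap: "(LINT y|lborel. LINT z|lborel. F z y) = (LINT z|lborel. LINT y|lborel. F z y)"
    using lborel_pair.Fubini_integral[OF Fpi] .
  have cle: "\<bar>conv w \<eta> y\<bar> * decay_weight s y \<le> (LINT z|lborel. F z y)" for y
  proof -
    have "\<bar>conv w \<eta> y\<bar> \<le> (LINT z|lborel. \<bar>w z * \<eta> (z - y)\<bar>)" unfolding conv_def by (rule integral_abs_bound)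
    also have "\<dots> = (LINT z|lborel. \<bar>w z\<bar> * \<eta> (z - y))" using \<eta>(3) by (simp add: abs_mult)
    finally have "\<bar>conv w \<eta> y\<bar> * decay_weight s y \<le> (LINT z|lborel. \<bar>w z\<bar> * \<eta> (z - y)) * decay_weight s y"
      using decay_weight_pos[of s y] by (intro mult_right_mono) auto
    then show ?thesis by (simp add: F_def)
  qed
  show ci: "integrable lborel (\<lambda>y. \<bar>conv w \<eta> y\<bar> * decay_weight s y)"
  proof (rule Bochner_Integration.integrable_bound[OF snd_i])
    show "AE y in lborel. norm (\<bar>conv w \<eta> y\<bar> * decay_weight s y) \<le> norm (LINT z|lborel. F z y)"
    proof (rule AE_I2)
      fix y
      have "0 \<le> \<bar>conv w \<eta> y\<bar> * decay_weight s y" using decay_weight_pos[of s y] by simp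
      then show "norm (\<bar>conv w \<eta> y\<bar> * decay_weight s y) \<le> norm (LINT z|lborel. F z y)" using cle[of y] by simp
    qed
  qed measurable
  have "(LINT y|lborel. \<bar>conv w \<eta> y\<bar> * decay_weight s y) \<le> (LINT y|lborel. LINT z|lborel. F z y)"
    by (rule integral_mono[OF ci snd_i cle])
  also have "\<dots> \<le> (LINT z|lborel. (W * (LINT y|lborel. \<eta> y)) * (\<bar>w z\<bar> * decay_weight s z))"
    unfolding swap by (rule integral_mono[OF FIi integrable_mult_right[OF w(2)] FI])
  also have "\<dots> = (W * (LINT y|lborel. \<eta> y)) * (LINT z|lborel. \<bar>w z\<bar> * decay_weight s z)"
    by (rule integral_mult_right_zero)
  finally show "(LINT y|lborel. \<bar>conv w \<eta> y\<bar> * decay_weight s y) \<le>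
      (1 + 2 powr (real DIM('a) + 2 * s)) * (LINT z|lborel. \<bar>w z\<bar> * decay_weight s z) * (LINT z|lborel. \<eta> z)"
    by (simp add: W_def mult_ac)
qed

text \<open>A nonnegative test function \<eta> in the unit ball with gradient G and uniform
  second-order bounds. The correlation is studied at the origin only; other points are reached by
  translating \<eta>.\<close>

locale test_setting =
  fixes s lam Lam :: real and K w \<eta> :: "'a::euclidean_space \<Rightarrow> real" and G :: "'a \<Rightarrow> 'a" and C :: real
  assumes s: "0 < s" "s < 1" and lam: "0 < lam" and K: "stable_kernel s lam Lam K"
    and w: "w \<in> borel_measurable borel" "integrable lborel (\<lambda>z. \<bar>w z\<bar> * decay_weight s z)"
    and \<eta>_nonneg: "\<And>x. 0 \<le> \<eta> x"
    and C: "0 \<le> C" and der: "\<And>x. (\<eta> has_derivative (\<lambda>h. G x \<bullet> h)) (at x)" and G_cont: "continuous_on UNIV G"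
    and \<eta>_le: "\<And>x. \<bar>\<eta> x\<bar> \<le> C" and G_le: "\<And>x. norm (G x) \<le> C"
    and taylor: "\<And>x y. \<bar>\<eta> (x + y) - \<eta> x - G x \<bullet> y\<bar> \<le> C * (norm y)\<^sup>2"
    and supp: "\<And>x. 1 \<le> norm x \<Longrightarrow> \<eta> x = 0" "\<And>x. 1 < norm x \<Longrightarrow> G x = 0"
begin

lemma eta_cont: "continuous_on UNIV \<eta>"
  using der by (auto intro!: continuous_at_imp_continuous_on has_derivative_continuous)

lemma meas [measurable]: "\<eta> \<in> borel_measurable borel" "G \<in> borel_measurable borel" "w \<in> borel_measurable borel" "K \<in> borel_measurable borel"
  using eta_cont G_cont w K by (auto intro: borel_measurable_continuous_onI simp: stable_kernel_def)

lemma K_bounds: "0 \<le> K y" "K y \<le> Lam * norm y powr (- (real DIM('a) + 2 * s))"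
proof -
  have 1: "lam * norm y powr (- (real DIM('a) + 2 * s)) \<le> K y" "K y \<le> Lam * norm y powr (- (real DIM('a) + 2 * s))" using K by (auto simp: stable_kernel_def)
  have "0 \<le> lam * norm y powr (- (real DIM('a) + 2 * s))" using lam by simp
  with 1 show "0 \<le> K y" "K y \<le> Lam * norm y powr (- (real DIM('a) + 2 * s))" by linarith+
qed

lemma Lam_nonneg: "0 \<le> Lam"
proof -
  obtain i :: 'a where "i \<in> Basis" by (metis nonempty_Basis ex_in_conv)
  then show ?thesis using K_bounds[of i] by simp
qed

lemma eta_integrable: "integrable lborel \<eta>"
proof (rule Bochner_Integration.integrable_bound)
  show "integrable lborel (\<lambda>y::'a. C * indicator (ball 0 1) y)"
    using emeasure_lborel_ball_finite[of "0::'a" 1] by (intro integrable_mult_right integrable_real_indicator) auto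
  show "AE x in lborel. norm (\<eta> x) \<le> norm (C * indicator (ball 0 1) x)"
    using \<eta>_le supp(1) C by (intro AE_I2) (auto simp: indicator_def not_less)
qed simp

text \<open>The corrected integrand of the adjoint operator applied to \<eta> at z, after the
  substitution of -y for y that turns K(-y) back into K(y).\<close>

definition H :: "'a \<Rightarrow> 'a \<Rightarrow> real" where
  "H z y = \<eta> z - \<eta> (z - y) - correction s 1 y * (G z \<bullet> y)"

lemma H_measurable [measurable]: "case_prod H \<in> borel_measurable (lborel \<Otimes>\<^sub>M lborel)"
  unfolding H_def[abs_def] by measurable

text \<open>The gradient of \<open>conv w \<eta>\<close> at 0; the minus sign comes from \<eta>(z -
  y).\<close>

definition P :: 'a where "P = - (LINT z|lborel. w z *\<^sub>R G z)"

lemma wG_integrable: "integrable lborel (\<lambda>z. w z *\<^sub>R G z)"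
proof (rule Bochner_Integration.integrable_bound)
  show "integrable lborel (\<lambda>z. w z * (C * indicator (cball 0 1) z))"
    using C by (intro integrable_mult_compact_support(1)[OF s(1) w, of _ C 2]) (auto simp: indicator_def)
  show "AE z in lborel. norm (w z *\<^sub>R G z) \<le> norm (w z * (C * indicator (cball 0 1) z))"
    using G_le supp(2) C by (intro AE_I2) (auto simp: indicator_def abs_mult mult_left_mono not_le)
qed measurable

lemma wG_inner: "integrable lborel (\<lambda>z. w z * (G z \<bullet> v))" "(LINT z|lborel. w z * (G z \<bullet> v)) = - (P \<bullet> v)"
proof -
  have "integrable lborel (\<lambda>z. (w z *\<^sub>R G z) \<bullet> v)" using wG_integrable by (intro integrable_inner_left) auto
  then show "integrable lborel (\<lambda>z. w z * (G z \<bullet> v))" by simp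
  have "(LINT z|lborel. (w z *\<^sub>R G z) \<bullet> v) = (LINT z|lborel. w z *\<^sub>R G z) \<bullet> v"
    using wG_integrable by (intro integral_inner_left) auto
  then show "(LINT z|lborel. w z * (G z \<bullet> v)) = - (P \<bullet> v)" by (simp add: P_def)
qed

lemma w_eta_integrable: "integrable lborel (\<lambda>z. w z * \<eta> (z - y))"
proof (rule integrable_mult_compact_support(1)[OF s(1) w, of _ C "norm y + 1"])
  fix z :: 'a assume "norm y + 1 \<le> norm z"
  then have "1 \<le> norm (z - y)" using norm_triangle_ineq2[of z y] by linarith
  then show "\<eta> (z - y) = 0" by (rule supp)
qed (use \<eta>_le in auto)

lemma w_H_integral: "(LINT z|lborel. w z * H z y) = conv w \<eta> 0 - conv w \<eta> y + correction s 1 y * (P \<bullet> y)"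
proof -
  have i0: "integrable lborel (\<lambda>z. w z * \<eta> z)" using w_eta_integrable[of 0] by simp
  have "(LINT z|lborel. w z * H z y) = (LINT z|lborel. w z * \<eta> z - w z * \<eta> (z - y) - correction s 1 y * (w z * (G z \<bullet> y)))"
    by (intro Bochner_Integration.integral_cong refl) (simp add: H_def algebra_simps)
  also have "\<dots> = (LINT z|lborel. w z * \<eta> z) - (LINT z|lborel. w z * \<eta> (z - y)) - correction s 1 y * (LINT z|lborel. w z * (G z \<bullet> y))"
    using i0 w_eta_integrable[of y] wG_inner(1)[of y]
    by (simp only: Bochner_Integration.integral_diff Bochner_Integration.integrable_diff integrable_mult_right integral_mult_right_zero)
  finally show ?thesis by (simp add: wG_inner(2) conv_def)
qed

text \<open>The expansion of \<eta> at z, integrated against w. For |y| < 1 the remainder is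
  supported in |z| < 2, where the decay weight is bounded below. The constant contains C and thus
  depends on \<eta>; it serves only to make the operator converge.\<close>

lemma conv_taylor:
  assumes "norm y < 1"
  shows "\<bar>conv w \<eta> 0 - conv w \<eta> y + P \<bullet> y\<bar> \<le>
    (C * (1 + 2 powr (real DIM('a) + 2 * s)) * (LINT z|lborel. \<bar>w z\<bar> * decay_weight s z)) * (norm y)\<^sup>2"
proof -
  define h where "h z = \<eta> z - \<eta> (z - y) - G z \<bullet> y" for z
  have i0: "integrable lborel (\<lambda>z. w z * \<eta> z)" using w_eta_integrable[of 0] by simp
  have "(LINT z|lborel. w z * h z) = (LINT z|lborel. w z * \<eta> z - w z * \<eta> (z - y) - w z * (G z \<bullet> y))"
    by (intro Bochner_Integration.integral_cong refl) (simp add: h_def algebra_simps)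
  also have "\<dots> = (LINT z|lborel. w z * \<eta> z) - (LINT z|lborel. w z * \<eta> (z - y)) - (LINT z|lborel. w z * (G z \<bullet> y))"
    using i0 w_eta_integrable[of y] wG_inner(1)[of y]
    by (simp only: Bochner_Integration.integral_diff Bochner_Integration.integrable_diff)
  finally have eq: "(LINT z|lborel. w z * h z) = conv w \<eta> 0 - conv w \<eta> y + P \<bullet> y"
    by (simp add: wG_inner(2) conv_def)
  have "\<bar>LINT z|lborel. w z * h z\<bar> \<le> (C * (norm y)\<^sup>2) * (1 + 2 powr (real DIM('a) + 2 * s)) * (LINT z|lborel. \<bar>w z\<bar> * decay_weight s z)"
  proof (rule integrable_mult_compact_support(2)[OF s(1) w])
    show "h \<in> borel_measurable borel" unfolding h_def[abs_def] by measurable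
    show "\<bar>h z\<bar> \<le> C * (norm y)\<^sup>2" for z
      using taylor[of z "- y"] by (simp add: h_def)
    fix z :: 'a assume z: "2 \<le> norm z"
    then have "1 \<le> norm (z - y)" using norm_triangle_ineq2[of z y] assms by linarith
    then show "h z = 0" using z by (simp add: h_def supp)
  qed auto
  then show ?thesis unfolding eq by (simp add: mult_ac)
qed

text \<open>The kernel of the double integral is dominated by \<open>|w z| (1 + |z|)^(-n-2s)\<close> times a function
  whose integral in \<open>y\<close> does not depend on \<open>z\<close>.\<close>

lemma H_dominated:
  obtains A \<alpha> \<beta> where "0 \<le> A" "0 < \<alpha>" "0 < \<beta>"
    "\<And>z y. \<bar>H z y\<bar> * K y \<le> A * decay_weight s z * (indicator (ball 0 1) y * norm y powr (\<alpha> - real DIM('a)) +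
        indicator (- ball 0 1) y * norm y powr (- \<beta> - real DIM('a)) + indicator (ball 0 1) (z - y))"
proof -
  define k where "k = (if s < 1/2 then 1 else 2 :: nat)"
  define \<alpha> where "\<alpha> = real k - 2 * s"
  define \<beta> where "\<beta> = (if s \<le> 1/2 then 2 * s else 2 * s - 1)"
  define W where "W = 1 + 2 powr (real DIM('a) + 2 * s)"
  define A where "A = 2 * C * Lam * W"
  have \<alpha>: "0 < \<alpha>" and \<beta>: "0 < \<beta>" using s by (auto simp: \<alpha>_def k_def \<beta>_def)
  have W: "1 \<le> W" by (simp add: W_def)
  have A: "0 \<le> A" using C Lam_nonneg W by (simp add: A_def)
  note L = Lam_nonneg
  show ?thesis
  proof (rule that[OF A \<alpha> \<beta>])
    fix z y :: 'a
    let ?\<kappa> = "norm y powr (- (real DIM('a) + 2 * s))" and ?e = "decay_weight s z"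
    have e: "0 < ?e" by (rule decay_weight_pos)
    show "\<bar>H z y\<bar> * K y \<le> A * ?e * (indicator (ball 0 1) y * norm y powr (\<alpha> - real DIM('a)) +
        indicator (- ball 0 1) y * norm y powr (- \<beta> - real DIM('a)) + indicator (ball 0 1) (z - y))"
    proof (cases "norm y < 1")
      case y: True
      have main: "\<bar>H z y\<bar> * K y \<le> A * ?e * norm y powr (\<alpha> - real DIM('a))"
      proof (cases "norm z < 2")
        case False
        then have "1 \<le> norm (z - y)" using norm_triangle_ineq2[of z y] y by linarith
        then have "H z y = 0" using False by (simp add: H_def supp)
        then show ?thesis using A e by simp
      next
        case True
        have We: "1 \<le> W * ?e" using decay_weight_near[of s z 2] True s by (simp add: W_def)
        have T: "\<bar>\<eta> z - \<eta> (z - y) - G z \<bullet> y\<bar> \<le> C * (norm y)\<^sup>2" using taylor[of z "- y"] by simp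
        have "\<bar>H z y\<bar> \<le> 2 * C * norm y ^ k"
        proof (cases "s < 1/2")
          case True
          have "\<bar>G z \<bullet> y\<bar> \<le> C * norm y"
            using Cauchy_Schwarz_ineq2[of "G z" y] mult_right_mono[OF G_le[of z], of "norm y"] by simp
          moreover have "C * (norm y)\<^sup>2 \<le> C * norm y"
            using y C by (intro mult_left_mono) (auto simp: power2_eq_square mult_left_le)
          ultimately have "\<bar>\<eta> z - \<eta> (z - y)\<bar> \<le> 2 * (C * norm y)" using T by linarith
          then show ?thesis using True by (simp add: H_def correction_def k_def)
        next
          case False
          then have "correction s 1 y = 1" using y by (auto simp: correction_def)
          moreover have "C * (norm y)\<^sup>2 \<le> 2 * (C * (norm y)\<^sup>2)" using C by simp
          ultimately show ?thesis using T False by (simp add: H_def k_def)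
        qed
        then have "\<bar>H z y\<bar> * K y \<le> (2 * C * norm y ^ k) * (Lam * ?\<kappa>)"
          using K_bounds[of y] C by (intro mult_mono) auto
        also have "\<dots> = (2 * C * Lam) * (norm y ^ k * ?\<kappa>)" by simp
        also have "norm y ^ k * ?\<kappa> = norm y powr (\<alpha> - real DIM('a))"
          by (cases "y = 0") (auto simp: \<alpha>_def powr_realpow[symmetric] powr_add[symmetric] algebra_simps k_def)
        also have "(2 * C * Lam) * norm y powr (\<alpha> - real DIM('a)) * 1 \<le> (2 * C * Lam) * norm y powr (\<alpha> - real DIM('a)) * (W * ?e)"
          using We C L by (intro mult_left_mono) auto
        finally show ?thesis by (simp add: A_def mult_ac)
      qed
      have "A * ?e * norm y powr (\<alpha> - real DIM('a)) \<le> A * ?e * (norm y powr (\<alpha> - real DIM('a)) + indicator (ball 0 1) (z - y))"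
        using A e by (intro mult_left_mono) auto
      then show ?thesis using main y by simp
    next
      case False
      then have y: "1 \<le> norm y" by simp
      have kb: "?\<kappa> \<le> norm y powr (- \<beta> - real DIM('a))" "norm y * ?\<kappa> \<le> norm y powr (- \<beta> - real DIM('a))" if "s > 1/2"
      proof -
        have "norm y * ?\<kappa> = norm y powr 1 * ?\<kappa>" using y by simp
        also have "\<dots> = norm y powr (- \<beta> - real DIM('a))" using that by (simp only: powr_add[symmetric]) (simp add: \<beta>_def algebra_simps)
        finally show 1: "norm y * ?\<kappa> \<le> norm y powr (- \<beta> - real DIM('a))" by simp
        have "1 * ?\<kappa> \<le> norm y * ?\<kappa>" using y by (intro mult_right_mono) auto
        with 1 show "?\<kappa> \<le> norm y powr (- \<beta> - real DIM('a))" by simp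
      qed
      have kb': "?\<kappa> = norm y powr (- \<beta> - real DIM('a))" if "s \<le> 1/2"
        by (rule arg_cong[where f = "\<lambda>e. norm y powr e"]) (use that in \<open>simp add: \<beta>_def\<close>)
      have part1: "\<bar>\<eta> z - correction s 1 y * (G z \<bullet> y)\<bar> * K y \<le> A * ?e * norm y powr (- \<beta> - real DIM('a))"
      proof (cases "norm z \<le> 1")
        case False
        then show ?thesis using A e by (simp add: supp)
      next
        case True
        have We: "1 \<le> W * ?e" using decay_weight_near[of s z 2] True s by (simp add: W_def)
        have "\<bar>\<eta> z - correction s 1 y * (G z \<bullet> y)\<bar> * (Lam * ?\<kappa>) \<le> (2 * C * Lam) * norm y powr (- \<beta> - real DIM('a))"
        proof (cases "s \<le> 1/2")
          case True
          then have "correction s 1 y = 0" using False by (auto simp: correction_def)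
          moreover have "\<bar>\<eta> z\<bar> * (Lam * ?\<kappa>) \<le> (2 * C) * (Lam * ?\<kappa>)"
            using \<eta>_le[of z] C L by (intro mult_right_mono) auto
          ultimately show ?thesis unfolding kb'[OF True] by (simp add: mult_ac)
        next
          case s1: False
          then have "correction s 1 y = 1" by (auto simp: correction_def)
          then have "\<bar>\<eta> z - correction s 1 y * (G z \<bullet> y)\<bar> \<le> C + C * norm y"
            using \<eta>_le[of z] Cauchy_Schwarz_ineq2[of "G z" y] mult_right_mono[OF G_le[of z], of "norm y"] by simp
          then have "\<bar>\<eta> z - correction s 1 y * (G z \<bullet> y)\<bar> * (Lam * ?\<kappa>) \<le> (C + C * norm y) * (Lam * ?\<kappa>)"
            using L by (intro mult_right_mono) auto
          also have "\<dots> = C * Lam * (?\<kappa> + norm y * ?\<kappa>)" by (simp add: algebra_simps)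
          also have "\<dots> \<le> C * Lam * (norm y powr (- \<beta> - real DIM('a)) + norm y powr (- \<beta> - real DIM('a)))"
            using kb s1 C L by (intro mult_left_mono add_mono) auto
          finally show ?thesis by simp
        qed
        then have "\<bar>\<eta> z - correction s 1 y * (G z \<bullet> y)\<bar> * K y \<le> (2 * C * Lam) * norm y powr (- \<beta> - real DIM('a)) * 1"
          using mult_left_mono[OF K_bounds(2)[of y], of "\<bar>\<eta> z - correction s 1 y * (G z \<bullet> y)\<bar>"] by simp
        also have "\<dots> \<le> (2 * C * Lam) * norm y powr (- \<beta> - real DIM('a)) * (W * ?e)"
          using We C L by (intro mult_left_mono) auto
        finally show ?thesis by (simp add: A_def mult_ac)
      qed
      \<comment> \<open>Here z may be far away. Since z - y lies in the unit ball and |y| is at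
        least 1, |z| \<le> 2 |y|, so the kernel at y is bounded by the weight at z.\<close>
      have part2: "\<bar>\<eta> (z - y)\<bar> * K y \<le> A * ?e * indicator (ball 0 1) (z - y)"
      proof (cases "norm (z - y) < 1")
        case False
        then show ?thesis by (simp add: supp)
      next
        case True
        have "norm z \<le> 2 * (norm y / 1)" using norm_triangle_ineq2[of z y] True y by simp
        then have "?\<kappa> \<le> W * ?e" using decay_weight_far[OF s(1) _ y, of z 2] by (simp add: W_def)
        then have "C * (Lam * ?\<kappa>) \<le> C * (Lam * (W * ?e))" using C L by (intro mult_left_mono) auto
        moreover have "\<bar>\<eta> (z - y)\<bar> * K y \<le> C * (Lam * ?\<kappa>)"
          using \<eta>_le[of "z - y"] K_bounds[of y] C by (intro mult_mono) auto
        moreover have "C * (Lam * (W * ?e)) \<le> 2 * (C * (Lam * (W * ?e)))" using C L W e by simp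
        ultimately have "\<bar>\<eta> (z - y)\<bar> * K y \<le> 2 * (C * (Lam * (W * ?e)))" by linarith
        then show ?thesis using True by (simp add: A_def mult_ac)
      qed
      have "\<bar>H z y\<bar> * K y \<le> (\<bar>\<eta> z - correction s 1 y * (G z \<bullet> y)\<bar> + \<bar>\<eta> (z - y)\<bar>) * K y"
        unfolding H_def using K_bounds(1) by (intro mult_right_mono) auto
      also have "\<dots> \<le> A * ?e * norm y powr (- \<beta> - real DIM('a)) + A * ?e * indicator (ball 0 1) (z - y)"
        using part1 part2 by (simp add: distrib_right)
      finally show ?thesis using False by (simp add: distrib_left)
    qed
  qed
qed

text \<open>Fubini for w(z) H(z, y) K(y). Integrating in y first gives w times the adjoint operator
  on \<eta>, apart from the drift; integrating in z first gives the corrected increment of the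
  correlation times K. The domination shows that the absolute value is integrable in both
  variables.\<close>

lemma
  shows HK_integrable: "integrable lborel (\<lambda>y. H z y * K y)"
    and double_integral: "(LINT z|lborel. w z * (LINT y|lborel. H z y * K y)) =
      (LINT y|lborel. (conv w \<eta> 0 - conv w \<eta> y + correction s 1 y * (P \<bullet> y)) * K y)"
    and wHK_integrable: "integrable lborel (\<lambda>z. w z * (LINT y|lborel. H z y * K y))"
proof -
  obtain A \<alpha> \<beta> where A: "0 \<le> A" and \<alpha>: "0 < \<alpha>" and \<beta>: "0 < \<beta>" and dom:
    "\<And>z y. \<bar>H z y\<bar> * K y \<le> A * decay_weight s z * (indicator (ball 0 1) y * norm y powr (\<alpha> - real DIM('a)) +
        indicator (- ball 0 1) y * norm y powr (- \<beta> - real DIM('a)) + indicator (ball 0 1) (z - y))"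
    by (rule H_dominated) (rule that)
  define g where "g y = indicator (ball 0 1) y * norm y powr (\<alpha> - real DIM('a)) +
        indicator (- ball 0 1) y * norm y powr (- \<beta> - real DIM('a))" for y :: 'a
  have gi: "integrable lborel g"
  proof -
    have "integrable lborel (\<lambda>y::'a. indicator (ball 0 1) y * norm y powr (\<alpha> - real DIM('a)))"
      by (rule radial_integral_ball[OF \<alpha>, where 'a='a]) (metis zero_less_one)
    moreover have "integrable lborel (\<lambda>y::'a. indicator (- ball 0 1) y * norm y powr (- \<beta> - real DIM('a)))"
      by (rule radial_integral_outside[OF \<beta>, where 'a='a]) (metis zero_less_one)
    ultimately show ?thesis unfolding g_def[abs_def] by (rule Bochner_Integration.integrable_add)
  qed
  have ball_eq: "indicator (ball 0 1) (z - y) = (indicator (ball z 1) y :: real)" for z y :: 'a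
    by (simp add: indicator_def dist_norm norm_minus_commute)
  define \<Psi> where "\<Psi> z y = A * decay_weight s z * (g y + indicator (ball z 1) y)" for z y :: 'a
  have bi: "integrable lborel (indicator (ball z 1) :: 'a \<Rightarrow> real)" for z
    using emeasure_lborel_ball_finite[of z 1] by (intro integrable_real_indicator) auto
  have \<Psi>i: "integrable lborel (\<Psi> z)" for z
    unfolding \<Psi>_def[abs_def] using gi bi by (intro integrable_mult_right Bochner_Integration.integrable_add)
  have \<Psi>I: "(LINT y|lborel. \<Psi> z y) = A * decay_weight s z * (integral\<^sup>L lborel g + unit_ball_vol (real DIM('a)))" for z
  proof -
    have "(LINT y|lborel. g y + indicator (ball z 1) y) = integral\<^sup>L lborel g + (LINT y|lborel. indicator (ball z 1) y)"
      by (rule Bochner_Integration.integral_add[OF gi bi])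
    also have "(LINT y|lborel. indicator (ball z 1) y) = unit_ball_vol (real DIM('a))"
      using content_ball[of 1 z] by simp
    finally show ?thesis by (simp add: \<Psi>_def)
  qed
  have dom': "\<bar>H z y * K y\<bar> \<le> \<Psi> z y" for z y
    using dom[of z y] K_bounds(1)[of y] by (simp add: \<Psi>_def g_def ball_eq abs_mult)
  have Hm [measurable]: "H z \<in> borel_measurable borel" for z unfolding H_def[abs_def] by measurable
  show HKi: "integrable lborel (\<lambda>y. H z y * K y)" for z
    by (rule Bochner_Integration.integrable_bound[OF \<Psi>i[of z]])
       (use dom' in \<open>auto intro!: AE_I2 order_trans[OF _ abs_ge_self]\<close>)
  define F where "F z y = w z * (H z y * K y)" for z y
  have Fm [measurable]: "case_prod F \<in> borel_measurable (lborel \<Otimes>\<^sub>M lborel)"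
    unfolding F_def[abs_def] by measurable
  define c where "c = A * (integral\<^sup>L lborel g + unit_ball_vol (real DIM('a)))"
  have Fi: "integrable lborel (F z)" for z unfolding F_def[abs_def] by (intro integrable_mult_right HKi)
  have FI: "(LINT y|lborel. norm (F z y)) \<le> c * (\<bar>w z\<bar> * decay_weight s z)" for z
  proof -
    have "(LINT y|lborel. norm (F z y)) \<le> (LINT y|lborel. \<bar>w z\<bar> * \<Psi> z y)"
    proof (rule integral_mono[OF integrable_norm[OF Fi] integrable_mult_right[OF \<Psi>i]])
      fix y show "norm (F z y) \<le> \<bar>w z\<bar> * \<Psi> z y"
        using mult_left_mono[OF dom'[of z y] abs_ge_zero[of "w z"]] by (simp add: F_def abs_mult)
    qed
    also have "\<dots> = \<bar>w z\<bar> * (LINT y|lborel. \<Psi> z y)" by simp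
    finally show ?thesis unfolding \<Psi>I c_def by (simp add: mult_ac)
  qed
  have Fpi: "integrable (lborel \<Otimes>\<^sub>M lborel) (case_prod F)"
  proof (rule lborel_pair.Fubini_integrable)
    show "integrable lborel (\<lambda>z. LINT y|lborel. norm (case (z, y) of (z, y) \<Rightarrow> F z y))"
    proof (rule Bochner_Integration.integrable_bound[OF integrable_mult_right[OF w(2), of c]])
      show "AE z in lborel. norm (LINT y|lborel. norm (case (z, y) of (z, y) \<Rightarrow> F z y)) \<le> norm (c * (\<bar>w z\<bar> * decay_weight s z))"
      proof (rule AE_I2)
        fix z
        have "0 \<le> (LINT y|lborel. norm (F z y))" by (intro Bochner_Integration.integral_nonneg) simp
        then show "norm (LINT y|lborel. norm (case (z, y) of (z, y) \<Rightarrow> F z y)) \<le> norm (c * (\<bar>w z\<bar> * decay_weight s z))"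
          using FI[of z] by simp
      qed
    qed measurable
  qed (use Fi in auto)
  have "integrable lborel (\<lambda>z. LINT y|lborel. F z y)" using lborel_pair.integrable_fst[OF Fpi] by simp
  then show "integrable lborel (\<lambda>z. w z * (LINT y|lborel. H z y * K y))" by (simp add: F_def)
  have "(LINT y|lborel. LINT z|lborel. F z y) = (LINT z|lborel. LINT y|lborel. F z y)"
    using lborel_pair.Fubini_integral[OF Fpi] .
  moreover have "(LINT z|lborel. F z y) = (conv w \<eta> 0 - conv w \<eta> y + correction s 1 y * (P \<bullet> y)) * K y" for y
  proof -
    have "(LINT z|lborel. F z y) = (LINT z|lborel. w z * H z y * K y)" by (simp add: F_def mult.assoc)
    then show ?thesis using w_H_integral[of y] by simp
  qed
  ultimately show "(LINT z|lborel. w z * (LINT y|lborel. H z y * K y)) =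
      (LINT y|lborel. (conv w \<eta> 0 - conv w \<eta> y + correction s 1 y * (P \<bullet> y)) * K y)"
    by (simp add: F_def)
qed

text \<open>The reflected kernel satisfies the same bounds, and its shell moments are the negatives
  of those of K. The adjoint operator therefore has the absolutely convergent form too, and
  reflecting the variable brings back K. The drift enters with the opposite sign.\<close>

lemma stable_op_adj_eq:
  assumes KK: "AE y in lborel. K\<^sub>0 y = K y"
  shows "stable_op_adj s K\<^sub>0 b \<eta> z = (LINT y|lborel. H z y * K y) - (if s = 1/2 then b \<bullet> G z else 0)"
proof -
  define K' where "K' y = K (- y)" for y
  have K'm: "K' \<in> borel_measurable borel" unfolding K'_def[abs_def] by measurable
  have K': "stable_kernel s lam Lam K'"
    unfolding stable_kernel_def
  proof (intro conjI allI impI K'm)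
    fix y show "lam * norm y powr (- (real DIM('a) + 2 * s)) \<le> K' y" "K' y \<le> Lam * norm y powr (- (real DIM('a) + 2 * s))"
      using K by (auto simp: stable_kernel_def K'_def dest: spec[of _ "- y"])
  next
    fix p q :: real assume s2: "s = 1/2" and pq: "0 < p" "p < q"
    let ?f = "\<lambda>y::'a. indicator {y. p \<le> norm y \<and> norm y < q} y *\<^sub>R (K y *\<^sub>R y)"
    have "(LINT y|lborel. ?f (- y)) = (LINT y|lborel. ?f y)"
      by (rule lborel_integral_reflect) measurable
    also have "\<dots> = 0" using K s2 pq by (auto simp: stable_kernel_def)
    finally have "(LINT y|lborel. ?f (- y)) = 0" .
    moreover have "(LINT y|lborel. ?f (- y)) = (LINT y|lborel. - (indicator {y. p \<le> norm y \<and> norm y < q} y *\<^sub>R (K' y *\<^sub>R y)))"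
      by (intro Bochner_Integration.integral_cong refl) (simp add: K'_def indicator_def)
    ultimately show "(LINT y|lborel. indicator {y. p \<le> norm y \<and> norm y < q} y *\<^sub>R (K' y *\<^sub>R y)) = 0"
      by simp
  qed
  have KK': "AE y in lborel. K\<^sub>0 (- y) = K' y" unfolding K'_def by (rule AE_lborel_reflect[OF KK])
  define f where "f y = \<eta> z - \<eta> (z + y)" for y
  have fm: "f \<in> borel_measurable borel" unfolding f_def[abs_def] by measurable
  have gr: "grad \<eta> z = G z" by (rule grad_eqI[OF der])
  have op: "stable_op_adj s K\<^sub>0 b \<eta> z = increment_op s K' (- b) f (G z)"
    unfolding stable_op_adj_def f_def[abs_def] gr[symmetric]
    by (rule stable_op_increment[OF K'm KK']) auto
  have near: "\<bar>f y + G z \<bullet> y\<bar> \<le> C * (norm y)\<^sup>2" for y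
    using taylor[of z y] by (simp add: f_def)
  have tail: "integrable lborel (\<lambda>y. indicator (- ball 0 1) y * (\<bar>f y\<bar> * norm y powr (- (real DIM('a) + 2 * s))))"
  proof (rule Bochner_Integration.integrable_bound)
    have s2: "0 < 2 * s" using s by simp
    have "integrable lborel (\<lambda>y::'a. indicator (- ball 0 1) y * norm y powr (- (2 * s) - real DIM('a)))"
      by (rule radial_integral_outside[OF s2, where 'a='a]) (metis zero_less_one)
    then show "integrable lborel (\<lambda>y::'a. (2 * C) * (indicator (- ball 0 1) y * norm y powr (- (2 * s) - real DIM('a))))"
      by (rule integrable_mult_right)
    show "(\<lambda>y. indicator (- ball 0 1) y * (\<bar>f y\<bar> * norm y powr (- (real DIM('a) + 2 * s)))) \<in> borel_measurable lborel" using fm by measurable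
    have fb: "\<bar>f y\<bar> \<le> 2 * C" for y using \<eta>_le[of z] \<eta>_le[of "z + y"] by (simp add: f_def)
    show "AE y in lborel. norm (indicator (- ball 0 1) y * (\<bar>f y\<bar> * norm y powr (- (real DIM('a) + 2 * s))))
        \<le> norm ((2 * C) * (indicator (- ball 0 1) y * norm y powr (- (2 * s) - real DIM('a))))"
    proof (rule AE_I2)
      fix y :: 'a
      have e: "norm y powr (- (real DIM('a) + 2 * s)) = norm y powr (- (2 * s) - real DIM('a))"
        by (rule arg_cong[where f = "\<lambda>e. norm y powr e"]) simp
      have "\<bar>f y\<bar> * norm y powr (- (2 * s) - real DIM('a)) \<le> 2 * C * norm y powr (- (2 * s) - real DIM('a))"
        by (intro mult_right_mono fb) auto
      then show "norm (indicator (- ball 0 1) y * (\<bar>f y\<bar> * norm y powr (- (real DIM('a) + 2 * s))))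
        \<le> norm ((2 * C) * (indicator (- ball 0 1) y * norm y powr (- (2 * s) - real DIM('a))))"
        unfolding e using C by (auto simp: indicator_def abs_mult)
    qed
  qed
  have "increment_op s K' (- b) f (G z) = (LINT y|lborel. (f y + correction s 1 y * (G z \<bullet> y)) * K' y) + (if s = 1/2 then (- b) \<bullet> G z else 0)"
    by (rule increment_op_eq(2)[OF s lam K' fm zero_less_one order_refl near tail])
  moreover have "(LINT y|lborel. (f y + correction s 1 y * (G z \<bullet> y)) * K' y) = (LINT y|lborel. H z y * K y)"
  proof -
    have "(LINT y|lborel. H z (- y) * K (- y)) = (LINT y|lborel. H z y * K y)"
      by (rule lborel_integral_reflect) (simp add: H_def[abs_def])
    moreover have "H z (- y) * K (- y) = (f y + correction s 1 y * (G z \<bullet> y)) * K' y" for y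
      by (simp add: H_def f_def K'_def correction_minus)
    ultimately show ?thesis by simp
  qed
  ultimately show ?thesis unfolding op by simp
qed

text \<open>Testing with \<eta> is the same as applying the operator to the correlation at 0: the
  double integral is exchanged, and the drift -b acting on G becomes b acting on P because P carries
  a minus sign.\<close>

lemma weak_increment_bound:
  assumes KK: "AE y in lborel. K\<^sub>0 y = K y" and uw: "AE y in lborel. u y = w y"
    and weak: "weak_subsolution s K\<^sub>0 b C\<^sub>0 u" and test: "test_function (ball 0 1) \<eta>"
  shows "increment_op s K b (\<lambda>y. conv w \<eta> 0 - conv w \<eta> y) P \<le> C\<^sub>0 * (LINT z|lborel. \<eta> z)"
proof -
  have "(LINT x|lebesgue. u x * stable_op_adj s K\<^sub>0 b \<eta> x) \<le> C\<^sub>0 * (LINT x:ball 0 1|lebesgue. \<eta> x)"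
    using weak test \<eta>_nonneg by (auto simp: weak_subsolution_def)
  also have "(LINT x:ball 0 1|lebesgue. \<eta> x) = (LINT z|lborel. \<eta> z)"
    unfolding set_lebesgue_integral_def
  proof (rule lebesgue_AE_eq(2))
    show "AE x in lborel. indicator (ball 0 1) x *\<^sub>R \<eta> x = \<eta> x"
      using supp(1) by (intro AE_I2) (auto simp: indicator_def not_less)
  qed measurable
  also have "(LINT x|lebesgue. u x * stable_op_adj s K\<^sub>0 b \<eta> x) =
      (LINT z|lborel. w z * (LINT y|lborel. H z y * K y) - (if s = 1/2 then 1 else 0) * (w z * (G z \<bullet> b)))"
  proof (rule lebesgue_AE_eq(2))
    show "AE x in lborel. u x * stable_op_adj s K\<^sub>0 b \<eta> x =
        w x * (LINT y|lborel. H x y * K y) - (if s = 1/2 then 1 else 0) * (w x * (G x \<bullet> b))"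
      using uw by eventually_elim (simp add: stable_op_adj_eq[OF KK] right_diff_distrib inner_commute)
  qed measurable
  also have "\<dots> = (LINT z|lborel. w z * (LINT y|lborel. H z y * K y)) - (if s = 1/2 then 1 else 0) * (LINT z|lborel. w z * (G z \<bullet> b))"
    using wHK_integrable wG_inner(1)[of b]
    by (simp only: Bochner_Integration.integral_diff integrable_mult_right integral_mult_right_zero)
  also have "\<dots> = (LINT y|lborel. (conv w \<eta> 0 - conv w \<eta> y + correction s 1 y * (P \<bullet> y)) * K y) + (if s = 1/2 then b \<bullet> P else 0)"
    unfolding double_integral wG_inner(2) by (simp add: inner_commute)
  also have "\<dots> = increment_op s K b (\<lambda>y. conv w \<eta> 0 - conv w \<eta> y) P"
  proof (rule increment_op_eq(2)[OF s lam K _ zero_less_one order_refl conv_taylor, symmetric])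
    note [measurable] = conv_measurable[OF meas(3,1)]
    show "(\<lambda>y. conv w \<eta> 0 - conv w \<eta> y) \<in> borel_measurable borel" by measurable
    show "integrable lborel (\<lambda>y. indicator (- ball 0 1) y * (\<bar>conv w \<eta> 0 - conv w \<eta> y\<bar> * norm y powr (- (real DIM('a) + 2 * s))))"
    proof (rule Bochner_Integration.integrable_bound)
      have s2: "0 < 2 * s" using s by simp
      have "integrable lborel (\<lambda>y::'a. indicator (- ball 0 1) y * norm y powr (- (2 * s) - real DIM('a)))"
        by (rule radial_integral_outside[OF s2, where 'a='a]) (metis zero_less_one)
      moreover have "integrable lborel (\<lambda>y. \<bar>conv w \<eta> y\<bar> * decay_weight s y)"
        by (rule conv_decay(1)[OF s(1) w meas(1) eta_integrable \<eta>_nonneg supp(1)])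
      ultimately show "integrable lborel (\<lambda>y. \<bar>conv w \<eta> 0\<bar> * (indicator (- ball 0 1) y * norm y powr (- (2 * s) - real DIM('a))) +
          (1 + 1 powr (real DIM('a) + 2 * s)) * (\<bar>conv w \<eta> y\<bar> * decay_weight s y))"
        by (intro Bochner_Integration.integrable_add integrable_mult_right)
      show "AE y in lborel. norm (indicator (- ball 0 1) y * (\<bar>conv w \<eta> 0 - conv w \<eta> y\<bar> * norm y powr (- (real DIM('a) + 2 * s))))
        \<le> norm (\<bar>conv w \<eta> 0\<bar> * (indicator (- ball 0 1) y * norm y powr (- (2 * s) - real DIM('a))) +
          (1 + 1 powr (real DIM('a) + 2 * s)) * (\<bar>conv w \<eta> y\<bar> * decay_weight s y))"
      proof (rule AE_I2)
        fix y :: 'a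
        have n0: "0 \<le> (1 + 1 powr (real DIM('a) + 2 * s)) * (\<bar>conv w \<eta> y\<bar> * decay_weight s y)"
          using decay_weight_pos[of s y] by simp
        show "norm (indicator (- ball 0 1) y * (\<bar>conv w \<eta> 0 - conv w \<eta> y\<bar> * norm y powr (- (real DIM('a) + 2 * s))))
          \<le> norm (\<bar>conv w \<eta> 0\<bar> * (indicator (- ball 0 1) y * norm y powr (- (2 * s) - real DIM('a))) +
            (1 + 1 powr (real DIM('a) + 2 * s)) * (\<bar>conv w \<eta> y\<bar> * decay_weight s y))"
        proof (cases "norm y < 1")
          case True
          then show ?thesis using n0 by simp
        next
          case False
          then have "norm y powr (- (real DIM('a) + 2 * s)) \<le> (1 + 1 powr (real DIM('a) + 2 * s)) * decay_weight s y"
            using decay_weight_far[OF s(1) zero_less_one, of y y 1] by simp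
          then have 1: "\<bar>conv w \<eta> y\<bar> * norm y powr (- (real DIM('a) + 2 * s)) \<le> \<bar>conv w \<eta> y\<bar> * ((1 + 1 powr (real DIM('a) + 2 * s)) * decay_weight s y)"
            by (intro mult_left_mono) auto
          have 2: "\<bar>conv w \<eta> 0 - conv w \<eta> y\<bar> * norm y powr (- (real DIM('a) + 2 * s)) \<le> (\<bar>conv w \<eta> 0\<bar> + \<bar>conv w \<eta> y\<bar>) * norm y powr (- (real DIM('a) + 2 * s))"
            by (intro mult_right_mono) auto
          have 3: "- (real DIM('a) + 2 * s) = - (2 * s) - real DIM('a)" by simp
          show ?thesis using 1 2 n0 False unfolding 3 by (simp add: distrib_right mult_ac)
        qed
      qed
    qed measurable
  qed
  finally show ?thesis .
qed

end

section \<open>Contact points of mollified subsolutions and the almost everywhere bound\<close>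

lemma touching_gradient:
  fixes P q :: "'a::euclidean_space" and f :: "'a \<Rightarrow> real"
  assumes \<rho>: "0 < \<rho>" and P: "\<And>y. norm y < \<rho> \<Longrightarrow> \<bar>c - f y + P \<bullet> y\<bar> \<le> C * (norm y)\<^sup>2"
    and q: "\<And>y. norm y < \<rho> \<Longrightarrow> f y \<le> c + q \<bullet> y + B * (norm y)\<^sup>2"
  shows "P = q"
proof (rule ccontr)
  assume "P \<noteq> q"
  \<comment> \<open>Combining both expansions along t v gives t |v|^2 \<le> (B + C) t^2 |v|^2. The
    choice of t keeps t v in the ball and makes D t at most 1/2, a contradiction.\<close>
  define v where "v = P - q"
  have v: "0 < norm v" using \<open>P \<noteq> q\<close> by (simp add: v_def)
  define D where "D = \<bar>B + C\<bar> + 1"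
  define t where "t = min (\<rho> / (2 * norm v)) (1 / (2 * D))"
  have D: "1 \<le> D" by (simp add: D_def)
  have t: "0 < t" using \<rho> v D by (simp add: t_def)
  have "t * norm v \<le> \<rho> / 2" using v by (simp add: t_def min_def field_simps)
  then have y: "norm (t *\<^sub>R v) < \<rho>" using t \<rho> by simp
  have "P \<bullet> (t *\<^sub>R v) \<le> q \<bullet> (t *\<^sub>R v) + (B + C) * (norm (t *\<^sub>R v))\<^sup>2"
    using P[OF y] q[OF y] by (simp add: distrib_right abs_le_iff)
  moreover have "v \<bullet> (t *\<^sub>R v) = P \<bullet> (t *\<^sub>R v) - q \<bullet> (t *\<^sub>R v)" by (simp only: v_def inner_diff_left)
  ultimately have e1: "v \<bullet> (t *\<^sub>R v) \<le> (B + C) * (norm (t *\<^sub>R v))\<^sup>2" by linarith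
  have e2: "v \<bullet> (t *\<^sub>R v) = (t * (norm v)\<^sup>2) * 1" by (simp add: power2_norm_eq_inner)
  have e3: "(B + C) * (norm (t *\<^sub>R v))\<^sup>2 \<le> D * (norm (t *\<^sub>R v))\<^sup>2" by (intro mult_right_mono) (auto simp: D_def)
  have e4: "D * (norm (t *\<^sub>R v))\<^sup>2 = (t * (norm v)\<^sup>2) * (D * t)" using t by (simp add: power_mult_distrib power2_eq_square)
  have "(t * (norm v)\<^sup>2) * 1 \<le> (t * (norm v)\<^sup>2) * (D * t)" using order_trans[OF e1 e3] unfolding e2 e4 .
  then have "1 \<le> D * t" using t v by (subst (asm) mult_le_cancel_left_pos) auto
  moreover have "D * t \<le> D * (1 / (2 * D))" using D by (intro mult_left_mono) (auto simp: t_def)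
  moreover have "D * (1 / (2 * D)) = 1/2" using D by simp
  ultimately show False by linarith
qed

text \<open>The correlation U with a density of mass 1 satisfies the inequality pointwise in the
  closed ball of radius 3/4: a density supported in the ball of radius 1/8 and moved by at most 3/4
  is still a test function in the unit ball. The contact argument then applies to U, whose norm is
  at most \<open>W * N\<close>, with a constant free of k, j and the box.\<close>

lemma weak_mollified_bound:
  fixes s lam Lam :: real
  assumes s: "0 < s" "s < 1" and lam: "0 < lam" "lam \<le> Lam"
  obtains A where "0 < A"
    "\<And>(K\<^sub>0 :: 'a::euclidean_space \<Rightarrow> real) K b u w C\<^sub>0 x N k j l l'.
       stable_kernel s lam Lam K \<Longrightarrow> AE y in lborel. K\<^sub>0 y = K y \<Longrightarrow> (s = 1/2 \<longrightarrow> norm b \<le> Lam) \<Longrightarrow>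
       w \<in> borel_measurable borel \<Longrightarrow> AE y in lborel. u y = w y \<Longrightarrow> 0 < C\<^sub>0 \<Longrightarrow>
       weak_subsolution s K\<^sub>0 b C\<^sub>0 u \<Longrightarrow> integrable lborel (\<lambda>z. \<bar>w z\<bar> * decay_weight s z) \<Longrightarrow>
       (LINT z|lborel. \<bar>w z\<bar> * decay_weight s z) \<le> N \<Longrightarrow> norm x < 1/2 \<Longrightarrow>
       0 \<le> k \<Longrightarrow> box l l' \<subseteq> ball 0 (1/8) \<Longrightarrow> (LINT z|lborel. k * box_bump j l l' z) = 1 \<Longrightarrow>
       conv w (\<lambda>z. k * box_bump j l l' z) x \<le> A * (N + C\<^sub>0)"
proof -
  define n where "n = real DIM('a)"
  have n: "1 \<le> n" by (simp add: n_def Suc_le_eq)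
  have p1: "0 \<le> 2 * n" "0 \<le> 19 * n\<^sup>2" "0 < 1 / (6 * n)" using n by auto
  obtain \<theta> A where \<theta>: "0 < \<theta>" "\<theta> \<le> 1 / (6 * n)" "\<theta> \<le> 1" and A: "0 < A"
    and contact: "\<And>(K :: 'a \<Rightarrow> real) b V x\<^sub>0 u\<^sub>0 d p N \<rho> C C\<^sub>0.
       stable_kernel s lam Lam K \<Longrightarrow> (s = 1/2 \<longrightarrow> norm b \<le> Lam) \<Longrightarrow> V \<in> borel_measurable borel \<Longrightarrow>
       norm x\<^sub>0 < 1 \<Longrightarrow> 0 < d \<Longrightarrow> d \<le> 1 \<Longrightarrow> 0 < u\<^sub>0 \<Longrightarrow> norm p \<le> (2 * n) / d \<Longrightarrow>
       (\<forall>y. norm y < \<theta> * d \<longrightarrow> V (x\<^sub>0 + y) \<le> u\<^sub>0 * (1 + p \<bullet> y + (19 * n\<^sup>2) / d\<^sup>2 * (norm y)\<^sup>2)) \<Longrightarrow>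
       0 < \<rho> \<Longrightarrow> \<rho> \<le> \<theta> * d \<Longrightarrow>
       (\<forall>y. norm y < \<rho> \<longrightarrow> \<bar>u\<^sub>0 - V (x\<^sub>0 + y) + (u\<^sub>0 *\<^sub>R p) \<bullet> y\<bar> \<le> C * (norm y)\<^sup>2) \<Longrightarrow>
       integrable lborel (\<lambda>z. \<bar>V z\<bar> * decay_weight s z) \<Longrightarrow> (LINT z|lborel. \<bar>V z\<bar> * decay_weight s z) \<le> N \<Longrightarrow>
       0 \<le> C\<^sub>0 \<Longrightarrow> increment_op s K b (\<lambda>y. u\<^sub>0 - V (x\<^sub>0 + y)) (u\<^sub>0 *\<^sub>R p) \<le> C\<^sub>0 \<Longrightarrow>
       u\<^sub>0 * d ^ DIM('a) \<le> A * (N + C\<^sub>0)"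
    by (rule contact_point_bound[OF s lam p1, where 'a='a]) (rule that)
  define c where "c = (5/16 :: real) ^ DIM('a)"
  have c: "0 < c" by (simp add: c_def)
  define W where "W = 1 + 2 powr (real DIM('a) + 2 * s)"
  have W: "1 \<le> W" by (simp add: W_def)
  show ?thesis
  proof (rule that[of "A * W / c"])
    show "0 < A * W / c" using A c W by simp
    fix K\<^sub>0 K :: "'a \<Rightarrow> real" and b :: 'a and u w :: "'a \<Rightarrow> real" and C\<^sub>0 N k :: real and x l l' :: 'a and j :: nat
    assume K: "stable_kernel s lam Lam K" and KK: "AE y in lborel. K\<^sub>0 y = K y" and b: "s = 1/2 \<longrightarrow> norm b \<le> Lam"
      and wm: "w \<in> borel_measurable borel" and uw: "AE y in lborel. u y = w y" and C0: "0 < C\<^sub>0"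
      and weak: "weak_subsolution s K\<^sub>0 b C\<^sub>0 u" and wi: "integrable lborel (\<lambda>z. \<bar>w z\<bar> * decay_weight s z)"
      and wN: "(LINT z|lborel. \<bar>w z\<bar> * decay_weight s z) \<le> N" and x: "norm x < 1/2"
      and k: "0 \<le> k" and box: "box l l' \<subseteq> ball 0 (1/8)" and one: "(LINT z|lborel. k * box_bump j l l' z) = 1"
    define \<eta> where "\<eta> z = k * box_bump j l l' z" for z
    define U where "U = conv w \<eta>"
    have N0: "0 \<le> N"
      by (rule order_trans[OF Bochner_Integration.integral_nonneg wN]) (intro mult_nonneg_nonneg abs_ge_zero less_imp_le[OF decay_weight_pos])
    have \<eta>0: "0 \<le> \<eta> z" for z using k by (simp add: \<eta>_def box_bump_nonneg)
    have \<eta>out: "\<eta> z = 0" if "1/8 \<le> norm z" for z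
    proof -
      have "z \<notin> box l l'" using box that by auto
      then show ?thesis by (simp add: \<eta>_def box_bump_outside)
    qed
    have el: "elementary (\<lambda>z. \<eta> (z - x))" for x
      unfolding \<eta>_def by (intro elementary.mult elementary.const elementary_box_bump)
    have \<eta>m [measurable]: "\<eta> \<in> borel_measurable borel"
    proof -
      have "C_k_on 0 UNIV (\<lambda>z. \<eta> (z - 0))" by (rule elementary_C_k_on[OF el])
      then show ?thesis by (auto intro: borel_measurable_continuous_onI)
    qed
    have int1: "(LINT z|lborel. \<eta> z) = 1" using one by (simp add: \<eta>_def)
    then have \<eta>i: "integrable lborel \<eta>" using not_integrable_integral_eq[of lborel \<eta>] by auto
    \<comment> \<open>Everything near x is read off at the origin for the translated density
      \<zeta>, supported in the ball of radius 7/8.\<close>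
    have local: "\<exists>P C. (\<forall>y. norm y < 1 \<longrightarrow> \<bar>U x - U (x + y) + P \<bullet> y\<bar> \<le> C * (norm y)\<^sup>2) \<and>
        increment_op s K b (\<lambda>y. U x - U (x + y)) P \<le> C\<^sub>0" if x: "norm x \<le> 3/4" for x
    proof -
      define \<zeta> where "\<zeta> z = \<eta> (z - x)" for z
      have far: "1/8 \<le> norm (z - x)" if "7/8 \<le> norm z" for z
        using norm_triangle_ineq2[of z x] that x by linarith
      have \<zeta>out: "\<zeta> z = 0" if "7/8 \<le> norm z" for z
        unfolding \<zeta>_def by (rule \<eta>out[OF far[OF that]])
      have \<zeta>C: "C_k_on k UNIV \<zeta>" for k unfolding \<zeta>_def[abs_def] by (rule elementary_C_k_on[OF el])
      have \<zeta>out1: "\<zeta> z = 0" if "1 \<le> norm z" for z using \<zeta>out[of z] that by simp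
      obtain G C where G: "0 \<le> C" "\<And>x. (\<zeta> has_derivative (\<lambda>h. G x \<bullet> h)) (at x)" "continuous_on UNIV G"
        "\<And>x. \<bar>\<zeta> x\<bar> \<le> C" "\<And>x. norm (G x) \<le> C" "\<And>x y. \<bar>\<zeta> (x + y) - \<zeta> x - G x \<bullet> y\<bar> \<le> C * (norm y)\<^sup>2"
        "\<And>x. 1 < norm x \<Longrightarrow> G x = 0"
        by (rule C2_taylor_bounds[where R = 1, OF \<zeta>C \<zeta>out1]) (assumption, rule that)
      interpret T: test_setting s lam Lam K w \<zeta> G C
        by unfold_locales (fact s lam K wm wi G \<zeta>out1 | simp add: \<zeta>_def \<eta>0)+
      have sub: "closure {z. \<zeta> z \<noteq> 0} \<subseteq> cball 0 (7/8)"
      proof (rule closure_minimal)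
        show "{z. \<zeta> z \<noteq> 0} \<subseteq> cball 0 (7/8)" using \<zeta>out by (auto simp: not_le) (metis less_imp_le not_less)
      qed simp
      have "test_function (ball 0 1) \<zeta>"
        unfolding test_function_def
      proof (intro conjI allI \<zeta>C)
        show "compact (closure {z. \<zeta> z \<noteq> 0})"
          using sub by (meson bounded_cball bounded_subset closed_closure compact_eq_bounded_closed)
        show "closure {z. \<zeta> z \<noteq> 0} \<subseteq> ball 0 1" using sub by (rule order_trans) auto
      qed
      then have op: "increment_op s K b (\<lambda>y. conv w \<zeta> 0 - conv w \<zeta> y) T.P \<le> C\<^sub>0 * (LINT z|lborel. \<zeta> z)"
        by (rule T.weak_increment_bound[OF KK uw weak])
      have cz: "conv w \<zeta> y = U (x + y)" for y unfolding \<zeta>_def[abs_def] U_def by (rule conv_shift)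
      have "(LINT z|lborel. \<eta> (- x + z)) = (LINT z|lborel. \<eta> z)" by (rule lborel_translate(2)) measurable
      then have "(LINT z|lborel. \<zeta> z) = 1" by (simp add: \<zeta>_def int1)
      then have "increment_op s K b (\<lambda>y. U x - U (x + y)) T.P \<le> C\<^sub>0" using op by (simp add: cz)
      moreover have "\<bar>U x - U (x + y) + T.P \<bullet> y\<bar> \<le> (C * (1 + 2 powr (real DIM('a) + 2 * s)) * (LINT z|lborel. \<bar>w z\<bar> * decay_weight s z)) * (norm y)\<^sup>2"
        if "norm y < 1" for y using T.conv_taylor[OF that] by (simp add: cz)
      ultimately show ?thesis by blast
    qed
    have usc: "\<forall>\<^sub>F z in nhds x. U z < a" if x: "norm x \<le> 3/4" and a: "U x < a" for x a
    proof -
      obtain P C where PC: "\<And>y. norm y < 1 \<Longrightarrow> \<bar>U x - U (x + y) + P \<bullet> y\<bar> \<le> C * (norm y)\<^sup>2" using local[OF x] by blast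
      have "(U has_derivative (\<lambda>h. P \<bullet> h)) (at x)"
      proof (rule taylor_imp_has_derivative[OF zero_less_one])
        fix y :: 'a assume "norm y < 1"
        from PC[OF this] show "\<bar>U (x + y) - U x - P \<bullet> y\<bar> \<le> C * (norm y)\<^sup>2" by linarith
      qed
      then have "isCont U x" by (rule has_derivative_continuous)
      then have "(U \<longlongrightarrow> U x) (nhds x)" by (simp add: continuous_at tendsto_at_iff_tendsto_nhds)
      then show ?thesis using a by (rule order_tendstoD(2))
    qed
    have \<eta>out1: "\<eta> z = 0" if "1 \<le> norm z" for z using \<eta>out[of z] that by simp
    have Um: "U \<in> borel_measurable borel" unfolding U_def by (rule conv_measurable[OF wm \<eta>m])
    have Ui: "integrable lborel (\<lambda>z. \<bar>U z\<bar> * decay_weight s z)"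
      unfolding U_def by (rule conv_decay(1)[OF s(1) wm wi \<eta>m \<eta>i \<eta>0 \<eta>out1])
    have UN: "(LINT z|lborel. \<bar>U z\<bar> * decay_weight s z) \<le> W * N"
    proof -
      have "(LINT z|lborel. \<bar>U z\<bar> * decay_weight s z) \<le> W * (LINT z|lborel. \<bar>w z\<bar> * decay_weight s z) * (LINT z|lborel. \<eta> z)"
        unfolding U_def W_def by (rule conv_decay(2)[OF s(1) wm wi \<eta>m \<eta>i \<eta>0 \<eta>out1])
      also have "\<dots> \<le> W * N * 1" unfolding int1 using W wN by (intro mult_right_mono mult_left_mono) auto
      finally show ?thesis by simp
    qed
    show "conv w (\<lambda>z. k * box_bump j l l' z) x \<le> A * W / c * (N + C\<^sub>0)"
      unfolding \<eta>_def[abs_def, symmetric] U_def[symmetric]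
    proof (cases "0 < U x")
      case False
      have "0 \<le> A * W / c * (N + C\<^sub>0)" using A c W N0 C0 by simp
      then show "U x \<le> A * W / c * (N + C\<^sub>0)" using False by linarith
    next
      case True
      obtain x\<^sub>0 d p where x0: "norm x\<^sub>0 < 3/4" and d: "0 < d" "d \<le> 1" and u0: "0 < U x\<^sub>0"
        and main: "U x * (5/16) ^ DIM('a) \<le> U x\<^sub>0 * d ^ DIM('a)" and p: "norm p \<le> 2 * n / d"
        and up: "\<And>y. norm y < 1 / (6 * n) * d \<Longrightarrow> U (x\<^sub>0 + y) \<le> U x\<^sub>0 * (1 + p \<bullet> y + 19 * n\<^sup>2 / d\<^sup>2 * (norm y)\<^sup>2)"
        by (rule barrier_contact_point[OF usc x True]) (simp_all add: n_def)
      obtain P C where PC: "\<And>y. norm y < 1 \<Longrightarrow> \<bar>U x\<^sub>0 - U (x\<^sub>0 + y) + P \<bullet> y\<bar> \<le> C * (norm y)\<^sup>2"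
        and op: "increment_op s K b (\<lambda>y. U x\<^sub>0 - U (x\<^sub>0 + y)) P \<le> C\<^sub>0"
        using local[of x\<^sub>0] x0 by auto
      have td: "\<theta> * d \<le> 1 / (6 * n) * d" using \<theta>(2) d by (intro mult_right_mono) auto
      have td1: "\<theta> * d \<le> 1" using \<theta> d by (intro mult_le_one) auto
      have td0: "0 < \<theta> * d" using \<theta> d by simp
      have up': "U (x\<^sub>0 + y) \<le> U x\<^sub>0 * (1 + p \<bullet> y + 19 * n\<^sup>2 / d\<^sup>2 * (norm y)\<^sup>2)" if "norm y < \<theta> * d" for y
        using up[of y] that td by linarith
      \<comment> \<open>The operator bound comes with the true gradient of U, the contact estimate
        with the gradient of the barrier. Touching from above identifies the two.\<close>
      have Pp: "P = U x\<^sub>0 *\<^sub>R p"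
      proof (rule touching_gradient[OF td0])
        fix y :: 'a assume y: "norm y < \<theta> * d"
        show "\<bar>U x\<^sub>0 - U (x\<^sub>0 + y) + P \<bullet> y\<bar> \<le> C * (norm y)\<^sup>2" using y td1 by (intro PC) linarith
        have "U x\<^sub>0 * (1 + p \<bullet> y + 19 * n\<^sup>2 / d\<^sup>2 * (norm y)\<^sup>2) =
            U x\<^sub>0 + (U x\<^sub>0 *\<^sub>R p) \<bullet> y + U x\<^sub>0 * (19 * n\<^sup>2 / d\<^sup>2) * (norm y)\<^sup>2"
          by (simp add: distrib_left)
        then show "U (x\<^sub>0 + y) \<le> U x\<^sub>0 + (U x\<^sub>0 *\<^sub>R p) \<bullet> y + U x\<^sub>0 * (19 * n\<^sup>2 / d\<^sup>2) * (norm y)\<^sup>2"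
          using up'[OF y] by linarith
      qed
      have "U x\<^sub>0 * d ^ DIM('a) \<le> A * (W * N + C\<^sub>0)"
      proof (rule contact[OF K b Um _ d u0 p _ td0 order_refl _ Ui UN _ op[unfolded Pp]])
        show "norm x\<^sub>0 < 1" using x0 by simp
        show "\<forall>y. norm y < \<theta> * d \<longrightarrow> U (x\<^sub>0 + y) \<le> U x\<^sub>0 * (1 + p \<bullet> y + 19 * n\<^sup>2 / d\<^sup>2 * (norm y)\<^sup>2)"
          using up' by blast
        show "\<forall>y. norm y < \<theta> * d \<longrightarrow> \<bar>U x\<^sub>0 - U (x\<^sub>0 + y) + (U x\<^sub>0 *\<^sub>R p) \<bullet> y\<bar> \<le> C * (norm y)\<^sup>2"
          using PC[unfolded Pp] td1 by auto
      qed (use C0 in simp)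
      also have "\<dots> \<le> A * (W * (N + C\<^sub>0))"
      proof -
        have "1 * C\<^sub>0 \<le> W * C\<^sub>0" using W C0 by (intro mult_right_mono) auto
        then show ?thesis using A by (intro mult_left_mono) (auto simp: distrib_left)
      qed
      also have "\<dots> = A * W * (N + C\<^sub>0)" by simp
      finally have "U x * c \<le> A * W * (N + C\<^sub>0)" unfolding c_def by (rule order_trans[OF main])
      then show "U x \<le> A * W / c * (N + C\<^sub>0)" using c by (simp add: field_simps)
    qed
  qed
qed

text \<open>The bumps normalised to mass 1 converge to the normalised indicator of the box.
  Dominated convergence passes the uniform bound to the limit, written without division as
  \<open>a j \<le> B * c j\<close>. The masses \<open>c j\<close> are positive for large j because
  their limit is.\<close>

lemma box_average_bound:
  fixes w :: "'a::euclidean_space \<Rightarrow> real"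
  assumes s: "0 < s" and w: "w \<in> borel_measurable borel" "integrable lborel (\<lambda>z. \<bar>w z\<bar> * decay_weight s z)"
    and h: "0 < h" "real DIM('a) * h \<le> 1/8"
    and bound: "\<And>k j. 0 \<le> k \<Longrightarrow> (LINT z|lborel. k * box_bump j 0 (h *\<^sub>R One) (z :: 'a)) = 1 \<Longrightarrow>
       conv w (\<lambda>z. k * box_bump j 0 (h *\<^sub>R One) z) x \<le> B"
  shows "(LINT z|lborel. w z * indicator (box x (x + h *\<^sub>R One)) z) \<le> B * h ^ DIM('a)"
proof -
  let ?b = "box 0 (h *\<^sub>R One) :: 'a set"
  have bm: "(\<lambda>z. box_bump j 0 (h *\<^sub>R One) (z - c)) \<in> borel_measurable borel" for j and c :: 'a
    using elementary_C_k_on[OF elementary_box_bump, of 0 UNIV j 0 "h *\<^sub>R One" c]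
    by (auto intro: borel_measurable_continuous_onI)
  have box_sub: "norm z \<le> 1/8" if "z \<in> ?b" for z
  proof -
    have "norm z \<le> (\<Sum>i\<in>Basis. \<bar>z \<bullet> i\<bar>)" by (rule norm_le_l1)
    also have "\<dots> \<le> (\<Sum>i\<in>(Basis::'a set). h)"
      by (rule sum_mono) (use that in \<open>auto simp: mem_box\<close>)
    finally show ?thesis using h(2) by simp
  qed
  define g :: "'a \<Rightarrow> real" where "g z = indicator (cball x 1) z" for z
  have gi: "integrable lborel (\<lambda>z. w z * g z)"
  proof (rule integrable_mult_compact_support(1)[OF s w])
    show "g \<in> borel_measurable borel" unfolding g_def[abs_def] by (intro borel_measurable_indicator borel_closed closed_cball)
    show "\<bar>g z\<bar> \<le> 1" for z by (simp add: g_def indicator_def)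
    show "g z = 0" if "norm x + 2 \<le> norm z" for z
      using norm_triangle_ineq2[of z x] that by (simp add: g_def indicator_def dist_norm norm_minus_commute)
  qed simp
  have bump_le: "box_bump j 0 (h *\<^sub>R One) (z - x) \<le> g z" for j z
  proof (cases "z - x \<in> ?b")
    case True
    then have "g z = 1" using box_sub[OF True] by (simp add: g_def indicator_def dist_norm norm_minus_commute)
    then show ?thesis by (simp add: box_bump_le_1)
  qed (simp add: box_bump_outside g_def)
  define a where "a j = (LINT z|lborel. w z * box_bump j 0 (h *\<^sub>R One) (z - x))" for j
  define c where "c j = (LINT z|lborel. box_bump j 0 (h *\<^sub>R One) (z :: 'a))" for j
  have am: "(\<lambda>z. w z * indicator ?b (z - x)) \<in> borel_measurable borel" using w(1) by measurable
  have "a \<longlonglongrightarrow> (LINT z|lborel. w z * indicator ?b (z - x))"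
    unfolding a_def
  proof (rule integral_dominated_convergence[where w = "\<lambda>z. norm (w z * g z)"])
    show "(\<lambda>z. w z * box_bump j 0 (h *\<^sub>R One) (z - x)) \<in> borel_measurable lborel" for j
      using w(1) bm[of j x] by simp
    show "AE z in lborel. (\<lambda>j. w z * box_bump j 0 (h *\<^sub>R One) (z - x)) \<longlonglongrightarrow> w z * indicator ?b (z - x)"
      by (intro AE_I2 tendsto_mult tendsto_const box_bump_tendsto)
    show "AE z in lborel. norm (w z * box_bump j 0 (h *\<^sub>R One) (z - x)) \<le> norm (w z * g z)" for j
    proof (rule AE_I2)
      fix z
      show "norm (w z * box_bump j 0 (h *\<^sub>R One) (z - x)) \<le> norm (w z * g z)"
        using bump_le[of j z] box_bump_nonneg[of j 0 "h *\<^sub>R One" "z - x"]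
        by (simp add: abs_mult mult_left_mono)
    qed
  qed (use am gi in auto)
  moreover have "(\<lambda>z. w z * indicator ?b (z - x)) = (\<lambda>z. w z * indicator (box x (x + h *\<^sub>R One)) z)"
    by (rule ext) (auto simp: indicator_def mem_box inner_diff_left inner_add_left algebra_simps)
  ultimately have a_lim: "a \<longlonglongrightarrow> (LINT z|lborel. w z * indicator (box x (x + h *\<^sub>R One)) z)" by simp
  have "c \<longlonglongrightarrow> (LINT z|lborel. indicator ?b z)"
    unfolding c_def
  proof (rule integral_dominated_convergence[where w = "indicator ?b"])
    show "integrable lborel (indicator ?b :: 'a \<Rightarrow> real)"
      using emeasure_lborel_box_finite[of "0::'a" "h *\<^sub>R One"] by (intro integrable_real_indicator) auto
    show "(box_bump j 0 (h *\<^sub>R One) :: 'a \<Rightarrow> real) \<in> borel_measurable lborel" for j :: nat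
      using bm[of j 0] by simp
    show "AE z in lborel. (\<lambda>j. box_bump j 0 (h *\<^sub>R One) z) \<longlonglongrightarrow> indicator ?b z"
      by (intro AE_I2 box_bump_tendsto)
    show "AE z in lborel. norm (box_bump j 0 (h *\<^sub>R One) z) \<le> indicator ?b z" for j
    proof (rule AE_I2)
      fix z :: 'a
      show "norm (box_bump j 0 (h *\<^sub>R One) z) \<le> indicator ?b z"
        using box_bump_nonneg[of j 0 "h *\<^sub>R One" z] box_bump_le_1[of j 0 "h *\<^sub>R One" z]
        by (cases "z \<in> ?b") (auto simp: box_bump_outside)
    qed
  qed auto
  moreover have "(LINT z|lborel. indicator ?b z) = h ^ DIM('a)"
    using h(1) by (simp add: measure_def emeasure_lborel_box_eq)
  ultimately have c_lim: "c \<longlonglongrightarrow> h ^ DIM('a)" by simp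
  have "\<forall>\<^sub>F j in sequentially. 0 < c j" by (rule order_tendstoD(1)[OF c_lim]) (simp add: h(1))
  then have "\<forall>\<^sub>F j in sequentially. a j \<le> B * c j"
  proof eventually_elim
    case (elim j)
    have "conv w (\<lambda>z. (1 / c j) * box_bump j 0 (h *\<^sub>R One) z) x \<le> B"
    proof (rule bound)
      have "(LINT z|lborel. (1 / c j) * box_bump j 0 (h *\<^sub>R One) (z :: 'a)) = (1 / c j) * c j"
        unfolding c_def by (rule integral_mult_right_zero)
      then show "(LINT z|lborel. (1 / c j) * box_bump j 0 (h *\<^sub>R One) (z :: 'a)) = 1" using elim by simp
    qed (use elim in simp)
    also have "conv w (\<lambda>z. (1 / c j) * box_bump j 0 (h *\<^sub>R One) z) x = (LINT z|lborel. (1 / c j) * (w z * box_bump j 0 (h *\<^sub>R One) (z - x)))"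
      unfolding conv_def by (intro Bochner_Integration.integral_cong refl) simp
    also have "\<dots> = (1 / c j) * a j" unfolding a_def by (rule integral_mult_right_zero)
    finally show ?case using elim by (simp add: field_simps)
  qed
  then show ?thesis
    by (rule tendsto_le[OF trivial_limit_sequentially tendsto_mult[OF tendsto_const c_lim] a_lim])
qed

text \<open>By Lebesgue's differentiation theorem, w is almost everywhere the limit of its averages
  over cubes with a corner at x. A point where w exceeds B would have averages exceeding B as
  well.\<close>

lemma AE_bound_from_box_averages:
  fixes w :: "'a::euclidean_space \<Rightarrow> real"
  assumes s: "0 < s" and w: "w \<in> borel_measurable borel" "integrable lborel (\<lambda>z. \<bar>w z\<bar> * decay_weight s z)"
    and avg: "\<And>x h. norm x < 1/2 \<Longrightarrow> 0 < h \<Longrightarrow> real DIM('a) * h \<le> 1/8 \<Longrightarrow>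
       (LINT z|lborel. w z * indicator (box x (x + h *\<^sub>R One)) z) \<le> B * h ^ DIM('a)"
  shows "AE x in lebesgue. norm x < 1/2 \<longrightarrow> w x \<le> B"
proof -
  \<comment> \<open>The cutoff makes the function integrable. Cubes of side h with n h \<le> 1/8 at
    points of the ball of radius 1/2 stay inside the ball of radius 2, so the averages do not
    change.\<close>
  define f where "f z = w z * indicator (ball 0 2) z" for z
  have fi: "integrable lborel f"
    unfolding f_def[abs_def] by (rule integrable_mult_compact_support(1)[OF s w, of _ 1 2]) (auto simp: indicator_def)
  have "f integrable_on cbox a b" for a b
    using integrable_on_lborel[OF fi] by (rule integrable_on_subcbox) simp
  then obtain N where N: "negligible N" "\<And>x e. \<lbrakk>x \<notin> N; 0 < e\<rbrakk> \<Longrightarrow>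
      \<exists>d>0. \<forall>h. 0 < h \<and> h < d \<longrightarrow> norm(integral (cbox x (x + h *\<^sub>R One)) f /\<^sub>R h ^ DIM('a) - f x) < e"
    by (rule integrable_ccontinuous_explicit) (rule that)
  have "w x \<le> B" if x: "norm x < 1/2" "x \<notin> N" for x
  proof (rule ccontr)
    assume "\<not> w x \<le> B"
    then have e: "0 < w x - B" by simp
    obtain d where d: "0 < d" "\<And>h. 0 < h \<Longrightarrow> h < d \<Longrightarrow>
        norm(integral (cbox x (x + h *\<^sub>R One)) f /\<^sub>R h ^ DIM('a) - f x) < w x - B"
      using N(2)[OF x(2) e] by blast
    define h where "h = min (d / 2) (1 / (8 * real DIM('a)))"
    have h: "0 < h" "h < d" "h \<le> 1 / (8 * real DIM('a))" using d(1) by (auto simp: h_def)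
    have nh: "real DIM('a) * h \<le> 1/8" using h(3) by (simp add: field_simps)
    have fx: "f x = w x" using x(1) by (simp add: f_def)
    have sub: "z \<in> ball 0 2" if "z \<in> box x (x + h *\<^sub>R One)" for z
    proof -
      have "norm (z - x) \<le> (\<Sum>i\<in>Basis. \<bar>(z - x) \<bullet> i\<bar>)" by (rule norm_le_l1)
      also have "\<dots> \<le> (\<Sum>i\<in>(Basis::'a set). h)"
      proof (rule sum_mono)
        fix i :: 'a assume i: "i \<in> Basis"
        then have "x \<bullet> i < z \<bullet> i" "z \<bullet> i < x \<bullet> i + h" using that by (auto simp: mem_box inner_add_left)
        then show "\<bar>(z - x) \<bullet> i\<bar> \<le> h" by (simp add: inner_diff_left)
      qed
      finally have "norm (z - x) \<le> 1/8" using nh by simp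
      then show ?thesis using norm_triangle_ineq2[of z x] x(1) by simp
    qed
    have "integral (cbox x (x + h *\<^sub>R One)) f = integral (box x (x + h *\<^sub>R One)) f"
      by (rule integral_open_interval[symmetric])
    also have "\<dots> = integral UNIV (\<lambda>z. if z \<in> box x (x + h *\<^sub>R One) then f z else 0)"
      by (rule integral_restrict_UNIV[symmetric])
    also have "(\<lambda>z. if z \<in> box x (x + h *\<^sub>R One) then f z else 0) = (\<lambda>z. w z * indicator (box x (x + h *\<^sub>R One)) z)"
      using sub by (auto simp: f_def indicator_def fun_eq_iff)
    also have "integral UNIV \<dots> = (LINT z|lborel. w z * indicator (box x (x + h *\<^sub>R One)) z)"
    proof (rule integral_unique[OF has_integral_integral_lborel])
      show "integrable lborel (\<lambda>z. w z * indicator (box x (x + h *\<^sub>R One)) z)"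
      proof (rule integrable_mult_compact_support(1)[OF s w, of _ 1 2])
        show "indicator (box x (x + h *\<^sub>R One)) z = (0::real)" if "2 \<le> norm z" for z
          using sub[of z] that by (auto simp: indicator_def)
      qed (auto simp: indicator_def)
    qed
    also have "\<dots> \<le> B * h ^ DIM('a)" by (rule avg[OF x(1) h(1) nh])
    finally have "integral (cbox x (x + h *\<^sub>R One)) f /\<^sub>R h ^ DIM('a) \<le> B" using h(1) by (simp add: field_simps)
    then show False using d(2)[OF h(1,2)] unfolding fx by simp
  qed
  moreover have "AE x in lebesgue. x \<notin> N" using N(1) by (intro AE_not_in) (simp add: negligible_iff_null_sets)
  ultimately show ?thesis by (auto elim: eventually_mono)
qed

text \<open>The constant is chosen before kernel, drift, u and \<open>C\<^sub>0\<close>, so it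
  depends on the dimension, s, lam and Lam only. A weak subsolution is determined up to null sets,
  hence the essential supremum; a viscosity subsolution has point values. Extended reals let the
  weighted norm be infinite.\<close>

theorem theorem3p9:
  fixes s lam Lam :: real
  assumes "0 < s" "s < 1" "0 < lam" "lam \<le> Lam"
  shows "\<exists>C>0. \<forall>(K :: 'a::euclidean_space \<Rightarrow> real) (b :: 'a) (u :: 'a \<Rightarrow> real) (C\<^sub>0 :: real).
    admissible s Lam K b \<longrightarrow>
    (\<forall>y. y \<noteq> 0 \<longrightarrow> lam / norm y powr (real DIM('a) + 2 * s) \<le> K y
                 \<and> K y \<le> Lam / norm y powr (real DIM('a) + 2 * s)) \<longrightarrow>
    u \<in> borel_measurable lebesgue \<longrightarrow>
    0 < C\<^sub>0 \<longrightarrow>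
    (weak_subsolution s K b C\<^sub>0 u \<longrightarrow>
       esssup (lebesgue_on (ball 0 (1/2))) (\<lambda>x. ereal (u x))
       \<le> ereal C * (enn2ereal (\<integral>\<^sup>+x. ennreal (\<bar>u x\<bar> / (1 + norm x powr (real DIM('a) + 2 * s))) \<partial>lebesgue)
                    + ereal C\<^sub>0)) \<and>
    (viscosity_subsolution s K b C\<^sub>0 u \<longrightarrow>
       (SUP x\<in>ball 0 (1/2). ereal (u x))
       \<le> ereal C * (enn2ereal (\<integral>\<^sup>+x. ennreal (\<bar>u x\<bar> / (1 + norm x powr (real DIM('a) + 2 * s))) \<partial>lebesgue)
                    + ereal C\<^sub>0))"
proof -
  obtain A1 where A1: "0 < A1" and visc: "\<And>(K\<^sub>0 :: 'a \<Rightarrow> real) K b u w C\<^sub>0 x N.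
       stable_kernel s lam Lam K \<Longrightarrow> AE y in lborel. K\<^sub>0 y = K y \<Longrightarrow> (s = 1/2 \<longrightarrow> norm b \<le> Lam) \<Longrightarrow>
       w \<in> borel_measurable borel \<Longrightarrow> AE y in lborel. u y = w y \<Longrightarrow> 0 < C\<^sub>0 \<Longrightarrow>
       viscosity_subsolution s K\<^sub>0 b C\<^sub>0 u \<Longrightarrow> integrable lborel (\<lambda>z. \<bar>w z\<bar> * decay_weight s z) \<Longrightarrow>
       (LINT z|lborel. \<bar>w z\<bar> * decay_weight s z) \<le> N \<Longrightarrow> norm x < 1/2 \<Longrightarrow> u x \<le> A1 * (N + C\<^sub>0)"
    by (rule viscosity_bound[OF assms, where 'a='a]) (rule that)
  obtain A2 where A2: "0 < A2" and weak: "\<And>(K\<^sub>0 :: 'a \<Rightarrow> real) K b u w C\<^sub>0 x N k j l l'.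
       stable_kernel s lam Lam K \<Longrightarrow> AE y in lborel. K\<^sub>0 y = K y \<Longrightarrow> (s = 1/2 \<longrightarrow> norm b \<le> Lam) \<Longrightarrow>
       w \<in> borel_measurable borel \<Longrightarrow> AE y in lborel. u y = w y \<Longrightarrow> 0 < C\<^sub>0 \<Longrightarrow>
       weak_subsolution s K\<^sub>0 b C\<^sub>0 u \<Longrightarrow> integrable lborel (\<lambda>z. \<bar>w z\<bar> * decay_weight s z) \<Longrightarrow>
       (LINT z|lborel. \<bar>w z\<bar> * decay_weight s z) \<le> N \<Longrightarrow> norm x < 1/2 \<Longrightarrow>
       0 \<le> k \<Longrightarrow> box l l' \<subseteq> ball 0 (1/8) \<Longrightarrow> (LINT z|lborel. k * box_bump j l l' z) = 1 \<Longrightarrow>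
       conv w (\<lambda>z. k * box_bump j l l' z) x \<le> A2 * (N + C\<^sub>0)"
    by (rule weak_mollified_bound[OF assms, where 'a='a]) (rule that)
  show ?thesis
  proof (intro exI[of _ "max A1 A2"] conjI[of "_ < _"] allI impI)
    show C: "0 < max A1 A2" using A1 by simp
    fix K\<^sub>0 :: "'a \<Rightarrow> real" and b :: 'a and u :: "'a \<Rightarrow> real" and C\<^sub>0 :: real
    assume adm: "admissible s Lam K\<^sub>0 b" and bds: "\<forall>y. y \<noteq> 0 \<longrightarrow> lam / norm y powr (real DIM('a) + 2 * s) \<le> K\<^sub>0 y
                 \<and> K\<^sub>0 y \<le> Lam / norm y powr (real DIM('a) + 2 * s)"
      and um: "u \<in> borel_measurable lebesgue" and C0: "0 < C\<^sub>0"
    let ?I = "\<integral>\<^sup>+x. ennreal (\<bar>u x\<bar> / (1 + norm x powr (real DIM('a) + 2 * s))) \<partial>lebesgue"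
    let ?B = "ereal (max A1 A2) * (enn2ereal ?I + ereal C\<^sub>0)"
    obtain K where K: "stable_kernel s lam Lam K" and KK: "AE y in lborel. K\<^sub>0 y = K y"
      by (rule admissible_stable_kernel[OF assms(3,4) adm bds])
    have b: "s = 1/2 \<longrightarrow> norm b \<le> Lam" using adm by (simp add: admissible_def)
    obtain w where w: "w \<in> borel_measurable borel" and uw: "AE y in lborel. u y = w y"
      using completion_ex_borel_measurable_real[OF um] by auto
    show "(weak_subsolution s K\<^sub>0 b C\<^sub>0 u \<longrightarrow> esssup (lebesgue_on (ball 0 (1/2))) (\<lambda>x. ereal (u x)) \<le> ?B) \<and>
      (viscosity_subsolution s K\<^sub>0 b C\<^sub>0 u \<longrightarrow> (SUP x\<in>ball 0 (1/2). ereal (u x)) \<le> ?B)"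
    \<comment> \<open>If the weighted integral is infinite, so is the right-hand side, because the
      constant is positive.\<close>
    proof (cases "?I = \<infinity>")
      case True
      have "ereal c * \<infinity> = \<infinity>" if "0 < c" for c using that by simp
      from this[OF C] have "?B = \<infinity>" unfolding True by (simp del: ereal_max)
      then show ?thesis by (simp only:) simp
    next
      case False
      define N where "N = enn2real ?I"
      have N: "?I = ennreal N" "0 \<le> N" using False by (auto simp: N_def less_top)
      have B: "?B = ereal (max A1 A2 * (N + C\<^sub>0))" unfolding N(1) using N(2) by (simp add: enn2ereal_ennreal del: ereal_max)
      have wm: "(\<lambda>x. ennreal (\<bar>w x\<bar> * decay_weight s x)) \<in> borel_measurable borel" using w by measurable
      have "?I = (\<integral>\<^sup>+x. ennreal (\<bar>w x\<bar> * decay_weight s x) \<partial>lebesgue)"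
        by (rule nn_integral_cong_AE, rule AE_completion)
           (use uw in \<open>auto elim!: eventually_mono simp: decay_weight_def\<close>)
      also have "\<dots> = (\<integral>\<^sup>+x. ennreal (\<bar>w x\<bar> * decay_weight s x) \<partial>lborel)"
        using wm by (simp add: nn_integral_completion)
      finally have wI: "(\<integral>\<^sup>+x. ennreal (\<bar>w x\<bar> * decay_weight s x) \<partial>lborel) \<le> ennreal N" using N(1) by simp
      have wm': "(\<lambda>x. \<bar>w x\<bar> * decay_weight s x) \<in> borel_measurable lborel" using w by measurable
      have w0: "0 \<le> \<bar>w x\<bar> * decay_weight s x" for x using decay_weight_pos[of s x] by simp
      note wi = nn_integral_le_imp_integrable(1)[OF wm' w0 N(2) wI]
      note wN = nn_integral_le_imp_integrable(2)[OF wm' w0 N(2) wI]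
      have NC: "0 \<le> N + C\<^sub>0" using N C0 by simp
      have m1: "A1 * (N + C\<^sub>0) \<le> max A1 A2 * (N + C\<^sub>0)" and m2: "A2 * (N + C\<^sub>0) \<le> max A1 A2 * (N + C\<^sub>0)"
        using NC by (intro mult_right_mono; simp)+
      show ?thesis
        unfolding B
      proof (intro conjI impI)
        assume ws: "weak_subsolution s K\<^sub>0 b C\<^sub>0 u"
        have "AE x in lebesgue. norm x < 1/2 \<longrightarrow> w x \<le> A2 * (N + C\<^sub>0)"
        proof (rule AE_bound_from_box_averages[OF assms(1) w wi])
          fix x :: 'a and h :: real
          assume x: "norm x < 1/2" and h: "0 < h" "real DIM('a) * h \<le> 1/8"
          have "box 0 (h *\<^sub>R One) \<subseteq> ball (0::'a) (1/8)"
          proof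
            fix z :: 'a assume z: "z \<in> box 0 (h *\<^sub>R One)"
            have "norm z \<le> (\<Sum>i\<in>Basis. \<bar>z \<bullet> i\<bar>)" by (rule norm_le_l1)
            also have "\<dots> < (\<Sum>i\<in>(Basis::'a set). h)"
              by (rule sum_strict_mono) (use z in \<open>auto simp: mem_box\<close>)
            finally show "z \<in> ball 0 (1/8)" using h(2) by simp
          qed
          then show "(LINT z|lborel. w z * indicator (box x (x + h *\<^sub>R One)) z) \<le> A2 * (N + C\<^sub>0) * h ^ DIM('a)"
            by (intro box_average_bound[OF assms(1) w wi h] weak[OF K KK b w uw C0 ws wi wN x])
        qed
        moreover have "AE x in lebesgue. u x = w x" by (rule AE_completion[OF uw])
        ultimately have "AE x in lebesgue. x \<in> ball 0 (1/2) \<longrightarrow> ereal (u x) \<le> ereal (max A1 A2 * (N + C\<^sub>0))"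
          by eventually_elim (use m2 in auto)
        then have "AE x in lebesgue_on (ball 0 (1/2)). ereal (u x) \<le> ereal (max A1 A2 * (N + C\<^sub>0))"
          by (subst AE_restrict_space_iff) auto
        then show "esssup (lebesgue_on (ball 0 (1/2))) (\<lambda>x. ereal (u x)) \<le> ereal (max A1 A2 * (N + C\<^sub>0))"
          using um by (intro esssup_I measurable_restrict_space1) auto
      next
        assume vs: "viscosity_subsolution s K\<^sub>0 b C\<^sub>0 u"
        show "(SUP x\<in>ball 0 (1/2). ereal (u x)) \<le> ereal (max A1 A2 * (N + C\<^sub>0))"
        proof (rule SUP_least)
          fix x :: 'a assume "x \<in> ball 0 (1/2)"
          then have "u x \<le> A1 * (N + C\<^sub>0)" by (intro visc[OF K KK b w uw C0 vs wi wN]) simp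
          then show "ereal (u x) \<le> ereal (max A1 A2 * (N + C\<^sub>0))" using m1 by simp
        qed
      qed
    qed
  qed
qed

end
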